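(* Let $M$ be a hermitean symmetric space, $p\in M$ and $Z\in T_pM$. The holomorphically extended vector field $Z^{\mathrm{knc}}$ associated to $Z$ equals the quadratic vector field $$Z^{\mathrm{knc}}(X)=Z-\frac14\Big(R_{Z,X}X-R_{Z,IX}IX\Big)$$ on the tangent space $T_pM$. In particular all Killing vector fields on a hermitean symmetric space become at most quadratic vector fields (polynomial vector fields on $T_pM$ of degree at most $2$) when written in Kähler normal coordinates $\mathrm{knc}_p$.
   Context: A Kähler manifold is a smooth manifold $M$ with a Riemannian metric $g$ and an orthogonal almost complex structure $I$ with $\nabla I=0$ for the Levi-Civita connection $\nabla$. A hermitean (locally) symmetric space is a Kähler manifold with $\nabla R=0$, where $R_{X,Y}Z=\nabla_X\nabla_YZ-\nabla_Y\nabla_XZ-\nabla_{[X,Y]}Z$; in the formula $R=R_p$, $I=I_p$. The Kähler form is $\omega(X,Y)=g(IX,Y)$. A local potential is a real function $\theta^{\mathrm{loc}}$ on an open set with $\omega=\frac i2\partial\overline\partial\theta^{\mathrm{loc}}$. $\mathrm{Sym}^{\kappa,\overline\kappa}T_p^*M$ is the space of complex valued polynomials $\eta$ on $T_pM$, homogeneous of degree $\kappa+\overline\kappa$, with $\frac d{dt}|_0\eta(X+tI_pX)=i(\kappa-\overline\kappa)\eta(X)$. $\overline{\mathrm{Sym}}^{\ge(2,2)}T_p^*M$ is the space of real formal power series on $T_pM$ all of whose bihomogeneous components have $\kappa,\overline\kappa\ge2$. Anchored coordinates centered in $p$ are a smooth map $\varphi$ from a neighborhood of $0\in T_pM$ to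 $M$, diffeomorphic onto a neighborhood of $p$, with $\varphi(0)=p$ and differential $\mathrm{id}_{T_pM}$ at $0$. Kähler normal coordinates (Bochner): there are unique (as germs) anchored coordinates $\mathrm{knc}_p$ centered in $p$, holomorphic with respect to $I_p$ on $T_pM$ and $I$ on $M$, and a unique local potential $\theta_p^{\mathrm{loc}}$ near $p$ such that the Taylor series of $\theta_p^{\mathrm{loc}}\circ\mathrm{knc}_p$ in $0$ is congruent to $g_p(X,X)$ modulo $\overline{\mathrm{Sym}}^{\ge(2,2)}T_p^*M$. Holomorphically extended vector field: for a curve $\gamma$ in $M$ with $\gamma(0)=p$, $\dot\gamma(0)=Z$ and parallel transport $\mathrm{PT}^\nabla_\gamma(t):T_pM\to T_{\gamma(t)}M$, $$Z^{\mathrm{knc}}:=\frac d{dt}\Big|_0\Big(\mathrm{knc}_p^{-1}\circ\mathrm{knc}_{\gamma(t)}\circ\mathrm{PT}^\nabla_\gamma(t)\Big),$$ a vector field on (a neighborhood of $0$ in) $T_pM$, independent of the choice of $\gamma$. *)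

theory Defs
  imports "HOL-Analysis.Analysis"
begin

section \<open>Smooth manifolds\<close>

fun differentiable_times_on :: "nat \<Rightarrow> 'a::real_normed_vector set \<Rightarrow> ('a \<Rightarrow> 'b::real_normed_vector) \<Rightarrow> bool"
  where
    "differentiable_times_on 0 S f \<longleftrightarrow> continuous_on S f"
  | "differentiable_times_on (Suc n) S f \<longleftrightarrow>
       (\<forall>x\<in>S. f differentiable (at x)) \<and>
       (\<forall>v. differentiable_times_on n S (\<lambda>x. frechet_derivative f (at x) v))"

text \<open>Smoothness; only used for open \<open>S\<close>.\<close>

definition smooth_on :: "'a::real_normed_vector set \<Rightarrow> ('a \<Rightarrow> 'b::real_normed_vector) \<Rightarrow> bool"
  where "smooth_on S f \<longleftrightarrow> (\<forall>n. differentiable_times_on n S f)"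

text \<open>
  The manifold is the whole type \<open>'m\<close>, modelled on the Euclidean space \<open>'e\<close> (of arbitrary positive
  dimension).  The smooth structure is given by an atlas containing a distinguished chart
  \<open>chart M q : cdom M q \<rightarrow> 'e\<close> around every point \<open>q\<close>.  The differential of \<open>chart M q\<close> at \<open>q\<close>
  identifies the tangent space at \<open>q\<close> with \<open>'e\<close>, so that tangent vectors at \<open>q\<close> are elements
  of \<open>'e\<close>, to be read with respect to the chart of their own base point: the representing vectors
  of tangent vectors at different points can only be compared after applying \<open>dchart\<close> below.
  The norm of \<open>'e\<close> plays no geometric role; the inner product on the tangent space at \<open>q\<close> is
  \<open>metric M q\<close>.
\<close>

record ('m, 'e) almost_hermitian =
  cdom :: "'m \<Rightarrow> 'm set"
  chart :: "'m \<Rightarrow> 'm \<Rightarrow> 'e"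
  metric :: "'m \<Rightarrow> 'e \<Rightarrow> 'e \<Rightarrow> real"
  cplx :: "'m \<Rightarrow> 'e \<Rightarrow> 'e"

definition chart_inv :: "('m, 'e) almost_hermitian \<Rightarrow> 'm \<Rightarrow> 'e \<Rightarrow> 'm"
  where "chart_inv M c = inv_into (cdom M c) (chart M c)"

definition smooth_manifold ::
    "('m::{t2_space,second_countable_topology}, 'e::euclidean_space) almost_hermitian \<Rightarrow> bool"
  where "smooth_manifold M \<longleftrightarrow>
    (\<forall>c. c \<in> cdom M c \<and> open (cdom M c) \<and> open (chart M c ` cdom M c) \<and>
         homeomorphism (cdom M c) (chart M c ` cdom M c) (chart M c) (chart_inv M c)) \<and>
    (\<forall>c d. smooth_on (chart M c ` (cdom M c \<inter> cdom M d)) (chart M d \<circ> chart_inv M c))"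

text \<open>
  For \<open>q\<close> in \<open>cdom M c\<close>: \<open>dchart M c q\<close> is the differential at \<open>q\<close> of \<open>chart M c\<close>, mapping a
  tangent vector at \<open>q\<close> to its components in the chart \<open>chart M c\<close>, and \<open>coord_field M c w\<close> is the
  vector field on \<open>cdom M c\<close> with constant components \<open>w\<close> in this chart.
\<close>

definition dchart :: "('m, 'e::real_normed_vector) almost_hermitian \<Rightarrow> 'm \<Rightarrow> 'm \<Rightarrow> 'e \<Rightarrow> 'e"
  where "dchart M c q v = frechet_derivative (chart M c \<circ> chart_inv M q) (at (chart M q q)) v"

definition coord_field :: "('m, 'e::real_normed_vector) almost_hermitian \<Rightarrow> 'm \<Rightarrow> 'e \<Rightarrow> 'm \<Rightarrow> 'e"
  where "coord_field M c w q = frechet_derivative (chart M q \<circ> chart_inv M c) (at (chart M c q)) w"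

text \<open>Vector fields are functions \<open>'m \<Rightarrow> 'e\<close>; \<open>components M c X\<close> are the components of \<open>X\<close>
  in the chart \<open>chart M c\<close>, as a function of the coordinates.\<close>

definition components :: "('m, 'e::real_normed_vector) almost_hermitian \<Rightarrow> 'm \<Rightarrow> ('m \<Rightarrow> 'e) \<Rightarrow> 'e \<Rightarrow> 'e"
  where "components M c X x = dchart M c (chart_inv M c x) (X (chart_inv M c x))"

definition smooth_field :: "('m, 'e::real_normed_vector) almost_hermitian \<Rightarrow> 'm set \<Rightarrow> ('m \<Rightarrow> 'e) \<Rightarrow> bool"
  where "smooth_field M V X \<longleftrightarrow> (\<forall>c. smooth_on (chart M c ` (V \<inter> cdom M c)) (components M c X))"

definition smooth_fun ::
    "('m, 'e::real_normed_vector) almost_hermitian \<Rightarrow> 'm set \<Rightarrow> ('m \<Rightarrow> 'b::real_normed_vector) \<Rightarrow> bool"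
  where "smooth_fun M V f \<longleftrightarrow> (\<forall>c. smooth_on (chart M c ` (V \<inter> cdom M c)) (f \<circ> chart_inv M c))"

definition smooth_into ::
    "('m::topological_space, 'e::real_normed_vector) almost_hermitian \<Rightarrow> 'a::real_normed_vector set \<Rightarrow> ('a \<Rightarrow> 'm) \<Rightarrow> bool"
  where "smooth_into M U f \<longleftrightarrow>
    continuous_on U f \<and> (\<forall>c. smooth_on (U \<inter> f -` cdom M c) (chart M c \<circ> f))"

definition map_differential ::
    "('m, 'e::real_normed_vector) almost_hermitian \<Rightarrow> ('a::real_normed_vector \<Rightarrow> 'm) \<Rightarrow> 'a \<Rightarrow> 'a \<Rightarrow> 'e"
  where "map_differential M f x u = frechet_derivative (chart M (f x) \<circ> f) (at x) u"

text \<open>Derivative of a function on the manifold in the direction of a tangent vector \<open>u\<close> at \<open>q\<close>.\<close>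

definition dir_deriv ::
    "('m, 'e::real_normed_vector) almost_hermitian \<Rightarrow> ('m \<Rightarrow> 'b::real_normed_vector) \<Rightarrow> 'm \<Rightarrow> 'e \<Rightarrow> 'b"
  where "dir_deriv M f q u = frechet_derivative (f \<circ> chart_inv M q) (at (chart M q q)) u"

definition lie_bracket ::
    "('m, 'e::real_normed_vector) almost_hermitian \<Rightarrow> ('m \<Rightarrow> 'e) \<Rightarrow> ('m \<Rightarrow> 'e) \<Rightarrow> 'm \<Rightarrow> 'e"
  where "lie_bracket M X Y q =
    frechet_derivative (components M q Y) (at (chart M q q)) (X q) -
    frechet_derivative (components M q X) (at (chart M q q)) (Y q)"


section \<open>Riemannian metrics and the Levi-Civita connection\<close>

definition riemannian_metric :: "('m, 'e::real_normed_vector) almost_hermitian \<Rightarrow> bool"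
  where "riemannian_metric M \<longleftrightarrow>
    (\<forall>q. bilinear (metric M q) \<and>
         (\<forall>u v. metric M q u v = metric M q v u) \<and>
         (\<forall>u. u \<noteq> 0 \<longrightarrow> metric M q u u > 0)) \<and>
    (\<forall>c u v. smooth_fun M (cdom M c) (\<lambda>q. metric M q (coord_field M c u q) (coord_field M c v q)))"

text \<open>
  \<open>christoffel M q u v\<close> is the Levi-Civita covariant derivative at \<open>q\<close>, in the direction \<open>u\<close>, of the
  coordinate field of the chart \<open>chart M q\<close> with constant components \<open>v\<close>.  Symmetry is torsion-freeness
  (coordinate fields commute), the second condition is compatibility with the metric.
\<close>

definition christoffel :: "('m, 'e::real_normed_vector) almost_hermitian \<Rightarrow> 'm \<Rightarrow> 'e \<Rightarrow> 'e \<Rightarrow> 'e"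
  where "christoffel M q = (THE \<Gamma>. bilinear \<Gamma> \<and>
    (\<forall>u v. \<Gamma> u v = \<Gamma> v u) \<and>
    (\<forall>u v w. dir_deriv M (\<lambda>r. metric M r (coord_field M q v r) (coord_field M q w r)) q u =
             metric M q (\<Gamma> u v) w + metric M q v (\<Gamma> u w)))"

definition nabla ::
    "('m, 'e::real_normed_vector) almost_hermitian \<Rightarrow> ('m \<Rightarrow> 'e) \<Rightarrow> ('m \<Rightarrow> 'e) \<Rightarrow> 'm \<Rightarrow> 'e"
  where "nabla M X Y q =
    frechet_derivative (components M q Y) (at (chart M q q)) (X q) + christoffel M q (X q) (Y q)"

definition curvature_field ::
    "('m, 'e::real_normed_vector) almost_hermitian \<Rightarrow> ('m \<Rightarrow> 'e) \<Rightarrow> ('m \<Rightarrow> 'e) \<Rightarrow> ('m \<Rightarrow> 'e) \<Rightarrow> 'm \<Rightarrow> 'e"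
  where "curvature_field M X Y Z q =
    nabla M X (nabla M Y Z) q - nabla M Y (nabla M X Z) q - nabla M (lie_bracket M X Y) Z q"

text \<open>The curvature tensor at \<open>q\<close>, evaluated by extending tangent vectors at \<open>q\<close> to coordinate fields.\<close>

definition curvature :: "('m, 'e::real_normed_vector) almost_hermitian \<Rightarrow> 'm \<Rightarrow> 'e \<Rightarrow> 'e \<Rightarrow> 'e \<Rightarrow> 'e"
  where "curvature M q u v w =
    curvature_field M (coord_field M q u) (coord_field M q v) (coord_field M q w) q"

definition parallel_curvature :: "('m::topological_space, 'e::real_normed_vector) almost_hermitian \<Rightarrow> bool"
  where "parallel_curvature M \<longleftrightarrow>
    (\<forall>V W X Y Z. open V \<and> smooth_field M V W \<and> smooth_field M V X \<and> smooth_field M V Y \<and> smooth_field M V Z \<longrightarrow>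
      (\<forall>q\<in>V. nabla M W (\<lambda>r. curvature M r (X r) (Y r) (Z r)) q =
              curvature M q (nabla M W X q) (Y q) (Z q) +
              curvature M q (X q) (nabla M W Y q) (Z q) +
              curvature M q (X q) (Y q) (nabla M W Z q)))"

definition killing_field :: "('m::topological_space, 'e::real_normed_vector) almost_hermitian \<Rightarrow> ('m \<Rightarrow> 'e) \<Rightarrow> bool"
  where "killing_field M \<xi> \<longleftrightarrow> smooth_field M UNIV \<xi> \<and>
    (\<forall>V X Y. open V \<and> smooth_field M V X \<and> smooth_field M V Y \<longrightarrow>
      (\<forall>q\<in>V. dir_deriv M (\<lambda>r. metric M r (X r) (Y r)) q (\<xi> q) =
              metric M q (lie_bracket M \<xi> X q) (Y q) + metric M q (X q) (lie_bracket M \<xi> Y q)))"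

definition velocity :: "('m, 'e::real_normed_vector) almost_hermitian \<Rightarrow> (real \<Rightarrow> 'm) \<Rightarrow> real \<Rightarrow> 'e"
  where "velocity M \<gamma> t = vector_derivative (chart M (\<gamma> t) \<circ> \<gamma>) (at t)"

text \<open>\<open>V s\<close> is a tangent vector at \<open>\<gamma> s\<close>.  The covariant derivative of \<open>V\<close> along \<open>\<gamma>\<close> at time \<open>t\<close>
  is computed in the chart of the point \<open>\<gamma> t\<close>.\<close>

definition parallel_along ::
    "('m, 'e::real_normed_vector) almost_hermitian \<Rightarrow> real set \<Rightarrow> (real \<Rightarrow> 'm) \<Rightarrow> (real \<Rightarrow> 'e) \<Rightarrow> bool"
  where "parallel_along M J \<gamma> V \<longleftrightarrow>
    (\<forall>t\<in>J. ((\<lambda>s. dchart M (\<gamma> t) (\<gamma> s) (V s)) has_vector_derivative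
             - christoffel M (\<gamma> t) (velocity M \<gamma> t) (V t)) (at t))"

definition parallel_transport ::
    "('m, 'e::real_normed_vector) almost_hermitian \<Rightarrow> real set \<Rightarrow> (real \<Rightarrow> 'm) \<Rightarrow> real \<Rightarrow> 'e \<Rightarrow> 'e"
  where "parallel_transport M J \<gamma> t v = (THE w. \<exists>V. parallel_along M J \<gamma> V \<and> V 0 = v \<and> V t = w)"


section \<open>Kaehler manifolds and hermitean symmetric spaces\<close>

definition orthogonal_almost_complex :: "('m, 'e::real_normed_vector) almost_hermitian \<Rightarrow> bool"
  where "orthogonal_almost_complex M \<longleftrightarrow>
    (\<forall>q. linear (cplx M q) \<and>
         (\<forall>u. cplx M q (cplx M q u) = - u) \<and>
         (\<forall>u v. metric M q (cplx M q u) (cplx M q v) = metric M q u v)) \<and>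
    (\<forall>c u. smooth_field M (cdom M c) (\<lambda>q. cplx M q (coord_field M c u q)))"

definition parallel_cplx :: "('m::topological_space, 'e::real_normed_vector) almost_hermitian \<Rightarrow> bool"
  where "parallel_cplx M \<longleftrightarrow>
    (\<forall>V X Y. open V \<and> smooth_field M V X \<and> smooth_field M V Y \<longrightarrow>
      (\<forall>q\<in>V. nabla M X (\<lambda>r. cplx M r (Y r)) q = cplx M q (nabla M X Y q)))"

definition kahler_manifold ::
    "('m::{t2_space,second_countable_topology}, 'e::euclidean_space) almost_hermitian \<Rightarrow> bool"
  where "kahler_manifold M \<longleftrightarrow>
    smooth_manifold M \<and> riemannian_metric M \<and> orthogonal_almost_complex M \<and> parallel_cplx M"

definition hermitean_symmetric_space ::
    "('m::{t2_space,second_countable_topology}, 'e::euclidean_space) almost_hermitian \<Rightarrow> bool"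
  where "hermitean_symmetric_space M \<longleftrightarrow> kahler_manifold M \<and> parallel_curvature M"


section \<open>Local potentials\<close>

definition kahler_form :: "('m, 'e) almost_hermitian \<Rightarrow> 'm \<Rightarrow> 'e \<Rightarrow> 'e \<Rightarrow> real"
  where "kahler_form M q u v = metric M q (cplx M q u) v"

text \<open>Exterior derivative of a complex 1-form, with the convention
  \<open>d\<alpha>(X,Y) = X\<cdot>\<alpha>(Y) - Y\<cdot>\<alpha>(X) - \<alpha>([X,Y])\<close>.\<close>

definition ext_deriv ::
    "('m, 'e::real_normed_vector) almost_hermitian \<Rightarrow> ('m \<Rightarrow> 'e \<Rightarrow> complex) \<Rightarrow> 'm \<Rightarrow> 'e \<Rightarrow> 'e \<Rightarrow> complex"
  where "ext_deriv M \<alpha> q u v =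
    dir_deriv M (\<lambda>r. \<alpha> r (coord_field M q v r)) q u -
    dir_deriv M (\<lambda>r. \<alpha> r (coord_field M q u r)) q v -
    \<alpha> q (lie_bracket M (coord_field M q u) (coord_field M q v) q)"

text \<open>The (0,1)-part of \<open>d\<theta>\<close>, where (0,1)-forms are the 1-forms with \<open>\<alpha>(I u) = - i \<alpha>(u)\<close>.\<close>

definition delbar :: "('m, 'e::real_normed_vector) almost_hermitian \<Rightarrow> ('m \<Rightarrow> real) \<Rightarrow> 'm \<Rightarrow> 'e \<Rightarrow> complex"
  where "delbar M \<theta> q u =
    (complex_of_real (dir_deriv M \<theta> q u) + \<i> * complex_of_real (dir_deriv M \<theta> q (cplx M q u))) / 2"

text \<open>For a (0,1)-form \<open>\<beta>\<close>, the form \<open>\<partial>\<beta>\<close> is the (1,1)-part of \<open>d\<beta>\<close>; a 2-form is of type (1,1) iff it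
  is invariant under the complex structure, the (2,0)- and (0,2)-parts change sign.\<close>

definition del :: "('m, 'e::real_normed_vector) almost_hermitian \<Rightarrow> ('m \<Rightarrow> 'e \<Rightarrow> complex) \<Rightarrow> 'm \<Rightarrow> 'e \<Rightarrow> 'e \<Rightarrow> complex"
  where "del M \<beta> q u v =
    (ext_deriv M \<beta> q u v + ext_deriv M \<beta> q (cplx M q u) (cplx M q v)) / 2"

definition local_potential ::
    "('m::topological_space, 'e::real_normed_vector) almost_hermitian \<Rightarrow> 'm set \<Rightarrow> ('m \<Rightarrow> real) \<Rightarrow> bool"
  where "local_potential M V \<theta> \<longleftrightarrow> open V \<and> smooth_fun M V \<theta> \<and>
    (\<forall>q\<in>V. \<forall>u v. complex_of_real (kahler_form M q u v) = \<i> / 2 * del M (delbar M \<theta>) q u v)"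


section \<open>Power series on a tangent space\<close>

definition Sym :: "('m, 'e::euclidean_space) almost_hermitian \<Rightarrow> 'm \<Rightarrow> nat \<Rightarrow> nat \<Rightarrow> ('e \<Rightarrow> complex) set"
  where "Sym M p k l = {\<eta>. polynomial_function \<eta> \<and>
    (\<forall>t X. \<eta> (t *\<^sub>R X) = of_real t ^ (k + l) * \<eta> X) \<and>
    (\<forall>X. ((\<lambda>t. \<eta> (X + t *\<^sub>R cplx M p X)) has_vector_derivative
           \<i> * (of_nat k - of_nat l) * \<eta> X) (at 0))}"

text \<open>A real formal power series is the sequence of its homogeneous components.  The
  bihomogeneous components of its component of degree \<open>n\<close> are \<open>\<eta> k (n - k)\<close> for \<open>k \<le> n\<close>.\<close>

definition bihomogeneous_components ::
    "('m, 'e::euclidean_space) almost_hermitian \<Rightarrow> 'm \<Rightarrow> (nat \<Rightarrow> 'e \<Rightarrow> real) \<Rightarrow> (nat \<Rightarrow> nat \<Rightarrow> 'e \<Rightarrow> complex) \<Rightarrow> bool"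
  where "bihomogeneous_components M p F \<eta> \<longleftrightarrow>
    (\<forall>k l. \<eta> k l \<in> Sym M p k l) \<and>
    (\<forall>n X. complex_of_real (F n X) = (\<Sum>k\<le>n. \<eta> k (n - k) X))"

definition Sym_ge22 :: "('m, 'e::euclidean_space) almost_hermitian \<Rightarrow> 'm \<Rightarrow> (nat \<Rightarrow> 'e \<Rightarrow> real) set"
  where "Sym_ge22 M p = {F. \<exists>\<eta>. bihomogeneous_components M p F \<eta> \<and>
    (\<forall>k l. \<eta> k l \<noteq> (\<lambda>_. 0) \<longrightarrow> 2 \<le> k \<and> 2 \<le> l)}"

text \<open>The homogeneous component of degree \<open>n\<close> of the Taylor series of \<open>f\<close> in \<open>0\<close>.\<close>

definition taylor_component :: "('e::real_normed_vector \<Rightarrow> real) \<Rightarrow> nat \<Rightarrow> 'e \<Rightarrow> real"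
  where "taylor_component f n X = (deriv ^^ n) (\<lambda>t. f (t *\<^sub>R X)) 0 / fact n"


section \<open>Kaehler normal coordinates\<close>

definition anchored_coordinates ::
    "('m::topological_space, 'e::real_normed_vector) almost_hermitian \<Rightarrow> 'm \<Rightarrow> 'e set \<Rightarrow> ('e \<Rightarrow> 'm) \<Rightarrow> bool"
  where "anchored_coordinates M p U \<phi> \<longleftrightarrow>
    open U \<and> 0 \<in> U \<and> open (\<phi> ` U) \<and> inj_on \<phi> U \<and>
    smooth_into M U \<phi> \<and> smooth_fun M (\<phi> ` U) (inv_into U \<phi>) \<and>
    \<phi> 0 = p \<and> (\<forall>u. map_differential M \<phi> 0 u = u)"

definition kahler_normal_coordinates ::
    "('m::topological_space, 'e::euclidean_space) almost_hermitian \<Rightarrow> 'm \<Rightarrow> 'e set \<Rightarrow> ('e \<Rightarrow> 'm) \<Rightarrow> bool"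
  where "kahler_normal_coordinates M p U \<phi> \<longleftrightarrow>
    anchored_coordinates M p U \<phi> \<and>
    (\<forall>X\<in>U. \<forall>u. map_differential M \<phi> X (cplx M p u) = cplx M (\<phi> X) (map_differential M \<phi> X u)) \<and>
    (\<exists>V \<theta>. p \<in> V \<and> local_potential M V \<theta> \<and>
      (\<lambda>n X. taylor_component (\<theta> \<circ> \<phi>) n X - (if n = 2 then metric M p X X else 0)) \<in> Sym_ge22 M p)"

text \<open>
  By Bochner's theorem \<open>knc\<^sub>q\<close> exists for every \<open>q\<close> and is unique as a germ.  A system of Kaehler normal
  coordinates is a choice of representatives \<open>knc q\<close> of these germs, with domains \<open>D q\<close>, such that
  the domains together contain a neighborhood of the zero section of the tangent bundle.  Without
  the latter condition there need not be any fixed \<open>X \<noteq> 0\<close> in the domains of the representatives along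
  a curve, and the derivative in the definition of \<open>Z\<^sup>k\<^sup>n\<^sup>c\<close> would make no sense pointwise.
\<close>

definition knc_system ::
    "('m::topological_space, 'e::euclidean_space) almost_hermitian \<Rightarrow> ('m \<Rightarrow> 'e set) \<Rightarrow> ('m \<Rightarrow> 'e \<Rightarrow> 'm) \<Rightarrow> bool"
  where "knc_system M D knc \<longleftrightarrow>
    (\<forall>q. kahler_normal_coordinates M q (D q) (knc q)) \<and>
    (\<forall>p. \<exists>W r. open W \<and> p \<in> W \<and> r > 0 \<and> (\<forall>q\<in>W. {v. metric M q v v < r\<^sup>2} \<subseteq> D q))"

text \<open>\<open>V\<close> is, as a germ at \<open>0\<close>, the vector field \<open>Z\<^sup>k\<^sup>n\<^sup>c\<close> on the tangent space at \<open>p\<close>, computed with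
  any curve; the first condition says that the differentiated composition is defined for small \<open>t\<close>.\<close>

definition is_knc_extension ::
    "('m::topological_space, 'e::real_normed_vector) almost_hermitian \<Rightarrow> ('m \<Rightarrow> 'e set) \<Rightarrow> ('m \<Rightarrow> 'e \<Rightarrow> 'm) \<Rightarrow>
     'm \<Rightarrow> 'e \<Rightarrow> ('e \<Rightarrow> 'e) \<Rightarrow> bool"
  where "is_knc_extension M D knc p Z V \<longleftrightarrow>
    (\<forall>\<epsilon> \<gamma>. \<epsilon> > 0 \<and> smooth_into M {-\<epsilon><..<\<epsilon>} \<gamma> \<and> \<gamma> 0 = p \<and> velocity M \<gamma> 0 = Z \<longrightarrow>
      (let PT = parallel_transport M {-\<epsilon><..<\<epsilon>} \<gamma> in
       \<forall>\<^sub>F X in nhds 0.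
         (\<forall>\<^sub>F t in nhds 0. PT t X \<in> D (\<gamma> t) \<and> knc (\<gamma> t) (PT t X) \<in> knc p ` D p) \<and>
         ((\<lambda>t. inv_into (D p) (knc p) (knc (\<gamma> t) (PT t X))) has_vector_derivative V X) (at 0)))"

text \<open>A vector field \<open>\<xi>\<close> on the manifold, written in the coordinates \<open>\<phi>\<close>.\<close>

definition field_in_coordinates ::
    "('m, 'e::real_normed_vector) almost_hermitian \<Rightarrow> ('e \<Rightarrow> 'm) \<Rightarrow> ('m \<Rightarrow> 'e) \<Rightarrow> 'e \<Rightarrow> 'e"
  where "field_in_coordinates M \<phi> \<xi> X = inv (map_differential M \<phi> X) (\<xi> (\<phi> X))"

definition at_most_quadratic :: "('e::real_vector \<Rightarrow> 'e) \<Rightarrow> bool"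
  where "at_most_quadratic Q \<longleftrightarrow>
    (\<exists>a L B. linear L \<and> bilinear B \<and> Q = (\<lambda>X. a + L X + B X X))"

end

theory Submission
  imports Defs "HOL-Complex_Analysis.Complex_Analysis"
begin

text \<open>
  Local Killing fields are the solutions of a flat linear system for the pair \<open>(\<xi>, \<nabla>\<xi>)\<close>, so they exist for all initial values whose
  endomorphism part annihilates the curvature.  In Kaehler normal coordinates the field \<open>X \<mapsto> I X\<close> is Killing, because apart from
  the metric the potential has only components of type \<open>(k, l)\<close> with \<open>k, l \<ge> 2\<close>.  Its bracket with a transvection, of initial
  value \<open>(W, 0)\<close>, is an Euler equation which forces the transvection to be the quadratic field \<open>K W\<close>.  Parallel transport preserves
  the curvature, so these are the transvections in the normal coordinates at every point \<open>\<gamma> t\<close>; comparing them with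
  the transvections at \<open>p\<close> and integrating along rays gives the derivative in \<open>t\<close>.  For a Killing field of initial value
  \<open>(Z, A)\<close>, the part of \<open>A\<close> that anticommutes with \<open>I\<close> annihilates the curvature in each argument (a Peirce
  argument for the triple product), which leaves a linear field besides \<open>K Z\<close>.
\<close>

text \<open>\<open>knc_system\<close> asks for no regularity of \<open>knc q\<close> in the point
  \<open>q\<close>, so the curve of maps in \<open>is_knc_extension\<close> cannot be differentiated
  by a chain rule: its derivative has to come out of estimates. What links the coordinates at
  \<open>p\<close> with those at \<open>\<gamma> t\<close> are the transvections. They are intrinsic
  vector fields, and both coordinate systems show them as the same fields \<open>K W\<close>,
  because the curvature at the centre determines \<open>K\<close>. For small y the vectors
  \<open>K W y\<close> exhaust the tangent space, so knowing how the transition map carries these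
  fields amounts to a differential equation for the map along rays. No real analyticity is assumed
  either, so the Taylor series of the potential does not determine a field at once. The rotation
  field is recovered from its Taylor coefficients only because the derivative of a Killing field
  whose endomorphism commutes with \<open>I\<close> is complex linear, which brings the identity
  theorem on complex lines into play.\<close>

notation scaleR (infixr "*R" 75)
notation has_vector_derivative (infix "hvd" 50)
abbreviation at01 :: "real => real filter" where "at01 t == at t within {0..1}"

section \<open>Directional derivatives and closure properties of smooth maps\<close>

abbreviation dd :: "'a::real_normed_vector => ('a => 'b::real_normed_vector) => 'a => 'b"
 where "dd v f \<equiv> (%x. frechet_derivative f (at x) v)"

lemma dd_cong_open:
 assumes "open S" "x : S" "!!y. y : S ==> f y = g y"
 shows "frechet_derivative f (at x) = frechet_derivative g (at x)"
proof -
 have "(f has_derivative f') (at x) \<longleftrightarrow> (g has_derivative f') (at x)" for f'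
 using assms by (metis has_derivative_transform_within_open)
 then show ?thesis by (simp add: frechet_derivative_def)
qed

lemma dd_eqI: "(f has_derivative f') (at x) ==> frechet_derivative f (at x) v = f' v"
 by (metis frechet_derivative_at)

lemma differentiable_cong_open:
 assumes "open S" "x : S" "!!y. y : S ==> f y = g y" "f differentiable (at x)"
 shows "g differentiable (at x)"
 using assms unfolding differentiable_def by (metis has_derivative_transform_within_open)

lemma dto_cong:
 assumes "open S" "!!x. x : S ==> f x = g x"
 shows "differentiable_times_on n S f \<longleftrightarrow> differentiable_times_on n S g"
 using assms(2)
proof (induction n arbitrary: f g)
 case 0
 then show ?case by (simp cong: continuous_on_cong)
next
 case (Suc n)
 have fd: "frechet_derivative f (at x) = frechet_derivative g (at x)" if "x : S" for x
 using dd_cong_open[OF assms(1) that] Suc.prems by blast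
 have "f differentiable (at x) \<longleftrightarrow> g differentiable (at x)" if "x : S" for x
 using differentiable_cong_open[OF assms(1) that, of f g] differentiable_cong_open[OF assms(1) that, of g f] Suc.prems
 by (metis (no_types, lifting))
 moreover have "differentiable_times_on n S (dd v f) \<longleftrightarrow> differentiable_times_on n S (dd v g)" for v
 by (rule Suc.IH) (simp add: fd)
 ultimately show ?case by simp
qed

lemma differentiable_times_on_subset:
 "differentiable_times_on n S f ==> T \<subseteq> S ==> differentiable_times_on n T f"
 by (induction n arbitrary: f) (auto intro: continuous_on_subset)

lemma differentiable_times_on_Suc_imp:
 "differentiable_times_on (Suc n) S f ==> differentiable_times_on n S f"
proof (induction n arbitrary: f)
 case 0
 then show ?case
 by (auto intro!: continuous_at_imp_continuous_on differentiable_imp_continuous_within)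
next
 case (Suc n)
 then show ?case by auto
qed

text \<open>The clauses of \<open>differentiable_times_on\<close> use \<open>at x\<close> and not
  \<open>at x within S\<close>, so each of them only sees a neighbourhood of x.\<close>

lemma dto_local:
 assumes "!!x. x : S ==> EX T. open T & x : T & differentiable_times_on n T f"
 shows "differentiable_times_on n S f"
 using assms
proof (induction n arbitrary: f)
 case 0
 have "continuous (at x) f" if "x : S" for x
 using 0[OF that] by (auto simp: continuous_on_eq_continuous_at)
 then show ?case
 by (simp add: continuous_at_imp_continuous_on)
next
 case (Suc n)
 have "f differentiable (at x)" if "x : S" for x
 using Suc.prems[OF that] by auto
 moreover have "differentiable_times_on n S (dd v f)" for v
 using Suc.prems by (intro Suc.IH) (metis differentiable_times_on.simps(2))
 ultimately show ?case by simp
qed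

lemma dto_const [simp]: "differentiable_times_on n S (%x. c)"
 by (induction n arbitrary: c) auto

lemma dto_linear:
 assumes "bounded_linear l"
 shows "differentiable_times_on n S l"
proof (cases n)
 case 0
 then show ?thesis using assms by (simp add: linear_continuous_on)
next
 case (Suc m)
 have "frechet_derivative l (at x) = l" for x
 using bounded_linear_imp_has_derivative[OF assms] by (metis frechet_derivative_at)
 then show ?thesis using Suc assms bounded_linear_imp_differentiable by auto
qed

lemma dto_bl:
 assumes "open S" "bounded_linear l" "differentiable_times_on n S f"
 shows "differentiable_times_on n S (%x. l (f x))"
 using assms(3)
proof (induction n arbitrary: f)
 case 0
 then show ?case using assms(2) by (auto intro: bounded_linear.continuous_on)
next
 case (Suc n)
 have d: "((%x. l (f x)) has_derivative (%v. l (frechet_derivative f (at x) v))) (at x)" if "x : S" for x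
 by (rule bounded_linear.has_derivative[OF assms(2)])
  (use Suc.prems that in \<open>simp_all add: frechet_derivative_works[symmetric]\<close>)
 have "differentiable_times_on n S (dd v (%x. l (f x)))" for v
 using Suc.IH[of "dd v f"] Suc.prems
 by (subst dto_cong[OF assms(1), of _ "%x. l (dd v f x)"]) (auto simp: dd_eqI[OF d])
 then show ?case using d by (auto intro: differentiableI)
qed

lemma dto_add:
 assumes "open S" "differentiable_times_on n S f" "differentiable_times_on n S g"
 shows "differentiable_times_on n S (%x. f x + g x)"
 using assms(2,3)
proof (induction n arbitrary: f g)
 case 0
 then show ?case by (auto intro: continuous_on_add)
next
 case (Suc n)
 have d: "((%x. f x + g x) has_derivative (%v. frechet_derivative f (at x) v + frechet_derivative g (at x) v)) (at x)"
 if "x : S" for x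
 by (rule has_derivative_add) (use Suc.prems that in \<open>simp_all add: frechet_derivative_works[symmetric]\<close>)
 have "differentiable_times_on n S (dd v (%x. f x + g x))" for v
 using Suc.IH[of "dd v f" "dd v g"] Suc.prems
 by (subst dto_cong[OF assms(1), of _ "%x. dd v f x + dd v g x"]) (auto simp: dd_eqI[OF d])
 then show ?case using d by (auto intro: differentiableI)
qed

lemma dto_bilinear:
 assumes "open S" "bounded_bilinear B" "differentiable_times_on n S f" "differentiable_times_on n S g"
 shows "differentiable_times_on n S (%x. B (f x) (g x))"
 using assms(3,4)
proof (induction n arbitrary: f g)
 case 0
 then show ?case using assms(2) by (auto intro: bounded_bilinear.continuous_on)
next
 case (Suc n)
 have d: "((%x. B (f x) (g x)) has_derivative
  (%v. B (f x) (frechet_derivative g (at x) v) + B (frechet_derivative f (at x) v) (g x))) (at x)"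
 if "x : S" for x
 by (rule bounded_bilinear.FDERIV[OF assms(2)])
  (use Suc.prems that in \<open>simp_all add: frechet_derivative_works[symmetric]\<close>)
 have "differentiable_times_on n S (dd v (%x. B (f x) (g x)))" for v
 proof (subst dto_cong[OF assms(1), of _ "%x. B (f x) (dd v g x) + B (dd v f x) (g x)"])
 show "differentiable_times_on n S (%x. B (f x) (dd v g x) + B (dd v f x) (g x))"
  using Suc.prems[THEN differentiable_times_on_Suc_imp] Suc.prems
  by (intro dto_add assms(1) Suc.IH) simp_all
 qed (auto simp: dd_eqI[OF d])
 then show ?case using d by (auto intro: differentiableI)
qed

lemma dto_sum:
 assumes "open S" "!!i. i : A ==> differentiable_times_on n S (f i)"
 shows "differentiable_times_on n S (%x. \<Sum>i\<in>A. f i x)"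
 using assms(2)
 by (induction A rule: infinite_finite_induct) (auto intro: dto_add[OF assms(1)])

lemma frechet_derivative_basis_sum:
 fixes f :: "'a::euclidean_space => 'b::real_normed_vector"
 assumes "f differentiable (at x)"
 shows "frechet_derivative f (at x) v = (\<Sum>b\<in>Basis. (v \<bullet> b) *R frechet_derivative f (at x) b)"
proof -
 have l: "linear (frechet_derivative f (at x))"
 using assms linear_frechet_derivative by blast
 have "frechet_derivative f (at x) v = frechet_derivative f (at x) (\<Sum>b\<in>Basis. (v \<bullet> b) *R b)"
 by (simp add: euclidean_representation)
 also have "... = (\<Sum>b\<in>Basis. (v \<bullet> b) *R frechet_derivative f (at x) b)"
 using l by (simp add: linear_sum linear_scale)
 finally show ?thesis .
qed

text \<open>The chain rule differentiates \<open>f\<close> in the direction \<open>dd v g x\<close>,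
  which varies with x, whereas the definition only speaks of fixed directions. Expanding this
  direction in the basis brings the induction back to fixed ones.\<close>

lemma dto_compose:
 fixes f :: "'b::euclidean_space => 'c::real_normed_vector" and g :: "'a::real_normed_vector => 'b"
 assumes "open S" "open T" "g ` S \<subseteq> T" "differentiable_times_on n T f" "differentiable_times_on n S g"
 shows "differentiable_times_on n S (%x. f (g x))"
 using assms(4,5)
proof (induction n arbitrary: f)
 case 0
 then show ?case using assms(3) by (auto intro: continuous_on_compose2)
next
 case (Suc n)
 have fd: "f differentiable at (g x)" and gd: "g differentiable at x" if "x : S" for x
 using Suc.prems that assms(3) by auto
 have d: "((%x. f (g x)) has_derivative
  (%v. frechet_derivative f (at (g x)) (frechet_derivative g (at x) v))) (at x)"
 if "x : S" for x
 using has_derivative_compose[OF gd[OF that, unfolded frechet_derivative_works] fd[OF that, unfolded frechet_derivative_works]]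
 by simp
 have "differentiable_times_on n S (dd v (%x. f (g x)))" for v
 proof (subst dto_cong[OF assms(1),
  of _ "%x. \<Sum>b\<in>Basis. (dd v g x \<bullet> b) *R dd b f (g x)"])
 show "differentiable_times_on n S (%x. \<Sum>b\<in>Basis. (dd v g x \<bullet> b) *R dd b f (g x))"
 proof (intro dto_sum dto_bilinear[OF _ bounded_bilinear_scaleR] assms(1))
  fix b :: 'b
  show "differentiable_times_on n S (%x. dd v g x \<bullet> b)"
  using Suc.prems by (intro dto_bl[OF assms(1) bounded_linear_inner_left]) auto
  show "differentiable_times_on n S (%x. dd b f (g x))"
  using Suc.prems(1) Suc.prems(2)[THEN differentiable_times_on_Suc_imp] by (intro Suc.IH) auto
 qed
 qed (auto simp: dd_eqI[OF d] intro!: frechet_derivative_basis_sum fd)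
 then show ?case using d by (auto intro: differentiableI)
qed

lemma smooth_cong: "open S ==> (!!x. x : S ==> f x = g x) ==> smooth_on S f \<longleftrightarrow> smooth_on S g"
 unfolding smooth_on_def using dto_cong by metis

lemma smooth_subset: "smooth_on S f ==> T \<subseteq> S ==> smooth_on T f"
 unfolding smooth_on_def using differentiable_times_on_subset by metis

lemma smooth_on_local: "(!!x. x : S ==> EX T. open T & x : T & smooth_on T f) ==> smooth_on S f"
 unfolding smooth_on_def by (meson dto_local)

lemma smooth_const [simp]: "smooth_on S (%x. c)"
 by (simp add: smooth_on_def)

lemma smooth_on_linear: "bounded_linear l ==> smooth_on S l"
 by (simp add: smooth_on_def dto_linear)

lemma smooth_on_id [simp]: "smooth_on S (%x. x)"
 by (rule smooth_on_linear) (rule bounded_linear_ident)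

lemma smooth_bl: "open S ==> bounded_linear l ==> smooth_on S f ==> smooth_on S (%x. l (f x))"
 by (simp add: smooth_on_def dto_bl)

lemma smooth_on_bilinear:
 "open S ==> bounded_bilinear B ==> smooth_on S f ==> smooth_on S g ==> smooth_on S (%x. B (f x) (g x))"
 by (simp add: smooth_on_def dto_bilinear)

lemma smooth_add: "open S ==> smooth_on S f ==> smooth_on S g ==> smooth_on S (%x. f x + g x)"
 by (simp add: smooth_on_def dto_add)

lemma smooth_on_minus: "open S ==> smooth_on S f ==> smooth_on S (%x. - f x)"
 by (rule smooth_bl) (auto intro: bounded_linear_minus[OF bounded_linear_ident])

lemma smooth_diff_fun: "open S ==> smooth_on S f ==> smooth_on S g ==> smooth_on S (%x. f x - g x)"
 using smooth_add[of S f "%x. - g x"] smooth_on_minus[of S g] by simp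

lemma smooth_sum: "open S ==> (!!i. i : A ==> smooth_on S (f i)) ==> smooth_on S (%x. \<Sum>i\<in>A. f i x)"
 by (simp add: smooth_on_def dto_sum)

lemma smooth_scaleR: "open S ==> smooth_on S f ==> smooth_on S g ==> smooth_on S (%x. f x *R g x)"
 by (rule smooth_on_bilinear[OF _ bounded_bilinear_scaleR])

lemma smooth_on_inner: "open S ==> smooth_on S f ==> smooth_on S (%x. f x \<bullet> b)"
 by (rule smooth_bl[OF _ bounded_linear_inner_left])

lemma smooth_compose:
 fixes f :: "'b::euclidean_space => 'c::real_normed_vector"
 assumes "open S" "open T" "!!x. x : S ==> g x : T" "smooth_on T f" "smooth_on S g"
 shows "smooth_on S (%x. f (g x))"
 using assms dto_compose[of S T g _ f] unfolding smooth_on_def by blast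

lemma smooth_dd: "smooth_on S f ==> smooth_on S (dd v f)"
 unfolding smooth_on_def by (metis differentiable_times_on.simps(2))

lemma smooth_diff: "smooth_on S f ==> x : S ==> f differentiable (at x)"
 unfolding smooth_on_def by (metis differentiable_times_on.simps(2))

lemma smooth_deriv: "smooth_on S f ==> x : S ==> (f has_derivative frechet_derivative f (at x)) (at x)"
 using smooth_diff frechet_derivative_works by blast

lemma smooth_cont: "smooth_on S f ==> continuous_on S f"
 unfolding smooth_on_def by (metis differentiable_times_on.simps(1))

lemma smooth_on_dd_var:
 fixes f :: "'a::euclidean_space => 'b::real_normed_vector"
 assumes "open S" "smooth_on S f" "smooth_on S w"
 shows "smooth_on S (%x. frechet_derivative f (at x) (w x))"
proof (subst smooth_cong[OF assms(1), of _ "%x. \<Sum>b\<in>Basis. (w x \<bullet> b) *R dd b f x"])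
 show "smooth_on S (%x. \<Sum>b\<in>Basis. (w x \<bullet> b) *R dd b f x)"
 using assms by (intro smooth_sum smooth_scaleR smooth_on_inner smooth_dd)
qed (rule frechet_derivative_basis_sum[OF smooth_diff[OF assms(2)]])

text \<open>A field of linear maps is usually known to be smooth on fixed vectors only; the basis
  expansion extends this to a variable argument.\<close>

lemma smooth_basis:
 fixes T :: "'a::real_normed_vector => 'c::euclidean_space => 'b::real_normed_vector"
 assumes "open S" "!!x. x : S ==> linear (T x)" "!!b. b : Basis ==> smooth_on S (%x. T x b)" "smooth_on S w"
 shows "smooth_on S (%x. T x (w x))"
proof (subst smooth_cong[OF assms(1), of _ "%x. \<Sum>b\<in>Basis. (w x \<bullet> b) *R T x b"])
 show "smooth_on S (%x. \<Sum>b\<in>Basis. (w x \<bullet> b) *R T x b)"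
 using assms by (intro smooth_sum smooth_scaleR smooth_on_inner) auto
 show "T x (w x) = (\<Sum>b\<in>Basis. (w x \<bullet> b) *R T x b)" if "x : S" for x
 proof -
 have "T x (w x) = T x (\<Sum>b\<in>Basis. (w x \<bullet> b) *R b)" by (simp add: euclidean_representation)
 also have "... = (\<Sum>b\<in>Basis. (w x \<bullet> b) *R T x b)"
  using assms(2)[OF that] by (simp add: linear_sum linear_scale)
 finally show ?thesis .
 qed
qed

section \<open>Mean value estimates and symmetry of second derivatives\<close>

lemma hvd_linearization:
 fixes g :: "real => 'b::real_normed_vector"
 assumes "0 <= h" "!!s. s : {0..h} ==> (g hvd g' s) (at s within {0..h})"
 and "!!s. s : {0..h} ==> norm (g' s - c) <= e"
 shows "norm (g h - g 0 - h *R c) <= e * h"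
proof -
 define k where "k s = g s - s *R c" for s
 have k: "(k has_derivative (%x. x *R (g' s - c))) (at s within {0..h})" if "s : {0..h}" for s
 unfolding k_def using assms(2)[OF that]
 by (auto intro!: derivative_eq_intros simp: has_vector_derivative_def algebra_simps)
 have "norm (k h - k 0) <= e * norm (h - 0)"
 proof (rule differentiable_bound[OF _ k])
 fix s assume s: "s : {0..h}"
 have "onorm (%x. x *R (g' s - c)) <= norm (g' s - c)"
  by (rule onorm_le) (simp add: mult.commute)
 with assms(3)[OF s] show "onorm (%x. x *R (g' s - c)) <= e" by simp
 qed (use assms(1) in auto)
 then show ?thesis using assms(1) by (simp add: k_def algebra_simps)
qed

lemma hvd_along_line:
 assumes "(f has_derivative f') (at (x + s *R u))"
 shows "((%s. f (x + s *R u)) hvd f' u) (at s within T)"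
proof -
 have "((%s. x + s *R u) has_derivative (%t. t *R u)) (at s within T)"
 by (auto intro!: derivative_eq_intros)
 from has_derivative_compose[OF this assms] show ?thesis
 using linear_scale[OF has_derivative_linear[OF assms]]
 by (simp add: has_vector_derivative_def)
qed

text \<open>The mean value estimate is applied twice, inside in the direction v and outside in the
  direction u. The second difference is symmetric in u and v while the approximating derivative is
  not visibly so, which is what \<open>dd_commute\<close> exploits.\<close>

lemma second_difference_estimate:
 fixes f :: "'a::real_normed_vector => 'b::real_normed_vector"
 assumes "open S" "smooth_on S f" "x : S" "e > 0"
 shows "EX d>0. ALL h. 0 < h & h < d -->
 norm (f (x + h *R u + h *R v) - f (x + h *R u) - f (x + h *R v) + f x - (h * h) *R dd v (dd u f) x) <= e * (h * h)"
proof -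
 have "continuous_on S (dd v (dd u f))"
 using assms by (intro smooth_cont smooth_dd)
 then have "continuous (at x) (dd v (dd u f))"
 using assms continuous_on_eq_continuous_at by blast
 then obtain d0 where d0: "d0 > 0" "!!y. dist y x < d0 ==> dist (dd v (dd u f) y) (dd v (dd u f) x) < e"
 using assms(4) unfolding continuous_at_eps_delta by blast
 obtain d1 where d1: "d1 > 0" "ball x d1 \<subseteq> S" using assms(1,3) openE by blast
 \<comment> \<open>\<open>h * c\<close> dominates the norm of \<open>s *R u + r *R v\<close> for s
   and r up to h; the summand 1 keeps \<open>c\<close> positive.\<close>
 define c where "c = norm u + norm v + 1"
 have c: "c > 0" by (simp add: c_def add_pos_nonneg add_nonneg_pos)
 define d where "d = min d0 d1 / c"
 have near: "dist (x + s *R u + r *R v) x < min d0 d1" if "0 <= s" "s <= h" "0 <= r" "r <= h" "0 < h" "h < d" for s r h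
 proof -
 have "norm (s *R u + r *R v) <= s * norm u + r * norm v"
  using norm_triangle_ineq[of "s *R u" "r *R v"] that by simp
 also have "... <= h * norm u + h * norm v" using that by (intro add_mono mult_right_mono) auto
 also have "... < h * c" using that by (simp add: c_def algebra_simps)
 also have "h * c < min d0 d1" using that c by (simp add: d_def pos_less_divide_eq)
 finally show ?thesis by (simp add: dist_norm add.assoc)
 qed
 have inS: "x + s *R u + r *R v : S" if "0 <= s" "s <= h" "0 <= r" "r <= h" "0 < h" "h < d" for s r h
 proof -
 have "x + s *R u + r *R v : ball x d1" using near[OF that] by (simp add: dist_commute)
 then show ?thesis using d1 by blast
 qed
 show ?thesis
 proof (intro exI[of _ d] conjI allI impI)
 show "d > 0" using d0 d1 c by (simp add: d_def)
 fix h assume h: "0 < h & h < d"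
 have inner: "norm (dd u f (x + s *R u + h *R v) - dd u f (x + s *R u) - h *R dd v (dd u f) x) <= e * h"
  if s: "s : {0..h}" for s
 proof -
  have "norm ((%r. dd u f (x + s *R u + r *R v)) h - (%r. dd u f (x + s *R u + r *R v)) 0 - h *R dd v (dd u f) x) <= e * h"
  proof (rule hvd_linearization)
  fix r assume r: "r : {0..h}"
  have y: "x + s *R u + r *R v : S" using inS[of s h r] s r h by auto
  show "((%r. dd u f (x + s *R u + r *R v)) hvd dd v (dd u f) (x + s *R u + r *R v)) (at r within {0..h})"
   by (rule hvd_along_line smooth_deriv[OF smooth_dd[OF assms(2)]] y)+
  show "norm (dd v (dd u f) (x + s *R u + r *R v) - dd v (dd u f) x) <= e"
   using d0(2)[of "x + s *R u + r *R v"] near[of s h r] s r h by (auto simp: dist_norm)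
  qed (use h in auto)
  then show ?thesis by simp
 qed
 have "norm ((%s. f (x + s *R u + h *R v) - f (x + s *R u)) h - (%s. f (x + s *R u + h *R v) - f (x + s *R u)) 0
  - h *R (h *R dd v (dd u f) x)) <= (e * h) * h"
 proof (rule hvd_linearization)
  fix s assume s: "s : {0..h}"
  have y: "x + s *R u + h *R v : S" "x + s *R u : S" using inS[of s h h] inS[of s h 0] s h by auto
  have "((%s. f ((x + h *R v) + s *R u)) hvd dd u f (x + s *R u + h *R v)) (at s within {0..h})"
  using hvd_along_line[of f _ "x + h *R v" s u, OF smooth_deriv[OF assms(2)]] y(1)
  by (simp add: algebra_simps)
  moreover have "((%s. f (x + s *R u)) hvd dd u f (x + s *R u)) (at s within {0..h})"
  by (rule hvd_along_line smooth_deriv[OF assms(2)] y)+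
  ultimately show "((%s. f (x + s *R u + h *R v) - f (x + s *R u)) hvd dd u f (x + s *R u + h *R v) - dd u f (x + s *R u)) (at s within {0..h})"
  by (intro has_vector_derivative_diff) (simp_all add: algebra_simps)
 qed (use h inner in auto)
 then show "norm (f (x + h *R u + h *R v) - f (x + h *R u) - f (x + h *R v) + f x - (h * h) *R dd v (dd u f) x) <= e * (h * h)"
  by (simp add: algebra_simps)
 qed
qed

lemma dd_commute:
 fixes f :: "'a::real_normed_vector => 'b::real_normed_vector"
 assumes "open S" "smooth_on S f" "x : S"
 shows "dd v (dd u f) x = dd u (dd v f) x"
proof (rule ccontr)
 assume ne: "dd v (dd u f) x ~= dd u (dd v f) x"
 \<comment> \<open>The two estimates together allow a distance of at most \<open>2 * e\<close>, so a
   third of the distance gives the contradiction.\<close>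
 define e where "e = norm (dd v (dd u f) x - dd u (dd v f) x) / 3"
 have e: "e > 0" using ne by (simp add: e_def)
 obtain d1 where d1: "d1 > 0" "!!h. 0 < h & h < d1 ==>
 norm (f (x + h *R u + h *R v) - f (x + h *R u) - f (x + h *R v) + f x - (h * h) *R dd v (dd u f) x) <= e * (h * h)"
 using second_difference_estimate[OF assms e, of u v] by blast
 obtain d2 where d2: "d2 > 0" "!!h. 0 < h & h < d2 ==>
 norm (f (x + h *R v + h *R u) - f (x + h *R v) - f (x + h *R u) + f x - (h * h) *R dd u (dd v f) x) <= e * (h * h)"
 using second_difference_estimate[OF assms e, of v u] by blast
 define h where "h = min d1 d2 / 2"
 have h: "0 < h" "h < d1" "h < d2" using d1(1) d2(1) by (auto simp: h_def)
 define A where "A = f (x + h *R u + h *R v) - f (x + h *R u) - f (x + h *R v) + f x"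
 have "norm (A - (h * h) *R dd v (dd u f) x) <= e * (h * h)" using d1(2)[of h] h by (simp add: A_def)
 moreover have "norm (A - (h * h) *R dd u (dd v f) x) <= e * (h * h)"
 using d2(2)[of h] h by (simp add: A_def algebra_simps)
 ultimately have "norm ((A - (h * h) *R dd u (dd v f) x) - (A - (h * h) *R dd v (dd u f) x)) <= e * (h * h) + e * (h * h)"
 by (meson add_mono norm_triangle_ineq4 order_trans)
 also have "(A - (h * h) *R dd u (dd v f) x) - (A - (h * h) *R dd v (dd u f) x) = (h * h) *R (dd v (dd u f) x - dd u (dd v f) x)"
 by (simp add: algebra_simps)
 finally have "(h * h) * norm (dd v (dd u f) x - dd u (dd v f) x) <= (h * h) * (2 * e)"
 using h(1) by (simp add: norm_mult mult.assoc mult.commute mult.left_commute)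
 then have "norm (dd v (dd u f) x - dd u (dd v f) x) <= 2 * e" using h(1) by (simp add: mult_le_cancel_left)
 then show False using e by (simp add: e_def)
qed

section \<open>Gronwall estimates and linear differential equations\<close>

lemma hvd_majorant:
 fixes f :: "real => 'b::real_normed_vector"
 assumes "t : {0..1}"
 and f: "!!s. s : {0..1} ==> (f hvd f' s) (at01 s)"
 and g: "!!s. s : {0..1} ==> (g hvd g' s) (at01 s)"
 and le: "!!s. s : {0..1} ==> norm (f' s) <= g' s"
 shows "norm (f t - f 0) <= g t - g 0"
proof (cases "t = 0")
 case False
 then have t: "0 < t" "t <= 1" using assms(1) by auto
 show ?thesis
 proof (rule differentiable_bound_general[OF t(1)])
 show "continuous_on {0..t} f" "continuous_on {0..t} g"
  using continuous_on_vector_derivative[of "{0..1}", OF f] continuous_on_vector_derivative[of "{0..1}", OF g] t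
  by (auto elim: continuous_on_subset)
 fix x assume x: "0 < x" "x < t"
 then have "at x within {0..1} = at x" using t by (intro at_within_interior) simp
 then show "(f hvd f' x) (at x)" "(g hvd g' x) (at x)"
  using f[of x] g[of x] x t by auto
 show "norm (f' x) <= g' x" using le x t by auto
 qed
qed simp

lemma exp_term_has_real_derivative:
 "((%s::real. K * ((C * s) ^ Suc n / fact (Suc n))) has_real_derivative C * (K * ((C * s) ^ n / fact n))) (at s within T)"
proof -
 have "((%s. C * s) has_real_derivative C) (at s within T)"
 by (auto intro!: derivative_eq_intros)
 from DERIV_cmult[OF DERIV_cdivide[OF DERIV_power_Suc[OF this, of n], of "fact (Suc n)"], of K]
 have "((%s. K * ((C * s) ^ Suc n / fact (Suc n))) has_real_derivative
 K * ((1 + real n) * (C * (C * s) ^ n) / fact (Suc n))) (at s within T)" .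
 moreover have "K * ((1 + real n) * (C * (C * s) ^ n) / fact (Suc n)) = C * (K * ((C * s) ^ n / fact n))"
 by simp
 ultimately show ?thesis by metis
qed

text \<open>Each derivative is bounded by the largest member of the family, so no member satisfies a
  differential inequality of its own. The a priori bound \<open>K\<close> is improved by
  integration: after n rounds the excess over the comparison solution is
  \<open>K * (C * t) ^ n / fact n\<close>, which tends to 0. No norm has to be
  differentiated.\<close>

lemma gronwall_family:
 fixes N N' :: "'i => real => 'b::real_normed_vector"
 assumes C: "C >= 1" "\<e> >= 0" "\<d> >= 0"
 and der: "!!i t. i : J ==> t : {0..1} ==> (N i hvd N' i t) (at01 t)"
 and bd: "!!i t. i : J ==> t : {0..1} ==> norm (N i t) <= K"
 and ini: "!!i. i : J ==> norm (N i 0) <= \<d>"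
 and step: "!!t \<k> i. t : {0..1} ==> (!!j. j : J ==> norm (N j t) <= \<k>) ==> i : J ==> norm (N' i t) <= C * \<k> + \<e>"
 and i: "i : J" and t: "t : {0..1}"
 shows "norm (N i t) <= (\<d> + \<e>) * exp C"
proof -
 \<comment> \<open>The solution of b' = C b + \<e> with initial value \<d>.\<close>
 define b where "b t = (\<d> + \<e> / C) * exp (C * t) - \<e> / C" for t
 have C0: "C > 0" using C by simp
 have K: "K >= 0" using bd[OF i t] by (meson norm_ge_zero order_trans)
 have claim: "i : J ==> t : {0..1} ==> norm (N i t) <= b t + K * (C * t) ^ n / fact n" for n i t
 proof (induction n arbitrary: i t)
 case 0
 have "\<e> / C * 1 <= (\<d> + \<e> / C) * exp (C * t)"
  using C C0 0 by (intro mult_mono) auto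
 then have "b t >= 0" by (simp add: b_def)
 then show ?case using bd[OF 0] by simp
 next
 case (Suc n)
 let ?g = "%s. b s + K * (C * s) ^ Suc n / fact (Suc n)"
 have g0: "?g 0 = \<d>" by (simp add: b_def)
 have "norm (N i t - N i 0) <= ?g t - ?g 0"
 proof (rule hvd_majorant[OF Suc.prems(2) der[OF Suc.prems(1)]])
  fix s :: real assume s: "s : {0..1}"
  have "((%s. K * (C * s) ^ Suc n / fact (Suc n)) has_real_derivative C * (K * (C * s) ^ n / fact n)) (at01 s)"
  using exp_term_has_real_derivative[of K C n] by simp
  moreover have "(b has_real_derivative C * b s + \<e>) (at01 s)"
  unfolding b_def using C0 by (auto intro!: derivative_eq_intros simp: field_simps)
  ultimately have "(?g has_real_derivative (C * b s + \<e>) + C * (K * (C * s) ^ n / fact n)) (at01 s)"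
  by (intro DERIV_add) auto
  then show "(?g hvd (C * (b s + K * (C * s) ^ n / fact n) + \<e>)) (at01 s)"
  by (simp add: has_real_derivative_iff_has_vector_derivative algebra_simps)
  show "norm (N' i s) <= C * (b s + K * (C * s) ^ n / fact n) + \<e>"
  by (rule step[OF s _ Suc.prems(1)]) (rule Suc.IH[OF _ s])
 qed auto
 moreover have "norm (N i t) <= norm (N i t - N i 0) + norm (N i 0)"
  by (metis add.commute diff_add_cancel norm_triangle_ineq)
 ultimately show ?case using g0 ini[OF Suc.prems(1)] by linarith
 qed
 have "(%n. inverse (fact n) * (C * t) ^ n) \<longlonglongrightarrow> 0"
 by (rule summable_LIMSEQ_zero[OF summable_exp])
 then have "(%n. b t + K * (inverse (fact n) * (C * t) ^ n)) \<longlonglongrightarrow> b t + K * 0"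
 by (intro tendsto_intros)
 then have "norm (N i t) <= b t + K * 0"
 by (rule LIMSEQ_le_const) (use claim[OF i t] in \<open>auto simp: field_simps\<close>)
 also have "... <= (\<d> + \<e>) * exp C"
 proof -
 have "\<e> / C <= \<e>" using C C0 by (simp add: pos_divide_le_eq mult_left_le_one_le mult_le_cancel_left1)
 moreover have "C * t <= C" using C0 t by auto
 ultimately have "(\<d> + \<e> / C) * exp (C * t) <= (\<d> + \<e>) * exp C"
  using C C0 by (intro mult_mono) auto
 moreover have "\<e> / C >= 0" using C C0 by simp
 ultimately show ?thesis by (simp add: b_def)
 qed
 finally show ?thesis .
qed

lemma gronwall:
 fixes y :: "real => 'b::real_normed_vector"
 assumes "C >= 1" "\<e> >= 0"
 and der: "!!t. t : {0..1} ==> (y hvd y' t) (at01 t)"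
 and le: "!!t. t : {0..1} ==> norm (y' t) <= C * norm (y t) + \<e>"
 and t: "t : {0..1}"
 shows "norm (y t) <= (norm (y 0) + \<e>) * exp C"
proof -
 have "continuous_on {0..1} y" using der by (rule continuous_on_vector_derivative)
 then have "compact (y ` {0..1})" by (intro compact_continuous_image) auto
 then obtain K where K: "!!t. t : {0..1} ==> norm (y t) <= K"
 using compact_imp_bounded bounded_iff by (metis imageI)
 have "norm ((%i::unit. y) () t) <= (norm (y 0) + \<e>) * exp C"
 proof (rule gronwall_family[where N = "%i. y" and J = UNIV and N' = "%i. y'" and K = K])
 fix t \<k> and i :: unit
 assume t: "t : {0..1}" and k: "!!j::unit. j : UNIV ==> norm (y t) <= \<k>"
 have "C * norm (y t) <= C * \<k>" using k assms(1) by (intro mult_left_mono) auto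
 then show "norm (y' t) <= C * \<k> + \<e>" using le[OF t] by linarith
 qed (use assms K in auto)
 then show ?thesis by simp
qed

text \<open>Neumann series: the n-th iterated integral is bounded by a term of an exponential
  series, so the sum converges uniformly together with its termwise derivatives.\<close>

lemma linear_ode_exists:
 fixes a :: "real => 'f::banach => 'f"
 assumes lin: "!!t. t : {0..1} ==> linear (a t)"
 and bd: "!!t y. t : {0..1} ==> norm (a t y) <= C * norm y"
 and cont: "!!y. continuous_on {0..1} y ==> continuous_on {0..1} (%t. a t (y t))"
 shows "EX y. y 0 = y0 & (ALL t:{0..1}. (y hvd a t (y t)) (at01 t))"
proof -
 define D where "D = max C 0"
 have D: "D >= 0" by (simp add: D_def)
 have bdD: "norm (a t y) <= D * norm y" if "t : {0..1}" for t y
 proof -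
 have "C * norm y <= D * norm y" by (intro mult_right_mono) (auto simp: D_def)
 then show ?thesis using bd[OF that, of y] by linarith
 qed
 define Y where "Y = rec_nat (%t. y0) (%n Yn t. integral {0..t} (%s. a s (Yn s)))"
 have Y0: "Y 0 = (%t. y0)" and YS: "Y (Suc n) = (%t. integral {0..t} (%s. a s (Y n s)))" for n
 by (simp_all add: Y_def)
 have cY: "continuous_on {0..1} (Y n)" for n
 proof (induction n)
 case (Suc n)
 have "(Y (Suc n) hvd a t (Y n t)) (at01 t)" if "t : {0..1}" for t
  unfolding YS by (rule integral_has_vector_derivative[OF cont[OF Suc] that])
 then show ?case by (rule continuous_on_vector_derivative)
 qed (simp add: Y0)
 have dY: "(Y (Suc n) hvd a t (Y n t)) (at01 t)" if "t : {0..1}" for t n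
 unfolding YS by (rule integral_has_vector_derivative[OF cont[OF cY] that])
 have bY: "t : {0..1} ==> norm (Y n t) <= norm y0 * ((D * t) ^ n / fact n)" for t n
 proof (induction n arbitrary: t)
 case (Suc n)
 let ?g = "%s. norm y0 * ((D * s) ^ Suc n / fact (Suc n))"
 have "norm (Y (Suc n) t - Y (Suc n) 0) <= ?g t - ?g 0"
 proof (rule hvd_majorant[OF Suc.prems dY])
  fix s :: real assume s: "s : {0..1}"
  show "(?g hvd D * (norm y0 * ((D * s) ^ n / fact n))) (at01 s)"
  unfolding has_real_derivative_iff_has_vector_derivative[symmetric]
  by (rule exp_term_has_real_derivative)
  show "norm (a s (Y n s)) <= D * (norm y0 * ((D * s) ^ n / fact n))"
  using bdD[OF s, of "Y n s"] mult_left_mono[OF Suc.IH[OF s] D] by linarith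
 qed auto
 then show ?case by (simp add: YS)
 qed (simp add: Y0)
 define M where "M n = norm y0 * (D ^ n / fact n)" for n
 have bM: "norm (Y n t) <= M n" if "t : {0..1}" for t n
 proof -
 have "(D * t) ^ n <= D ^ n" using D that by (intro power_mono) (auto simp: mult_left_le)
 then have "norm y0 * ((D * t) ^ n / fact n) <= M n" unfolding M_def
  by (intro mult_left_mono divide_right_mono) auto
 then show ?thesis using bY[OF that, of n] by linarith
 qed
 have sM: "summable M"
 unfolding M_def using summable_exp[of D] by (intro summable_mult) (simp add: field_simps)
 have ul: "uniform_limit {0..1} (%n t. \<Sum>i<n. Y i t) (%t. \<Sum>i. Y i t) sequentially"
 by (rule Weierstrass_m_test[OF bM sM])
 define S where "S t = (\<Sum>i. Y i t)" for t
 have sums: "(%n. Y n t) sums S t" if "t : {0..1}" for t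
 unfolding S_def using bM[OF that] by (intro summable_sums summable_comparison_test'[OF sM, of 0]) auto
 \<comment> \<open>Termwise derivatives are shifted by one: \<open>Y (Suc m)\<close> has the
   derivative \<open>a t (Y m t)\<close>, and the constant \<open>Y 0\<close> has derivative
   0.\<close>
 define Y' where "Y' n t = (case n of 0 => 0 | Suc m => a t (Y m t))" for n t
 have "EX g. ALL t:{0..1}. (%n. Y n t) sums g t & (g has_derivative (%h. h *R a t (S t))) (at01 t)"
 proof (rule has_derivative_series[of "{0..1}" Y "%n t h. h *R Y' n t"])
 show "(Y n has_derivative (%h. h *R Y' n t)) (at01 t)" if "t : {0..1}" for n t
  using dY[OF that] by (cases n) (auto simp: Y'_def Y0 has_vector_derivative_def)
 show "(0::real) : {0..1}" "(%n. Y n 0) sums S 0" using sums[of 0] by auto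
 fix e :: real assume e: "e > 0"
 have "e / (D + 1) > 0" using e D by simp
 then have "\<forall>\<^sub>F n in sequentially. ALL t:{0..1}. dist (\<Sum>i<n. Y i t) (S t) < e / (D + 1)"
  using ul unfolding uniform_limit_iff S_def by blast
 then obtain N where N: "!!n t. n >= N ==> t : {0..1} ==> dist (\<Sum>i<n. Y i t) (S t) < e / (D + 1)"
  unfolding eventually_sequentially by blast
 have "norm ((\<Sum>i<n. h *R Y' i t) - h *R a t (S t)) <= e * norm h" if n: "n >= Suc N" and t: "t : {0..1}" for n t h
 proof -
  obtain m where m: "n = Suc m" "m >= N" using n by (cases n) auto
  have "(\<Sum>i<n. Y' i t) = a t (\<Sum>i<m. Y i t)"
  unfolding m by (simp add: sum.lessThan_Suc_shift Y'_def linear_sum[OF lin[OF t]] del: sum.lessThan_Suc)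
  then have "(\<Sum>i<n. h *R Y' i t) - h *R a t (S t) = h *R a t ((\<Sum>i<m. Y i t) - S t)"
  by (simp add: scaleR_sum_right[symmetric] scaleR_diff_right linear_diff[OF lin[OF t]])
  then have "norm ((\<Sum>i<n. h *R Y' i t) - h *R a t (S t)) = norm h * norm (a t ((\<Sum>i<m. Y i t) - S t))" by simp
  also have "... <= norm h * (D * norm ((\<Sum>i<m. Y i t) - S t))"
  by (intro mult_left_mono bdD t) auto
  also have "... <= norm h * ((D + 1) * (e / (D + 1)))"
  using N[OF m(2) t] D e by (intro mult_left_mono mult_mono) (auto simp: dist_norm)
  also have "... = e * norm h" using D by simp
  finally show ?thesis .
 qed
 then show "\<forall>\<^sub>F n in sequentially. ALL t:{0..1}. ALL h. norm ((\<Sum>i<n. h *R Y' i t) - h *R a t (S t)) <= e * norm h"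
  unfolding eventually_sequentially by blast
 qed auto
 then obtain g where g: "!!t. t : {0..1} ==> (%n. Y n t) sums g t"
 "!!t. t : {0..1} ==> (g has_derivative (%h. h *R a t (S t))) (at01 t)" by blast
 have gS: "g t = S t" if "t : {0..1}" for t using g(1)[OF that] sums[OF that] sums_unique2 by blast
 have "(%n. Y n 0) sums y0"
 proof -
 have "Y n 0 = (if n = 0 then y0 else 0)" for n by (cases n) (auto simp: Y0 YS)
 then show ?thesis using sums_single[of 0 "%_. y0"] by simp
 qed
 then have "g 0 = y0" using g(1)[of 0] sums_unique2 by force
 then show ?thesis
 using g(2) gS by (intro exI[of _ g]) (auto simp: has_vector_derivative_def)
qed

section \<open>Uniform bounds for fields of linear and multilinear maps\<close>

lemma has_derivative_quadratic:
 fixes f :: "'a::real_normed_vector => 'b::real_normed_vector"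
 assumes "bounded_linear L" "r > 0"
 and "!!h. norm h < r ==> norm (f (x + h) - f x - L h) <= C * (norm h)\<^sup>2"
 shows "(f has_derivative L) (at x)"
 unfolding has_derivative_at_alt
proof (intro conjI allI impI assms(1))
 fix e :: real assume e: "e > 0"
 define d where "d = min r (e / (\<bar>C\<bar> + 1))"
 have "norm (f y - f x - L (y - x)) <= e * norm (y - x)" if y: "norm (y - x) < d" for y
 proof -
 have "norm (f y - f x - L (y - x)) <= C * (norm (y - x))\<^sup>2"
  using assms(3)[of "y - x"] y by (simp add: d_def)
 also have "... <= ((\<bar>C\<bar> + 1) * norm (y - x)) * norm (y - x)"
  by (simp add: power2_eq_square mult.assoc mult_right_mono)
 also have "... <= e * norm (y - x)"
 proof (rule mult_right_mono)
  have "norm (y - x) <= e / (\<bar>C\<bar> + 1)" using y by (simp add: d_def)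
  then show "(\<bar>C\<bar> + 1) * norm (y - x) <= e" by (simp add: pos_le_divide_eq mult.commute add_nonneg_pos)
 qed simp
 finally show ?thesis .
 qed
 moreover have "d > 0" using e assms(2) by (simp add: d_def add_nonneg_pos)
 ultimately show "EX d>0. ALL y. norm (y - x) < d --> norm (f y - f x - L (y - x)) <= e * norm (y - x)" by blast
qed

lemma basis_expansion:
 fixes f :: "'a::euclidean_space => 'b::real_vector"
 assumes "linear f"
 shows "f v = (\<Sum>b\<in>Basis. (v \<bullet> b) *R f b)"
proof -
 have "f (\<Sum>b\<in>Basis. (v \<bullet> b) *R b) = (\<Sum>b\<in>Basis. (v \<bullet> b) *R f b)"
 unfolding linear_sum[OF assms] linear_scale[OF assms] ..
 then show ?thesis by (simp add: euclidean_representation)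
qed

lemma linear_basis_bound:
 fixes f :: "'a::euclidean_space => 'b::real_normed_vector"
 assumes "linear f" "!!b. b : Basis ==> norm (f b) <= M"
 shows "norm (f u) <= real DIM('a) * M * norm u"
proof -
 have "norm (f u) <= (\<Sum>b\<in>(Basis::'a set). norm u * M)"
 unfolding basis_expansion[OF assms(1), of u] using assms(2) by (intro sum_norm_le) (auto intro!: mult_mono Basis_le_norm)
 then show ?thesis by (simp add: mult_ac)
qed

lemma compact_norm_bound:
 fixes f :: "'a::metric_space => 'b::real_normed_vector"
 assumes "compact K" "continuous_on K f"
 shows "EX C>=0. ALL x:K. norm (f x) <= C"
proof -
 have "bounded (f ` K)" using assms compact_continuous_image compact_imp_bounded by blast
 then obtain C where "ALL x:K. norm (f x) <= C" by (auto simp: bounded_iff)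
 then show ?thesis by (intro exI[of _ "max C 0"]) (simp add: le_max_iff_disj)
qed

lemma finite_bound_choice:
 assumes "finite A" "!!a. a : A ==> EX C>=0::real. P a C" "!!a C D. P a C ==> C <= D ==> P a D"
 shows "EX C>=0. ALL a:A. P a C"
proof -
 obtain f where f: "!!a. a : A ==> f a >= 0 & P a (f a)" using assms(2) by metis
 show ?thesis
 proof (intro exI[of _ "\<Sum>a\<in>A. f a"] conjI ballI)
 show "(\<Sum>a\<in>A. f a) >= 0" using f by (simp add: sum_nonneg)
 fix a assume a: "a : A"
 have "f a <= (\<Sum>a\<in>A. f a)" using f a assms(1) by (intro member_le_sum) auto
 then show "P a (\<Sum>a\<in>A. f a)" using assms(3) f[OF a] by blast
 qed
qed

lemma smooth_on_blinfunI:
 fixes f :: "'a::real_normed_vector => 'b::euclidean_space \<Rightarrow>\<^sub>L 'c::real_normed_vector"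
 assumes S: "open S" and f: "!!b. b : Basis ==> smooth_on S (%x. f x b)"
 shows "smooth_on S f"
proof -
 have bl: "bounded_linear (%c. blinfun_scaleR_left c o\<^sub>L blinfun_inner_left b)" for b :: 'b
 by (rule bounded_linear_compose[OF bounded_bilinear.bounded_linear_left[OF bounded_bilinear_blinfun_compose, of "blinfun_inner_left b"] bounded_linear_blinfun_scaleR_left])
 have "f x = (\<Sum>b\<in>Basis. blinfun_scaleR_left (f x b) o\<^sub>L blinfun_inner_left b)" for x
 proof (rule blinfun_eqI)
 fix i
 have "f x i = (\<Sum>b\<in>Basis. (i \<bullet> b) *R f x b)"
  by (rule basis_expansion[OF bounded_linear.linear[OF blinfun.bounded_linear_right]])
 then show "f x i = (\<Sum>b\<in>Basis. blinfun_scaleR_left (f x b) o\<^sub>L blinfun_inner_left b) i"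
  by (simp add: blinfun.sum_left)
 qed
 moreover have "smooth_on S (%x. \<Sum>b\<in>Basis. blinfun_scaleR_left (f x b) o\<^sub>L blinfun_inner_left b)"
 by (intro smooth_sum S smooth_bl[OF S bl] f)
 ultimately show ?thesis by simp
qed

lemma Blinfun_apply: "linear f ==> blinfun_apply (Blinfun f) x = f x"
 for f :: "'a::euclidean_space => 'b::real_normed_vector"
 by (simp add: bounded_linear_Blinfun_apply linear_conv_bounded_linear)

lemma smooth_on_Blinfun:
 fixes T :: "'a::real_normed_vector => 'b::euclidean_space => 'c::real_normed_vector"
 assumes S: "open S" and lin: "!!x. x : S ==> linear (T x)" and T: "!!b. smooth_on S (%x. T x b)"
 shows "smooth_on S (%x. Blinfun (T x))"
 by (rule smooth_on_blinfunI[OF S], rule smooth_cong[OF S, THEN iffD1, OF _ T]) (simp add: Blinfun_apply lin)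

text \<open>Packing the bilinear maps into one operator-valued map makes bounds uniform: on a
  compact set the operator norm is bounded, which covers all arguments at once.\<close>

lemma bilinear_blinfun_field:
 fixes T :: "'a::real_normed_vector => 'b::euclidean_space => 'c::euclidean_space => 'd::real_normed_vector"
 assumes S: "open S" and bil: "!!x. x : S ==> bilinear (T x)" and T: "!!u v. smooth_on S (%x. T x u v)"
 obtains F where "smooth_on S F" "!!x u v. x : S ==> blinfun_apply (blinfun_apply (F x) u) v = T x u v"
proof -
 have l: "x : S ==> linear (T x u)" "x : S ==> linear (%u. T x u v)" for x u v using bil by (auto simp: bilinear_def)
 have l2: "x : S ==> linear (%u. Blinfun (T x u))" for x
 by (intro linearI blinfun_eqI)
  (simp_all add: Blinfun_apply l blinfun.add_left blinfun.scaleR_left linear_add[OF l(2)] linear_scale[OF l(2)])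
 show thesis
 proof (rule that[of "%x. Blinfun (%u. Blinfun (T x u))"])
 show "smooth_on S (%x. Blinfun (%u. Blinfun (T x u)))" by (intro smooth_on_Blinfun S l l2 T)
 qed (simp add: Blinfun_apply l l2)
qed

lemma trilinear_blinfun_field:
 fixes T :: "'a::real_normed_vector => 'b::euclidean_space => 'c::euclidean_space => 'd::euclidean_space => 'f::real_normed_vector"
 assumes S: "open S" and bil: "!!x u. x : S ==> bilinear (T x u)" and lin: "!!x v w. x : S ==> linear (%u. T x u v w)"
 and T: "!!u v w. smooth_on S (%x. T x u v w)"
 obtains F where "smooth_on S F" "!!x u v w. x : S ==> blinfun_apply (blinfun_apply (blinfun_apply (F x) u) v) w = T x u v w"
proof -
 have "EX F. smooth_on S F & (ALL x:S. ALL v w. blinfun_apply (blinfun_apply (F x) v) w = T x u v w)" for u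
 by (rule bilinear_blinfun_field[OF S bil T]) blast+
 then obtain F where F: "!!u. smooth_on S (F u)" "!!u x v w. x : S ==> blinfun_apply (blinfun_apply (F u x) v) w = T x u v w" by metis
 have l: "x : S ==> linear (%u. F u x)" for x
 by (intro linearI blinfun_eqI) (simp_all add: F blinfun.add_left blinfun.scaleR_left linear_add[OF lin] linear_scale[OF lin])
 show thesis
 by (rule that[of "%x. Blinfun (%u. F u x)"]) (auto intro!: smooth_on_Blinfun S l F(1) simp: Blinfun_apply l F(2))
qed

lemma dd_blinfun_apply:
 assumes "smooth_on S F" "x : S"
 shows "dd h (%y. blinfun_apply (F y) u) x = blinfun_apply (dd h F x) u"
 by (rule dd_eqI[OF bounded_linear.has_derivative[OF blinfun.bounded_linear_left smooth_deriv[OF assms]]])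

lemma bilinear_dd:
 fixes T :: "'a::real_normed_vector => 'b::euclidean_space => 'c::euclidean_space => 'd::real_normed_vector"
 assumes S: "open S" and bil: "!!x. x : S ==> bilinear (T x)" and T: "!!u v. smooth_on S (%x. T x u v)" and x: "x : S"
 shows "bilinear (%u v. dd h (%y. T y u v) x)"
proof -
 obtain F where F: "smooth_on S F" "!!x u v. x : S ==> blinfun_apply (blinfun_apply (F x) u) v = T x u v"
 by (rule bilinear_blinfun_field[OF S bil T]) blast+
 have "dd h (%y. T y u v) x = blinfun_apply (blinfun_apply (dd h F x) u) v" for u v
 proof -
 have "frechet_derivative (%y. T y u v) (at x) = frechet_derivative (%y. blinfun_apply (blinfun_apply (F y) u) v) (at x)"
  by (rule dd_cong_open[OF S x]) (simp add: F(2))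
 then show ?thesis
  using dd_blinfun_apply[OF smooth_bl[OF S blinfun.bounded_linear_left F(1)] x] dd_blinfun_apply[OF F(1) x] by simp
 qed
 then show ?thesis by (simp add: bilinear_def linear_iff blinfun.bilinear_simps)
qed

text \<open>A bound for the second derivative is a Lipschitz constant for the first, and this gives
  the quadratic remainder. The constant is the sum of the three suprema, so that one constant serves
  all estimates.\<close>

lemma smooth_bounds:
 fixes f :: "'a::euclidean_space => 'b::real_normed_vector"
 assumes S: "open S" and f: "smooth_on S f" and K: "compact K" "convex K" "K \<subseteq> S"
 obtains C where "C >= 1" "!!x. x : K ==> norm (f x) <= C" "!!x h. x : K ==> norm (dd h f x) <= C * norm h"
 "!!x y. x : K ==> y : K ==> norm (f y - f x) <= C * norm (y - x)"
 "!!x y. x : K ==> y : K ==> norm (f y - f x - dd (y - x) f x) <= C * (norm (y - x))\<^sup>2"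
proof -
 have lin: "x : S ==> linear (%h. dd h g x)" if "smooth_on S g" for x and g :: "'a => 'c::real_normed_vector"
 by (rule linear_frechet_derivative[OF smooth_diff[OF that]])
 define D where "D x = Blinfun (%h. dd h f x)" for x
 have D: "smooth_on S D" unfolding D_def by (rule smooth_on_Blinfun[OF S lin[OF f] smooth_dd[OF f]])
 have Dh: "blinfun_apply (D x) h = dd h f x" if "x : S" for x h by (simp add: D_def Blinfun_apply lin[OF f that])
 define E where "E x = Blinfun (%h. dd h D x)" for x
 have E: "smooth_on S E" unfolding E_def by (rule smooth_on_Blinfun[OF S lin[OF D] smooth_dd[OF D]])
 have Eh: "blinfun_apply (E x) h = dd h D x" if "x : S" for x h by (simp add: E_def Blinfun_apply lin[OF D that])
 have bnd: "EX C>=0. ALL x:K. norm (g x) <= C" if "smooth_on S g" for g :: "'a => 'c::real_normed_vector"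
 by (rule compact_norm_bound[OF K(1) continuous_on_subset[OF smooth_cont[OF that] K(3)]])
 obtain C0 C1 C2 where C0: "C0 >= 0" "ALL x:K. norm (f x) <= C0" and C1: "C1 >= 0" "ALL x:K. norm (D x) <= C1"
 and C2: "C2 >= 0" "ALL x:K. norm (E x) <= C2" using bnd[OF f] bnd[OF D] bnd[OF E] by blast
 define C where "C = 1 + C0 + C1 + C2"
 have C: "norm (f x) <= C" "norm (D x) <= C" "norm (E x) <= C" if "x : K" for x
 using that C0 C1 C2 by (fastforce simp: C_def)+
 have lip: "norm (g y - g x) <= C * norm (y - x)"
 if g: "smooth_on S g" and G: "!!x h. x : S ==> blinfun_apply (G x) h = dd h g x" "!!x. x : K ==> norm (G x) <= C" and xy: "x : K" "y : K"
 for g :: "'a => 'c::real_normed_vector" and G x y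
 proof (rule differentiable_bound[OF K(2)])
 fix z assume z: "z : K"
 show "(g has_derivative frechet_derivative g (at z)) (at z within K)"
  using z K(3) by (intro has_derivative_at_withinI[OF smooth_deriv[OF g]]) auto
 have "norm (dd h g z) <= C * norm h" for h
  using norm_blinfun[of "G z" h] G(1)[of z h] mult_right_mono[OF G(2)[OF z] norm_ge_zero[of h]] z K(3) by auto
 then show "onorm (frechet_derivative g (at z)) <= C" by (rule onorm_le)
 qed (use xy in auto)
 show thesis
 proof (rule that[of C])
 show "C >= 1" using C0 C1 C2 by (simp add: C_def)
 show "norm (dd h f x) <= C * norm h" if "x : K" for x h
  using norm_blinfun[of "D x" h] Dh[of x h] mult_right_mono[OF C(2)[OF that] norm_ge_zero[of h]] that K(3) by auto
 show "norm (f y - f x) <= C * norm (y - x)" if "x : K" "y : K" for x y by (rule lip[OF f Dh C(2) that])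
 show "norm (f y - f x - dd (y - x) f x) <= C * (norm (y - x))\<^sup>2" if xy: "x : K" "y : K" for x y
 proof -
  have seg: "closed_segment x y \<subseteq> K" using xy K(2) by (simp add: closed_segment_subset)
  have "norm (f y - f x - blinfun_apply (D x) (y - x)) <= norm (y - x) * (C * norm (y - x))"
  proof (rule differentiable_bound_linearization[where S = "closed_segment x y" and f' = "%z. blinfun_apply (D z)"])
  show "x + t *R (y - x) : closed_segment x y" if "t : {0..1}" for t using that by (auto simp: in_segment algebra_simps)
  fix z assume z: "z : closed_segment x y"
  then have zS: "z : K" "z : S" using seg K(3) by auto
  have "blinfun_apply (D z) = frechet_derivative f (at z)" using Dh[OF zS(2)] by auto
  then show "(f has_derivative blinfun_apply (D z)) (at z within closed_segment x y)"
   by (simp add: has_derivative_at_withinI[OF smooth_deriv[OF f zS(2)]])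
  have "onorm (%h. blinfun_apply (D z) h - blinfun_apply (D x) h) = norm (D z - D x)" by (simp add: norm_blinfun.rep_eq minus_blinfun.rep_eq)
  also have "... <= C * norm (z - x)" by (rule lip[OF D Eh C(3) xy(1) zS(1)])
  also have "... <= C * norm (y - x)"
   using segment_bound(1)[OF z] C0(1) C1(1) C2(1) by (intro mult_left_mono) (auto simp: C_def norm_minus_commute)
  finally show "onorm (blinfun_apply (D z) - blinfun_apply (D x)) <= C * norm (y - x)" by (simp add: fun_diff_def)
  qed simp
  then show ?thesis using Dh[of x "y - x"] xy(1) K(3) by (auto simp: power2_eq_square mult_ac)
 qed
 qed (rule C(1))
qed

text \<open>Frobenius theorem for a linear system. The solution is obtained by integrating along
  rays from \<open>x0\<close>; flatness is what makes its derivative correct in the directions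
  across the rays. Flatness is required only at states satisfying \<open>Inv\<close>, since the
  Killing system is not flat at arbitrary states; in return \<open>Inv\<close> has to persist along
  every solution on a ray.\<close>

theorem flat_linear_system:
 fixes a :: "'e::euclidean_space => 'e \<Rightarrow>\<^sub>L 'f::banach \<Rightarrow>\<^sub>L 'f"
 assumes \<O>: "open \<O>" "convex \<O>" "x0 : \<O>" and a: "smooth_on \<O> a"
 and inv: "!!x y t. x : \<O> ==> y 0 = s0 ==>
  (!!t. t : {0..1} ==> (y hvd a (x0 + t *R (x - x0)) (x - x0) (y t)) (at01 t)) ==>
  t : {0..1} ==> Inv (x0 + t *R (x - x0)) (y t)"
 and flat: "!!x s u v. x : \<O> ==> Inv x s ==> dd u a x v s + a x v (a x u s) = dd v a x u s + a x u (a x v s)"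
 shows "EX s. s x0 = s0 & (ALL x:\<O>. Inv x (s x) & (s has_derivative (%v. a x v (s x))) (at x))"
proof -
 define p where "p x t = x0 + t *R (x - x0)" for x and t :: real
 have pin: "p x t : S" if "convex S" "x0 : S" "x : S" "t : {0..1}" for S x t
 using convexD[OF that(1,2,3), of "1 - t" t] that(4) by (simp add: p_def algebra_simps)
 note p\<O> = pin[OF \<O>(2,3)]
 have da: "((%t. a (p x t)) hvd dd (x - x0) a (p x t)) (at01 t)" if "x : \<O>" "t : {0..1}" for x t
 using hvd_along_line[of a _ x0 t "x - x0", OF smooth_deriv[OF a]] p\<O>[OF that] unfolding p_def by blast
 have nb: "norm (A v s) <= \<a> * \<b> * \<c>" if "norm A <= \<a>" "norm v <= \<b>" "norm s <= \<c>" for A :: "'e \<Rightarrow>\<^sub>L 'f \<Rightarrow>\<^sub>L 'f" and v s \<a> \<b> \<c>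
 proof -
 have "norm (A v s) <= norm A * norm v * norm s"
  by (rule order_trans[OF norm_blinfun mult_right_mono[OF norm_blinfun norm_ge_zero]])
 also have "... <= \<a> * \<b> * \<c>" using that that[THEN order_trans[OF norm_ge_zero]] by (intro mult_mono mult_nonneg_nonneg) auto
 finally show ?thesis .
 qed
 have "EX y. y 0 = s0 & (ALL t:{0..1}. (y hvd a (p x t) (x - x0) (y t)) (at01 t))"
 if x: "x : \<O>" for x
 proof -
 have c: "continuous_on {0..1} (%t. a (p x t))" by (rule continuous_on_vector_derivative[OF da[OF x]])
 obtain C where C: "ALL t:{0..1}. norm (a (p x t)) <= C" using compact_norm_bound[OF compact_Icc c] by blast
 show ?thesis
 proof (rule linear_ode_exists)
  show "linear (blinfun_apply (a (p x t) (x - x0)))" for t by (rule bounded_linear.linear[OF blinfun.bounded_linear_right])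
  show "norm (a (p x t) (x - x0) y) <= C * norm (x - x0) * norm y" if "t : {0..1}" for t y
  using C that by (intro nb) auto
  show "continuous_on {0..1} (%t. a (p x t) (x - x0) (y t))" if "continuous_on {0..1} y" for y
  using c that by (intro continuous_intros)
 qed
 qed
 then obtain y where y0: "!!x. x : \<O> ==> y x 0 = s0"
 and dy: "!!x t. x : \<O> ==> t : {0..1} ==> (y x hvd a (p x t) (x - x0) (y x t)) (at01 t)"
 by metis
 define s where "s x = y x 1" for x
 have Invs: "Inv (p x t) (y x t)" if "x : \<O>" "t : {0..1}" for x t
 unfolding p_def using dy[OF that(1)] by (intro inv that y0) (auto simp: p_def)
 have p1: "p x 1 = x" for x by (simp add: p_def)
 have "s x0 = s0"
 proof -
 have "norm (y x0 1 - y x0 0) <= 0 - 0"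
  by (rule hvd_majorant[OF _ dy[OF \<O>(3)], where g = "%_. 0" and g' = "%_. 0"]) auto
 then show ?thesis using y0[OF \<O>(3)] by (simp add: s_def)
 qed
 moreover have "(s has_derivative (%v. a x v (s x))) (at x)" if x: "x : \<O>" for x
 proof -
 obtain r0 where r0: "r0 > 0" "cball x r0 \<subseteq> \<O>" using \<O>(1) x open_contains_cball by blast
 define r where "r = min r0 1"
 have r: "r > 0" "r <= 1" "cball x r \<subseteq> \<O>" using r0 by (auto simp: r_def)
 \<comment> \<open>All rays from \<open>x0\<close> to points near x stay in this compact convex set,
   so one constant controls the coefficients on all of them.\<close>
 define K where "K = convex hull (insert x0 (cball x r))"
 have "insert x0 (cball x r) \<subseteq> \<O>" using \<O>(3) r(3) by blast
 then have K: "compact K" "convex K" "K \<subseteq> \<O>"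
  unfolding K_def by (simp_all add: compact_convex_hull hull_minimal \<O>(2))
 have K': "x0 : K" "cball x r \<subseteq> K" using hull_subset[of "insert x0 (cball x r)" convex] by (auto simp: K_def)
 obtain C where C: "C >= 1" "!!x. x : K ==> norm (a x) <= C" "!!x h. x : K ==> norm (dd h a x) <= C * norm h"
  "!!x y. x : K ==> y : K ==> norm (a y - a x) <= C * norm (y - x)"
  "!!x y. x : K ==> y : K ==> norm (a y - a x - dd (y - x) a x) <= C * (norm (y - x))\<^sup>2"
  by (rule smooth_bounds[OF \<O>(1) a K]) blast
 note pK = pin[OF K(2) K'(1)]
 define \<r> where "\<r> = norm (x - x0) + 1"
 have \<r>: "\<r> >= 1" by (simp add: \<r>_def)
 have C\<r>: "C * \<r> >= 1" using mult_mono[of 1 C 1 \<r>] C(1) \<r> by simp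
 have zx: "norm (z - x0) <= \<r>" if "z : cball x r" for z
  using norm_triangle_ineq[of "x - x0" "z - x"] that r(2) by (auto simp: \<r>_def dist_norm norm_minus_commute)
 define B where "B = norm s0 * exp (C * \<r>)"
 have B: "norm (y z t) <= B" if z: "z : cball x r" and t: "t : {0..1}" for z t
 proof -
  have z\<O>: "z : \<O>" using z r by blast
  have "norm (y z t) <= (norm (y z 0) + 0) * exp (C * \<r>)"
  by (rule gronwall[OF C\<r> order_refl dy[OF z\<O>] _ t]) (use K'(2) z in \<open>auto intro!: nb C(2) pK zx\<close>)
  then show ?thesis by (simp add: y0 z\<O> B_def)
 qed
 have B0: "B >= 0" by (simp add: B_def)
 define E where "E = (C * B + C * \<r> * B) * exp (C * \<r>)"
 have E: "E >= 0" using C(1) \<r> B0 by (auto simp: E_def intro!: mult_nonneg_nonneg add_nonneg_nonneg)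
 define F where "F = C * \<r> * B + (C * \<r> * E + (C * B + C * E))"
 have F: "F >= 0" using C(1) \<r> B0 E by (auto simp: F_def intro!: mult_nonneg_nonneg add_nonneg_nonneg)
 have quad: "norm (s (x + h) - s x - a x h (s x)) <= F * exp (C * \<r>) * (norm h)\<^sup>2" if h: "norm h < r" for h
 proof -
  define z where "z = x + h"
  have z: "z : cball x r" "z : \<O>" "z : K" and xc: "x : cball x r" "x : K" using h r K'(2) by (auto simp: z_def dist_norm subset_iff)
  let ?\<x> = "x - x0" and ?P = "p x" and ?Q = "p z" and ?Y = "y x" and ?Z = "y z"
  have zh: "z - x0 = ?\<x> + h" by (simp add: z_def)
  have QP: "?Q t - ?P t = t *R h" for t by (simp add: p_def z_def algebra_simps)
  have nQP: "norm (?Q t - ?P t) <= norm h" if "t : {0..1}" for t unfolding QP using that by (auto intro: mult_left_le_one_le)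
  have aQP: "norm (a (?Q t) - a (?P t)) <= C * norm h" if "t : {0..1}" for t
  using C(4)[OF pK[OF xc(2) that] pK[OF z(3) that]] mult_left_mono[OF nQP[OF that], of C] C(1) by linarith
  have le1: "norm (?Z t - ?Y t) <= E * norm h" if t: "t : {0..1}" for t
  proof -
  have "norm (?Z t - ?Y t) <= (norm (?Z 0 - ?Y 0) + (C * norm h * B + C * norm h * \<r> * B)) * exp (C * \<r>)"
  proof (rule gronwall[where y = "%t. ?Z t - ?Y t", OF C\<r> _ has_vector_derivative_diff[OF dy[OF z(2)] dy[OF x]] _ t])
   show "C * norm h * B + C * norm h * \<r> * B >= 0" using C(1) B0 \<r> by simp
   fix t :: real assume t: "t : {0..1}"
   have "a (?Q t) (z - x0) (?Z t) - a (?P t) ?\<x> (?Y t) =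
   a (?Q t) (z - x0) (?Z t - ?Y t) + (a (?Q t) h (?Y t) + (a (?Q t) - a (?P t)) ?\<x> (?Y t))"
   by (simp add: zh blinfun.bilinear_simps)
   also have "norm ... <= C * \<r> * norm (?Z t - ?Y t) + (C * norm h * B + C * norm h * \<r> * B)"
   by (intro norm_triangle_mono nb C(2) pK z xc t zx aQP B order_refl)
   finally show "norm (a (?Q t) (z - x0) (?Z t) - a (?P t) ?\<x> (?Y t)) <= C * \<r> * norm (?Z t - ?Y t) + (C * norm h * B + C * norm h * \<r> * B)" .
  qed
  then show ?thesis by (simp add: y0 x z E_def algebra_simps)
  qed
  \<comment> \<open>Moving the endpoint by h moves the point at parameter t by
    \<open>t *R h\<close>. Hence the expected first order change of the solution there is
    \<open>t *R a (p x t) h (y x t)\<close>, and \<open>\<D>\<close> is the remainder.\<close>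
  define \<D> where "\<D> t = ?Z t - ?Y t - t *R a (?P t) h (?Y t)" for t
  define \<D>' where "\<D>' t = a (?Q t) (z - x0) (?Z t) - a (?P t) ?\<x> (?Y t)
  - (t *R (a (?P t) h (a (?P t) ?\<x> (?Y t)) + dd ?\<x> a (?P t) h (?Y t)) + 1 *R a (?P t) h (?Y t))" for t
  have d\<D>: "(\<D> hvd \<D>' t) (at01 t)" if t: "t : {0..1}" for t
  proof -
  note ah = bounded_linear.has_vector_derivative[OF blinfun.bounded_linear_left da[OF x t], of h]
  show ?thesis
   unfolding \<D>_def[abs_def] \<D>'_def
   by (intro has_vector_derivative_diff dy x z t has_vector_derivative_scaleR[OF DERIV_ident]
    bounded_bilinear.has_vector_derivative[OF bounded_bilinear_blinfun_apply ah dy[OF x t]])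
  qed
  have b\<D>: "norm (\<D>' t) <= C * \<r> * norm (\<D> t) + F * (norm h)\<^sup>2" if t: "t : {0..1}" for t
  proof -
  have "linear (%h. dd h a (?P t))" by (rule linear_frechet_derivative[OF smooth_diff[OF a p\<O>[OF x t]]])
  from linear_scale[OF this, of t h] have sc: "dd (?Q t - ?P t) a (?P t) = t *R dd h a (?P t)" unfolding QP .
  \<comment> \<open>Flatness exchanges the derivative of \<open>a\<close> along the ray for the
    derivative in the direction h. Besides the term linear in \<open>\<D>\<close>, every summand is
    then of second order in h.\<close>
  have "A' (\<x> + h) Z - A \<x> Y - (t *R (A h (A \<x> Y) + D h Y) + 1 *R A h Y) =
   A \<x> (Z - Y - t *R A h Y) + ((A' - A - t *R D') \<x> Z + ((t *R D') \<x> (Z - Y) + ((A' - A) h Z + A h (Z - Y))))"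
   if "D h Y + A h (A \<x> Y) = D' \<x> Y + A \<x> (A h Y)" for A A' D D' :: "'e \<Rightarrow>\<^sub>L 'f \<Rightarrow>\<^sub>L 'f" and \<x> Y Z
  proof -
   have "A h (A \<x> Y) + D h Y = D' \<x> Y + A \<x> (A h Y)" using that by (simp add: add.commute)
   then show ?thesis by (simp add: blinfun.bilinear_simps algebra_simps)
  qed
  from this[OF flat[OF p\<O>[OF x t] Invs[OF x t], of ?\<x> h], of "a (?Q t)" "?Z t"]
  have "\<D>' t = a (?P t) ?\<x> (\<D> t) + ((a (?Q t) - a (?P t) - dd (?Q t - ?P t) a (?P t)) ?\<x> (?Z t)
   + ((t *R dd h a (?P t)) ?\<x> (?Z t - ?Y t) + ((a (?Q t) - a (?P t)) h (?Z t) + a (?P t) h (?Z t - ?Y t))))"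
   unfolding \<D>'_def \<D>_def sc zh .
  also have "norm ... <= C * \<r> * norm (\<D> t) + (C * (norm h)\<^sup>2 * \<r> * B
   + (C * norm h * \<r> * (E * norm h) + (C * norm h * norm h * B + C * norm h * (E * norm h))))"
  proof (intro norm_triangle_mono nb C(2) pK z xc t zx aQP B le1 order_refl)
   show "norm (a (?Q t) - a (?P t) - dd (?Q t - ?P t) a (?P t)) <= C * (norm h)\<^sup>2"
   using C(5)[OF pK[OF xc(2) t] pK[OF z(3) t]] mult_left_mono[OF power_mono[OF nQP[OF t] norm_ge_zero, of 2], of C] C(1) by linarith
   show "norm (t *R dd h a (?P t)) <= C * norm h"
   using C(3)[OF pK[OF xc(2) t], of h] t mult_left_le_one_le[of "norm (dd h a (?P t))" t] by simp
  qed
  finally show ?thesis by (simp add: F_def algebra_simps power2_eq_square)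
  qed
  have "norm (\<D> 1) <= (norm (\<D> 0) + F * (norm h)\<^sup>2) * exp (C * \<r>)"
  by (rule gronwall[OF C\<r> _ d\<D> b\<D>]) (use F in auto)
  then show ?thesis unfolding z_def[symmetric] by (simp add: \<D>_def y0 x z s_def p1 algebra_simps)
 qed
 show ?thesis by (rule has_derivative_quadratic[OF _ r(1) quad]) (rule bounded_linear_compose[OF blinfun.bounded_linear_left blinfun.bounded_linear_right])
 qed
 moreover have "Inv x (s x)" if "x : \<O>" for x
 using Invs[OF that, of 1] by (simp add: s_def p1)
 ultimately show ?thesis by blast
qed

section \<open>Inner products and smooth fields of bilinear forms\<close>

lemma coercive_bilinear:
 fixes g :: "'e::euclidean_space => 'e => real"
 assumes "bilinear g" "!!u. u ~= 0 ==> g u u > 0"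
 shows "EX c>0. ALL z. c * (norm z)\<^sup>2 <= g z z"
proof -
 have "bounded_bilinear g" using assms(1) bilinear_conv_bounded_bilinear by blast
 then have "continuous_on (sphere 0 1) (%z. g z z)"
 by (rule bounded_bilinear.continuous_on) (rule continuous_on_id)+
 moreover have "sphere (0::'e) 1 ~= {}" by simp
 ultimately obtain z0 where z0: "z0 : sphere 0 1" "!!z. z : sphere 0 1 ==> g z0 z0 <= g z z"
 using continuous_attains_inf[of "sphere (0::'e) 1" "%z. g z z"] by auto
 have "g z0 z0 * (norm z)\<^sup>2 <= g z z" for z
 proof (cases "z = 0")
 case False
 have "g z0 z0 <= g (z /\<^sub>R norm z) (z /\<^sub>R norm z)" using False by (intro z0) auto
 also have "... = g z z / (norm z)\<^sup>2"
  by (simp add: bilinear_lmul[OF assms(1)] bilinear_rmul[OF assms(1)] power2_eq_square divide_simps)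
 finally show ?thesis using False by (simp add: pos_le_divide_eq)
 qed (simp add: bilinear_lzero[OF assms(1)])
 moreover have "g z0 z0 > 0" using z0(1) by (intro assms(2)) auto
 ultimately show ?thesis by blast
qed

lemma riesz_bilinear:
 fixes g :: "'e::euclidean_space => 'e => real"
 assumes "bilinear g" "!!u. u ~= 0 ==> g u u > 0" "linear l"
 shows "EX z. ALL w. g z w = l w"
proof -
 define F where "F z = (\<Sum>b\<in>Basis. g z b *R b)" for z
 have Fi: "F z \<bullet> b = g z b" if "b : Basis" for z b using that by (simp add: F_def)
 have lin: "linear F" unfolding F_def
 by (simp add: linear_iff bilinear_ladd[OF assms(1)] bilinear_lmul[OF assms(1)]
  sum.distrib scaleR_sum_right scaleR_add_left)
 have ext: "g z w = g' w" if "linear g'" "!!b. b : Basis ==> g z b = g' b" for z w g'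
 using linear_eq_on_span[of "g z" g' Basis w] that assms(1) by (auto simp: bilinear_def)
 have "inj F"
 proof (subst linear_injective_0[OF lin], intro allI impI)
 fix z assume "F z = 0"
 then have "g z b = 0" if "b : Basis" for b using Fi[OF that, of z] by simp
 then have "g z z = 0" using ext[of "%_. 0" z z] by (simp add: linear_iff)
 then show "z = 0" using assms(2)[of z] by (cases "z = 0") auto
 qed
 then have "surj F" using lin linear_injective_imp_surjective by blast
 then obtain z where z: "F z = (\<Sum>b\<in>Basis. l b *R b)" by (metis surjD)
 have "g z b = l b" if "b : Basis" for b using Fi[OF that, of z] that by (simp add: z)
 then show ?thesis using ext[OF assms(3)] by blast
qed

lemma posdef_eqI:
 fixes g :: "'e::euclidean_space => 'e => real"
 assumes "bilinear g" "!!u. u ~= 0 ==> g u u > 0" "!!w. g z w = g z' w"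
 shows "z = z'"
proof -
 have "g (z - z') (z - z') = 0" using assms(3)[of "z - z'"] by (simp add: bilinear_lsub[OF assms(1)])
 then show ?thesis using assms(2)[of "z - z'"] by (cases "z - z' = 0") auto
qed

text \<open>Expanding \<open>\<s> y\<close> in the basis reduces the product rule to derivatives of
  \<open>T\<close> on fixed vectors. Linearity of \<open>T'\<close> in its vector comes from
  uniqueness of derivatives (\<open>exp'\<close>).\<close>

lemma linear_field_deriv:
 fixes T :: "'a::real_normed_vector => 'c::euclidean_space => 'b::real_normed_vector"
 assumes "open S" "x : S" and lin: "!!y. y : S ==> linear (T y)"
 and T': "!!v. ((%y. T y v) has_derivative T' v) (at x)" and \<s>: "(\<s> has_derivative \<s>') (at x)"
 shows "((%y. T y (\<s> y)) has_derivative (%h. T' (\<s> x) h + T x (\<s>' h))) (at x)"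
proof -
 have exp: "T y v = (\<Sum>b\<in>Basis. (v \<bullet> b) *R T y b)" if "y : S" for y v
 by (rule basis_expansion[OF lin[OF that]])
 have exp': "T' v h = (\<Sum>b\<in>Basis. (v \<bullet> b) *R T' b h)" for v h
 proof -
 have "((%y. \<Sum>b\<in>Basis. (v \<bullet> b) *R T y b) has_derivative (%h. \<Sum>b\<in>Basis. (v \<bullet> b) *R T' b h)) (at x)"
  by (intro has_derivative_sum has_derivative_scaleR_right T')
 then have "((%y. T y v) has_derivative (%h. \<Sum>b\<in>Basis. (v \<bullet> b) *R T' b h)) (at x)"
  by (rule has_derivative_transform_within_open[OF _ assms(1,2)]) (rule exp[symmetric])
 from has_derivative_unique[OF T'[of v] this] show ?thesis by (rule fun_cong)
 qed
 have "((%y. \<Sum>b\<in>Basis. (\<s> y \<bullet> b) *R T y b) has_derivative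
 (%h. \<Sum>b\<in>Basis. (\<s> x \<bullet> b) *R T' b h + (\<s>' h \<bullet> b) *R T x b)) (at x)"
 by (intro has_derivative_sum has_derivative_scaleR T' has_derivative_inner_left \<s>)
 moreover have "(%h. \<Sum>b\<in>Basis. (\<s> x \<bullet> b) *R T' b h + (\<s>' h \<bullet> b) *R T x b) = (%h. T' (\<s> x) h + T x (\<s>' h))"
 unfolding sum.distrib exp'[of "\<s> x", symmetric] exp[OF assms(2), symmetric] ..
 ultimately have "((%y. \<Sum>b\<in>Basis. (\<s> y \<bullet> b) *R T y b) has_derivative (%h. T' (\<s> x) h + T x (\<s>' h))) (at x)" by simp
 then show ?thesis
 by (rule has_derivative_transform_within_open[OF _ assms(1,2)]) (rule exp[symmetric])
qed

lemma bilinear_field_deriv: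
 fixes T :: "'a::real_normed_vector => 'c::euclidean_space => 'd::euclidean_space => 'b::real_normed_vector"
 assumes "open S" "x : S" and bil: "!!y. y : S ==> bilinear (T y)"
 and T': "!!v w. ((%y. T y v w) has_derivative T' v w) (at x)"
 and \<s>: "(\<s> has_derivative \<s>') (at x)" and \<t>: "(\<t> has_derivative \<t>') (at x)"
 shows "((%y. T y (\<s> y) (\<t> y)) has_derivative (%h. T' (\<s> x) (\<t> x) h + T x (\<s> x) (\<t>' h) + T x (\<s>' h) (\<t> x))) (at x)"
proof (rule linear_field_deriv[OF assms(1,2), where T = "%y v. T y v (\<t> y)"
  and T' = "%v h. T' v (\<t> x) h + T x v (\<t>' h)", OF _ _ \<s>])
 show "linear (%v. T y v (\<t> y))" if "y : S" for y using bil[OF that] by (simp add: bilinear_def)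
 show "((%y. T y v (\<t> y)) has_derivative (%h. T' v (\<t> x) h + T x v (\<t>' h))) (at x)" for v
 by (rule linear_field_deriv[OF assms(1,2) _ T' \<t>]) (use bil in \<open>simp add: bilinear_def\<close>)
qed

lemma smooth_bilinear_field:
 fixes T :: "'a::real_normed_vector => 'c::euclidean_space => 'd::euclidean_space => 'b::real_normed_vector"
 assumes "open S" "!!x. x : S ==> bilinear (T x)" "!!v w. smooth_on S (%x. T x v w)" "smooth_on S \<s>" "smooth_on S \<t>"
 shows "smooth_on S (%x. T x (\<s> x) (\<t> x))"
proof (rule smooth_basis[OF assms(1), where T = "%x v. T x v (\<t> x)", OF _ _ assms(4)])
 show "linear (%v. T x v (\<t> x))" if "x : S" for x using assms(2)[OF that] by (simp add: bilinear_def)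
 show "smooth_on S (%x. T x b (\<t> x))" for b
 by (rule smooth_basis[OF assms(1) _ assms(3,5)]) (use assms(2) in \<open>simp add: bilinear_def\<close>)
qed

text \<open>The derivative of a reciprocal is a product of reciprocals with a smooth function, so
  every order of differentiability yields the next.\<close>

lemma smooth_on_inverse:
 fixes f :: "'a::real_normed_vector => real"
 assumes S: "open S" and f: "smooth_on S f" and nz: "!!x. x : S ==> f x ~= 0"
 shows "smooth_on S (%x. inverse (f x))"
proof -
 note d = Deriv.has_derivative_inverse[OF nz smooth_deriv[OF f]]
 have "differentiable_times_on n S (%x. inverse (f x))" for n
 proof (induction n)
 case 0
 show ?case using smooth_cont[OF f] nz by (auto intro: continuous_intros)
 next
 case (Suc n)
 have "differentiable_times_on n S (dd v (%x. inverse (f x)))" for v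
 proof (subst dto_cong[OF S dd_eqI[OF d]])
  have "differentiable_times_on n S (dd v f)" using smooth_dd[OF f] by (simp add: smooth_on_def)
  then show "differentiable_times_on n S (%x. - (inverse (f x) * dd v f x * inverse (f x)))"
  by (intro dto_bl[where l = uminus] dto_bilinear[OF S bounded_bilinear_mult] Suc S
   bounded_linear_minus bounded_linear_ident)
 qed
 then show ?case using d by (auto intro: differentiableI)
 qed
 then show ?thesis by (simp add: smooth_on_def)
qed

text \<open>The vectors are orthogonal but not normalized, so that quotients occur but no square
  roots. The span condition is the invariant of the orthogonalization; for \<open>B = Basis\<close>
  it turns the vectors into a frame.\<close>

definition orthogonal_frame :: "('a::real_normed_vector => 'e::euclidean_space => 'e => real) => 'a set => 'e set => ('e => 'a => 'e) => bool"
 where "orthogonal_frame G S B v \<longleftrightarrow> (ALL b:B. smooth_on S (v b)) & (ALL x:S. (ALL b:B. v b x ~= 0) &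
 (ALL b:B. ALL c:B. b ~= c --> G x (v b x) (v c x) = 0) & span ((%b. v b x) ` B) = span B)"

lemma orthogonal_frameD:
 assumes "orthogonal_frame G S B v"
 shows "b : B ==> smooth_on S (v b)" "x : S ==> b : B ==> v b x ~= 0"
 "x : S ==> b : B ==> c : B ==> b ~= c ==> G x (v b x) (v c x) = 0" "x : S ==> span ((%b. v b x) ` B) = span B"
 using assms by (auto simp: orthogonal_frame_def)

text \<open>Gram--Schmidt orthogonalization with respect to a field of inner products.\<close>

lemma smooth_orthogonal_frame:
 fixes G :: "'a::real_normed_vector => 'e::euclidean_space => 'e => real"
 assumes S: "open S" and bil: "!!x. x : S ==> bilinear (G x)" and pos: "!!x u. x : S ==> u ~= 0 ==> G x u u > 0"
 and sym: "!!x u v. x : S ==> G x u v = G x v u" and sm: "!!u v. smooth_on S (%x. G x u v)" and B: "B \<subseteq> Basis"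
 shows "EX v. orthogonal_frame G S B v"
 using finite_subset[OF B finite_Basis] B
proof (induction B rule: finite_induct)
 case (insert a B)
 then obtain v where "orthogonal_frame G S B v" by auto
 note v = orthogonal_frameD[OF this]
 define k where "k c x = G x a (v c x) * inverse (G x (v c x) (v c x))" for c x
 define u where "u x = a - (\<Sum>c\<in>B. k c x *R v c x)" for x
 have "smooth_on S (k c)" if c: "c : B" for c
 unfolding k_def[abs_def] using v(2)[OF _ c] pos
 by (intro smooth_on_bilinear[OF S bounded_bilinear_mult] smooth_on_inverse[OF S] smooth_bilinear_field[OF S bil sm] v(1) c smooth_const)
  (auto simp: less_le)
 then have su: "smooth_on S u" unfolding u_def[abs_def] by (intro smooth_diff_fun smooth_sum smooth_scaleR S v(1) smooth_const)
 have orth: "G x (u x) (v d x) = 0" if x: "x : S" and d: "d : B" for x d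
 proof -
 have l: "linear (%u. G x u (v d x))" using bil[OF x] by (simp add: bilinear_def)
 have "(\<Sum>c\<in>B. k c x * G x (v c x) (v d x)) = (\<Sum>c\<in>B. if c = d then G x a (v d x) else 0)"
  by (intro sum.cong refl) (use v(3)[OF x _ d] v(2)[OF x d] pos[OF x] in \<open>force simp: k_def less_le\<close>)
 then show ?thesis
  using d insert.hyps(1) by (simp add: u_def linear_diff[OF l] linear_sum[OF l] linear_scale[OF l])
 qed
 have nz: "u x ~= 0" and sp: "span (insert (u x) ((%b. v b x) ` B)) = span (insert a B)" if x: "x : S" for x
 proof -
 have "a - u x : span ((%b. v b x) ` B)" unfolding u_def by (simp add: span_sum span_scale span_base)
 then have "u x - a : span ((%b. v b x) ` B)" and a: "a - u x : span B" using span_neg[of "a - u x"] v(4)[OF x] by auto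
 then show "span (insert (u x) ((%b. v b x) ` B)) = span (insert a B)"
  using eq_span_insert_eq[of "u x" a] by (simp add: span_insert v(4)[OF x])
 have "independent (insert a B)" using insert.prems independent_Basis independent_mono by blast
 then have "a \<notin> span B" using insert.hyps(2) by (simp add: independent_insert)
 then show "u x ~= 0" using a by auto
 qed
 have "(%b. (v(a := u)) b x) ` insert a B = insert (u x) ((%b. v b x) ` B)" for x using insert.hyps(2) by auto
 then show ?case
 using v(1-3) su orth sym nz sp insert.hyps(2) by (intro exI[of _ "v(a := u)"]) (auto simp: orthogonal_frame_def)
qed (intro exI, simp add: orthogonal_frame_def)

text \<open>In an orthogonal frame the coefficients of \<open>s x\<close> are quotients of smooth
  functions. This takes the place of Cramer's rule and yields smooth Christoffel symbols from the
  Koszul formula.\<close>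

lemma smooth_on_metric_solve:
 fixes G :: "'a::real_normed_vector => 'e::euclidean_space => 'e => real"
 assumes S: "open S" and bil: "!!x. x : S ==> bilinear (G x)" and pos: "!!x u. x : S ==> u ~= 0 ==> G x u u > 0"
 and sym: "!!x u v. x : S ==> G x u v = G x v u" and sm: "!!u v. smooth_on S (%x. G x u v)"
 and s: "!!x w. x : S ==> G x (s x) w = k w x" and k: "!!w. smooth_on S (k w)"
 shows "smooth_on S s"
proof -
 obtain v where "orthogonal_frame G S Basis v" using smooth_orthogonal_frame[OF S bil pos sym sm subset_refl] by blast
 note v = orthogonal_frameD[OF this]
 define c where "c b x = k (v b x) x * inverse (G x (v b x) (v b x))" for b x
 have lk: "linear (%w. k w x)" if "x : S" for x using bil[OF that] s[OF that, symmetric] by (simp add: bilinear_def)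
 have "smooth_on S (c b)" if b: "b : Basis" for b
 unfolding c_def[abs_def] using v(2)[OF _ b] pos
 by (intro smooth_on_bilinear[OF S bounded_bilinear_mult] smooth_on_inverse[OF S] smooth_bilinear_field[OF S bil sm]
  smooth_basis[OF S lk k] v(1) b smooth_const) (auto simp: less_le)
 then have "smooth_on S (%x. \<Sum>b\<in>Basis. c b x *R v b x)" by (intro smooth_sum smooth_scaleR S v(1))
 moreover have "(\<Sum>b\<in>Basis. c b x *R v b x) = s x" if x: "x : S" for x
 proof -
 define z where "z = (\<Sum>b\<in>Basis. c b x *R v b x) - s x"
 have l: "linear (%u. G x u w)" "linear (G x w)" for w using bil[OF x] by (auto simp: bilinear_def)
 have "G x z (v d x) = 0" if d: "d : Basis" for d
 proof -
  have "(\<Sum>b\<in>Basis. c b x * G x (v b x) (v d x)) = (\<Sum>b\<in>Basis. if b = d then k (v d x) x else 0)"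
  by (intro sum.cong refl) (use v(3)[OF x _ d] v(2)[OF x d] pos[OF x] in \<open>force simp: c_def less_le\<close>)
  then show ?thesis using d by (simp add: z_def linear_diff[OF l(1)] linear_sum[OF l(1)] linear_scale[OF l(1)] s[OF x])
 qed
 then have "G x z y = 0" if "y : (%b. v b x) ` Basis" for y using that by blast
 from linear_eq_on_span[OF l(2) linear_zero this] have "G x z z = 0" by (simp add: v(4)[OF x])
 then have "z = 0" using pos[OF x, of z] by (cases "z = 0") auto
 then show ?thesis by (simp add: z_def)
 qed
 ultimately show ?thesis by (rule smooth_cong[OF S, THEN iffD1, rotated])
qed

section \<open>Torsion-free and metric connections, local symmetric models\<close>

lemma dd_add:
 "smooth_on S f ==> smooth_on S g ==> x : S ==> dd u (%y. f y + g y) x = dd u f x + dd u g x"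
 by (rule dd_eqI[OF has_derivative_add[OF smooth_deriv smooth_deriv]])

text \<open>The vectors stand for constant coordinate fields. These commute, so the bracket term of
  the curvature is absent.\<close>

definition curv :: "('e::real_normed_vector => 'e => 'e => 'e) => 'e => 'e => 'e => 'e => 'e"
 where "curv \<G> x u v w = dd u (%y. \<G> y v w) x - dd v (%y. \<G> y u w) x + \<G> x u (\<G> x v w) - \<G> x v (\<G> x u w)"

definition cov :: "('e::real_normed_vector => 'e => 'e => 'e) => 'e => ('e => 'e) => 'e => 'e"
 where "cov \<G> u \<s> x = dd u \<s> x + \<G> x u (\<s> x)"

locale connection =
 fixes \<O> :: "'e::euclidean_space set" and \<G> :: "'e => 'e => 'e => 'e"
 assumes open_\<O>: "open \<O>"
 and \<G>_bil: "!!x. x : \<O> ==> bilinear (\<G> x)"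
 and \<G>_sym: "!!x u v. x : \<O> ==> \<G> x u v = \<G> x v u"
 and \<G>_smooth: "!!u v. smooth_on \<O> (%x. \<G> x u v)"
begin

abbreviation "R \<equiv> curv \<G>"
abbreviation "nab \<equiv> cov \<G>"

lemma \<G>_linear: "x : \<O> ==> linear (\<G> x u)" "x : \<O> ==> linear (%u. \<G> x u v)"
 using \<G>_bil by (auto simp: bilinear_def)

lemmas \<G>_simps = \<G>_linear(1)[THEN linear_add] \<G>_linear(1)[THEN linear_diff] \<G>_linear(1)[THEN linear_scale] \<G>_linear(1)[THEN linear_0]
 \<G>_linear(1)[THEN linear_neg] \<G>_linear(2)[THEN linear_add] \<G>_linear(2)[THEN linear_diff] \<G>_linear(2)[THEN linear_scale]
 \<G>_linear(2)[THEN linear_0] \<G>_linear(2)[THEN linear_neg]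

lemma \<G>_has_derivative: "x : \<O> ==> ((%y. \<G> y u v) has_derivative (%h. dd h (%y. \<G> y u v) x)) (at x)"
 using smooth_deriv[OF \<G>_smooth] by simp

lemma smooth_\<G>_field: "smooth_on \<O> \<s> ==> smooth_on \<O> \<t> ==> smooth_on \<O> (%y. \<G> y (\<s> y) (\<t> y))"
 by (rule smooth_bilinear_field[OF open_\<O> \<G>_bil \<G>_smooth])

lemma smooth_nab: "smooth_on \<O> \<s> ==> smooth_on \<O> (nab u \<s>)"
 unfolding cov_def[abs_def]
 by (intro smooth_add smooth_dd smooth_\<G>_field open_\<O>) auto

lemma R_linear:
 assumes "x : \<O>"
 shows "linear (R x u v)" "linear (%v. R x u v w)" "linear (%u. R x u v w)"
proof -
 have b: "bilinear (%u w. dd h (%y. \<G> y u w) x)" for h by (rule bilinear_dd[OF open_\<O> \<G>_bil \<G>_smooth assms])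
 have l: "linear (%h. dd h (%y. \<G> y u w) x)" for u w
 by (rule linear_frechet_derivative[OF smooth_diff[OF \<G>_smooth assms]])
 note s = bilinear_ladd[OF b] bilinear_radd[OF b] bilinear_lmul[OF b] bilinear_rmul[OF b] linear_add[OF l] linear_scale[OF l]
 \<G>_simps[OF assms]
 show "linear (R x u v)" "linear (%v. R x u v w)" "linear (%u. R x u v w)"
 by (simp_all add: linear_iff curv_def s algebra_simps)
qed

lemma R_bilinear: "x : \<O> ==> bilinear (R x u)"
 using R_linear by (simp add: bilinear_def)

lemmas R_simps = R_linear(1)[THEN linear_add] R_linear(1)[THEN linear_diff] R_linear(1)[THEN linear_scale] R_linear(1)[THEN linear_0] R_linear(1)[THEN linear_neg]
 R_linear(2)[THEN linear_add] R_linear(2)[THEN linear_diff] R_linear(2)[THEN linear_scale] R_linear(2)[THEN linear_0] R_linear(2)[THEN linear_neg]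
 R_linear(3)[THEN linear_add] R_linear(3)[THEN linear_diff] R_linear(3)[THEN linear_scale] R_linear(3)[THEN linear_0] R_linear(3)[THEN linear_neg]

lemma smooth_R: "smooth_on \<O> (%x. R x u v w)"
 unfolding curv_def
 by (intro smooth_add smooth_diff_fun smooth_dd smooth_\<G>_field open_\<O> \<G>_smooth smooth_const)

lemma smooth_R_field:
 assumes "smooth_on \<O> a" "smooth_on \<O> b" "smooth_on \<O> c"
 shows "smooth_on \<O> (%y. R y (a y) (b y) (c y))"
 by (rule smooth_basis[OF open_\<O>, where T = "%y v. R y v (b y) (c y)", OF R_linear(3) _ assms(1)])
 (auto intro!: smooth_bilinear_field[OF open_\<O> R_bilinear smooth_R] assms)

lemma R_has_derivative:
 assumes "x : \<O>" "(a has_derivative a') (at x)" "(b has_derivative b') (at x)" "(c has_derivative c') (at x)"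
 shows "((%y. R y (a y) (b y) (c y)) has_derivative (%h. dd h (%y. R y (a x) (b x) (c x)) x
 + R x (a x) (b x) (c' h) + R x (a x) (b' h) (c x) + R x (a' h) (b x) (c x))) (at x)"
proof (rule linear_field_deriv[OF open_\<O> assms(1), where T = "%y v. R y v (b y) (c y)"
  and T' = "%v h. dd h (%y. R y v (b x) (c x)) x + R x v (b x) (c' h) + R x v (b' h) (c x)", OF _ _ assms(2)])
 show "linear (%v. R y v (b y) (c y))" if "y : \<O>" for y by (rule R_linear(3)[OF that])
 show "((%y. R y v (b y) (c y)) has_derivative (%h. dd h (%y. R y v (b x) (c x)) x + R x v (b x) (c' h) + R x v (b' h) (c x))) (at x)" for v
 by (rule bilinear_field_deriv[OF open_\<O> assms(1), where T' = "%b c h. dd h (%y. R y v b c) x", OF R_bilinear _ assms(3,4)])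
  (use smooth_deriv[OF smooth_R assms(1)] in auto)
qed

lemma R_anti: "R x u v w = - R x v u w"
 by (simp add: curv_def)

lemma R_same: "R x u u w = 0"
 by (simp add: curv_def)

lemma bianchi: "x : \<O> ==> R x u v w + R x v w u + R x w u v = 0"
proof -
 assume x: "x : \<O>"
 have "dd a (%y. \<G> y b c) x = dd a (%y. \<G> y c b) x" for a b c
 using dd_cong_open[OF open_\<O> x, of "%y. \<G> y b c" "%y. \<G> y c b"] \<G>_sym by metis
 from this[of u v w] this[of v w u] this[of w u v] show ?thesis
 using \<G>_sym[OF x, of v w] \<G>_sym[OF x, of u w] \<G>_sym[OF x, of v u]
 by (simp add: curv_def)
qed

lemma ricci_identity:
 assumes x: "x : \<O>" and \<s>: "smooth_on \<O> \<s>"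
 shows "nab u (nab v \<s>) x - nab v (nab u \<s>) x = R x u v (\<s> x)"
proof -
 have d: "dd a (nab b \<s>) x = dd a (dd b \<s>) x + (dd a (%y. \<G> y b (\<s> x)) x + \<G> x b (dd a \<s> x))" for a b
 proof -
 have "((%y. \<G> y b (\<s> y)) has_derivative (%h. dd h (%y. \<G> y b (\<s> x)) x + \<G> x b (dd h \<s> x))) (at x)"
  by (rule linear_field_deriv[OF open_\<O> x, where T = "%y. \<G> y b" and T' = "%v h. dd h (%y. \<G> y b v) x"])
  (use \<G>_linear \<G>_has_derivative[OF x] smooth_deriv[OF \<s> x] in auto)
 from has_derivative_add[OF smooth_deriv[OF smooth_dd[OF \<s>] x, of b] this]
 show ?thesis unfolding cov_def[abs_def] by (rule dd_eqI)
 qed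
 show ?thesis
 using dd_commute[OF open_\<O> \<s> x, of u v]
 by (simp add: cov_def[of \<G> u "nab v \<s>"] cov_def[of \<G> v "nab u \<s>"] d)
  (simp add: cov_def curv_def \<G>_simps[OF x] algebra_simps)
qed

lemma nab_const: "nab u (%y. w) x = \<G> x u w"
 by (simp add: cov_def)

lemma nab_add: "x : \<O> ==> smooth_on \<O> \<s> ==> smooth_on \<O> \<t> ==> nab u (%y. \<s> y + \<t> y) x = nab u \<s> x + nab u \<t> x"
 by (simp add: cov_def dd_eqI[OF has_derivative_add[OF smooth_deriv smooth_deriv]] \<G>_simps)

lemma nab_diff: "x : \<O> ==> smooth_on \<O> \<s> ==> smooth_on \<O> \<t> ==> nab u (%y. \<s> y - \<t> y) x = nab u \<s> x - nab u \<t> x"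
 by (simp add: cov_def dd_eqI[OF has_derivative_diff[OF smooth_deriv smooth_deriv]] \<G>_simps)

lemma nab_cong: "x : \<O> ==> (!!y. y : \<O> ==> \<s> y = \<t> y) ==> nab u \<s> x = nab u \<t> x"
 unfolding cov_def using dd_cong_open[OF open_\<O>, of x \<s> \<t>] by simp

lemma nab_nab_field:
 assumes x: "x : \<O>" and b: "smooth_on \<O> b" and c: "smooth_on \<O> c"
 shows "nab u (%y. nab (b y) c y) x = nab u (nab (b x) c) x + nab (dd u b x) c x"
proof -
 have "linear (%v. nab v c y)" if "y : \<O>" for y
 using linear_compose_add[OF linear_frechet_derivative[OF smooth_diff[OF c that]] \<G>_linear(2)[OF that]] by (simp add: cov_def)
 then have "((%y. nab (b y) c y) has_derivative (%h. dd h (nab (b x) c) x + nab (dd h b x) c x)) (at x)"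
 by (intro linear_field_deriv[OF open_\<O> x, where T = "%y v. nab v c y" and T' = "%v h. dd h (nab v c) x"]
  smooth_deriv[OF smooth_nab[OF c] x] smooth_deriv[OF b x])
 from dd_eqI[OF this, of u] show ?thesis by (simp add: cov_def)
qed

text \<open>For variable fields the bracket term of the curvature comes back. This version is for
  coordinate fields of a chart of the manifold, which are not constant in another
  parametrization.\<close>

lemma ricci_identity_field:
 assumes x: "x : \<O>" and a: "smooth_on \<O> a" and b: "smooth_on \<O> b" and c: "smooth_on \<O> c"
 shows "nab (a x) (%y. nab (b y) c y) x - nab (b x) (%y. nab (a y) c y) x - nab (dd (a x) b x - dd (b x) a x) c x = R x (a x) (b x) (c x)"
proof -
 have "nab (dd (a x) b x - dd (b x) a x) c x = nab (dd (a x) b x) c x - nab (dd (b x) a x) c x"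
 using linear_diff[OF linear_frechet_derivative[OF smooth_diff[OF c x]]] by (simp add: cov_def \<G>_simps x)
 then show ?thesis
 using ricci_identity[OF x c, of "a x" "b x"] by (simp add: nab_nab_field[OF x a c] nab_nab_field[OF x b c])
qed

lemma dd_nab: "dd u \<s> x = nab u \<s> x - \<G> x u (\<s> x)"
 by (simp add: cov_def)

end

locale metric_connection = connection \<O> \<G>
 for \<O> :: "'e::euclidean_space set" and \<G> :: "'e => 'e => 'e => 'e" +
 fixes G :: "'e => 'e => 'e => real"
 assumes G_bil: "!!x. x : \<O> ==> bilinear (G x)"
 and G_sym: "!!x u v. x : \<O> ==> G x u v = G x v u"
 and G_pos: "!!x u. x : \<O> ==> u ~= 0 ==> G x u u > 0"
 and G_smooth: "!!u v. smooth_on \<O> (%x. G x u v)"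
 and compat: "!!x u v w. x : \<O> ==> dd u (%x. G x v w) x = G x (\<G> x u v) w + G x v (\<G> x u w)"
begin

lemmas G_simps = bilinear_ladd[OF G_bil] bilinear_radd[OF G_bil] bilinear_lsub[OF G_bil] bilinear_rsub[OF G_bil]
 bilinear_lmul[OF G_bil] bilinear_rmul[OF G_bil] bilinear_lzero[OF G_bil] bilinear_rzero[OF G_bil] bilinear_lneg[OF G_bil] bilinear_rneg[OF G_bil]

lemma G_eqI: "x : \<O> ==> (!!w. G x z w = G x z' w) ==> z = z'"
 by (rule posdef_eqI[OF G_bil G_pos])

lemma dd_G_field:
 assumes x: "x : \<O>" and "smooth_on \<O> \<s>" "smooth_on \<O> \<t>"
 shows "dd u (%y. G y (\<s> y) (\<t> y)) x = G x (nab u \<s> x) (\<t> x) + G x (\<s> x) (nab u \<t> x)"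
proof -
 have "((%y. G y (\<s> y) (\<t> y)) has_derivative (%h. dd h (%y. G y (\<s> x) (\<t> x)) x
  + G x (\<s> x) (dd h \<t> x) + G x (dd h \<s> x) (\<t> x))) (at x)"
 by (rule bilinear_field_deriv[OF open_\<O> x, where T' = "%v w h. dd h (%y. G y v w) x"])
  (use G_bil smooth_deriv[OF G_smooth x] smooth_deriv[OF assms(2) x] smooth_deriv[OF assms(3) x] in auto)
 then show ?thesis
 by (simp add: dd_eqI[where x = x] compat[OF x] cov_def G_simps[OF x])
qed

lemma metric_connection_subset:
 assumes "open S" "S \<subseteq> \<O>"
 shows "metric_connection S \<G> G"
proof (intro metric_connection.intro metric_connection_axioms.intro connection.intro)
 show "open S" by (rule assms(1))
qed (use assms(2) in \<open>auto intro: \<G>_bil \<G>_sym G_bil G_sym G_pos compat smooth_subset[OF \<G>_smooth] smooth_subset[OF G_smooth]\<close>)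

end

text \<open>Local model of a hermitean symmetric space in holomorphic coordinates: the complex
  structure is a constant \<open>I\<close>, and its parallelism reduces to complex linearity of
  \<open>\<G> x u\<close>. Parallel curvature is tested on constant fields;
  \<open>nab_R_field\<close> passes to all smooth ones.\<close>

locale local_symmetric = metric_connection \<O> \<G> G
 for \<O> :: "'e::euclidean_space set" and \<G> :: "'e => 'e => 'e => 'e" and G :: "'e => 'e => 'e => real" +
 fixes I :: "'e => 'e"
 assumes I_linear: "linear I"
 and I_I: "!!u. I (I u) = - u"
 and G_I: "!!x u v. x : \<O> ==> G x (I u) (I v) = G x u v"
 and \<G>_I: "!!x u v. x : \<O> ==> \<G> x u (I v) = I (\<G> x u v)"
 and R_parallel: "!!x t u v w. x : \<O> ==> cov \<G> t (%y. curv \<G> y u v w) x =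
  curv \<G> x (\<G> x t u) v w + curv \<G> x u (\<G> x t v) w + curv \<G> x u v (\<G> x t w)"
begin

lemmas I_simps = linear_add[OF I_linear] linear_diff[OF I_linear] linear_scale[OF I_linear] linear_0[OF I_linear] linear_neg[OF I_linear] I_I

lemma I_bounded_linear: "bounded_linear I"
 using I_linear linear_conv_bounded_linear by blast

lemma G_I_left: "x : \<O> ==> G x (I u) v = - G x u (I v)"
 using G_I[of x u "I v"] by (simp add: I_I G_simps)

lemma \<G>_I_left: "x : \<O> ==> \<G> x (I u) v = I (\<G> x u v)"
 using \<G>_I \<G>_sym by metis

lemma nab_R_field:
 assumes x: "x : \<O>" and "smooth_on \<O> a" "smooth_on \<O> b" "smooth_on \<O> c"
 shows "nab t (%y. R y (a y) (b y) (c y)) x = R x (nab t a x) (b x) (c x) + R x (a x) (nab t b x) (c x) + R x (a x) (b x) (nab t c x)"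
proof -
 note d = R_has_derivative[OF x smooth_deriv[OF assms(2) x] smooth_deriv[OF assms(3) x] smooth_deriv[OF assms(4) x]]
 show ?thesis
 using R_parallel[OF x, of t "a x" "b x" "c x"]
 by (simp add: cov_def dd_eqI[OF d] R_simps[OF x] algebra_simps)
qed

lemma nab_I: "x : \<O> ==> smooth_on \<O> \<s> ==> nab u (%y. I (\<s> y)) x = I (nab u \<s> x)"
 by (simp add: cov_def dd_eqI[OF bounded_linear.has_derivative[OF I_bounded_linear smooth_deriv]] \<G>_I I_simps)

lemma R_I: "x : \<O> ==> R x u v (I w) = I (R x u v w)"
proof -
 assume x: "x : \<O>"
 have n: "nab u (%y. I w) y = I (nab u (%y. w) y)" if "y : \<O>" for u y using nab_I[OF that smooth_const] .
 have "nab u (nab v (%y. I w)) x = I (nab u (nab v (%y. w)) x)" for u v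
 using nab_cong[OF x, of "nab v (%y. I w)" "%y. I (nab v (%y. w) y)"] n nab_I[OF x smooth_nab[OF smooth_const]] by metis
 then show ?thesis
 using ricci_identity[OF x smooth_const, of u v "I w"] ricci_identity[OF x smooth_const, of u v w]
 by (metis linear_diff[OF I_linear])
qed

text \<open>The second derivatives of the function \<open>G y w z\<close> commute. Expanding them by
  metric compatibility, the mixed terms cancel and the curvature terms remain.\<close>

lemma R_skew: "x : \<O> ==> G x (R x u v w) z = - G x w (R x u v z)"
proof -
 assume x: "x : \<O>"
 have n: "dd v (%y. G y w z) y = G y (nab v (%y. w) y) z + G y w (nab v (%y. z) y)" if "y : \<O>" for v y
 using dd_G_field[OF that smooth_const smooth_const] .
 have s: "smooth_on \<O> (%y. G y (\<s> y) (\<t> y))" if "smooth_on \<O> \<s>" "smooth_on \<O> \<t>" for \<s> \<t>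
 using smooth_bilinear_field[OF open_\<O> G_bil G_smooth that] .
 have "dd u (dd v (%y. G y w z)) x = G x (nab u (nab v (%y. w)) x) z + G x (nab v (%y. w) x) (nab u (%y. z) x)
 + (G x (nab u (%y. w) x) (nab v (%y. z) x) + G x w (nab u (nab v (%y. z)) x))" for u v
 proof -
 have "frechet_derivative (dd v (%y. G y w z)) (at x) = frechet_derivative (%y. G y (nab v (%y. w) y) z + G y w (nab v (%y. z) y)) (at x)"
  by (rule dd_cong_open[OF open_\<O> x]) (rule n)
 then have "dd u (dd v (%y. G y w z)) x = dd u (%y. G y (nab v (%y. w) y) z + G y w (nab v (%y. z) y)) x" by simp
 also have "... = dd u (%y. G y (nab v (%y. w) y) z) x + dd u (%y. G y w (nab v (%y. z) y)) x"
  by (rule dd_add[where S = \<O>]) (intro s smooth_nab smooth_const x)+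
 finally show ?thesis
  by (simp add: dd_G_field[OF x] smooth_nab)
 qed
 moreover have "dd v (dd u (%y. G y w z)) x = dd u (dd v (%y. G y w z)) x"
 by (rule dd_commute[OF open_\<O> G_smooth x])
 ultimately have "G x (nab u (nab v (%y. w)) x - nab v (nab u (%y. w)) x) z + G x w (nab u (nab v (%y. z)) x - nab v (nab u (%y. z)) x) = 0"
 by (simp add: G_simps[OF x])
 then show ?thesis by (simp add: ricci_identity[OF x smooth_const])
qed

text \<open>The octahedron argument: four Bianchi identities combined with skewness in the first and
  in the last pair.\<close>

lemma R_pair: "x : \<O> ==> G x (R x u v w) z = G x (R x w z u) v"
proof -
 assume x: "x : \<O>"
 have b: "G x (R x a b c) d + G x (R x b c a) d + G x (R x c a b) d = 0" for a b c d
 using bianchi[OF x, of a b c] by (metis G_simps(1)[OF x] G_simps(7)[OF x])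
 have a: "G x (R x a b c) d = - G x (R x b a c) d" for a b c d
 by (metis R_anti G_simps(9)[OF x])
 have s: "G x (R x a b c) d = - G x (R x a b d) c" for a b c d
 by (metis R_skew[OF x] G_sym[OF x])
 show ?thesis
 using b[of u v w z] b[of v w z u] b[of w z u v] b[of z u v w]
  s[of u v w z] s[of v w u z] s[of w u v z] s[of v w z u] s[of w z v u] s[of z v w u]
  s[of w z u v] s[of z u w v] s[of u w z v] s[of z u v w] s[of u v z w] s[of v z u w]
  a[of w u v z] a[of z v w u] a[of u w z v] a[of v z u w] a[of z u v w] a[of u v z w] a[of v w u z] a[of w z v u]
 by linarith
qed

text \<open>Curvature endomorphisms commute with \<open>I\<close>; pair symmetry moves this from the
  last two arguments to the first two.\<close>

lemma R_I_I: "x : \<O> ==> R x (I u) (I v) w = R x u v w"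
proof (rule G_eqI)
 fix z assume x: "x : \<O>"
 show "G x (R x (I u) (I v) w) z = G x (R x u v w) z"
 using R_pair[OF x, of "I u" "I v" w z] R_pair[OF x, of u v w z] by (simp add: R_I[OF x] G_I[OF x])
qed

lemma R_I_left: "x : \<O> ==> R x (I u) v w = - R x u (I v) w"
 using R_I_I[of x u "I v" w] by (simp add: I_I R_simps) (metis minus_minus)

text \<open>A parallel tensor is annihilated by the curvature acting as a derivation. Here the
  tensor is the curvature itself, and the Ricci identity is applied to the field
  \<open>R y u v w\<close>.\<close>

lemma R_R:
 assumes x: "x : \<O>"
 shows "R x a b (R x u v w) = R x (R x a b u) v w + R x u (R x a b v) w + R x u v (R x a b w)"
proof -
 let ?c = "%w::'e. (%y::'e. w)"
 let ?\<s> = "%y. R y u v w"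
 note sm = smooth_const smooth_nab[OF smooth_const]
 have n: "nab b ?\<s> y = R y (nab b (?c u) y) v w + R y u (nab b (?c v) y) w + R y u v (nab b (?c w) y)" if "y : \<O>" for y b
 using nab_R_field[OF that sm(1) sm(1) sm(1)] .
 have nn: "nab a (nab b ?\<s>) x =
  R x (nab a (nab b (?c u)) x) v w + R x (nab b (?c u) x) (nab a (?c v) x) w + R x (nab b (?c u) x) v (nab a (?c w) x)
 + (R x (nab a (?c u) x) (nab b (?c v) x) w + R x u (nab a (nab b (?c v)) x) w + R x u (nab b (?c v) x) (nab a (?c w) x))
 + (R x (nab a (?c u) x) v (nab b (?c w) x) + R x u (nab a (?c v) x) (nab b (?c w) x) + R x u v (nab a (nab b (?c w)) x))" for a b
 proof -
 have "nab a (nab b ?\<s>) x = nab a (%y. R y (nab b (?c u) y) v w + R y u (nab b (?c v) y) w + R y u v (nab b (?c w) y)) x"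
  by (rule nab_cong[OF x n])
 also have "... = nab a (%y. R y (nab b (?c u) y) v w) x + nab a (%y. R y u (nab b (?c v) y) w) x + nab a (%y. R y u v (nab b (?c w) y)) x"
  using x by (simp add: nab_add smooth_add open_\<O> smooth_R_field sm)
 finally show ?thesis by (simp add: nab_R_field[OF x] sm)
 qed
 have "R x a b (R x u v w) = nab a (nab b ?\<s>) x - nab b (nab a ?\<s>) x"
 using ricci_identity[OF x smooth_R, of a b u v w] by simp
 also have "... = R x (nab a (nab b (?c u)) x - nab b (nab a (?c u)) x) v w
 + R x u (nab a (nab b (?c v)) x - nab b (nab a (?c v)) x) w + R x u v (nab a (nab b (?c w)) x - nab b (nab a (?c w)) x)"
 unfolding nn by (simp add: R_simps[OF x])
 finally show ?thesis by (simp add: ricci_identity[OF x smooth_const])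
qed

lemma local_symmetric_subset:
 assumes "open S" "S \<subseteq> \<O>"
 shows "local_symmetric S \<G> G I"
 by (intro local_symmetric.intro[OF metric_connection_subset[OF assms]] local_symmetric_axioms.intro)
 (use assms(2) in \<open>auto intro: I_linear I_I G_I \<G>_I R_parallel\<close>)

end

section \<open>Product rules and differential equations along lines\<close>

lemma linear_field_hvd:
 fixes T :: "real => 'c::euclidean_space => 'b::real_normed_vector"
 assumes "t : X" and lin: "!!s. s : X ==> linear (T s)"
 and T': "!!v. ((%s. T s v) hvd T' v) (at t within X)" and lin': "linear T'"
 and \<s>: "(\<s> hvd \<s>') (at t within X)"
 shows "((%s. T s (\<s> s)) hvd (T' (\<s> t) + T t \<s>')) (at t within X)"
proof -
 have "((%s. \<Sum>b\<in>Basis. (\<s> s \<bullet> b) *R T s b) hvd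
 (\<Sum>b\<in>Basis. (\<s> t \<bullet> b) *R T' b + (\<s>' \<bullet> b) *R T t b)) (at t within X)"
 using bounded_linear.has_vector_derivative[OF bounded_linear_inner_left \<s>]
 by (intro has_vector_derivative_sum has_vector_derivative_scaleR T')
  (simp add: has_real_derivative_iff_has_vector_derivative)
 then have "((%s. \<Sum>b\<in>Basis. (\<s> s \<bullet> b) *R T s b) hvd (T' (\<s> t) + T t \<s>')) (at t within X)"
 unfolding sum.distrib basis_expansion[OF lin', of "\<s> t", symmetric] basis_expansion[OF lin[OF assms(1)], of \<s>', symmetric] .
 then show ?thesis
 by (rule has_vector_derivative_transform[OF assms(1), rotated]) (rule basis_expansion[OF lin])
qed

lemma smooth_line:
 "smooth_on S f ==> x + s *R u : S ==>
 ((%s. f (x + s *R u)) hvd dd u f (x + s *R u)) (at s within T)"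
 by (rule hvd_along_line[OF smooth_deriv])

lemma dd_bilinear_field:
 fixes T :: "'a::real_normed_vector => 'b::euclidean_space => 'c::euclidean_space => 'd::real_normed_vector"
 assumes S: "open S" and bil: "!!x. x : S ==> bilinear (T x)" and T: "!!u v. smooth_on S (%x. T x u v)"
 and F: "smooth_on S F" "!!x u v. x : S ==> blinfun_apply (blinfun_apply (F x) u) v = T x u v" and x: "x : S"
 shows "dd h (%y. T y u v) x = blinfun_apply (blinfun_apply (dd h F x) u) v"
proof -
 have "frechet_derivative (%y. T y u v) (at x) = frechet_derivative (%y. blinfun_apply (blinfun_apply (F y) u) v) (at x)"
 by (rule dd_cong_open[OF S x]) (simp add: F(2))
 then show ?thesis
 using dd_blinfun_apply[OF smooth_bl[OF S blinfun.bounded_linear_left F(1)] x] dd_blinfun_apply[OF F(1) x] by simp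
qed

lemma bilinear_smooth_bounds:
 fixes T :: "'a::euclidean_space => 'c::euclidean_space => 'd::euclidean_space => 'b::real_normed_vector"
 assumes S: "open S" and bil: "!!x. x : S ==> bilinear (T x)" and sm: "!!u w. smooth_on S (%x. T x u w)"
 and K: "compact K" "convex K" "K \<subseteq> S"
 obtains C where "C >= 0" "!!x u w. x : K ==> norm (T x u w) <= C * (norm u * norm w)"
 "!!x h u w. x : K ==> norm (dd h (%y. T y u w) x) <= C * norm h * (norm u * norm w)"
 "!!x y u w. x : K ==> y : K ==>
  norm (T y u w - T x u w - dd (y - x) (%y. T y u w) x) <= C * (norm (y - x))\<^sup>2 * (norm u * norm w)"
proof -
 obtain F where F: "smooth_on S F" "!!x u v. x : S ==> blinfun_apply (blinfun_apply (F x) u) v = T x u v"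
 by (rule bilinear_blinfun_field[OF S bil sm]) blast+
 obtain C where C: "C >= 1" "!!x. x : K ==> norm (F x) <= C" "!!x h. x : K ==> norm (dd h F x) <= C * norm h"
 "!!x y. x : K ==> y : K ==> norm (F y - F x - dd (y - x) F x) <= C * (norm (y - x))\<^sup>2"
 by (rule smooth_bounds[OF S F(1) K]) blast
 have d: "dd h (%y. T y u w) x = blinfun_apply (blinfun_apply (dd h F x) u) w" if x: "x : S" for h u w x
 by (rule dd_bilinear_field[OF S bil sm F x])
 have n: "norm (f u w) <= c * (norm u * norm w)" if "norm f <= c" for f :: "'c \<Rightarrow>\<^sub>L 'd \<Rightarrow>\<^sub>L 'b" and u w c
 proof -
 have "norm (f u w) <= norm f * norm u * norm w" by (rule order_trans[OF norm_blinfun mult_right_mono[OF norm_blinfun norm_ge_zero]])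
 also have "... <= c * norm u * norm w" using that by (intro mult_right_mono) auto
 finally show ?thesis by (simp add: mult.assoc)
 qed
 note T = F(2)[OF subsetD[OF K(3)], symmetric] d[OF subsetD[OF K(3)]]
 show thesis
 proof (rule that[of C])
 show "norm (T y u w - T x u w - dd (y - x) (%y. T y u w) x) <= C * (norm (y - x))\<^sup>2 * (norm u * norm w)" if "x : K" "y : K" for x y u w
  using n[OF C(4)[OF that], of u w] by (simp add: T that blinfun.bilinear_simps)
 qed (use C(1) n[OF C(2)] n[OF C(3)] in \<open>auto simp: T\<close>)
qed

text \<open>With one variable flatness is automatic, so the Frobenius theorem becomes an existence
  theorem on open intervals with two-sided derivatives; \<open>linear_ode_exists\<close> only covers
  the closed unit interval.\<close>

lemma linear_ode_interval:
 fixes A :: "real => 'e::euclidean_space => 'e"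
 assumes T: "open T" "convex T" "i : T" and lin: "!!x. x : T ==> linear (A x)" and sm: "!!w. smooth_on T (%x. A x w)"
 shows "EX s. s i = s0 & (ALL x:T. (s hvd A x (s x)) (at x))"
proof -
 define a where "a x = blinfun_scaleR_left (Blinfun (A x))" for x
 have a: "smooth_on T a"
 unfolding a_def by (rule smooth_bl[OF T(1) bounded_linear_blinfun_scaleR_left smooth_on_Blinfun[OF T(1) lin sm]])
 have "EX s. s i = s0 & (ALL x:T. True & (s has_derivative (%v. a x v (s x))) (at x))"
 proof (rule flat_linear_system[OF T a])
 fix x :: real and s u v assume x: "x : T"
 have d: "dd u a x = u *R dd 1 a x" for u
  using linear_scale[OF linear_frechet_derivative[OF smooth_diff[OF a x]], of u 1] by simp
 have e: "dd 1 a x v = v *R dd 1 a x 1" for v using blinfun.scaleR_right[of "dd 1 a x" v 1] by simp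
 show "dd u a x v s + a x v (a x u s) = dd v a x u s + a x u (a x v s)"
  unfolding d[of u] d[of v] blinfun.scaleR_left e[of u] e[of v] by (simp add: a_def blinfun.scaleR_right blinfun.scaleR_left mult.commute)
 qed auto
 then obtain s where s: "s i = s0" "!!x. x : T ==> (s has_derivative (%v. a x v (s x))) (at x)" by blast
 have "(s hvd A x (s x)) (at x)" if "x : T" for x
 using s(2)[OF that] by (simp add: has_vector_derivative_def a_def blinfun.bilinear_simps Blinfun_apply lin[OF that])
 then show ?thesis using s(1) by blast
qed

section \<open>Killing pairs: the prolonged Killing equation\<close>

context local_symmetric begin

text \<open>Prolongation of the Killing equation: \<open>A\<close> is the covariant derivative of
  \<open>\<x>\<close>, and the covariant derivative of \<open>A\<close> is the curvature with
  \<open>\<x>\<close> inserted. Skewness of \<open>A\<close> is not demanded, so these are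
  infinitesimal affine fields; \<open>killing_pair_skew\<close> propagates skewness from one
  point.\<close>

definition killing_pair :: "('e => 'e) => ('e => 'e => 'e) => bool"
 where "killing_pair \<x> A \<longleftrightarrow> smooth_on \<O> \<x> & (ALL w. smooth_on \<O> (%x. A x w)) & (ALL x:\<O>. linear (A x)) &
 (ALL x:\<O>. ALL u. nab u \<x> x = A x u) &
 (ALL x:\<O>. ALL u w. nab u (%y. A y w) x = A x (\<G> x u w) + R x u (\<x> x) w)"

lemma kpD:
 assumes "killing_pair \<x> A"
 shows "smooth_on \<O> \<x>" "smooth_on \<O> (%x. A x w)" "x : \<O> ==> linear (A x)" "x : \<O> ==> nab u \<x> x = A x u"
 "x : \<O> ==> nab u (%y. A y w) x = A x (\<G> x u w) + R x u (\<x> x) w"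
 using assms by (auto simp: killing_pair_def)

lemma smooth_A_field:
 assumes "killing_pair \<x> A" "smooth_on \<O> \<s>"
 shows "smooth_on \<O> (%y. A y (\<s> y))"
 by (rule smooth_basis[OF open_\<O> kpD(3)[OF assms(1)] kpD(2)[OF assms(1)] assms(2)])

lemma nab_A_field:
 assumes kp: "killing_pair \<x> A" and \<s>: "smooth_on \<O> \<s>" and x: "x : \<O>"
 shows "nab u (%y. A y (\<s> y)) x = A x (nab u \<s> x) + R x u (\<x> x) (\<s> x)"
proof -
 note l = kpD(3)[OF kp x]
 have "((%y. A y (\<s> y)) has_derivative (%h. dd h (%y. A y (\<s> x)) x + A x (dd h \<s> x))) (at x)"
 by (rule linear_field_deriv[OF open_\<O> x kpD(3)[OF kp], where T' = "%v h. dd h (%y. A y v) x"])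
  (use smooth_deriv[OF kpD(2)[OF kp] x] smooth_deriv[OF \<s> x] in auto)
 from dd_eqI[OF this, of u] kpD(5)[OF kp x, of u "\<s> x"] show ?thesis
 by (simp add: cov_def linear_add[OF l] algebra_simps)
qed

text \<open>The integrability condition of the prolonged system: the Ricci identity for the field
  \<open>A y w\<close>, with its second derivatives evaluated by the system.\<close>

lemma kp_curvature:
 assumes kp: "killing_pair \<x> A" and x: "x : \<O>"
 shows "A x (R x u v w) = R x (A x u) v w + R x u (A x v) w + R x u v (A x w)"
proof -
 let ?c = "%w::'e. (%y::'e. w)"
 note sm = smooth_const smooth_nab[OF smooth_const]
 have n: "nab v (%y. A y w) y = A y (nab v (?c w) y) + R y v (\<x> y) w" if "y : \<O>" for v y
 using nab_A_field[OF kp smooth_const that, of v w] .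
 have nn: "nab u (nab v (%y. A y w)) x = A x (nab u (nab v (?c w)) x) + R x u (\<x> x) (nab v (?c w) x)
  + (R x (nab u (?c v) x) (\<x> x) w + R x v (A x u) w + R x v (\<x> x) (nab u (?c w) x))" for u v
 proof -
 have "nab u (nab v (%y. A y w)) x = nab u (%y. A y (nab v (?c w) y) + R y v (\<x> y) w) x"
  by (rule nab_cong[OF x n])
 also have "... = nab u (%y. A y (nab v (?c w) y)) x + nab u (%y. R y v (\<x> y) w) x"
  by (intro nab_add x smooth_A_field[OF kp] smooth_R_field sm kpD(1)[OF kp])
 finally show ?thesis
  by (simp add: nab_A_field[OF kp _ x] nab_R_field[OF x] sm kpD(1)[OF kp] kpD(4)[OF kp x])
 qed
 have "R x u v (A x w) = nab u (nab v (%y. A y w)) x - nab v (nab u (%y. A y w)) x"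
 using ricci_identity[OF x kpD(2)[OF kp], of u v w] by simp
 also have "... = A x (nab u (nab v (?c w)) x - nab v (nab u (?c w)) x) + R x v (A x u) w - R x u (A x v) w"
 unfolding nn using \<G>_sym[OF x, of u v] by (simp add: nab_const linear_diff[OF kpD(3)[OF kp x]])
 finally show ?thesis
 using R_anti[of x v "A x u" w] by (simp add: ricci_identity[OF x smooth_const] algebra_simps)
qed

text \<open>The field is the Lie bracket of \<open>\<x>\<close> and \<open>\<h>\<close>, written as
  the difference of two covariant derivatives. The Bianchi identity merges the two curvature terms
  in its derivative, and \<open>kp_curvature\<close> handles the derivative of the
  endomorphism.\<close>

lemma killing_pair_bracket:
 assumes kp: "killing_pair \<x> A" "killing_pair \<h> B"
 shows "killing_pair (%x. B x (\<x> x) - A x (\<h> x)) (%x w. B x (A x w) - A x (B x w) + R x (\<x> x) (\<h> x) w)"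
proof -
 note s = kpD(1)[OF kp(1)] kpD(1)[OF kp(2)] kpD(2)[OF kp(1)] kpD(2)[OF kp(2)]
 smooth_A_field[OF kp(1)] smooth_A_field[OF kp(2)] smooth_R_field smooth_const
 show ?thesis
 unfolding killing_pair_def
 proof (intro conjI ballI allI)
 show "smooth_on \<O> (%x. B x (\<x> x) - A x (\<h> x))" "!!w. smooth_on \<O> (%x. B x (A x w) - A x (B x w) + R x (\<x> x) (\<h> x) w)"
  by (intro smooth_diff_fun smooth_add open_\<O> s)+
 fix x assume x: "x : \<O>"
 note lA = kpD(3)[OF kp(1) x] and lB = kpD(3)[OF kp(2) x]
 note ls = linear_add[OF lA] linear_add[OF lB] linear_diff[OF lA] linear_diff[OF lB] linear_scale[OF lA] linear_scale[OF lB]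
 show "linear (%w. B x (A x w) - A x (B x w) + R x (\<x> x) (\<h> x) w)"
  by (simp add: linear_iff ls R_simps[OF x] algebra_simps)
 fix u
 show "nab u (%x. B x (\<x> x) - A x (\<h> x)) x = B x (A x u) - A x (B x u) + R x (\<x> x) (\<h> x) u"
 proof -
  have "nab u (%x. B x (\<x> x) - A x (\<h> x)) x = nab u (%x. B x (\<x> x)) x - nab u (%x. A x (\<h> x)) x"
  by (intro nab_diff x s)
  also have "... = (B x (A x u) + R x u (\<h> x) (\<x> x)) - (A x (B x u) + R x u (\<x> x) (\<h> x))"
  by (simp only: nab_A_field[OF kp(1) kpD(1)[OF kp(2)] x] nab_A_field[OF kp(2) kpD(1)[OF kp(1)] x]
   kpD(4)[OF kp(1) x] kpD(4)[OF kp(2) x])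
  also have "... = B x (A x u) - A x (B x u) + (R x u (\<h> x) (\<x> x) + R x (\<x> x) u (\<h> x))"
  using R_anti[of x "\<x> x" u "\<h> x"] by simp
  also have "R x u (\<h> x) (\<x> x) + R x (\<x> x) u (\<h> x) = R x (\<x> x) (\<h> x) u"
  using bianchi[OF x, of u "\<h> x" "\<x> x"] R_anti[of x "\<x> x" "\<h> x" u]
  by (simp add: add_eq_0_iff)
  finally show ?thesis .
 qed
 fix w
 have sA: "smooth_on \<O> (%y. A y w)" and sB: "smooth_on \<O> (%y. B y w)" by (rule s)+
 have "nab u (%y. B y (A y w) - A y (B y w) + R y (\<x> y) (\<h> y) w) x
  = nab u (%y. B y (A y w)) x - nab u (%y. A y (B y w)) x + nab u (%y. R y (\<x> y) (\<h> y) w) x"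
  using x by (simp add: nab_add nab_diff smooth_diff_fun open_\<O> s)
 also have "... = B x (A x (\<G> x u w) + R x u (\<x> x) w) + R x u (\<h> x) (A x w) - (A x (B x (\<G> x u w) + R x u (\<h> x) w) + R x u (\<x> x) (B x w))
  + (R x (A x u) (\<h> x) w + R x (\<x> x) (B x u) w + R x (\<x> x) (\<h> x) (\<G> x u w))"
  by (simp add: nab_A_field[OF kp(1) _ x] nab_A_field[OF kp(2) _ x] nab_R_field[OF x] s kpD(4)[OF kp(1) x]
   kpD(4)[OF kp(2) x] nab_const)
 also have "... = B x (A x (\<G> x u w)) - A x (B x (\<G> x u w)) + R x (\<x> x) (\<h> x) (\<G> x u w) + R x u (B x (\<x> x) - A x (\<h> x)) w"
  using kp_curvature[OF kp(1) x, of u "\<h> x" w] kp_curvature[OF kp(2) x, of u "\<x> x" w]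
  R_anti[of x "\<x> x" "B x u" w]
  by (simp add: ls R_simps[OF x] algebra_simps)
 finally show "nab u (%y. B y (A y w) - A y (B y w) + R y (\<x> y) (\<h> y) w) x =
  B x (A x (\<G> x u w)) - A x (B x (\<G> x u w)) + R x (\<x> x) (\<h> x) (\<G> x u w) + R x u (B x (\<x> x) - A x (\<h> x)) w" .
 qed
qed

lemma killing_pair_diff:
 assumes kp: "killing_pair \<x> A" "killing_pair \<h> B"
 shows "killing_pair (%x. \<x> x - \<h> x) (%x w. A x w - B x w)"
proof -
 note s = kpD(1)[OF kp(1)] kpD(1)[OF kp(2)] kpD(2)[OF kp(1)] kpD(2)[OF kp(2)]
 show ?thesis
 unfolding killing_pair_def
 by (auto intro!: smooth_diff_fun open_\<O> s linear_compose_sub kpD(3)[OF kp(1)] kpD(3)[OF kp(2)]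
  simp: nab_diff s kpD(4,5)[OF kp(1)] kpD(4,5)[OF kp(2)] R_simps)
qed

lemma killing_pair_scale:
 assumes kp: "killing_pair \<x> A"
 shows "killing_pair (%x. c *R \<x> x) (%x w. c *R A x w)"
proof -
 have n: "nab u (%x. c *R \<s> x) x = c *R nab u \<s> x" if "x : \<O>" "smooth_on \<O> \<s>" for u \<s> x
 using that by (simp add: cov_def dd_eqI[OF has_derivative_scaleR_right[OF smooth_deriv]] \<G>_simps scaleR_add_right)
 note s = kpD(1)[OF kp] kpD(2)[OF kp]
 show ?thesis
 unfolding killing_pair_def
 by (auto intro!: smooth_scaleR open_\<O> s linear_compose_scale_right kpD(3)[OF kp]
  simp: n s kpD(4,5)[OF kp] R_simps scaleR_add_right)
qed

lemma compact_bounds: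
 assumes K: "compact K" "K \<subseteq> \<O>"
 obtains C where "C >= 1" "!!x u w. x : K ==> norm (\<G> x u w) <= C * (norm u * norm w)"
 "!!x u v w. x : K ==> norm (R x u v w) <= C * (norm u * norm v * norm w)"
proof -
 obtain F where F: "smooth_on \<O> F" "!!x u w. x : \<O> ==> blinfun_apply (blinfun_apply (F x) u) w = \<G> x u w"
 by (rule bilinear_blinfun_field[OF open_\<O> \<G>_bil \<G>_smooth]) blast+
 obtain H where H: "smooth_on \<O> H" "!!x u v w. x : \<O> ==> blinfun_apply (blinfun_apply (blinfun_apply (H x) u) v) w = R x u v w"
 by (rule trilinear_blinfun_field[OF open_\<O> R_bilinear R_linear(3) smooth_R]) blast+
 note b = compact_norm_bound[OF K(1) continuous_on_subset[OF smooth_cont K(2)]]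
 obtain C1 C2 where C: "C1 >= 0" "!!x. x : K ==> norm (F x) <= C1" "C2 >= 0" "!!x. x : K ==> norm (H x) <= C2"
 using b[OF F(1)] b[OF H(1)] by blast
 have n2: "norm (f u w) <= norm f * (norm u * norm w)" for f :: "'e \<Rightarrow>\<^sub>L 'e \<Rightarrow>\<^sub>L 'e" and u w
 using order_trans[OF norm_blinfun[of "f u" w] mult_right_mono[OF norm_blinfun[of f u] norm_ge_zero[of w]]] by (simp add: mult_ac)
 show thesis
 proof (rule that[of "C1 + C2 + 1"])
 show "norm (\<G> x u w) <= (C1 + C2 + 1) * (norm u * norm w)" if "x : K" for x u w
  unfolding F(2)[OF subsetD[OF K(2) that], symmetric]
  by (rule order_trans[OF n2 mult_right_mono]) (use C(2)[OF that] C(3) in auto)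
 show "norm (R x u v w) <= (C1 + C2 + 1) * (norm u * norm v * norm w)" if x: "x : K" for x u v w
 proof -
  have "norm (H x u v w) <= norm (H x) * norm u * (norm v * norm w)"
  by (rule order_trans[OF n2 mult_right_mono[OF norm_blinfun]]) simp
  also have "... <= (C1 + C2 + 1) * norm u * (norm v * norm w)" using C(4)[OF x] C(1) by (intro mult_right_mono) auto
  finally show ?thesis using H(2) K(2) x by (auto simp: mult_ac)
 qed
 qed (use C in auto)
qed

text \<open>Gronwall along a segment for the finitely many functions \<open>\<x>\<close> and
  \<open>A b\<close>. The factor \<open>L\<close> does not depend on the initial point
  \<open>x0\<close>, because later that point moves along a curve.\<close>

lemma killing_pair_bound:
 assumes K: "compact K" "convex K" "K \<subseteq> \<O>"
 obtains L where "L >= 0" "!!\<x> A x0 x \<e>. killing_pair \<x> A ==> x0 : K ==> x : K ==> norm (\<x> x0) <= \<e> ==>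
 (!!b. b : Basis ==> norm (A x0 b) <= \<e>) ==> norm (\<x> x) <= L * \<e> & (ALL b:Basis. norm (A x b) <= L * \<e>)"
proof -
 obtain C where C: "C >= 1" "!!x' u w. x' : K ==> norm (\<G> x' u w) <= C * (norm u * norm w)"
 "!!x' u v w. x' : K ==> norm (R x' u v w) <= C * (norm u * norm v * norm w)"
 by (rule compact_bounds[OF K(1,3)]) blast
 define m where "m = diameter K"
 have m: "norm (x - y) <= m" if "x : K" "y : K" for x y
 using diameter_bounded_bound[OF compact_imp_bounded[OF K(1)] that] by (simp add: m_def dist_norm)
 define D where "D = real DIM('e)"
 have D1: "D >= 1" by (simp add: D_def Suc_leI)
 have "norm (\<x> x) <= exp (3 * D * C * (\<bar>m\<bar> + 1)) * \<e> & (ALL b:Basis. norm (A x b) <= exp (3 * D * C * (\<bar>m\<bar> + 1)) * \<e>)"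
 if kp: "killing_pair \<x> A" and x0: "x0 : K" and x: "x : K" and ini: "norm (\<x> x0) <= \<e>" "!!b. b : Basis ==> norm (A x0 b) <= \<e>" for \<x> A x0 x \<e>
 proof -
 have \<e>: "\<e> >= 0" using ini(1) norm_ge_zero order_trans by blast
 define d where "d = x - x0"
 define p where "p t = x0 + t *R d" for t :: real
 have dm: "norm d <= \<bar>m\<bar>" using m[OF x x0] by (simp add: d_def)
 have pK: "p t : K" if "t : {0..1}" for t
 proof -
 have "p t = (1 - t) *R x0 + t *R x" by (simp add: p_def d_def algebra_simps)
 then show ?thesis using convexD_alt[OF K(2) x0 x, of t] that by simp
 qed
 have p\<O>: "p t : \<O>" if "t : {0..1}" for t using pK[OF that] K(3) by blast
 \<comment> \<open>\<open>None\<close> indexes the field, \<open>Some b\<close> the value of the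
   endomorphism on the basis vector b.\<close>
 define N where "N i t = (case i of None => \<x> (p t) | Some b => A (p t) b)" for i t
 define N' where "N' i t = (case i of None => dd d \<x> (p t) | Some b => dd d (%y. A y b) (p t))" for i t
 have dN: "(N i hvd N' i t) (at01 t)" if "t : {0..1}" for i t
 unfolding N_def[abs_def] N'_def p_def
 using smooth_line[OF kpD(1)[OF kp] p\<O>[OF that, unfolded p_def]]
  smooth_line[OF kpD(2)[OF kp] p\<O>[OF that, unfolded p_def]]
 by (cases i) auto
 define J where "J = insert None (Some ` (Basis::'e set))"
 define C' where "C' = 3 * D * C * (\<bar>m\<bar> + 1)"
 have C'1: "C' >= 1"
 proof -
 have "1 * 1 * 1 * 1 <= 3 * D * C * (\<bar>m\<bar> + 1)" using D1 C(1) by (intro mult_mono) auto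
 then show ?thesis by (simp add: C'_def)
 qed
 have cN: "continuous_on {0..1} (N i)" for i using dN by (rule continuous_on_vector_derivative)
 have "EX K>=0. ALL i:J. ALL t:{0..1}. norm (N i t) <= K"
 proof (rule finite_bound_choice)
 show "finite J" by (simp add: J_def)
 show "EX K>=0. ALL t:{0..1}. norm (N i t) <= K" for i
  by (rule compact_norm_bound[OF compact_Icc cN])
 qed (auto intro: order_trans)
 then obtain Kb where Kb: "!!i t. i : J ==> t : {0..1} ==> norm (N i t) <= Kb" by blast
 have main: "norm (N i 1) <= (\<e> + 0) * exp C'" if "i : J" for i
 proof (rule gronwall_family[where N = N and N' = N' and J = J and K = Kb, OF C'1 _ _ dN Kb])
 show "norm (N i 0) <= \<e>" if "i : J" for i
  using that ini by (cases i) (auto simp: N_def p_def J_def)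
 fix t \<k> i assume t: "t : {0..1}" and \<k>: "!!j. j : J ==> norm (N j t) <= \<k>" and i: "i : J"
 note lA = kpD(3)[OF kp p\<O>[OF t]]
 have \<k>\<x>: "norm (\<x> (p t)) <= \<k>" using \<k>[of None] by (simp add: J_def N_def)
 have \<k>0: "\<k> >= 0" using \<k>\<x> norm_ge_zero order_trans by blast
 have \<k>A: "norm (A (p t) b) <= \<k>" if "b : Basis" for b using \<k>[of "Some b"] that by (simp add: J_def N_def)
 have A: "norm (A (p t) u) <= D * \<k> * norm u" for u
  unfolding D_def by (rule linear_basis_bound[OF lA \<k>A])
 have DC: "D <= D * C" "C <= D * C" "norm d <= \<bar>m\<bar> + 1" using D1 C(1) dm by (auto simp: mult_le_cancel_left1 mult_le_cancel_right1)
 have nonneg: "D >= 0" "C >= 0" using D1 C(1) by auto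
 have e1: "D * \<k> * norm d <= D * C * (\<bar>m\<bar> + 1) * \<k>"
  using mult_mono[OF mult_mono[OF DC(1) DC(3)] order_refl, of \<k>] nonneg \<k>0 by (simp add: mult_ac)
 have e2: "C * (norm d * \<k>) <= D * C * (\<bar>m\<bar> + 1) * \<k>"
  using mult_mono[OF mult_mono[OF DC(2) DC(3)] order_refl, of \<k>] nonneg \<k>0 by (simp add: mult_ac)
 have e3: "D * \<k> * (C * norm d) <= D * C * (\<bar>m\<bar> + 1) * \<k>"
  using mult_mono[OF mult_mono[OF order_refl DC(3)] order_refl, of "D * C" \<k>] nonneg \<k>0 by (simp add: mult_ac)
 show "norm (N' i t) <= C' * \<k> + 0"
 proof (cases i)
  case None
  have "N' i t = A (p t) d - \<G> (p t) d (\<x> (p t))"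
  using kpD(4)[OF kp p\<O>[OF t], of d] by (simp add: None N'_def dd_nab)
  then have "norm (N' i t) <= norm (A (p t) d) + norm (\<G> (p t) d (\<x> (p t)))" by (simp add: norm_triangle_ineq4)
  also have "... <= D * \<k> * norm d + C * (norm d * \<k>)"
  using order_trans[OF C(2)[OF pK[OF t], of d "\<x> (p t)"] mult_left_mono[OF mult_left_mono[OF \<k>\<x> norm_ge_zero] nonneg(2)]] A[of d]
  by (rule add_mono[rotated])
  also have "... <= C' * \<k>"
  proof -
  have "0 <= D * C * (\<bar>m\<bar> + 1) * \<k>" using nonneg \<k>0 by simp
  then show ?thesis using e1 e2 by (simp add: C'_def mult.assoc)
  qed
  finally show ?thesis by simp
 next
  case (Some b)
  then have b: "b : Basis" "norm b = 1" using i by (auto simp: J_def)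
  have "N' i t = A (p t) (\<G> (p t) d b) + R (p t) d (\<x> (p t)) b - \<G> (p t) d (A (p t) b)"
  using kpD(5)[OF kp p\<O>[OF t], of d b] by (simp add: Some N'_def dd_nab)
  then have "norm (N' i t) <= norm (A (p t) (\<G> (p t) d b)) + norm (R (p t) d (\<x> (p t)) b) + norm (\<G> (p t) d (A (p t) b))"
  by (metis norm_triangle_ineq4 norm_triangle_ineq add_right_mono order_trans)
  also have "... <= D * \<k> * (C * norm d) + C * (norm d * \<k>) + C * (norm d * \<k>)"
  proof (intro add_mono)
  have "norm (A (p t) (\<G> (p t) d b)) <= D * \<k> * norm (\<G> (p t) d b)" by (rule A)
  also have "... <= D * \<k> * (C * norm d)"
   using C(2)[OF pK[OF t], of d b] b nonneg \<k>0 by (intro mult_left_mono) auto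
  finally show "norm (A (p t) (\<G> (p t) d b)) <= D * \<k> * (C * norm d)" .
  have "norm (R (p t) d (\<x> (p t)) b) <= C * (norm d * norm (\<x> (p t)) * norm b)" by (rule C(3)[OF pK[OF t]])
  also have "... <= C * (norm d * \<k>)" using b \<k>\<x> nonneg by (simp add: mult_left_mono)
  finally show "norm (R (p t) d (\<x> (p t)) b) <= C * (norm d * \<k>)" .
  have "norm (\<G> (p t) d (A (p t) b)) <= C * (norm d * norm (A (p t) b))" by (rule C(2)[OF pK[OF t]])
  also have "... <= C * (norm d * \<k>)" using \<k>A[OF b(1)] nonneg by (simp add: mult_left_mono)
  finally show "norm (\<G> (p t) d (A (p t) b)) <= C * (norm d * \<k>)" .
  qed
  also have "... <= C' * \<k>"
  proof -
  have "C' * \<k> = 3 * (D * C * (\<bar>m\<bar> + 1) * \<k>)" by (simp add: C'_def)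
  then show ?thesis using e2 e3 by linarith
  qed
  finally show ?thesis by simp
 qed
 qed (use that \<e> in auto)
 have p1: "p 1 = x" by (simp add: p_def d_def)
 show ?thesis using main[of None] main[of "Some b" for b] by (auto simp: J_def N_def p1 C'_def mult.commute)
 qed
 then show thesis by (intro that[of "exp (3 * D * C * (\<bar>m\<bar> + 1))"]) auto
qed

lemma killing_pair_zero:
 assumes kp: "killing_pair \<x> A" and "convex \<O>" "x0 : \<O>" "\<x> x0 = 0" "!!w. A x0 w = 0" and x: "x : \<O>"
 shows "\<x> x = 0" "A x w = 0"
proof -
 have K: "compact (closed_segment x0 x)" "convex (closed_segment x0 x)" "closed_segment x0 x \<subseteq> \<O>"
 using assms by (auto simp: closed_segment_subset)
 have ini: "norm (\<x> x0) <= 0" "!!b. norm (A x0 b) <= 0" by (simp_all add: assms(4,5))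
 obtain L where "!!\<x> A x0' x' \<e>. killing_pair \<x> A ==> x0' : closed_segment x0 x ==> x' : closed_segment x0 x ==> norm (\<x> x0') <= \<e> ==>
 (!!b. b : Basis ==> norm (A x0' b) <= \<e>) ==> norm (\<x> x') <= L * \<e> & (ALL b:Basis. norm (A x' b) <= L * \<e>)"
 by (rule killing_pair_bound[OF K]) blast
 from this[OF kp _ _ ini] have "norm (\<x> x) <= L * 0 & (ALL b:Basis. norm (A x b) <= L * 0)" by simp
 then show "\<x> x = 0" "A x w = 0" using basis_expansion[OF kpD(3)[OF kp x], of w] by simp_all
qed

lemma killing_pair_unique:
 assumes kp: "killing_pair \<x> A" "killing_pair \<h> B" and "convex \<O>" "x0 : \<O>" "\<x> x0 = \<h> x0" "!!w. A x0 w = B x0 w" and x: "x : \<O>"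
 shows "\<x> x = \<h> x" "A x w = B x w"
 using killing_pair_zero[OF killing_pair_diff[OF kp] assms(3,4) _ _ x] assms(5,6) by auto

lemma parallel_along_line:
 assumes "convex \<O>" "x0 + t *R d : \<O>"
 obtains w where "w t = w0" "!!s X. x0 + s *R d : \<O> ==> (w hvd - \<G> (x0 + s *R d) d (w s)) (at s within X)"
proof -
 define T where "T = (%s. x0 + s *R d) -` \<O>"
 have oT: "open T" unfolding T_def by (rule continuous_open_vimage[OF open_\<O>]) (intro continuous_intros)
 have cT: "convex T"
 proof (rule convexI)
 fix a b u v :: real assume ab: "a : T" "b : T" "0 <= u" "0 <= v" "u + v = 1"
 have "x0 = u *R x0 + v *R x0" using ab(5) by (metis scaleR_add_left scaleR_one)
 then have "x0 + (u *R a + v *R b) *R d = u *R (x0 + a *R d) + v *R (x0 + b *R d)" by (simp add: algebra_simps)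
 then show "u *R a + v *R b : T" using convexD[OF assms(1), of "x0 + a *R d" "x0 + b *R d" u v] ab by (simp add: T_def)
 qed
 have sm: "smooth_on T (%s. - \<G> (x0 + s *R d) d w)" for w
 by (rule smooth_on_minus[OF oT smooth_compose[OF oT open_\<O> _ \<G>_smooth]])
  (auto simp: T_def intro!: smooth_add oT[unfolded T_def] smooth_scaleR)
 have l: "linear (%w. - \<G> (x0 + s *R d) d w)" if "s : T" for s
 using that by (intro linear_compose_neg \<G>_linear(1)) (simp add: T_def)
 have "t : T" using assms(2) by (simp add: T_def)
 from linear_ode_interval[OF oT cT this l sm, of w0]
 obtain w where "w t = w0" "!!s. s : T ==> (w hvd - \<G> (x0 + s *R d) d (w s)) (at s)" by blast
 then show thesis by (intro that[of w]) (auto simp: T_def intro: has_vector_derivative_at_within)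
qed

lemma parallel_zero:
 assumes \<O>: "!!s. s : {0..1} ==> x0 + s *R d : \<O>"
 and Y: "!!s. s : {0..1} ==> (Y hvd - \<G> (x0 + s *R d) d (Y s)) (at01 s)" and "Y 0 = 0" "t : {0..1}"
 shows "Y t = 0"
proof -
 have "compact ((%s. x0 + s *R d) ` {0..1})" by (intro compact_continuous_image continuous_intros) auto
 then obtain C where C: "C >= 1" "!!x u w. x : (%s. x0 + s *R d) ` {0..1} ==> norm (\<G> x u w) <= C * (norm u * norm w)"
 by (rule compact_bounds) (use \<O> in blast)+
 have "norm (Y t) <= (norm (Y 0) + 0) * exp (C * norm d + C)"
 proof (rule gronwall[OF _ order_refl Y _ assms(4)])
 show "1 <= C * norm d + C" using C(1) by (simp add: add_increasing)
 fix s :: real assume s: "s : {0..1}"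
 have "0 <= C * norm (Y s)" using C(1) by simp
 then show "norm (- \<G> (x0 + s *R d) d (Y s)) <= (C * norm d + C) * norm (Y s) + 0"
  using C(2)[OF imageI[OF s], of d "Y s"] unfolding norm_minus_cancel distrib_right mult.assoc add_0_right by linarith
 qed
 then show ?thesis using assms(3) by simp
qed

text \<open>By \<open>dA\<close> the covariant derivative of the endomorphism is \<open>E\<close>.
  On a parallel vector nothing but \<open>E\<close> survives beside the connection term.\<close>

lemma endo_along:
 assumes t: "t : X" and A: "!!s. s : X ==> linear (A s)" and x: "x : \<O>" and E: "linear E"
 and dA: "!!w. ((%s. A s w) hvd A t (\<G> x d w) - \<G> x d (A t w) + E w) (at t within X)"
 and \<s>: "(\<s> hvd - \<G> x d (\<s> t)) (at t within X)"
 shows "((%s. A s (\<s> s)) hvd - \<G> x d (A t (\<s> t)) + E (\<s> t)) (at t within X)"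
proof -
 note l = linear_add[OF A[OF t]] linear_scale[OF A[OF t]] linear_neg[OF A[OF t]] linear_add[OF E] linear_scale[OF E]
 have "linear (%w. A t (\<G> x d w) - \<G> x d (A t w) + E w)" by (simp add: linear_iff l \<G>_simps[OF x] algebra_simps)
 from linear_field_hvd[OF t A dA this \<s>] show ?thesis by (simp add: l)
qed

lemma killing_pair_along:
 assumes kp: "killing_pair \<x> A" and \<O>: "!!s. s : {0..1} ==> x0 + s *R d : \<O>" and t: "t : {0..1}" and x: "x = x0 + t *R d"
 and \<s>: "(\<s> hvd - \<G> x d (\<s> t)) (at01 t)"
 shows "((%s. A (x0 + s *R d) (\<s> s)) hvd - \<G> x d (A x (\<s> t)) + R x d (\<x> x) (\<s> t)) (at01 t)"
proof -
 have x\<O>: "x : \<O>" using \<O>[OF t] x by simp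
 have "dd d (%y. A y w) x = A x (\<G> x d w) - \<G> x d (A x w) + R x d (\<x> x) w" for w
 using kpD(5)[OF kp x\<O>, of d w] by (simp add: dd_nab)
 then have dA: "((%s. A (x0 + s *R d) w) hvd
  A (x0 + t *R d) (\<G> x d w) - \<G> x d (A (x0 + t *R d) w) + R x d (\<x> x) w) (at01 t)" for w
 using smooth_line[OF kpD(2)[OF kp], of x0 t d] \<O>[OF t] unfolding x by simp
 from endo_along[where A = "%s. A (x0 + s *R d)", OF t kpD(3)[OF kp \<O>] x\<O> R_linear(1)[OF x\<O>] dA \<s>]
 show ?thesis unfolding x by blast
qed

lemma line_in_domain: "convex \<O> ==> x0 : \<O> ==> x : \<O> ==> s : {0..1} ==> x0 + s *R (x - x0) : \<O>"
 using convexD[of \<O> x0 x "1 - s" s] by (simp add: algebra_simps)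

text \<open>Curvature endomorphisms commute with \<open>I\<close>, so the commutator of
  \<open>A\<close> with \<open>I\<close>, applied to a parallel vector, is parallel along rays and
  vanishes with its initial value.\<close>

lemma killing_pair_holomorphic:
 assumes kp: "killing_pair \<x> A" and c: "convex \<O>" "x0 : \<O>" and ini: "!!w. A x0 (I w) = I (A x0 w)" and x: "x : \<O>"
 shows "A x (I v) = I (A x v)"
proof -
 define d where "d = x - x0"
 let ?p = "%s. x0 + s *R d"
 note p = line_in_domain[OF c x, folded d_def]
 obtain w where w: "w 1 = v" "!!s X. ?p s : \<O> ==> (w hvd - \<G> (?p s) d (w s)) (at s within X)"
 by (rule parallel_along_line[OF c(1) p[of 1], of v]) auto
 have "A (?p 1) (I (w 1)) - I (A (?p 1) (w 1)) = 0"
 proof (rule parallel_zero[OF p])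
 fix s :: real assume s: "s : {0..1}"
 note x = p[OF s] and I = bounded_linear.has_vector_derivative[OF I_bounded_linear]
 have "((%s. I (w s)) hvd - \<G> (?p s) d (I (w s))) (at01 s)"
  using I[OF w(2)[OF x]] by (simp add: I_simps \<G>_I[OF x])
 from has_vector_derivative_diff[OF killing_pair_along[OF kp p s refl this] I[OF killing_pair_along[OF kp p s refl w(2)[OF x]]]]
 show "((%s. A (?p s) (I (w s)) - I (A (?p s) (w s))) hvd
  - \<G> (?p s) d (A (?p s) (I (w s)) - I (A (?p s) (w s)))) (at01 s)"
  by (simp add: I_simps \<G>_I[OF x] R_I[OF x] \<G>_simps[OF x] algebra_simps)
 qed (auto simp: ini)
 then show ?thesis by (simp add: w(1) d_def)
qed

lemma smooth_G_field: "smooth_on \<O> \<s> ==> smooth_on \<O> \<t> ==> smooth_on \<O> (%y. G y (\<s> y) (\<t> y))"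
 by (rule smooth_bilinear_field[OF open_\<O> G_bil G_smooth])

text \<open>Curvature endomorphisms are skew, so the symmetric part of \<open>A\<close>, evaluated
  on two parallel vectors, is constant along rays.\<close>

lemma killing_pair_skew:
 assumes kp: "killing_pair \<x> A" and c: "convex \<O>" "x0 : \<O>" and ini: "!!v w. G x0 (A x0 v) w + G x0 v (A x0 w) = 0" and x: "x : \<O>"
 shows "G x (A x v) w + G x v (A x w) = 0"
proof -
 define d where "d = x - x0"
 let ?p = "%s. x0 + s *R d"
 note p = line_in_domain[OF c x, folded d_def]
 obtain a where a: "a 1 = v" "!!s X. ?p s : \<O> ==> (a hvd - \<G> (?p s) d (a s)) (at s within X)"
 by (rule parallel_along_line[OF c(1) p[of 1], of v]) auto
 obtain b where b: "b 1 = w" "!!s X. ?p s : \<O> ==> (b hvd - \<G> (?p s) d (b s)) (at s within X)"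
 by (rule parallel_along_line[OF c(1) p[of 1], of w]) auto
 have G: "((%s. G (?p s) (\<s> s) (\<t> s)) hvd G (?p s) \<s>' (\<t> s) + G (?p s) (\<s> s) \<t>') (at01 s)"
 if s: "s : {0..1}" and \<s>: "(\<s> hvd - \<G> (?p s) d (\<s> s) + \<s>') (at01 s)"
  and \<t>: "(\<t> hvd - \<G> (?p s) d (\<t> s) + \<t>') (at01 s)" for s \<s> \<t> \<s>' \<t>'
 proof -
 note x = p[OF s]
 have dG: "((%s. G (?p s) u z) hvd G (?p s) (\<G> (?p s) d u) z + G (?p s) u (\<G> (?p s) d z)) (at01 s)" for u z
  unfolding compat[OF x, symmetric] by (rule smooth_line[OF G_smooth x])
 have 1: "((%s. G (?p s) u (\<t> s)) hvd ((G (?p s) (\<G> (?p s) d u) (\<t> s) + G (?p s) u (\<G> (?p s) d (\<t> s)))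
  + G (?p s) u (- \<G> (?p s) d (\<t> s) + \<t>'))) (at01 s)" for u
  by (rule linear_field_hvd[where T = "%s. G (?p s) u"
   and T' = "%z. G (?p s) (\<G> (?p s) d u) z + G (?p s) u (\<G> (?p s) d z)", OF s _ dG _ \<t>])
  (simp_all add: linear_iff G_simps[OF p] G_simps[OF x] \<G>_simps[OF x] algebra_simps)
 have "((%s. G (?p s) (\<s> s) (\<t> s)) hvd (((G (?p s) (\<G> (?p s) d (\<s> s)) (\<t> s) + G (?p s) (\<s> s) (\<G> (?p s) d (\<t> s)))
  + G (?p s) (\<s> s) (- \<G> (?p s) d (\<t> s) + \<t>')) + G (?p s) (- \<G> (?p s) d (\<s> s) + \<s>') (\<t> s))) (at01 s)"
  by (rule linear_field_hvd[where T = "%s u. G (?p s) u (\<t> s)" and T' = "%u. (G (?p s) (\<G> (?p s) d u) (\<t> s)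
   + G (?p s) u (\<G> (?p s) d (\<t> s))) + G (?p s) u (- \<G> (?p s) d (\<t> s) + \<t>')", OF s _ 1 _ \<s>])
  (simp_all add: linear_iff G_simps[OF p] G_simps[OF x] \<G>_simps[OF x] algebra_simps)
 then show ?thesis by (simp add: G_simps[OF x] algebra_simps)
 qed
 define f where "f s = G (?p s) (A (?p s) (a s)) (b s) + G (?p s) (a s) (A (?p s) (b s))" for s
 have df: "(f hvd 0) (at01 s)" if s: "s : {0..1}" for s
 proof -
 note x = p[OF s]
 have ab: "(a hvd - \<G> (?p s) d (a s) + 0) (at01 s)"
  "(b hvd - \<G> (?p s) d (b s) + 0) (at01 s)" using a(2)[OF x] b(2)[OF x] by auto
 from has_vector_derivative_add[OF G[OF s killing_pair_along[OF kp p s refl a(2)[OF x]] ab(2)] G[OF s ab(1) killing_pair_along[OF kp p s refl b(2)[OF x]]]]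
 show ?thesis using R_skew[OF x] by (simp add: f_def[abs_def] G_simps[OF x])
 qed
 have "norm (f 1) <= (norm (f 0) + 0) * exp 1" by (rule gronwall[OF order_refl order_refl df]) auto
 moreover have "f 0 = 0" by (simp add: f_def ini)
 ultimately show ?thesis by (simp add: f_def a(1) b(1) d_def)
qed

text \<open>\<open>T\<close> is the defect in the second equation of a Killing pair. The Ricci and
  Bianchi identities make it symmetric in u and v, the differentiated Killing equation makes it skew
  in v and w, and only zero has both symmetries.\<close>

lemma killing_pair_of_killing_equation:
 assumes \<x>: "smooth_on \<O> \<x>"
 and eq: "!!x u v. x : \<O> ==> dd (\<x> x) (%y. G y u v) x + G x (dd u \<x> x) v + G x u (dd v \<x> x) = 0"
 shows "killing_pair \<x> (%x u. nab u \<x> x)" "x : \<O> ==> G x (nab u \<x> x) v + G x u (nab v \<x> x) = 0"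
proof -
 have skew: "G x (nab u \<x> x) v + G x u (nab v \<x> x) = 0" if x: "x : \<O>" for x u v
 using eq[OF x, of u v] \<G>_sym[OF x, of "\<x> x"] by (simp add: compat[OF x] cov_def G_simps[OF x])
 then show "x : \<O> ==> G x (nab u \<x> x) v + G x u (nab v \<x> x) = 0" .
 have lin: "linear (%u. nab u \<x> x)" if x: "x : \<O>" for x
 using linear_frechet_derivative[OF smooth_diff[OF \<x> x]] \<G>_linear(2)[OF x, of "\<x> x"]
 by (simp add: linear_iff cov_def algebra_simps)
 define A where "A x u = nab u \<x> x" for x u
 have sA: "smooth_on \<O> (%x. A x u)" for u unfolding A_def by (rule smooth_nab[OF \<x>])
 define T where "T x u v = nab u (%y. A y v) x - A x (\<G> x u v) - R x u (\<x> x) v" for x u v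
 have "T x u v = 0" if x: "x : \<O>" for x u v
 proof -
 have lA: "linear (A x)" unfolding A_def by (rule lin[OF x])
 have sym: "T x u v = T x v u" for u v
 proof -
  have "nab u (%y. A y v) x - nab v (%y. A y u) x = R x u v (\<x> x)"
  unfolding A_def by (rule ricci_identity[OF x \<x>])
  then have "T x u v - T x v u = R x u v (\<x> x) - R x u (\<x> x) v + R x v (\<x> x) u"
  using \<G>_sym[OF x, of u v] by (simp add: T_def algebra_simps)
  also have "... = 0"
  using bianchi[OF x, of u v "\<x> x"] R_anti[of x "\<x> x" u v] by (simp add: algebra_simps)
  finally show ?thesis by simp
 qed
 have anti: "G x (T x u v) w = - G x (T x u w) v" for u v w
 proof -
  have "dd u (%y. G y (A y v) w + G y v (A y w)) x = 0"
  proof -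
  have "frechet_derivative (%y. G y (A y v) w + G y v (A y w)) (at x) = frechet_derivative (%y. 0::real) (at x)"
   by (rule dd_cong_open[OF open_\<O> x]) (use skew in \<open>simp add: A_def\<close>)
  then show ?thesis by simp
  qed
  moreover have "dd u (%y. G y (A y v) w + G y v (A y w)) x = dd u (%y. G y (A y v) w) x + dd u (%y. G y v (A y w)) x"
  by (rule dd_add[OF smooth_G_field[OF sA smooth_const] smooth_G_field[OF smooth_const sA] x])
  ultimately have "G x (nab u (%y. A y v) x) w + G x (A x v) (\<G> x u w) + (G x (\<G> x u v) (A x w) + G x v (nab u (%y. A y w) x)) = 0"
  by (simp add: dd_G_field[OF x] sA nab_const)
  moreover have "G x (A x v) (\<G> x u w) = - G x v (A x (\<G> x u w))" "G x (\<G> x u v) (A x w) = - G x (A x (\<G> x u v)) w"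
  using skew[OF x, of v "\<G> x u w"] skew[OF x, of "\<G> x u v" w] by (simp_all add: A_def)
  ultimately show ?thesis
  using R_skew[OF x, of u "\<x> x" v w] G_sym[OF x] by (simp add: T_def G_simps[OF x])
 qed
 have "G x (T x u v) w = 0" for w
  using anti[of u v w] anti[of w u v] anti[of v w u] sym[of u v] sym[of w u] sym[of v w] by simp
 then show ?thesis using G_eqI[OF x, of "T x u v" 0] by (simp add: G_simps[OF x])
 qed
 then show "killing_pair \<x> (%x u. nab u \<x> x)"
 unfolding killing_pair_def using \<x> sA lin by (simp add: A_def T_def algebra_simps)
qed

end

section \<open>Existence of Killing pairs with prescribed initial values\<close>

lemma dto_linear_field:
 fixes T :: "'a::real_normed_vector => 'c::euclidean_space => 'b::real_normed_vector"
 assumes "open S" "!!x. x : S ==> linear (T x)" "!!b. b : Basis ==> differentiable_times_on n S (%x. T x b)"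
 "differentiable_times_on n S w"
 shows "differentiable_times_on n S (%x. T x (w x))"
proof (subst dto_cong[OF assms(1), of _ "%x. \<Sum>b\<in>Basis. (w x \<bullet> b) *R T x b"])
 show "differentiable_times_on n S (%x. \<Sum>b\<in>Basis. (w x \<bullet> b) *R T x b)"
 using assms by (intro dto_sum dto_bilinear[OF _ bounded_bilinear_scaleR]
  dto_bl[OF _ bounded_linear_inner_left]) auto
qed (rule basis_expansion[OF assms(2)])

context local_symmetric begin

text \<open>The Killing system solved for ordinary derivatives: the connection terms of the
  covariant derivatives stand on the right. The endomorphism in the state is a bounded linear map,
  so that states form a Banach space.\<close>

definition pair_endo :: "'e => 'e => 'e \<times> ('e \<Rightarrow>\<^sub>L 'e) => 'e => 'e"
 where "pair_endo x v s w = snd s (\<G> x v w) - \<G> x v (snd s w) + R x v (fst s) w"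

text \<open>Derivative of \<open>pair_endo\<close> in the base point in the direction h, with the
  state held fixed; \<open>pair_field'\<close> plays the same part for
  \<open>pair_field\<close>.\<close>

definition pair_endo' :: "'e => 'e => 'e => 'e \<times> ('e \<Rightarrow>\<^sub>L 'e) => 'e => 'e"
 where "pair_endo' x h v s w = snd s (dd h (%y. \<G> y v w) x) - dd h (%y. \<G> y v (snd s w)) x + dd h (%y. R y v (fst s) w) x"

definition pair_field :: "'e => 'e => 'e \<times> ('e \<Rightarrow>\<^sub>L 'e) => 'e \<times> ('e \<Rightarrow>\<^sub>L 'e)"
 where "pair_field x v s = (snd s v - \<G> x v (fst s), Blinfun (pair_endo x v s))"

definition pair_field' :: "'e => 'e => 'e => 'e \<times> ('e \<Rightarrow>\<^sub>L 'e) => 'e \<times> ('e \<Rightarrow>\<^sub>L 'e)"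
 where "pair_field' x h v s = (- dd h (%y. \<G> y v (fst s)) x, Blinfun (pair_endo' x h v s))"

lemma dd_\<G>_linear:
 assumes "x : \<O>"
 shows "linear (%h. dd h (%y. \<G> y u w) x)" "linear (%u. dd h (%y. \<G> y u w) x)" "linear (%w. dd h (%y. \<G> y u w) x)"
 using linear_frechet_derivative[OF smooth_diff[OF \<G>_smooth assms]]
 bilinear_dd[OF open_\<O> \<G>_bil \<G>_smooth assms, of h]
 by (auto simp: bilinear_def)

lemma dd_R_eq: "x : \<O> ==> dd h (%y. R y u v w) x =
 R x (\<G> x h u) v w + R x u (\<G> x h v) w + R x u v (\<G> x h w) - \<G> x h (R x u v w)"
 using R_parallel[of x h u v w] by (simp add: cov_def algebra_simps)

lemma pair_endo_apply: "x : \<O> ==> blinfun_apply (Blinfun (pair_endo x v s)) w = pair_endo x v s w"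
proof -
 assume x: "x : \<O>"
 have "linear (pair_endo x v s)"
 by (simp add: linear_iff pair_endo_def \<G>_simps[OF x] R_simps[OF x] blinfun.add_right blinfun.scaleR_right algebra_simps)
 then show ?thesis using linear_conv_bounded_linear bounded_linear_Blinfun_apply by metis
qed

lemma pair_endo'_apply: "x : \<O> ==> blinfun_apply (Blinfun (pair_endo' x h v s)) w = pair_endo' x h v s w"
proof -
 assume x: "x : \<O>"
 note l = linear_add[OF dd_\<G>_linear(3)[OF x]] linear_scale[OF dd_\<G>_linear(3)[OF x]]
 have "linear (pair_endo' x h v s)"
 by (simp add: linear_iff pair_endo'_def dd_R_eq[OF x] l \<G>_simps[OF x] R_simps[OF x] blinfun.add_right blinfun.scaleR_right algebra_simps)
 then show ?thesis using linear_conv_bounded_linear bounded_linear_Blinfun_apply by metis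
qed

lemma pair_field_apply: "x : \<O> ==> fst (pair_field x v s) = snd s v - \<G> x v (fst s)"
 "x : \<O> ==> blinfun_apply (snd (pair_field x v s)) w = pair_endo x v s w"
 "x : \<O> ==> fst (pair_field' x h v s) = - dd h (%y. \<G> y v (fst s)) x"
 "x : \<O> ==> blinfun_apply (snd (pair_field' x h v s)) w = pair_endo' x h v s w"
 by (simp_all add: pair_field_def pair_field'_def pair_endo_apply pair_endo'_apply)

lemma pair_eqI: "fst p = fst q ==> (!!w. blinfun_apply (snd p) w = blinfun_apply (snd q) w) ==> p = q"
 for p q :: "'e \<times> ('e \<Rightarrow>\<^sub>L 'e)"
 by (simp add: prod_eq_iff blinfun_eqI)

text \<open>\<open>flat_linear_system\<close> wants the system as one smooth operator-valued map.
  \<open>Q\<close> isolates its algebra: the right-hand side is bilinear in the state and in the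
  triple formed by \<open>\<G> x v\<close>, \<open>R x v\<close> and v, so smoothness comes from
  that of the connection and the curvature.\<close>

lemma pair_operator:
 obtains a where "smooth_on \<O> a" "!!x v s. x : \<O> ==> blinfun_apply (blinfun_apply (a x) v) s = pair_field x v s"
 "!!x h v s. x : \<O> ==> blinfun_apply (blinfun_apply (dd h a x) v) s = pair_field' x h v s"
proof -
 obtain g where g: "smooth_on \<O> g" "!!x u w. x : \<O> ==> blinfun_apply (blinfun_apply (g x) u) w = \<G> x u w"
 by (rule bilinear_blinfun_field[OF open_\<O> \<G>_bil \<G>_smooth]) blast+
 obtain H where H: "smooth_on \<O> H" "!!x u v w. x : \<O> ==> blinfun_apply (blinfun_apply (blinfun_apply (H x) u) v) w = R x u v w"
 by (rule trilinear_blinfun_field[OF open_\<O> R_bilinear R_linear(3) smooth_R]) blast+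
 define Q :: "('e \<Rightarrow>\<^sub>L 'e) \<times> ('e \<Rightarrow>\<^sub>L 'e \<Rightarrow>\<^sub>L 'e) \<times> 'e => 'e \<times> ('e \<Rightarrow>\<^sub>L 'e) => 'e \<times> ('e \<Rightarrow>\<^sub>L 'e)"
 where "Q m s = (snd s (snd (snd m)) - fst m (fst s), (snd s o\<^sub>L fst m) - (fst m o\<^sub>L snd s) + fst (snd m) (fst s))" for m s
 have bQ: "bounded_bilinear Q"
 proof (rule bounded_bilinear.intro)
 note ss = Q_def blinfun.bilinear_simps bounded_bilinear.add_left[OF bounded_bilinear_blinfun_compose]
  bounded_bilinear.add_right[OF bounded_bilinear_blinfun_compose] bounded_bilinear.scaleR_left[OF bounded_bilinear_blinfun_compose]
  bounded_bilinear.scaleR_right[OF bounded_bilinear_blinfun_compose] algebra_simps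
 show "Q (m + m') s = Q m s + Q m' s" "Q m (s + s') = Q m s + Q m s'" "Q (r *R m) s = r *R Q m s" "Q m (r *R s) = r *R Q m s" for m m' s s' r
  by (simp_all add: ss)
 show "EX K. ALL m s. norm (Q m s) <= norm m * norm s * K"
 proof (intro exI allI)
  fix m :: "('e \<Rightarrow>\<^sub>L 'e) \<times> ('e \<Rightarrow>\<^sub>L 'e \<Rightarrow>\<^sub>L 'e) \<times> 'e" and s :: "'e \<times> ('e \<Rightarrow>\<^sub>L 'e)"
  have le: "norm (fst z) <= norm z" "norm (snd z) <= norm z" for z :: "'x::real_normed_vector \<times> 'y::real_normed_vector"
  by (metis norm_fst_le prod.collapse, metis norm_snd_le prod.collapse)
  have lem: "norm (fst m) <= norm m" "norm (fst (snd m)) <= norm m" "norm (snd (snd m)) <= norm m"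
  using le(1)[of m] order_trans[OF le(1)[of "snd m"] le(2)[of m]] order_trans[OF le(2)[of "snd m"] le(2)[of m]] by auto
  have pr: "A <= norm m * norm s" if "A <= a * b" "a <= norm m" "b <= norm s" "0 <= b" for A a b :: real
  using that(1) mult_mono[OF that(2,3) norm_ge_zero that(4)] by linarith
  have 1: "norm (snd s (snd (snd m))) <= norm m * norm s" "norm (fst m (fst s)) <= norm m * norm s"
  "norm (snd s o\<^sub>L fst m) <= norm m * norm s" "norm (fst m o\<^sub>L snd s) <= norm m * norm s" "norm (fst (snd m) (fst s)) <= norm m * norm s"
  using pr[OF norm_blinfun[of "snd s", unfolded mult.commute[of "norm (snd s)"]] lem(3) le(2)] pr[OF norm_blinfun lem(1) le(1)]
   pr[OF norm_blinfun_compose[of "snd s", unfolded mult.commute[of "norm (snd s)"]] lem(1) le(2)] pr[OF norm_blinfun_compose lem(1) le(2)]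
   pr[OF norm_blinfun lem(2) le(1)] by auto
  have "norm (Q m s) <= norm (fst (Q m s)) + norm (snd (Q m s))" using norm_Pair_le[of "fst (Q m s)" "snd (Q m s)"] by simp
  also have "... <= (norm m * norm s + norm m * norm s) + (norm m * norm s + norm m * norm s + norm m * norm s)"
  unfolding Q_def fst_conv snd_conv by (intro add_mono norm_triangle_le norm_triangle_le_diff 1)
  finally show "norm (Q m s) <= norm m * norm s * 5" by (simp add: mult_ac)
 qed
 qed
 have Qa: "blinfun_apply (Blinfun (Q m)) = Q m" for m by (rule bounded_linear_Blinfun_apply[OF bounded_bilinear.bounded_linear_right[OF bQ]])
 have bl: "bounded_linear (%m. Blinfun (Q m))"
 using transfer_bounded_bilinear_bounded_linearI[of Q "%m. Blinfun (Q m)"] bQ by (simp add: Qa)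
 define a where "a x = Blinfun (%v. Blinfun (Q (g x v, H x v, v)))" for x
 have lin: "linear (%v. Blinfun (Q (g x v, H x v, v)))" for x
 proof -
 have "linear (%v. (g x v, H x v, v))" by (simp add: linear_iff blinfun.bilinear_simps)
 from linear_compose[OF this bounded_linear.linear[OF bl]] show ?thesis by (simp add: comp_def)
 qed
 have P: "smooth_on \<O> (%x. (f x, h x))" if f: "smooth_on \<O> f" and h: "smooth_on \<O> h"
 for f :: "'e => 'x::real_normed_vector" and h :: "'e => 'y::real_normed_vector"
 proof -
 have "smooth_on \<O> (%x. (f x, 0) + (0, h x))"
  by (intro smooth_add open_\<O> smooth_bl[OF open_\<O> bounded_linear_Pair[OF bounded_linear_ident bounded_linear_zero] f]
   smooth_bl[OF open_\<O> bounded_linear_Pair[OF bounded_linear_zero bounded_linear_ident] h])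
 then show ?thesis by simp
 qed
 have a: "smooth_on \<O> a"
 unfolding a_def
 by (rule smooth_on_Blinfun[OF open_\<O> lin]) (intro smooth_bl[OF open_\<O> bl] P
  smooth_bl[OF open_\<O> blinfun.bounded_linear_left g(1)] smooth_bl[OF open_\<O> blinfun.bounded_linear_left H(1)] smooth_const)
 have av: "blinfun_apply (blinfun_apply (a x) v) s = pair_field x v s" if x: "x : \<O>" for x v s
 by (rule pair_eqI) (simp_all add: a_def Blinfun_apply[OF lin] Qa Q_def g(2)[OF x] H(2)[OF x] pair_field_apply[OF x] pair_endo_def blinfun.bilinear_simps)
 have "blinfun_apply (blinfun_apply (dd h a x) v) s = pair_field' x h v s" if x: "x : \<O>" for x h v s
 proof -
 note sv = smooth_bl[OF open_\<O> blinfun.bounded_linear_left a]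
 note s\<G> = smooth_deriv[OF \<G>_smooth x] and sR = smooth_deriv[OF smooth_R x]
 define b where "b y = blinfun_apply (blinfun_apply (a y) v) s" for y
 have b: "smooth_on \<O> b" unfolding b_def[abs_def] by (rule smooth_bl[OF open_\<O> blinfun.bounded_linear_left sv])
 have db: "dd h b x = blinfun_apply (blinfun_apply (dd h a x) v) s"
  unfolding b_def[abs_def] using dd_blinfun_apply[OF sv x] dd_blinfun_apply[OF a x] by simp
 note lb = bounded_linear.has_derivative[OF _ smooth_deriv[OF b x]]
 have "dd h (%y. fst (b y)) x = dd h (%y. snd s v - \<G> y v (fst s)) x"
  by (subst dd_cong_open[OF open_\<O> x, of _ "%y. snd s v - \<G> y v (fst s)"]) (simp_all add: b_def av pair_field_apply)
 moreover have "dd h (%y. snd s v - \<G> y v (fst s)) x = - dd h (%y. \<G> y v (fst s)) x"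
  using dd_eqI[OF has_derivative_diff[OF has_derivative_const s\<G>]] by simp
 ultimately have 1: "fst (dd h b x) = - dd h (%y. \<G> y v (fst s)) x"
  using dd_eqI[OF lb[OF bounded_linear_fst], of h] by simp
 have 2: "blinfun_apply (snd (dd h b x)) w = pair_endo' x h v s w" for w
 proof -
  have "dd h (%y. blinfun_apply (snd (b y)) w) x = dd h (%y. pair_endo y v s w) x"
  by (subst dd_cong_open[OF open_\<O> x, of _ "%y. pair_endo y v s w"]) (simp_all add: b_def av pair_field_apply)
  also have "... = pair_endo' x h v s w"
  unfolding pair_endo_def pair_endo'_def
  by (rule dd_eqI[OF has_derivative_add[OF has_derivative_diff[OF bounded_linear.has_derivative[OF blinfun.bounded_linear_right s\<G>] s\<G>] sR]])
  finally show ?thesis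
  using dd_eqI[OF lb[OF bounded_linear_compose[OF blinfun.bounded_linear_left bounded_linear_snd]], of w h] by simp
 qed
 show ?thesis unfolding db[symmetric] by (rule pair_eqI) (simp_all add: 1 2 pair_field_apply[OF x])
 qed
 then show thesis using that[OF a av] by blast
qed

definition curvature_invariant :: "'e => ('e => 'e) => bool"
 where "curvature_invariant x A \<longleftrightarrow> (ALL u v w. A (R x u v w) = R x (A u) v w + R x u (A v) w + R x u v (A w))"

text \<open>For the first component the Bianchi identity suffices. In the second, the surplus terms
  are the endomorphism acting as a derivation on the curvature, which is why flatness is confined to
  curvature invariant states.\<close>

lemma pair_field_flat:
 assumes x: "x : \<O>" and inv: "curvature_invariant x (blinfun_apply (snd s))"
 shows "pair_field' x u v s + pair_field x v (pair_field x u s) = pair_field' x v u s + pair_field x u (pair_field x v s)"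
proof (rule pair_eqI)
 let ?\<x> = "fst s"
 define A where "A = blinfun_apply (snd s)"
 define d\<G> where "d\<G> u v w = dd u (%y. \<G> y v w) x" for u v w
 have A: "A (p + q) = A p + A q" "A (p - q) = A p - A q" for p q
 by (simp_all add: A_def blinfun.add_right blinfun.diff_right)
 have curv: "R x u v w = d\<G> u v w - d\<G> v u w + \<G> x u (\<G> x v w) - \<G> x v (\<G> x u w)" for w
 by (simp add: curv_def d\<G>_def)
 have sym: "\<G> x v u = \<G> x u v" by (rule \<G>_sym[OF x])
 have L1: "fst (pair_field' x u v s + pair_field x v (pair_field x u s)) =
 - d\<G> u v ?\<x> + A (\<G> x u v) - \<G> x u (A v) + R x u ?\<x> v - \<G> x v (A u) + \<G> x v (\<G> x u ?\<x>)" for u v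
 by (simp add: pair_field_apply[OF x] pair_endo_def A_def d\<G>_def \<G>_simps[OF x])
 have E: "R x u ?\<x> v - R x v ?\<x> u = R x u v ?\<x>"
 using bianchi[OF x, of u v ?\<x>] R_anti[of x ?\<x> u v] by (simp add: algebra_simps)
 show "fst (pair_field' x u v s + pair_field x v (pair_field x u s)) = fst (pair_field' x v u s + pair_field x u (pair_field x v s))"
 using E unfolding L1 curv sym by (simp add: algebra_simps)
 fix w
 have L2: "blinfun_apply (snd (pair_field' x u v s + pair_field x v (pair_field x u s))) w =
 A (d\<G> u v w) - d\<G> u v (A w) + (R x (\<G> x u v) ?\<x> w + R x v (\<G> x u ?\<x>) w + R x v ?\<x> (\<G> x u w) - \<G> x u (R x v ?\<x> w))
 + (A (\<G> x u (\<G> x v w)) - \<G> x u (A (\<G> x v w)) + R x u ?\<x> (\<G> x v w))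
 - (\<G> x v (A (\<G> x u w)) - \<G> x v (\<G> x u (A w)) + \<G> x v (R x u ?\<x> w))
 + (R x v (A u) w - R x v (\<G> x u ?\<x>) w)" for u v
 by (simp add: pair_field_apply[OF x] pair_endo_def pair_endo'_def A_def d\<G>_def dd_R_eq[OF x] \<G>_simps[OF x] R_simps[OF x] blinfun.add_left)
 have inv': "A (R x u v w) = R x (A u) v w + R x u (A v) w + R x u v (A w)"
 using inv by (simp add: curvature_invariant_def A_def)
 have cA: "R x u v (A w) = d\<G> u v (A w) - d\<G> v u (A w) + \<G> x u (\<G> x v (A w)) - \<G> x v (\<G> x u (A w))" by (rule curv)
 have Ac: "A (R x u v w) = A (d\<G> u v w) - A (d\<G> v u w) + A (\<G> x u (\<G> x v w)) - A (\<G> x v (\<G> x u w))"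
 unfolding curv A ..
 have an: "R x (A u) v w = - R x v (A u) w" by (rule R_anti)
 show "blinfun_apply (snd (pair_field' x u v s + pair_field x v (pair_field x u s))) w =
  blinfun_apply (snd (pair_field' x v u s + pair_field x u (pair_field x v s))) w"
 using inv' unfolding L2 cA Ac an sym by (simp add: algebra_simps)
qed

text \<open>Here \<open>a\<close>, \<open>b\<close> and \<open>e\<close> are the covariant
  derivatives of the three arguments along the curve. As the curvature is parallel, the product rule
  has no further term.\<close>

lemma R_along:
 assumes s: "s : X" and c: "!!s. s : X ==> c s : \<O>"
 and dR: "!!u v w. ((%s. R (c s) u v w) hvd dd d (%y. R y u v w) (c s)) (at s within X)"
 and \<a>: "(\<a> hvd - \<G> (c s) d (\<a> s) + a) (at s within X)" and \<b>: "(\<b> hvd - \<G> (c s) d (\<b> s) + b) (at s within X)"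
 and \<c>: "(\<c> hvd - \<G> (c s) d (\<c> s) + e) (at s within X)"
 shows "((%s. R (c s) (\<a> s) (\<b> s) (\<c> s)) hvd - \<G> (c s) d (R (c s) (\<a> s) (\<b> s) (\<c> s))
 + (R (c s) a (\<b> s) (\<c> s) + R (c s) (\<a> s) b (\<c> s) + R (c s) (\<a> s) (\<b> s) e)) (at s within X)"
proof -
 note x = c[OF s]
 note lin = dd_R_eq[OF x] \<G>_simps[OF x] R_simps[OF x]
 have 1: "((%s. R (c s) u v (\<c> s)) hvd (dd d (%y. R y u v (\<c> s)) (c s) + R (c s) u v (- \<G> (c s) d (\<c> s) + e))) (at s within X)" for u v
 by (rule linear_field_hvd[where T = "%s. R (c s) u v" and T' = "%w. dd d (%y. R y u v w) (c s)", OF s R_linear(1)[OF c] dR _ \<c>])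
  (simp_all add: linear_iff lin algebra_simps)
 have 2: "((%s. R (c s) u (\<b> s) (\<c> s)) hvd ((dd d (%y. R y u (\<b> s) (\<c> s)) (c s) + R (c s) u (\<b> s) (- \<G> (c s) d (\<c> s) + e))
  + R (c s) u (- \<G> (c s) d (\<b> s) + b) (\<c> s))) (at s within X)" for u
 by (rule linear_field_hvd[where T = "%s v. R (c s) u v (\<c> s)"
   and T' = "%v. dd d (%y. R y u v (\<c> s)) (c s) + R (c s) u v (- \<G> (c s) d (\<c> s) + e)", OF s R_linear(2)[OF c] 1 _ \<b>])
  (simp_all add: linear_iff lin algebra_simps)
 have "((%s. R (c s) (\<a> s) (\<b> s) (\<c> s)) hvd (((dd d (%y. R y (\<a> s) (\<b> s) (\<c> s)) (c s) + R (c s) (\<a> s) (\<b> s) (- \<G> (c s) d (\<c> s) + e))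
  + R (c s) (\<a> s) (- \<G> (c s) d (\<b> s) + b) (\<c> s)) + R (c s) (- \<G> (c s) d (\<a> s) + a) (\<b> s) (\<c> s))) (at s within X)"
 by (rule linear_field_hvd[where T = "%s u. R (c s) u (\<b> s) (\<c> s)"
   and T' = "%u. (dd d (%y. R y u (\<b> s) (\<c> s)) (c s) + R (c s) u (\<b> s) (- \<G> (c s) d (\<c> s) + e)) + R (c s) u (- \<G> (c s) d (\<b> s) + b) (\<c> s)",
   OF s R_linear(3)[OF c] 2 _ \<a>])
  (simp_all add: linear_iff lin algebra_simps)
 then show ?thesis by (simp add: lin algebra_simps)
qed

text \<open>The defect \<open>Y\<close>, taken on parallel vectors, is parallel: the covariant
  derivative of the endomorphism is a curvature endomorphism, and by \<open>R_R\<close> that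
  annihilates the curvature.\<close>

lemma curvature_invariant_along_ray:
 assumes c: "convex \<O>" "x0 : \<O>" "x : \<O>" and y0: "curvature_invariant x0 (blinfun_apply (snd (y 0)))"
 and dy: "!!t. t : {0..1} ==> (y hvd pair_field (x0 + t *R (x - x0)) (x - x0) (y t)) (at01 t)"
 and t: "t : {0..1}"
 shows "curvature_invariant (x0 + t *R (x - x0)) (blinfun_apply (snd (y t)))"
 unfolding curvature_invariant_def
proof (intro allI)
 fix u v w
 define d where "d = x - x0"
 define p where "p s = x0 + s *R d" for s :: real
 have p: "s : {0..1} ==> p s : \<O>" for s unfolding p_def d_def by (rule line_in_domain[OF c])
 define A where "A s = blinfun_apply (snd (y s))" for s
 define E where "E s = R (p s) d (fst (y s))" for s
 have lA: "linear (A s)" for s unfolding A_def by (simp add: blinfun.bounded_linear_right bounded_linear.linear)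
 have dA: "((%s. A s z) hvd A s (\<G> (p s) d z) - \<G> (p s) d (A s z) + E s z) (at01 s)" if s: "s : {0..1}" for s z
 proof -
 have "((%t. snd (y t)) hvd snd (pair_field (p s) d (y s))) (at01 s)"
  using bounded_linear.has_vector_derivative[OF bounded_linear_snd dy[OF s]] by (simp add: p_def d_def)
 from bounded_linear.has_vector_derivative[OF blinfun.bounded_linear_left this, of z]
 show ?thesis by (simp add: A_def E_def pair_field_apply[OF p[OF s]] pair_endo_def)
 qed
 have along: "((%s. A s (\<s> s)) hvd - \<G> (p s) d (A s (\<s> s)) + E s (\<s> s)) (at01 s)"
 if "s : {0..1}" "(\<s> hvd - \<G> (p s) d (\<s> s)) (at01 s)" for \<s> s
 by (rule endo_along[OF that(1) lA p[OF that(1)] _ dA[OF that(1)] that(2)]) (simp add: E_def R_linear(1)[OF p[OF that(1)]])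
 have ex: "EX a. a t = z & (ALL s:{0..1}. (a hvd - \<G> (p s) d (a s)) (at01 s))" for z
 by (rule parallel_along_line[OF c(1) p[OF t, unfolded p_def], of z]) (use p in \<open>unfold p_def, blast\<close>)
 obtain \<a> \<b> \<c> where ini: "\<a> t = u" "\<b> t = v" "\<c> t = w"
 and par: "!!s. s : {0..1} ==> (\<a> hvd - \<G> (p s) d (\<a> s)) (at01 s)"
  "!!s. s : {0..1} ==> (\<b> hvd - \<G> (p s) d (\<b> s)) (at01 s)"
  "!!s. s : {0..1} ==> (\<c> hvd - \<G> (p s) d (\<c> s)) (at01 s)"
 using ex[of u] ex[of v] ex[of w] by blast
 define Y where "Y s = A s (R (p s) (\<a> s) (\<b> s) (\<c> s)) - R (p s) (A s (\<a> s)) (\<b> s) (\<c> s)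
 - R (p s) (\<a> s) (A s (\<b> s)) (\<c> s) - R (p s) (\<a> s) (\<b> s) (A s (\<c> s))" for s
 have "Y t = 0"
 proof (rule parallel_zero[OF p[unfolded p_def] _ _ t])
 fix s :: real assume s: "s : {0..1}"
 have dR: "((%s. R (p s) u v w) hvd dd d (%y. R y u v w) (p s)) (at01 s)" for u v w
  unfolding p_def by (rule smooth_line[OF smooth_R p[OF s, unfolded p_def]])
 have z: "(\<s> hvd - \<G> (p s) d (\<s> s) + 0) (at01 s)"
  if "(\<s> hvd - \<G> (p s) d (\<s> s)) (at01 s)" for \<s> using that by simp
 note R = R_along[where c = p, OF s p dR] and a = par(1)[OF s] and b = par(2)[OF s] and e = par(3)[OF s]
 have "((%s. R (p s) (\<a> s) (\<b> s) (\<c> s)) hvd - \<G> (p s) d (R (p s) (\<a> s) (\<b> s) (\<c> s))) (at01 s)"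
  using R[OF _ z[OF a] z[OF b] z[OF e]] by (simp add: R_simps[OF p[OF s]])
 note D = has_vector_derivative_diff[OF has_vector_derivative_diff[OF has_vector_derivative_diff[OF along[OF s this]
  R[OF _ along[OF s a] z[OF b] z[OF e]]] R[OF _ z[OF a] along[OF s b] z[OF e]]] R[OF _ z[OF a] z[OF b] along[OF s e]]]
 have "(Y hvd - \<G> (p s) d (Y s)) (at01 s)"
  unfolding Y_def[abs_def]
  by (rule has_vector_derivative_eq_rhs[OF D]) (simp_all add: R_simps[OF p[OF s]] \<G>_simps[OF p[OF s]] E_def R_R[OF p[OF s], of d "fst (y s)"])
 then show "(Y hvd - \<G> (x0 + s *R d) d (Y s)) (at01 s)" by (simp add: p_def)
 next
 show "Y 0 = 0" using y0 by (simp add: Y_def A_def p_def curvature_invariant_def)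
 qed
 then show "blinfun_apply (snd (y t)) (R (x0 + t *R (x - x0)) u v w) = R (x0 + t *R (x - x0)) (blinfun_apply (snd (y t)) u) v w
  + R (x0 + t *R (x - x0)) u (blinfun_apply (snd (y t)) v) w + R (x0 + t *R (x - x0)) u v (blinfun_apply (snd (y t)) w)"
 by (simp add: Y_def ini A_def p_def d_def algebra_simps)
qed

theorem killing_pair_exists:
 assumes "convex \<O>" "x0 : \<O>" "linear A0" "curvature_invariant x0 A0"
 shows "EX \<x> A. killing_pair \<x> A & \<x> x0 = \<x>0 & A x0 = A0"
proof -
 have A0: "blinfun_apply (Blinfun A0) = A0"
 using assms(3) linear_conv_bounded_linear bounded_linear_Blinfun_apply by blast
 obtain a where a: "smooth_on \<O> a" "!!x v s. x : \<O> ==> blinfun_apply (blinfun_apply (a x) v) s = pair_field x v s"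
 "!!x h v s. x : \<O> ==> blinfun_apply (blinfun_apply (dd h a x) v) s = pair_field' x h v s" by (rule pair_operator) blast
 have "EX s. s x0 = (\<x>0, Blinfun A0) & (ALL x:\<O>. curvature_invariant x (blinfun_apply (snd (s x))) & (s has_derivative (%v. a x v (s x))) (at x))"
 proof (rule flat_linear_system[OF open_\<O> assms(1,2) a(1)])
 show "curvature_invariant (x0 + t *R (x - x0)) (blinfun_apply (snd (y t)))"
  if x: "x : \<O>" and y: "y 0 = (\<x>0, Blinfun A0)"
  and dy: "!!t. t : {0..1} ==> (y hvd a (x0 + t *R (x - x0)) (x - x0) (y t)) (at01 t)"
  and t: "t : {0..1}" for x y t
 proof (rule curvature_invariant_along_ray[OF assms(1,2) x _ _ t])
  show "(y hvd pair_field (x0 + t *R (x - x0)) (x - x0) (y t)) (at01 t)" if "t : {0..1}" for t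
  using dy[OF that] a(2)[OF line_in_domain[OF assms(1,2) x that]] by simp
 qed (use y A0 assms(4) in simp)
 qed (simp add: a pair_field_flat)
 then obtain s where s0: "s x0 = (\<x>0, Blinfun A0)" and "!!x. x : \<O> ==> (s has_derivative (%v. a x v (s x))) (at x)" by blast
 then have ds: "!!x. x : \<O> ==> (s has_derivative (%v. pair_field x v (s x))) (at x)" by (simp add: a(2))
 define \<x> where "\<x> x = fst (s x)" for x
 define A where "A x = blinfun_apply (snd (s x))" for x
 have lA: "linear (A x)" for x unfolding A_def by (simp add: blinfun.bounded_linear_right bounded_linear.linear)
 have d\<x>: "(\<x> has_derivative (%v. A x v - \<G> x v (\<x> x))) (at x)" if x: "x : \<O>" for x
 using bounded_linear.has_derivative[OF bounded_linear_fst ds[OF x]]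
 by (simp add: \<x>_def[abs_def] A_def pair_field_apply[OF x])
 have dA: "((%x. A x w) has_derivative (%v. A x (\<G> x v w) - \<G> x v (A x w) + R x v (\<x> x) w)) (at x)" if x: "x : \<O>" for x w
 using bounded_linear.has_derivative[OF blinfun.bounded_linear_left bounded_linear.has_derivative[OF bounded_linear_snd ds[OF x]], of w]
 by (simp add: \<x>_def A_def pair_field_apply[OF x] pair_endo_def)
 \<comment> \<open>Bootstrapping: by the system the first derivatives are linear in the solution
   with smooth coefficients.\<close>
 have sm: "differentiable_times_on n \<O> \<x> & (ALL w. differentiable_times_on n \<O> (%x. A x w))" for n
 proof (induction n)
 case 0
 show ?case using d\<x> dA by (auto intro!: continuous_at_imp_continuous_on has_derivative_continuous)
 next
 case (Suc n)
 have \<G>n: "differentiable_times_on n \<O> (%x. \<G> x u v)" and Rn: "differentiable_times_on n \<O> (%x. R x u v w)" for u v w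
  using \<G>_smooth smooth_R by (simp_all add: smooth_on_def)
 have An: "differentiable_times_on n \<O> (%x. A x w)" and \<x>n: "differentiable_times_on n \<O> \<x>" for w using Suc by auto
 have minus: "differentiable_times_on n \<O> (%x. f x - g x)" if "differentiable_times_on n \<O> f" "differentiable_times_on n \<O> g"
  for f g :: "'e => 'e"
  using dto_add[OF open_\<O> that(1) dto_bl[OF open_\<O> bounded_linear_minus[OF bounded_linear_ident] that(2)]]
  by simp
 have "differentiable_times_on n \<O> (dd v \<x>)" for v
  by (subst dto_cong[OF open_\<O> dd_eqI[OF d\<x>]])
  (auto intro!: minus An dto_linear_field[OF open_\<O> \<G>_linear(1) \<G>n \<x>n])
 moreover have "differentiable_times_on n \<O> (dd v (%x. A x w))" for v w
  by (subst dto_cong[OF open_\<O> dd_eqI[OF dA]])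
  (auto intro!: minus dto_add[OF open_\<O>] dto_linear_field[OF open_\<O> lA An \<G>n]
   dto_linear_field[OF open_\<O> \<G>_linear(1) \<G>n An]
   dto_linear_field[where T = "%x z. R x v z w", OF open_\<O> R_linear(2) Rn \<x>n])
 moreover have "\<x> differentiable (at x)" "(%x. A x w) differentiable (at x)" if "x : \<O>" for x w
  using d\<x>[OF that] dA[OF that] unfolding differentiable_def by blast+
 ultimately show ?case by simp
 qed
 have "killing_pair \<x> A"
 unfolding killing_pair_def
 proof (intro conjI ballI allI)
 show "smooth_on \<O> \<x>" "smooth_on \<O> (%x. A x w)" for w using sm by (auto simp: smooth_on_def)
 show "linear (A x)" for x by (rule lA)
 show "nab u \<x> x = A x u" if "x : \<O>" for x u by (simp add: cov_def dd_eqI[OF d\<x>[OF that]])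
 show "nab u (%y. A y w) x = A x (\<G> x u w) + R x u (\<x> x) w" if "x : \<O>" for x u w
  by (simp add: cov_def dd_eqI[OF dA[OF that]])
 qed
 moreover have "\<x> x0 = \<x>0" "A x0 = A0" by (auto simp: \<x>_def A_def s0 A0)
 ultimately show ?thesis by blast
qed

end

section \<open>Transvections in coordinates that admit the rotation field\<close>

context local_symmetric begin

definition transvection_term :: "'e => 'e => 'e => 'e"
 where "transvection_term x W X = (1/4) *R (R x W X X - R x W (I X) (I X))"

lemma killing_pair_dd: "killing_pair \<x> A ==> x : \<O> ==> dd v \<x> x = A x v - \<G> x v (\<x> x)"
 by (simp add: dd_nab kpD(4))

lemma killing_pair_dd_A: "killing_pair \<x> A ==> x : \<O> ==> dd v (%y. A y w) x = A x (\<G> x v w) + R x v (\<x> x) w - \<G> x v (A x w)"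
 by (simp add: dd_nab kpD(5))

lemma killing_pair_dd_I:
 assumes "killing_pair \<x> A" "x : \<O>" "!!w. A x (I w) = I (A x w)"
 shows "dd (I v) \<x> x = I (dd v \<x> x)"
 using assms by (simp add: killing_pair_dd \<G>_I_left I_simps)

lemma ray_in_convex: "convex \<O> ==> 0 : \<O> ==> X : \<O> ==> t : {0..1} ==> t *R X : \<O>" for t :: real
 using convexD[of \<O> 0 X "1 - t" t] by auto

lemma smooth_on_ray_derivative:
 fixes f :: "'e => 'x::real_normed_vector"
 assumes "smooth_on \<O> f" "t *R X : \<O>"
 shows "((%t. f (t *R X)) hvd dd X f (t *R X)) (at t within T)"
 using smooth_line[OF assms(1), of 0 t X] assms(2) by simp

text \<open>The integrating factor is the inverse of \<open>s ^ n\<close> on \<open>{t..1}\<close>.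
  At t = 0 the equation itself forces the value 0, provided n is positive.\<close>

lemma homogeneous_of_euler:
 fixes e :: "real => 'x::real_normed_vector"
 assumes d: "!!t. t : {0..1} ==> (e hvd e' t) (at01 t)"
 and eu: "!!t. t : {0..1} ==> t *R e' t = real n *R e t" and e0: "n ~= 0" and t: "t : {0..1}"
 shows "e t = t ^ n *R e 1"
proof (cases "t = 0")
 case True
 have "real n *R e 0 = 0" using eu[of 0] by simp
 then show ?thesis using True e0 by simp
next
 case False
 then have t0: "0 < t" "t <= 1" using t by auto
 have "((%s. inverse (s ^ n) *R e s) has_derivative (%h. 0)) (at s within {t..1})" if s: "s : {t..1}" for s
 proof -
 have s0: "s > 0" "s : {0..1}" using s t0 by auto
 have "(e hvd e' s) (at s within {t..1})"
  by (rule has_vector_derivative_within_subset[OF d[OF s0(2)]]) (use t0 in auto)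
 moreover have "((%s. inverse (s ^ n)) has_real_derivative - (real n * inverse (s ^ Suc n))) (at s within {t..1})"
 proof -
  obtain m where m: "n = Suc m" using e0 by (cases n) auto
  have "((%s. inverse (s ^ Suc m)) has_real_derivative
  - (inverse (s ^ Suc m) * ((1 + real m) * (1 * s ^ m)) * inverse (s ^ Suc m))) (at s within {t..1})"
  using s0 by (intro DERIV_inverse' DERIV_power_Suc DERIV_ident) auto
  moreover have "inverse (s ^ Suc m) * ((1 + real m) * (1 * s ^ m)) * inverse (s ^ Suc m) = real (Suc m) * inverse (s ^ Suc (Suc m))"
  using s0 by (simp add: field_simps)
  ultimately show ?thesis unfolding m by metis
 qed
 ultimately have "((%s. inverse (s ^ n) *R e s) hvd (inverse (s ^ n) *R e' s + (- (real n * inverse (s ^ Suc n))) *R e s)) (at s within {t..1})"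
  by (intro has_vector_derivative_scaleR)
 moreover have "inverse (s ^ n) *R e' s + (- (real n * inverse (s ^ Suc n))) *R e s = 0"
 proof -
  have "e' s = (real n / s) *R e s" using arg_cong[OF eu[OF s0(2)], of "%z. (1/s) *R z"] s0 by simp
  then show ?thesis using s0 by (simp add: scaleR_left_distrib[symmetric] field_simps)
 qed
 ultimately show ?thesis by (simp add: has_vector_derivative_def)
 qed
 then have "inverse (t ^ n) *R e t = inverse (1 ^ n) *R e 1"
 using t0 by (intro has_derivative_zero_unique[of "{t..1}" "%s. inverse (s ^ n) *R e s" 1 t, symmetric]) auto
 then have "t ^ n *R (inverse (t ^ n) *R e t) = t ^ n *R e 1" by simp
 then show ?thesis using t0 by simp
qed

text \<open>The hypothesis says that the field X \<mapsto> I X, which generates the rotations about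
  0, belongs to a Killing pair; \<open>rotation_killing_field\<close> provides this in normal
  coordinates.\<close>

context
 fixes B
 assumes rot: "killing_pair I B"
begin

lemma rotation_B: "x : \<O> ==> B x v = I v + \<G> x v (I x)"
 using kpD(4)[OF rot, of x v] dd_eqI[OF bounded_linear_imp_has_derivative[OF I_bounded_linear], of x v]
 by (simp add: cov_def)

text \<open>The Lie derivative of the connection along I x vanishes. Since \<open>\<G>\<close> is
  complex bilinear, its three other terms add up to \<open>I (\<G> x u v)\<close>.\<close>

lemma rotation_invariant_connection:
 assumes x: "x : \<O>"
 shows "dd (I x) (%y. \<G> y u v) x = - I (\<G> x u v)"
proof -
 have "((%y. \<G> y v (I y)) has_derivative (%h. dd h (%y. \<G> y v (I x)) x + \<G> x v (I h))) (at x)"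
 by (rule linear_field_deriv[OF open_\<O> x, where T = "%y. \<G> y v" and T' = "%w h. dd h (%y. \<G> y v w) x"])
  (use \<G>_linear(1) \<G>_has_derivative[OF x] bounded_linear_imp_has_derivative[OF I_bounded_linear] in auto)
 from has_derivative_add[OF has_derivative_const[of "I v"] this]
 have "dd u (%y. I v + \<G> y v (I y)) x = dd u (%y. \<G> y v (I x)) x + \<G> x v (I u)"
 by (simp add: dd_eqI)
 moreover have "dd u (%y. B y v) x = dd u (%y. I v + \<G> y v (I y)) x"
 using dd_cong_open[OF open_\<O> x rotation_B] by simp
 ultimately have "dd u (%y. \<G> y v (I x)) x + \<G> x v (I u) = B x (\<G> x u v) + R x u (I x) v - \<G> x u (B x v)"
 using killing_pair_dd_A[OF rot x, of v u] by simp
 moreover have "dd a (%y. \<G> y b c) x = dd a (%y. \<G> y c b) x" for a b c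
 using dd_cong_open[OF open_\<O> x, of "%y. \<G> y b c" "%y. \<G> y c b"] \<G>_sym by metis
 ultimately show ?thesis
 using \<G>_sym[OF x, of "\<G> x u v" "I x"] \<G>_sym[OF x, of "I x" v] \<G>_sym[OF x, of v u]
 by (simp add: rotation_B[OF x] curv_def \<G>_simps[OF x] \<G>_I[OF x])
qed

lemma rotation_connection_origin:
 assumes o: "0 : \<O>"
 shows "\<G> 0 u v = 0"
proof -
 have "dd 0 (%y. \<G> y u v) 0 = 0" by (rule linear_0[OF dd_\<G>_linear(1)[OF o]])
 then have "I (\<G> 0 u v) = 0" using rotation_invariant_connection[OF o, of u v] by (simp add: I_simps)
 then have "I (I (\<G> 0 u v)) = 0" by (simp add: I_simps)
 then show ?thesis by (simp only: I_I neg_equal_0_iff_equal)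
qed

text \<open>Differentiating the invariance at 0, the derivative of \<open>\<G>\<close> is antilinear
  in its direction while \<open>\<G>\<close> is complex linear in both slots. As
  \<open>\<G> 0\<close> vanishes, the curvature at 0 is a difference of two derivatives, one
  antilinear and one linear in u; the formula projects to the antilinear part.\<close>

lemma rotation_dd_connection_origin:
 assumes o: "0 : \<O>"
 shows "dd (I u) (%y. \<G> y v w) 0 = - I (dd u (%y. \<G> y v w) 0)"
 and "dd u (%y. \<G> y v w) 0 = (1/2) *R (R 0 u v w + I (R 0 (I u) v w))"
proof -
 let ?f = "%v w y. \<G> y v w"
 have anti: "dd (I u) (?f v w) 0 = - I (dd u (?f v w) 0)" for u v w
 proof -
 have 1: "((%y. frechet_derivative (?f v w) (at y) (I y)) has_derivative
  (%h. dd h (dd (I 0) (?f v w)) 0 + frechet_derivative (?f v w) (at 0) (I h))) (at 0)"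
  by (rule linear_field_deriv[OF open_\<O> o, where T = "%y. frechet_derivative (?f v w) (at y)" and T' = "%c h. dd h (dd c (?f v w)) 0"])
  (use linear_frechet_derivative[OF smooth_diff[OF \<G>_smooth]]
   smooth_deriv[OF smooth_dd[OF \<G>_smooth] o] bounded_linear_imp_has_derivative[OF I_bounded_linear] in auto)
 have 2: "((%y. - I (\<G> y v w)) has_derivative (%h. - I (dd h (?f v w) 0))) (at 0)"
  by (intro has_derivative_minus bounded_linear.has_derivative[OF I_bounded_linear] \<G>_has_derivative o)
 have 3: "frechet_derivative (%y. frechet_derivative (?f v w) (at y) (I y)) (at 0) = frechet_derivative (%y. - I (\<G> y v w)) (at 0)"
  by (rule dd_cong_open[OF open_\<O> o]) (rule rotation_invariant_connection)
 have "frechet_derivative (dd (I 0) (?f v w)) (at 0) u = 0"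
 proof -
  have "frechet_derivative (dd (I 0) (?f v w)) (at 0) = frechet_derivative (%y. 0) (at 0)"
  by (rule dd_cong_open[OF open_\<O> o]) (simp add: I_simps linear_0[OF dd_\<G>_linear(1)])
  then show ?thesis by simp
 qed
 then show ?thesis using fun_cong[OF 3, of u] by (simp add: dd_eqI[OF 1] dd_eqI[OF 2])
 qed
 then show "dd (I u) (?f v w) 0 = - I (dd u (?f v w) 0)" .
 note z = rotation_connection_origin[OF o]
 have R: "R 0 a b c = dd a (?f b c) 0 - dd b (?f a c) 0" for a b c by (simp add: curv_def z)
 have "dd v (?f (I u) w) 0 = I (dd v (?f u w) 0)"
 proof -
 have "frechet_derivative (?f (I u) w) (at 0) = frechet_derivative (%y. I (\<G> y u w)) (at 0)"
  by (rule dd_cong_open[OF open_\<O> o]) (rule \<G>_I_left)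
 then show ?thesis
  using dd_eqI[OF bounded_linear.has_derivative[OF I_bounded_linear \<G>_has_derivative[OF o]]] by simp
 qed
 then have "R 0 u v w + I (R 0 (I u) v w) = 2 *R dd u (?f v w) 0"
 by (simp add: R anti I_simps scaleR_2)
 then show "dd u (?f v w) 0 = (1/2) *R (R 0 u v w + I (R 0 (I u) v w))" by simp
qed

text \<open>The bracket of the rotation field with \<open>\<x>\<close> is again a Killing pair, and
  comparing initial values at 0 identifies it with \<open>\<z>\<close>. Because \<open>\<x>\<close>
  is holomorphic, this identity turns into an equation for the radial derivative.\<close>

lemma rotation_bracket:
 assumes kp: "killing_pair \<x> A" "killing_pair \<z> C" and "convex \<O>" and o: "0 : \<O>"
 and hol: "!!w. A 0 (I w) = I (A 0 w)" and \<z>: "\<z> 0 = - I (\<x> 0)" "!!w. C 0 w = 0" and x: "x : \<O>"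
 shows "dd x \<x> x - \<x> x = - I (\<z> x)"
proof -
 note br = killing_pair_bracket[OF rot kp(1)]
 have h: "A y (I w) = I (A y w)" if "y : \<O>" for y w
 by (rule killing_pair_holomorphic[OF kp(1) assms(3) o hol that])
 have "A x (I x) - B x (\<x> x) = \<z> x"
 proof (rule killing_pair_unique[OF br kp(2) assms(3) o _ _ x])
 show "A 0 (I 0) - B 0 (\<x> 0) = \<z> 0"
  using \<z> by (simp add: I_simps linear_0[OF kpD(3)[OF kp(1) o]] rotation_B[OF o] rotation_connection_origin[OF o])
 show "A 0 (B 0 w) - B 0 (A 0 w) + R 0 (I 0) (\<x> 0) w = C 0 w" for w
  using \<z>(2) hol by (simp add: I_simps R_simps[OF o] rotation_B[OF o] rotation_connection_origin[OF o])
 qed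
 then have "I (dd x \<x> x - \<x> x) = \<z> x"
 using \<G>_sym[OF x, of "I x" "\<x> x"]
 by (simp add: killing_pair_dd[OF kp(1) x] rotation_B[OF x] h[OF x] I_simps \<G>_I_left[OF x])
  (simp add: algebra_simps \<G>_I[OF x, symmetric] \<G>_sym[OF x, of x])
 then have "I (I (dd x \<x> x - \<x> x)) = I (\<z> x)" by simp
 then show ?thesis by (simp only: I_I) (metis minus_minus)
qed

text \<open>The bracket with the rotation field is zero here, so the field is homogeneous of degree
  1 along rays.\<close>

lemma linear_killing_field:
 assumes kp: "killing_pair \<h> A" and "convex \<O>" and o: "0 : \<O>" and \<h>0: "\<h> 0 = 0"
 and hol: "!!w. A 0 (I w) = I (A 0 w)" and X: "X : \<O>"
 shows "\<h> X = A 0 X"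
proof -
 have z: "killing_pair (%x. 0 *R I x) (%x w. 0 *R B x w)" by (rule killing_pair_scale[OF rot])
 have eu: "dd x \<h> x = \<h> x" if "x : \<O>" for x
 using rotation_bracket[OF kp z assms(2) o hol _ _ that] \<h>0 by (simp add: I_simps)
 define f where "f t = \<h> (t *R X)" for t
 have d: "(f hvd dd X \<h> (t *R X)) (at01 t)" if "t : {0..1}" for t
 unfolding f_def by (rule smooth_on_ray_derivative[OF kpD(1)[OF kp] ray_in_convex[OF assms(2) o X that]])
 have eu1: "t *R dd X \<h> (t *R X) = real 1 *R f t" if "t : {0..1}" for t
 using eu[OF ray_in_convex[OF assms(2) o X that]]
  linear_frechet_derivative[OF smooth_diff[OF kpD(1)[OF kp] ray_in_convex[OF assms(2) o X that]]]
 by (simp add: f_def linear_scale)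
 have "f t = t ^ 1 *R f 1" if "t : {0..1}" for t
 by (rule homogeneous_of_euler[OF d eu1 _ that]) auto
 note ft = this[unfolded power_one_right]
 have "((%t. t *R f 1) hvd dd X \<h> (0 *R X)) (at01 0)"
 by (rule has_vector_derivative_transform[OF _ ft[symmetric] d]) auto
 moreover have "((%t. t *R f 1) hvd f 1) (at01 0)"
 by (auto intro!: derivative_eq_intros simp: has_vector_derivative_def)
 ultimately have "f 1 = dd X \<h> 0"
 using vector_derivative_unique_within[of 0 "{0..1::real}"] by (simp add: trivial_limit_within)
 then show ?thesis
 by (simp add: f_def killing_pair_dd[OF kp o] \<h>0 \<G>_simps[OF o])
qed

text \<open>The bracket relation is used for W and for I W together: along a ray
  \<open>f W t - I (f (I W) t)\<close> is constant and \<open>f W t + I (f (I W) t)\<close> is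
  homogeneous of degree 2. So the field is W plus a quadratic term, and the second derivative at 0
  determines that term.\<close>

lemma transvection_field:
 assumes kp: "!!W. killing_pair (\<x> W) (A W)" and "convex \<O>" and o: "0 : \<O>"
 and ini: "!!W. \<x> W 0 = W" "!!W w. A W 0 w = 0" and X: "X : \<O>"
 shows "\<x> W X = W - transvection_term 0 W X"
proof -
 have br: "dd x (\<x> W) x = \<x> W x + I (\<x> (I W) x)" if "x : \<O>" for x W
 proof -
 have "killing_pair (%x. (- 1) *R \<x> (I W) x) (%x w. (- 1) *R A (I W) x w)" by (rule killing_pair_scale[OF kp])
 from rotation_bracket[OF kp this assms(2) o _ _ _ that] have "dd x (\<x> W) x - \<x> W x = - I ((- 1) *R \<x> (I W) x)"
  by (simp add: ini I_simps)
 then show ?thesis by (simp add: I_simps algebra_simps)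
 qed
 have neg: "\<x> (- W) x = - \<x> W x" if "x : \<O>" for x W
 using killing_pair_unique(1)[OF kp[of "- W"] killing_pair_scale[OF kp[of W], of "- 1"] assms(2) o _ _ that] by (simp add: ini)
 define f where "f W t = \<x> W (t *R X)" for W t
 note ray = ray_in_convex[OF assms(2) o X]
 have d: "(f W hvd dd X (\<x> W) (t *R X)) (at01 t)" if "t : {0..1}" for t W
 unfolding f_def by (rule smooth_on_ray_derivative[OF kpD(1)[OF kp] ray[OF that]])
 have t: "t *R dd X (\<x> W) (t *R X) = f W t + I (f (I W) t)" if "t : {0..1}" for t W
 using br[OF ray[OF that], of W] linear_frechet_derivative[OF smooth_diff[OF kpD(1)[OF kp[of W]] ray[OF that]]]
 by (simp add: f_def linear_scale)
 have t2: "t *R I (dd X (\<x> (I W)) (t *R X)) = I (f (I W) t) + f W t" if "t : {0..1}" for t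
 using arg_cong[OF t[OF that, of "I W"], of I] neg[OF ray[OF that], of W] by (simp add: I_simps f_def)
 have dI: "((%t. I (f (I W) t)) hvd I (dd X (\<x> (I W)) (t *R X))) (at01 t)" if "t : {0..1}" for t
 by (rule bounded_linear.has_vector_derivative[OF I_bounded_linear d[OF that]])
 have d0: "dd X (\<x> W) 0 = 0" for W
 by (simp add: killing_pair_dd[OF kp o] ini rotation_connection_origin[OF o])
 have minus: "f W t - I (f (I W) t) = 2 *R W" if tt: "t : {0..1}" for t
 proof -
 have "((%t. f W t - I (f (I W) t)) has_derivative (%h. 0)) (at01 t)" if "t : {0..1}" for t
 proof -
  have "dd X (\<x> W) (t *R X) - I (dd X (\<x> (I W)) (t *R X)) = 0"
  proof (cases "t = 0")
  case False
  have "t *R (dd X (\<x> W) (t *R X) - I (dd X (\<x> (I W)) (t *R X))) = 0"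
   using t[OF that, of W] t2[OF that] by (simp add: scaleR_diff_right)
  then show ?thesis using False by simp
  qed (simp add: d0 I_simps)
  then show ?thesis using has_vector_derivative_diff[OF d[OF that, of W] dI[OF that]] by (simp add: has_vector_derivative_def)
 qed
 from has_derivative_zero_unique[of "{0..1}", OF _ this _ tt, of 0]
 have "f W t - I (f (I W) t) = f W 0 - I (f (I W) 0)" by auto
 then show ?thesis by (simp add: f_def ini I_simps scaleR_2)
 qed
 have plus: "f W t + I (f (I W) t) = t\<^sup>2 *R (f W 1 + I (f (I W) 1))" if "t : {0..1}" for t
 proof (rule homogeneous_of_euler[where n = 2 and e = "%t. f W t + I (f (I W) t)", OF has_vector_derivative_add[OF d dI]])
 show "s *R (dd X (\<x> W) (s *R X) + I (dd X (\<x> (I W)) (s *R X))) = real 2 *R (f W s + I (f (I W) s))" if "s : {0..1}" for s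
  using t[OF that, of W] t2[OF that] by (simp add: scaleR_add_right scaleR_2 add.commute)
 qed (use that in auto)
 define b where "b = (1/2) *R (f W 1 + I (f (I W) 1))"
 have f: "f W t = W + t\<^sup>2 *R b" if "t : {0..1}" for t
 proof -
 have "2 *R f W t = (f W t - I (f (I W) t)) + (f W t + I (f (I W) t))" by (simp add: scaleR_2)
 also have "... = 2 *R W + t\<^sup>2 *R (2 *R b)" unfolding minus[OF that] plus[OF that] by (simp add: b_def)
 finally have "2 *R f W t = 2 *R (W + t\<^sup>2 *R b)" by (simp add: scaleR_add_right)
 then show ?thesis by simp
 qed
 have d2: "dd X (\<x> W) (t *R X) = t *R (2 *R b)" if tt: "t : {0..1}" for t
 proof -
 have "((%t. W + t\<^sup>2 *R b) hvd dd X (\<x> W) (t *R X)) (at01 t)"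
  by (rule has_vector_derivative_transform[OF tt _ d[OF tt]]) (use f in auto)
 moreover have "((%t. W + t\<^sup>2 *R b) hvd t *R (2 *R b)) (at01 t)"
  by (auto intro!: derivative_eq_intros simp: has_vector_derivative_def)
 ultimately show ?thesis
  using vector_derivative_unique_within[of t "{0..1::real}"] tt by (auto simp: trivial_limit_within islimpt_Icc)
 qed
 have "((%t. dd X (\<x> W) (t *R X)) hvd dd X (dd X (\<x> W)) (0 *R X)) (at01 0)"
 by (rule smooth_on_ray_derivative[OF smooth_dd[OF kpD(1)[OF kp]]]) (use o in simp)
 then have "((%t. t *R (2 *R b)) hvd dd X (dd X (\<x> W)) 0) (at01 0)"
 by (intro has_vector_derivative_transform[of 0 "{0..1}" "%t. t *R (2 *R b)"]) (use d2 in auto)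
 moreover have "((%t. t *R (2 *R b)) hvd 2 *R b) (at01 0)"
 by (auto intro!: derivative_eq_intros simp: has_vector_derivative_def)
 ultimately have b2: "2 *R b = dd X (dd X (\<x> W)) 0"
 using vector_derivative_unique_within[of 0 "{0..1::real}"] by (simp add: trivial_limit_within)
 \<comment> \<open>The Killing system gives the second derivative: one part is curvature, the other
   is the first derivative of the connection at 0, already expressed by curvature.\<close>
 have "dd X (dd X (\<x> W)) 0 = R 0 X W X - dd X (%y. \<G> y X W) 0"
 proof -
 have 1: "frechet_derivative (dd X (\<x> W)) (at 0) = frechet_derivative (%y. A W y X - \<G> y X (\<x> W y)) (at 0)"
  by (rule dd_cong_open[OF open_\<O> o]) (rule killing_pair_dd[OF kp])
 have 2: "((%y. \<G> y X (\<x> W y)) has_derivative (%h. dd h (%y. \<G> y X (\<x> W 0)) 0 + \<G> 0 X (dd h (\<x> W) 0))) (at 0)"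
  by (rule linear_field_deriv[OF open_\<O> o, where T = "%y. \<G> y X" and T' = "%w h. dd h (%y. \<G> y X w) 0"])
  (use \<G>_linear(1) \<G>_has_derivative[OF o] smooth_deriv[OF kpD(1)[OF kp] o] in auto)
 note 3 = has_derivative_diff[OF smooth_deriv[OF kpD(2)[OF kp] o] 2]
 show ?thesis unfolding 1 dd_eqI[OF 3]
  by (simp add: killing_pair_dd_A[OF kp o] ini rotation_connection_origin[OF o])
 qed
 also have "... = - (1/2) *R (R 0 W X X - R 0 W (I X) (I X))"
 proof -
 have "R 0 X X W = 0" by (rule R_same)
 moreover have "R 0 (I X) X W = R 0 W X (I X) - R 0 W (I X) X"
  using bianchi[OF o, of "I X" X W] R_anti[of 0 X W "I X"] by (simp add: algebra_simps)
 then have "I (R 0 (I X) X W) = - R 0 W X X - R 0 W (I X) (I X)"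
  by (simp add: I_simps R_I[OF o])
 moreover have "R 0 X W X = - R 0 W X X" by (rule R_anti)
 ultimately have "R 0 X W X - (1/2) *R (R 0 X X W + I (R 0 (I X) X W)) = - R 0 W X X + (1/2) *R (R 0 W X X + R 0 W (I X) (I X))"
  by (simp add: scaleR_diff_right scaleR_add_right)
 also have "... = - (1/2) *R (R 0 W X X - R 0 W (I X) (I X))"
 proof -
  have "- a + (1/2) *R (a + c) = - (1/2) *R (a - c)" for a c :: 'e
  proof -
  have "(1/2) *R a + (1/2) *R a = a" using scaleR_half_double[of a] by (simp add: scaleR_add_right)
  then have "- a + (1/2) *R (a + c) = - ((1/2) *R a + (1/2) *R a) + (1/2) *R (a + c)" by simp
  then show ?thesis by (simp add: scaleR_add_right scaleR_diff_right)
  qed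
  then show ?thesis .
 qed
 moreover have "dd X (%y. \<G> y X W) 0 = (1/2) *R (R 0 X X W + I (R 0 (I X) X W))"
  by (rule rotation_dd_connection_origin(2)[OF o])
 ultimately show ?thesis by simp
 qed
 finally have "2 *R b = - (1/2) *R (R 0 W X X - R 0 W (I X) (I X))" using b2 by simp
 then have "(1/2) *R (2 *R b) = (1/2) *R (- (1/2) *R (R 0 W X X - R 0 W (I X) (I X)))" by simp
 then have "b = - transvection_term 0 W X" by (simp add: transvection_term_def)
 then show ?thesis using f[of 1] by (simp add: f_def)
qed

end

end

section \<open>Taylor expansion along rays and polarization\<close>

definition iter_dd :: "'a::real_normed_vector => nat => ('a => 'b::real_normed_vector) => 'a => 'b"
 where "iter_dd X n f = ((%f. dd X f) ^^ n) f"

lemma iter_dd_0 [simp]: "iter_dd X 0 f = f"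
 and iter_dd_Suc: "iter_dd X (Suc n) f = dd X (iter_dd X n f)"
 by (simp_all add: iter_dd_def)

lemma iter_dd_Suc': "iter_dd X (Suc n) f = iter_dd X n (dd X f)"
 by (induction n) (simp_all add: iter_dd_Suc)

lemma smooth_iter_dd: "smooth_on S f ==> smooth_on S (iter_dd X n f)"
 by (induction n) (auto simp: iter_dd_Suc intro: smooth_dd)

lemma iter_dd_cong:
 assumes "open S" "!!x. x : S ==> f x = g x" "x : S"
 shows "iter_dd X n f x = iter_dd X n g x"
 using assms(3)
proof (induction n arbitrary: x)
 case (Suc n)
 then show ?case
 using dd_cong_open[OF assms(1) Suc.prems, of "iter_dd X n f" "iter_dd X n g"] by (simp add: iter_dd_Suc)
qed (use assms(2) in simp)

lemma iter_dd_commute: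
 assumes "open S" "smooth_on S f" "x : S"
 shows "dd u (iter_dd X n f) x = iter_dd X n (dd u f) x"
 using assms(3)
proof (induction n arbitrary: x)
 case (Suc n)
 have "dd u (dd X (iter_dd X n f)) x = dd X (dd u (iter_dd X n f)) x"
 by (rule dd_commute[OF assms(1) smooth_iter_dd[OF assms(2)] Suc.prems])
 then show ?case
 using dd_cong_open[OF assms(1) Suc.prems, of "dd u (iter_dd X n f)" "iter_dd X n (dd u f)"] Suc.IH
 by (simp add: iter_dd_Suc)
qed simp

lemma iter_dd_bounded_linear:
 assumes "open S" "bounded_linear l" "smooth_on S f" "x : S"
 shows "iter_dd X n (%x. l (f x)) x = l (iter_dd X n f x)"
 using assms(4)
proof (induction n arbitrary: x)
 case (Suc n)
 then show ?case
 using dd_cong_open[OF assms(1) Suc.prems, of "iter_dd X n (%x. l (f x))" "%x. l (iter_dd X n f x)"]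
  dd_eqI[OF bounded_linear.has_derivative[OF assms(2) smooth_deriv[OF smooth_iter_dd[OF assms(3)] Suc.prems]]]
 by (simp add: iter_dd_Suc)
qed simp

lemma iter_dd_diff:
 assumes "open S" "smooth_on S f" "smooth_on S g" "x : S"
 shows "iter_dd X n (%x. f x - g x) x = iter_dd X n f x - iter_dd X n g x"
 using assms(4)
proof (induction n arbitrary: x)
 case (Suc n)
 then show ?case
 using dd_cong_open[OF assms(1) Suc.prems, of "iter_dd X n (%x. f x - g x)" "%x. iter_dd X n f x - iter_dd X n g x"]
  dd_eqI[OF has_derivative_diff[OF smooth_deriv[OF smooth_iter_dd[OF assms(2)] Suc.prems]
  smooth_deriv[OF smooth_iter_dd[OF assms(3)] Suc.prems]]]
 by (simp add: iter_dd_Suc)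
qed simp

lemma iter_dd_const: "n > 0 ==> iter_dd X n (%x. c) = (%x. 0)"
proof (induction n)
 case (Suc n)
 then show ?case by (cases n) (auto simp: iter_dd_Suc)
qed simp

lemma iter_dd_scale:
 assumes "open S" "smooth_on S f" "x : S"
 shows "iter_dd (c *R X) n f x = c ^ n *R iter_dd X n f x"
 using assms(3)
proof (induction n arbitrary: x)
 case (Suc n)
 have "dd (c *R X) (iter_dd (c *R X) n f) x = dd (c *R X) (%x. c ^ n *R iter_dd X n f x) x"
 using dd_cong_open[OF assms(1) Suc.prems, of "iter_dd (c *R X) n f" "%x. c ^ n *R iter_dd X n f x"] Suc.IH by simp
 also have "... = c ^ n *R (c *R dd X (iter_dd X n f) x)"
 using dd_eqI[OF has_derivative_scaleR_right[OF smooth_deriv[OF smooth_iter_dd[OF assms(2)] Suc.prems]]]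
  linear_frechet_derivative[OF smooth_diff[OF smooth_iter_dd[OF assms(2)] Suc.prems]]
 by (simp add: linear_scale)
 finally show ?case by (simp add: iter_dd_Suc mult.commute)
qed simp

text \<open>The coefficient of \<open>s ^ j\<close> in the n-th derivative in the direction
  \<open>Y + s *R u\<close>; the recursion applies one more derivative in this direction and sorts
  by powers of s.\<close>

fun polarize_coeff :: "'a::real_normed_vector => 'a => ('a => 'b::real_normed_vector) => nat => nat => 'a => 'b"
 where "polarize_coeff Y u f 0 j = (if j = 0 then f else (%x. 0))"
 | "polarize_coeff Y u f (Suc n) j = (%x. dd Y (polarize_coeff Y u f n j) x + (if j = 0 then 0 else dd u (polarize_coeff Y u f n (j - 1)) x))"

lemma smooth_polarize_coeff: "open S ==> smooth_on S f ==> smooth_on S (polarize_coeff Y u f n j)"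
proof (induction n arbitrary: j)
 case (Suc n)
 then show ?case by (cases "j = 0") (auto intro!: smooth_add smooth_dd)
qed simp

lemma polarize_coeff_vanish: "open S ==> x : S ==> n < j ==> polarize_coeff Y u f n j x = 0"
proof (induction n arbitrary: j x)
 case (Suc n)
 have "frechet_derivative (polarize_coeff Y u f n i) (at x) = frechet_derivative (%x. 0) (at x)" if "n < i" for i
 by (rule dd_cong_open[OF Suc.prems(1,2)]) (rule Suc.IH[OF Suc.prems(1) _ that])
 then show ?case using Suc.prems(3) by auto
qed simp

lemma iter_dd_polarize:
 assumes "open S" "smooth_on S f" "x : S"
 shows "iter_dd (Y + s *R u) n f x = (\<Sum>j\<le>n. s ^ j *R polarize_coeff Y u f n j x)"
 using assms(3)
proof (induction n arbitrary: x)
 case (Suc n)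
 let ?c = "polarize_coeff Y u f n"
 have d: "((%x. \<Sum>j\<le>n. s ^ j *R ?c j x) has_derivative (%h. \<Sum>j\<le>n. s ^ j *R dd h (?c j) x)) (at x)"
 using smooth_deriv[OF smooth_polarize_coeff[OF assms(1,2)] Suc.prems]
 by (intro has_derivative_sum has_derivative_scaleR_right)
 have l: "dd (Y + s *R u) (?c j) x = dd Y (?c j) x + s *R dd u (?c j) x" for j
 using linear_frechet_derivative[OF smooth_diff[OF smooth_polarize_coeff[OF assms(1,2)] Suc.prems]]
 by (simp add: linear_add linear_scale)
 have z: "dd Y (?c (Suc n)) x = 0"
 proof -
 have "frechet_derivative (?c (Suc n)) (at x) = frechet_derivative (%x. 0) (at x)"
  by (rule dd_cong_open[OF assms(1) Suc.prems]) (rule polarize_coeff_vanish[OF assms(1)], auto)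
 then show ?thesis by simp
 qed
 have "iter_dd (Y + s *R u) (Suc n) f x = (\<Sum>j\<le>n. s ^ j *R dd (Y + s *R u) (?c j) x)"
 using dd_cong_open[OF assms(1) Suc.prems, of "iter_dd (Y + s *R u) n f" "%x. \<Sum>j\<le>n. s ^ j *R ?c j x"] Suc.IH
 by (simp add: iter_dd_Suc dd_eqI[OF d])
 also have "... = (\<Sum>j\<le>n. s ^ j *R dd Y (?c j) x) + (\<Sum>j\<le>n. s ^ Suc j *R dd u (?c j) x)"
 by (simp add: l scaleR_add_right sum.distrib mult.commute)
 also have "(\<Sum>j\<le>n. s ^ j *R dd Y (?c j) x) = (\<Sum>j\<le>Suc n. s ^ j *R dd Y (?c j) x)"
 by (simp add: z)
 also have "(\<Sum>j\<le>n. s ^ Suc j *R dd u (?c j) x) = (\<Sum>j\<le>Suc n. s ^ j *R (if j = 0 then 0 else dd u (?c (j - 1)) x))"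
 by (subst sum.atMost_Suc_shift) simp
 finally show ?case by (simp add: sum.distrib[symmetric] scaleR_add_right del: sum.atMost_Suc)
qed simp

lemma polarize_coeff_0_1:
 assumes "open S" "smooth_on S f" "x : S"
 shows "polarize_coeff Y u f n 0 x = iter_dd Y n f x"
 and "polarize_coeff Y u f (Suc n) 1 x = real (Suc n) *R iter_dd Y n (dd u f) x"
proof -
 have 0: "polarize_coeff Y u f n 0 x = iter_dd Y n f x" if "x : S" for n x
 using that
 proof (induction n arbitrary: x)
 case (Suc n)
 then show ?case
  using dd_cong_open[OF assms(1) Suc.prems, of "polarize_coeff Y u f n 0" "iter_dd Y n f"]
  by (simp add: iter_dd_Suc)
 qed simp
 show "polarize_coeff Y u f n 0 x = iter_dd Y n f x" by (rule 0[OF assms(3)])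
 show "polarize_coeff Y u f (Suc n) 1 x = real (Suc n) *R iter_dd Y n (dd u f) x"
 using assms(3)
 proof (induction n arbitrary: x)
 case (Suc n)
 have 1: "dd Y (polarize_coeff Y u f (Suc n) 1) x = real (Suc n) *R dd Y (iter_dd Y n (dd u f)) x"
 proof -
  have "frechet_derivative (polarize_coeff Y u f (Suc n) 1) (at x) = frechet_derivative (%x. real (Suc n) *R iter_dd Y n (dd u f) x) (at x)"
  by (rule dd_cong_open[OF assms(1) Suc.prems]) (rule Suc.IH)
  then show ?thesis
  using dd_eqI[OF has_derivative_scaleR_right[OF smooth_deriv[OF smooth_iter_dd[OF smooth_dd[OF assms(2)]] Suc.prems]]]
  by simp
 qed
 have 2: "dd u (polarize_coeff Y u f (Suc n) 0) x = iter_dd Y (Suc n) (dd u f) x"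
 proof -
  have "frechet_derivative (polarize_coeff Y u f (Suc n) 0) (at x) = frechet_derivative (iter_dd Y (Suc n) f) (at x)"
  by (rule dd_cong_open[OF assms(1) Suc.prems]) (rule 0)
  then show ?thesis using iter_dd_commute[OF assms(1,2) Suc.prems] by simp
 qed
 have "polarize_coeff Y u f (Suc (Suc n)) 1 x = dd Y (polarize_coeff Y u f (Suc n) 1) x + dd u (polarize_coeff Y u f (Suc n) 0) x"
  by (subst polarize_coeff.simps(2)) simp
 also have "... = real (Suc (Suc n)) *R iter_dd Y (Suc n) (dd u f) x"
  unfolding 1 2 iter_dd_Suc by (simp add: scaleR_left_distrib scaleR_2)
 finally show ?case .
 next
 case 0
 have "frechet_derivative (polarize_coeff Y u f 0 0) (at x) = frechet_derivative f (at x)" by simp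
 then show ?case by simp
 qed
qed

text \<open>As a polynomial in s, the derivative in the direction \<open>Y + s *R u\<close> vanishes
  identically, hence so does its linear coefficient, which is \<open>Suc n\<close> times the mixed
  derivative.\<close>

lemma iter_dd_polarization:
 assumes "open S" "smooth_on S f" "x : S" "!!Y. iter_dd Y (Suc n) f x = 0"
 shows "iter_dd Y n (dd u f) x = 0"
proof -
 let ?c = "polarize_coeff Y u f (Suc n)"
 have "((%s. \<Sum>j\<le>Suc n. s ^ j *R ?c j x) hvd (\<Sum>j\<le>Suc n. (real j * 0 ^ (j - 1)) *R ?c j x)) (at 0)"
 by (intro has_vector_derivative_sum)
  (auto simp: has_vector_derivative_def intro!: derivative_eq_intros simp del: polarize_coeff.simps)
 moreover have "(%s. \<Sum>j\<le>Suc n. s ^ j *R ?c j x) = (%s. 0)"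
 using iter_dd_polarize[OF assms(1-3), of Y _ u "Suc n"] assms(4) by simp
 ultimately have "((%s::real. 0) hvd (\<Sum>j\<le>Suc n. (real j * 0 ^ (j - 1)) *R ?c j x)) (at 0)" by simp
 then have "(\<Sum>j\<le>Suc n. (real j * 0 ^ (j - 1)) *R ?c j x) = 0"
 by (rule vector_derivative_unique_at) simp
 moreover have "(\<Sum>j\<le>Suc n. (real j * 0 ^ (j - 1)) *R ?c j x) = (\<Sum>j\<in>{1}. (real j * 0 ^ (j - 1)) *R ?c j x)"
 by (rule sum.mono_neutral_right) (auto simp: not_le simp del: polarize_coeff.simps)
 ultimately have "?c 1 x = 0" by (simp del: polarize_coeff.simps)
 then show ?thesis using polarize_coeff_0_1(2)[OF assms(1-3), of Y u n] by simp
qed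

text \<open>\<open>g i\<close> stands for the i-th derivative along a ray. Stating this for an
  abstract chain lets the induction pass to the shifted chain.\<close>

lemma taylor_remainder_chain:
 fixes g :: "nat => real => 'b::real_normed_vector"
 assumes "!!i t. i <= m ==> t : {0..1} ==> (g i hvd g (Suc i) t) (at01 t)"
 and "!!i. i < m ==> g i 0 = 0" and C: "C >= 0" "!!t. t : {0..1} ==> norm (g (Suc m) t) <= C" and t: "t : {0..1}"
 shows "norm (g 0 t - (t ^ m / fact m) *R g m 0) <= C * t ^ Suc m"
 using assms(1,2) C(2) t
proof (induction m arbitrary: g t)
 case 0
 have "norm (g 0 t - g 0 0) <= C * t - C * 0"
 by (rule hvd_majorant[OF 0(4) 0(1)[OF order_refl]])
  (use 0(3) in \<open>auto intro!: derivative_eq_intros simp: has_vector_derivative_def\<close>)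
 then show ?case by simp
next
 case (Suc m)
 have IH: "norm (g 1 s - (s ^ m / fact m) *R g (Suc m) 0) <= C * s ^ Suc m" if "s : {0..1}" for s
 using Suc.IH[of "%i. g (Suc i)" s] Suc.prems that by auto
 let ?f = "%t. g 0 t - (t ^ Suc m / fact (Suc m)) *R g (Suc m) 0"
 have "norm (?f t - ?f 0) <= (C * t ^ Suc (Suc m)) - (C * 0 ^ Suc (Suc m))"
 proof (rule hvd_majorant[OF Suc.prems(4)])
 fix s :: real assume s: "s : {0..1}"
 have p: "((%t. t ^ Suc m / fact (Suc m)) has_real_derivative s ^ m / fact m) (at01 s)"
  using exp_term_has_real_derivative[of 1 1 m s] by simp
 have "((%t. (t ^ Suc m / fact (Suc m)) *R g (Suc m) 0) hvd (s ^ m / fact m) *R g (Suc m) 0) (at01 s)"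
  using has_vector_derivative_scaleR[OF p has_vector_derivative_const[of "g (Suc m) 0"]] by simp
 then show "(?f hvd (g 1 s - (s ^ m / fact m) *R g (Suc m) 0)) (at01 s)"
  using Suc.prems(1)[of 0 s] s by (intro has_vector_derivative_diff) auto
 have "((%t. C * t ^ Suc (Suc m)) has_real_derivative C * ((1 + real (Suc m)) * (1 * s ^ Suc m))) (at01 s)"
  by (intro DERIV_cmult DERIV_power_Suc DERIV_ident)
 then show "((%t. C * t ^ Suc (Suc m)) hvd C * ((1 + real (Suc m)) * (1 * s ^ Suc m))) (at01 s)"
  by (simp only: has_real_derivative_iff_has_vector_derivative)
 have "C * s ^ Suc m <= C * ((1 + real (Suc m)) * (1 * s ^ Suc m))"
  using C(1) s by (intro mult_left_mono) (auto simp: mult_le_cancel_right1 simp del: power_Suc)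
 then show "norm (g 1 s - (s ^ m / fact m) *R g (Suc m) 0) <= C * ((1 + real (Suc m)) * (1 * s ^ Suc m))"
  using IH[OF s] by linarith
 qed
 then show ?case using Suc.prems(2)[of 0] by simp
qed

lemma ray_taylor:
 fixes f :: "'a::euclidean_space => 'b::real_normed_vector"
 assumes "open S" "smooth_on S f" and ray: "!!t. t : {0..1} ==> t *R X : S"
 and "!!i. i < m ==> iter_dd X i f 0 = 0"
 shows "EX C>=0. ALL t:{0..1}. norm (f (t *R X) - (t ^ m / fact m) *R iter_dd X m f 0) <= C * t ^ Suc m"
proof -
 define g where "g i t = iter_dd X i f (t *R X)" for i t
 have d: "(g i hvd g (Suc i) t) (at01 t)" if "t : {0..1}" for i t
 unfolding g_def iter_dd_Suc
 using smooth_line[OF smooth_iter_dd[OF assms(2)], of 0 t X] ray[OF that] by simp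
 have "continuous_on {0..1} (g (Suc m))" using d by (rule continuous_on_vector_derivative)
 from compact_norm_bound[OF compact_Icc this]
 obtain C where C: "C >= 0" "!!t. t : {0..1} ==> norm (g (Suc m) t) <= C" by blast
 have "norm (g 0 t - (t ^ m / fact m) *R g m 0) <= C * t ^ Suc m" if "t : {0..1}" for t
 by (rule taylor_remainder_chain[OF d _ C that]) (use assms(4) in \<open>auto simp: g_def\<close>)
 then show ?thesis using C(1) by (auto simp: g_def)
qed

lemma iter_dd_polynomial_ray:
 fixes f :: "'a::real_normed_vector => 'b::real_normed_vector"
 assumes "open S" "0 : S" "smooth_on S f" "e > 0" "!!t. \<bar>t\<bar> < e ==> f (t *R Y) = (\<Sum>d\<le>N. t ^ d *R c d)"
 shows "iter_dd Y n f 0 = (if n <= N then fact n *R c n else 0)"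
 using assms(3-5)
proof (induction n arbitrary: f c N e)
 case 0
 have "f 0 = (\<Sum>d\<le>N. 0 ^ d *R c d)" using 0(3)[of 0] 0(2) by simp
 also have "... = (\<Sum>d\<in>{0}. 0 ^ d *R c d)" by (rule sum.mono_neutral_right) auto
 finally show ?case by simp
next
 case (Suc n)
 obtain e' where e': "e' > 0" "ball 0 e' \<subseteq> S" using assms(1,2) openE by blast
 define e1 where "e1 = min e (e' / (norm Y + 1))"
 have e1: "e1 > 0" using Suc.prems(2) e'(1) by (simp add: e1_def add_nonneg_pos)
 have inS: "t *R Y : S" if "\<bar>t\<bar> < e1" for t
 proof -
 have "\<bar>t\<bar> * (norm Y + 1) < e'" using that by (simp add: e1_def pos_less_divide_eq add_nonneg_pos)
 then have "\<bar>t\<bar> * norm Y < e'" by (simp add: distrib_left)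
 then show ?thesis using e'(2) by (auto simp: subset_iff)
 qed
 \<comment> \<open>The derivative has degree \<open>N - 1\<close>. For N = 0 truncated subtraction
   still leaves one summand, which the conditional sets to 0.\<close>
 have "dd Y f (t *R Y) = (\<Sum>d\<le>N - 1. t ^ d *R (if N = 0 then 0 else real (Suc d) *R c (Suc d)))" if t: "\<bar>t\<bar> < e1" for t
 proof -
 have 1: "((%t. f (t *R Y)) hvd dd Y f (t *R Y)) (at t)"
  using smooth_line[OF Suc.prems(1), of 0 t Y UNIV] inS[OF t] by simp
 have 2: "((%t. \<Sum>d\<le>N. t ^ d *R c d) hvd (\<Sum>d\<le>N. (real d * t ^ (d - 1)) *R c d)) (at t)"
  by (intro has_vector_derivative_sum) (auto simp: has_vector_derivative_def intro!: derivative_eq_intros)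
 have "((%t. f (t *R Y)) hvd (\<Sum>d\<le>N. (real d * t ^ (d - 1)) *R c d)) (at t)"
  by (rule has_vector_derivative_transform_within_open[OF 2, of "ball 0 e1"])
  (use t Suc.prems(3) in \<open>auto simp: e1_def\<close>)
 then have "dd Y f (t *R Y) = (\<Sum>d\<le>N. (real d * t ^ (d - 1)) *R c d)"
  using 1 vector_derivative_unique_at by blast
 also have "... = (\<Sum>d\<le>N - 1. t ^ d *R (if N = 0 then 0 else real (Suc d) *R c (Suc d)))"
 proof (cases N)
  case (Suc M)
  have "(\<Sum>d\<le>Suc M. (real d * t ^ (d - 1)) *R c d) = (\<Sum>d\<le>M. (real (Suc d) * t ^ d) *R c (Suc d))"
  by (subst sum.atMost_Suc_shift) simp
  then show ?thesis by (simp add: Suc mult.commute)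
 qed simp
 finally show ?thesis .
 qed
 from Suc.IH[OF smooth_dd[OF Suc.prems(1)] e1 this]
 show ?case by (auto simp: iter_dd_Suc' Suc_le_eq)
qed

text \<open>The iterated one-variable derivatives have to be identified on a whole interval around 0
  for the induction to go through.\<close>

lemma taylor_component_iter_dd:
 fixes f :: "'a::real_normed_vector => real"
 assumes "open S" "0 : S" "smooth_on S f"
 shows "taylor_component f n X = iter_dd X n f 0 / fact n"
proof -
 obtain e' where e': "e' > 0" "ball 0 e' \<subseteq> S" using assms(1,2) openE by blast
 define e where "e = e' / (norm X + 1)"
 have e: "e > 0" using e'(1) by (simp add: e_def add_nonneg_pos)
 have inS: "t *R X : S" if "\<bar>t\<bar> < e" for t
 proof -
 have "\<bar>t\<bar> * (norm X + 1) < e'" using that by (simp add: e_def pos_less_divide_eq add_nonneg_pos)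
 then have "\<bar>t\<bar> * norm X < e'" by (simp add: distrib_left)
 then show ?thesis using e'(2) by (auto simp: subset_iff)
 qed
 have "(deriv ^^ n) (%t. f (t *R X)) t = iter_dd X n f (t *R X)" if "\<bar>t\<bar> < e" for t
 using that
 proof (induction n arbitrary: t)
 case (Suc n)
 have "((%t. iter_dd X n f (t *R X)) hvd dd X (iter_dd X n f) (t *R X)) (at t)"
  using smooth_line[OF smooth_iter_dd[OF assms(3)], of 0 t X X n UNIV] inS[OF Suc.prems] by simp
 then have "((deriv ^^ n) (%t. f (t *R X)) hvd dd X (iter_dd X n f) (t *R X)) (at t)"
  by (rule has_vector_derivative_transform_within_open[of _ _ _ "ball 0 e"]) (use Suc in auto)
 then show ?case
  by (simp add: iter_dd_Suc has_real_derivative_iff_has_vector_derivative[symmetric] DERIV_imp_deriv)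
 qed simp
 from this[of 0] show ?thesis using e by (simp add: taylor_component_def)
qed

lemma dd_sum:
 assumes "!!i. i : A ==> smooth_on S (f i)" "x : S"
 shows "dd u (%x. \<Sum>i\<in>A. f i x) x = (\<Sum>i\<in>A. dd u (f i) x)"
 by (rule dd_eqI[OF has_derivative_sum]) (rule smooth_deriv[OF assms(1) assms(2)])

lemma dd_bounded_linear:
 "bounded_linear l ==> smooth_on S f ==> x : S ==> dd u (%x. l (f x)) x = l (dd u f x)"
 by (rule dd_eqI[OF bounded_linear.has_derivative[OF _ smooth_deriv]])

lemma dd_cong: "open S ==> x : S ==> (!!y. y : S ==> f y = g y) ==> dd u f x = dd u g x"
 using dd_cong_open by metis

lemma dd_linear: "smooth_on S f ==> x : S ==> linear (%u. dd u f x)"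
 using linear_frechet_derivative[OF smooth_diff] .

text \<open>Orthogonality of characters; averaging over roots of unity replaces integration over a
  circle.\<close>

lemma sum_cis_roots:
 assumes "N > 0" "\<not> int N dvd n"
 shows "(\<Sum>j<N. cis (of_int n * (2 * pi * real j / real N))) = 0"
proof -
 define z where "z = cis (of_int n * (2 * pi / real N))"
 have p: "cis (of_int n * (2 * pi * real j / real N)) = z ^ j" for j
 by (simp add: z_def Complex.DeMoivre mult_ac)
 have "z ^ N = cis (2 * pi * of_int n)"
 using assms(1) by (simp add: z_def Complex.DeMoivre mult_ac)
 then have zN: "z ^ N = 1" by (simp add: cis_multiple_2pi)
 have "z ~= 1"
 proof
 assume "z = 1"
 then have "cos (of_int n * (2 * pi / real N)) = 1" by (simp add: z_def complex_eq_iff)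
 then obtain k :: int where "of_int n * (2 * pi / real N) = of_int k * (2 * pi)"
  using cos_one_2pi_int by (metis mult.assoc mult.commute)
 then have "real_of_int n = of_int k * real N" using assms(1) by (simp add: field_simps)
 then have "n = k * int N" by (metis of_int_eq_iff of_int_mult of_int_of_nat_eq)
 then show False using assms(2) by simp
 qed
 then have "(\<Sum>j<N. z ^ j) = 0" using zN geometric_sum[of z N] by simp
 then show ?thesis using p by simp
qed

text \<open>For a complex structure this is the complex Hessian: the composite of (dd u - i dd (I
  u)) / 2 and (dd v + i dd (I v)) / 2, linear in u and antilinear in v. The second bracket is the
  first one with I u in place of u, whence \<open>I (I u)\<close>.\<close>

definition levi_op :: "('e => 'e) => 'e::real_normed_vector => 'e => ('e => complex) => 'e => complex"
 where "levi_op I u v f x = (dd u (dd v f) x + dd (I u) (dd (I v) f) x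
 - \<i> * (dd (I u) (dd v f) x + dd (I (I u)) (dd (I v) f) x)) / 4"

lemma smooth_levi_op:
 assumes "open S" "smooth_on S f"
 shows "smooth_on S (levi_op I u v f)"
proof -
 note s = smooth_dd[OF smooth_dd[OF assms(2)]]
 have "smooth_on S (%x. (1 / 4) *R ((dd u (dd v f) x + dd (I u) (dd (I v) f) x)
  - \<i> * (dd (I u) (dd v f) x + dd (I (I u)) (dd (I v) f) x)))"
 by (intro smooth_scaleR smooth_diff_fun smooth_add smooth_bl[OF assms(1) bounded_linear_mult_right] s assms(1) smooth_const)
 then show ?thesis by (simp add: levi_op_def[abs_def] scaleR_conv_of_real)
qed

lemma levi_op_diff:
 assumes "open S" "smooth_on S f" "smooth_on S g" "x : S"
 shows "levi_op I u v (%x. f x - g x) x = levi_op I u v f x - levi_op I u v g x"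
proof -
 have "dd u (dd v (%x. f x - g x)) x = dd u (dd v f) x - dd u (dd v g) x" for u v
 proof -
 have "dd u (dd v (%x. f x - g x)) x = dd u (%x. dd v f x - dd v g x) x"
  by (rule dd_cong[OF assms(1,4)])
  (rule dd_eqI[OF has_derivative_diff[OF smooth_deriv[OF assms(2)] smooth_deriv[OF assms(3)]]])
 also have "... = dd u (dd v f) x - dd u (dd v g) x"
  by (rule dd_eqI[OF has_derivative_diff[OF smooth_deriv[OF smooth_dd[OF assms(2)] assms(4)]
   smooth_deriv[OF smooth_dd[OF assms(3)] assms(4)]]])
 finally show ?thesis .
 qed
 then show ?thesis by (simp only: levi_op_def) (simp add: field_simps)
qed

lemma levi_op_sum:
 assumes "open S" "finite A" "!!i. i : A ==> smooth_on S (f i)" "x : S"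
 shows "levi_op I u v (%x. \<Sum>i\<in>A. f i x) x = (\<Sum>i\<in>A. levi_op I u v (f i) x)"
proof -
 have "dd u (dd v (%x. \<Sum>i\<in>A. f i x)) x = (\<Sum>i\<in>A. dd u (dd v (f i)) x)" for u v
 proof -
 have "dd u (dd v (%x. \<Sum>i\<in>A. f i x)) x = dd u (%x. \<Sum>i\<in>A. dd v (f i) x) x"
  by (rule dd_cong[OF assms(1,4)]) (rule dd_sum[OF assms(3)])
 also have "... = (\<Sum>i\<in>A. dd u (dd v (f i)) x)" by (rule dd_sum[OF smooth_dd[OF assms(3)] assms(4)])
 finally show ?thesis .
 qed
 then show ?thesis
 by (simp add: levi_op_def sum_divide_distrib[symmetric] sum.distrib sum_subtractf sum_distrib_left ring_distribs)
qed

lemma dd_levi_op: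
 assumes "smooth_on S f" "x : S"
 shows "dd h (levi_op I u v f) x = (dd h (dd u (dd v f)) x + dd h (dd (I u) (dd (I v) f)) x
 - \<i> * (dd h (dd (I u) (dd v f)) x + dd h (dd (I (I u)) (dd (I v) f)) x)) / 4"
proof -
 have d: "(dd a (dd b f) has_derivative frechet_derivative (dd a (dd b f)) (at x)) (at x)" for a b
 by (rule smooth_deriv[OF smooth_dd[OF smooth_dd[OF assms(1)]] assms(2)])
 show ?thesis
 unfolding levi_op_def[abs_def]
 by (rule dd_eqI) (intro bounded_linear.has_derivative[OF bounded_linear_divide] has_derivative_diff has_derivative_add has_derivative_mult_right d)
qed

text \<open>A bihomogeneous component of degree \<open>(k, l)\<close>; differentiating it twice in a (1,1)-direction gives degree \<open>(k - 1, l - 1)\<close>.\<close>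

locale bihomogeneous =
 fixes I :: "'e::euclidean_space => 'e" and k l :: nat and \<h> :: "'e => complex"
 assumes lin: "linear I" and II: "!!u. I (I u) = - u" and smooth: "smooth_on UNIV \<h>"
 and hom: "!!t X. \<h> (t *R X) = of_real t ^ (k + l) * \<h> X"
 and rot: "!!X. ((%t. \<h> (X + t *R I X)) hvd \<i> * (of_nat k - of_nat l) * \<h> X) (at 0)"
begin

lemma bl: "bounded_linear I" using lin linear_conv_bounded_linear by blast

lemma dd_rotation: "dd (I x) \<h> x = \<i> * (of_nat k - of_nat l) * \<h> x"
proof -
 have "((%t. \<h> (x + t *R I x)) hvd dd (I x) \<h> (x + 0 *R I x)) (at 0)"
 by (rule smooth_line[OF smooth]) simp
 then show ?thesis using rot[of x] vector_derivative_unique_at by force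
qed

text \<open>The relation \<open>c\<close> is differentiated in the direction u; the linear field I x
  contributes the commutator term \<open>dd (I u) f x\<close>.\<close>

lemma dd_dd_rotation:
 fixes f g :: "'e => complex"
 assumes f: "smooth_on UNIV f" and c: "!!x. dd (I x) f x = g x" and g: "smooth_on UNIV g"
 shows "dd (I x) (dd u f) x = dd u g x - dd (I u) f x"
proof -
 have 1: "((%y. frechet_derivative f (at y) (I y)) has_derivative (%h. dd h (dd (I x) f) x + frechet_derivative f (at x) (I h))) (at x)"
 by (rule linear_field_deriv[OF open_UNIV UNIV_I, where T = "%y. frechet_derivative f (at y)" and T' = "%c h. dd h (dd c f) x"])
  (use dd_linear[OF f] smooth_deriv[OF smooth_dd[OF f]] bounded_linear_imp_has_derivative[OF bl] in auto)
 have "dd u (%y. frechet_derivative f (at y) (I y)) x = dd u g x" using c by simp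
 then have "dd u (dd (I x) f) x + dd (I u) f x = dd u g x" by (simp add: dd_eqI[OF 1])
 then show ?thesis using dd_commute[OF open_UNIV f, of x "I x" u] by (simp add: algebra_simps)
qed

text \<open>The operator lowers both degrees by one, so the weight k - l is kept: the commutator
  terms of the pair (u, v) cancel against those of (I u, I v).\<close>

lemma levi_rotation: "dd (I x) (levi_op I u v \<h>) x = \<i> * (of_nat k - of_nat l) * levi_op I u v \<h> x"
proof -
 let ?c = "\<i> * (of_nat k - of_nat l)"
 have sm: "smooth_on UNIV (%x. ?c * f x)" if "smooth_on UNIV f" for f :: "'e => complex"
 by (rule smooth_bl[OF open_UNIV bounded_linear_mult_right that])
 have dc: "dd u (%x. ?c * f x) x = ?c * dd u f x" if "smooth_on UNIV f" for f :: "'e => complex" and u x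
 by (rule dd_bounded_linear[OF bounded_linear_mult_right that UNIV_I])
 have 1: "dd (I x) (dd v \<h>) x = ?c * dd v \<h> x - dd (I v) \<h> x" for x v
 using dd_dd_rotation[OF smooth dd_rotation sm[OF smooth], of v x] by (simp add: dc smooth)
 have 2: "dd (I x) (dd u (dd v \<h>)) x = ?c * dd u (dd v \<h>) x - dd u (dd (I v) \<h>) x - dd (I u) (dd v \<h>) x" for u v
 proof -
 have s: "smooth_on UNIV (%x. ?c * dd v \<h> x - dd (I v) \<h> x)"
  by (intro smooth_diff_fun open_UNIV sm smooth_dd smooth)
 have "dd u (%x. ?c * dd v \<h> x - dd (I v) \<h> x) x = ?c * dd u (dd v \<h>) x - dd u (dd (I v) \<h>) x"
  using dd_eqI[OF has_derivative_diff[OF smooth_deriv[OF sm[OF smooth_dd[OF smooth]] UNIV_I]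
   smooth_deriv[OF smooth_dd[OF smooth] UNIV_I]]]
  by (simp add: dc smooth_dd[OF smooth])
 then show ?thesis using dd_dd_rotation[OF smooth_dd[OF smooth] 1 s, of u x] by simp
 qed
 have neg: "dd (- a) f x = - dd a f x" if "smooth_on UNIV f" for f :: "'e => complex" and a x
 by (rule linear_neg[OF dd_linear[OF that UNIV_I]])
 have neg2: "dd b (dd (- a) f) x = - dd b (dd a f) x" if "smooth_on UNIV f" for f :: "'e => complex" and a b x
 using dd_commute[OF open_UNIV that UNIV_I, of "- a" x b] dd_commute[OF open_UNIV that UNIV_I, of a x b] neg[OF smooth_dd[OF that]] by simp
 show ?thesis
 apply (simp only: dd_levi_op[OF smooth UNIV_I])
 apply (simp only: 2 levi_op_def)
 apply (simp only: II linear_neg[OF lin] neg[OF smooth_dd[OF smooth]] neg2[OF smooth])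
 apply (simp add: field_simps)
 done
qed

lemma levi_homogeneous:
 assumes "t > 0"
 shows "of_real (t\<^sup>2) * levi_op I u v \<h> (t *R x) = of_real t ^ (k + l) * levi_op I u v \<h> x"
proof -
 have sc: "((%x. f (t *R x)) has_derivative (%h. dd (t *R h) f (t *R x))) (at x)" if "smooth_on UNIV f" for f :: "'e => complex" and x
 by (rule has_derivative_compose[OF has_derivative_scaleR_right[OF has_derivative_ident] smooth_deriv[OF that UNIV_I]])
 have mu: "dd h (%x. of_real t ^ (k + l) * f x) x = of_real t ^ (k + l) * dd h f x" if "smooth_on UNIV f" for f :: "'e => complex" and h x
 by (rule dd_bounded_linear[OF bounded_linear_mult_right that UNIV_I])
 have ts: "dd (t *R h) f x = of_real t * dd h f x" if "smooth_on UNIV f" for f :: "'e => complex" and h x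
 using linear_scale[OF dd_linear[OF that UNIV_I]] by (simp add: scaleR_conv_of_real)
 have 1: "of_real t * dd h \<h> (t *R x) = of_real t ^ (k + l) * dd h \<h> x" for h x
 using dd_eqI[OF sc[OF smooth, of x], of h] mu[OF smooth, of x h] by (simp add: hom ts smooth)
 have 2: "of_real (t\<^sup>2) * dd u (dd v \<h>) (t *R x) = of_real t ^ (k + l) * dd u (dd v \<h>) x" for u v
 proof -
 have s: "smooth_on UNIV (%x. of_real t * dd v \<h> x)"
  by (rule smooth_bl[OF open_UNIV bounded_linear_mult_right smooth_dd[OF smooth]])
 have "dd u (%x. of_real t * dd v \<h> (t *R x)) x = of_real t * (of_real t * dd u (dd v \<h>) (t *R x))"
  using dd_eqI[OF sc[OF s, of x], of u] dd_bounded_linear[OF bounded_linear_mult_right smooth_dd[OF smooth] UNIV_I, of "of_real t" v "t *R x" "t *R u"]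
  by (simp add: ts smooth smooth_dd)
 then show ?thesis unfolding 1 by (simp add: mu smooth smooth_dd power2_eq_square)
 qed
 show ?thesis
 proof -
 have e: "s * ((a + b - \<i> * (c + d)) / 4) = (s * a + s * b - \<i> * (s * c + s * d)) / 4" for s a b c d :: complex
  by (simp add: field_simps)
 show ?thesis unfolding levi_op_def e 2 ..
 qed
qed

text \<open>The circle is an orbit \<open>p\<close> of the rotation flow, and along it
  \<open>levi_rotation\<close> is the differential equation of an exponential.\<close>

lemma levi_circle: "levi_op I u v \<h> (cos \<t> *R X + sin \<t> *R I X) = cis ((real k - real l) * \<t>) * levi_op I u v \<h> X"
proof -
 define p where "p \<t> = cos \<t> *R X + sin \<t> *R I X" for \<t> :: real
 define c where "c = real k - real l"
 let ?H = "levi_op I u v \<h>"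
 have Ip: "I (p \<t>) = - sin \<t> *R X + cos \<t> *R I X" for \<t>
 by (simp add: p_def linear_add[OF lin] linear_scale[OF lin] II)
 have dp: "(p has_derivative (%h. h *R I (p \<t>))) (at \<t>)" for \<t>
 unfolding p_def[abs_def] Ip[unfolded p_def]
 by (auto intro!: derivative_eq_intros simp: algebra_simps)
 have "((%\<t>. cis (- c * \<t>) * ?H (p \<t>)) has_derivative (%h. 0)) (at \<t>)" for \<t>
 proof -
 have l: "linear (%h. dd h ?H (p \<t>))" by (rule dd_linear[OF smooth_levi_op[OF open_UNIV smooth] UNIV_I])
 have 1: "((%\<t>. ?H (p \<t>)) hvd dd (I (p \<t>)) ?H (p \<t>)) (at \<t>)"
  using has_derivative_compose[OF dp[of \<t>] smooth_deriv[OF smooth_levi_op[OF open_UNIV smooth, of I u v] UNIV_I]]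
  unfolding has_vector_derivative_def linear_scale[OF l] .
 have 2: "((%\<t>. cis (- c * \<t>)) hvd - c *R (\<i> * cis (- c * \<t>))) (at \<t>)"
  unfolding has_vector_derivative_def
  by (auto intro!: derivative_eq_intros simp: scaleR_conv_of_real)
 have "((%\<t>. cis (- c * \<t>) * ?H (p \<t>)) hvd
  (cis (- c * \<t>) * dd (I (p \<t>)) ?H (p \<t>) + (- c *R (\<i> * cis (- c * \<t>))) * ?H (p \<t>))) (at \<t>)"
  by (rule has_vector_derivative_mult[OF 2 1])
 moreover have "cis (- c * \<t>) * dd (I (p \<t>)) ?H (p \<t>) + (- c *R (\<i> * cis (- c * \<t>))) * ?H (p \<t>) = 0"
  by (simp add: levi_rotation c_def scaleR_conv_of_real algebra_simps)
 ultimately show ?thesis by (simp add: has_vector_derivative_def)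
 qed
 then have "cis (- c * \<t>) * ?H (p \<t>) = cis (- c * 0) * ?H (p 0)"
 using has_derivative_zero_unique[of UNIV "%\<t>. cis (- c * \<t>) * ?H (p \<t>)" \<t> 0] by auto
 then have "cis (c * \<t>) * (cis (- c * \<t>) * ?H (p \<t>)) = cis (c * \<t>) * ?H X" by (simp add: p_def)
 then show ?thesis by (simp add: mult.assoc[symmetric] cis_mult p_def flip: c_def)
qed

end


section \<open>Kaehler normal coordinates: the rotation field is Killing\<close>

lemma power_div_fact_le: "0 <= t ==> t ^ m / fact m <= t ^ m" for t :: real
 using mult_left_mono[OF fact_ge_1[of m, where 'a = real], of "t ^ m"] by (simp add: pos_divide_le_eq)

lemma ray_taylor_bound:
 fixes f :: "'a::euclidean_space => 'b::real_normed_vector"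
 assumes "open S" "smooth_on S f" "!!t. t : {0..1} ==> t *R X : S" "!!i. i < m ==> iter_dd X i f 0 = 0"
 shows "EX C>=0. ALL t:{0..1}. norm (f (t *R X)) <= C * t ^ m"
proof -
 let ?d = "iter_dd X m f 0"
 obtain C where C: "C >= 0" "!!t. t : {0..1} ==> norm (f (t *R X) - (t ^ m / fact m) *R ?d) <= C * t ^ Suc m"
 using ray_taylor[OF assms, of m] by blast
 have "norm (f (t *R X)) <= (C + norm ?d) * t ^ m" if t: "t : {0..1}" for t
 proof -
 let ?a = "(t ^ m / fact m) *R ?d"
 have "norm (f (t *R X)) <= norm (f (t *R X) - ?a) + norm ?a"
  using norm_triangle_ineq[of "f (t *R X) - ?a" ?a] by simp
 moreover have "norm (f (t *R X) - ?a) <= C * t ^ m"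
  using C(2)[OF t] mult_left_mono[OF power_decreasing[of m "Suc m" t] C(1)] t by auto
 moreover have "norm ?a <= t ^ m * norm ?d"
  using mult_right_mono[OF power_div_fact_le[of t m] norm_ge_zero[of ?d]] t by simp
 ultimately show ?thesis by (simp add: algebra_simps)
 qed
 then show ?thesis using C(1) by (intro exI[of _ "C + norm ?d"]) auto
qed

text \<open>For c = i or c = - i the function is holomorphic or antiholomorphic, so its Taylor
  coefficients pick up a power when X is multiplied by a complex number.\<close>

lemma iter_dd_circle:
 fixes f :: "'e::real_normed_vector => complex"
 assumes "open S" "smooth_on S f" and c: "!!x w. x : S ==> dd (I w) f x = c * dd w f x" and x: "x : S"
 shows "iter_dd (a *R X + b *R I X) n f x = (of_real a + c * of_real b) ^ n * iter_dd X n f x"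
 using x
proof (induction n arbitrary: x)
 case (Suc n)
 let ?s = "(of_real a + c * of_real b) ^ n"
 note sm = smooth_iter_dd[OF assms(2)]
 have 1: "iter_dd X n (dd (I X) f) x = c * dd X (iter_dd X n f) x"
 proof -
 have "iter_dd X n (dd (I X) f) x = iter_dd X n (%x. c * dd X f x) x"
  by (rule iter_dd_cong[OF assms(1) _ Suc.prems]) (rule c)
 also have "... = c * iter_dd X n (dd X f) x"
  by (rule iter_dd_bounded_linear[OF assms(1) bounded_linear_mult_right smooth_dd[OF assms(2)] Suc.prems])
 finally show ?thesis using iter_dd_commute[OF assms(1,2) Suc.prems, of X n X] by simp
 qed
 let ?Y = "a *R X + b *R I X"
 have "iter_dd ?Y (Suc n) f x = dd ?Y (%x. ?s * iter_dd X n f x) x"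
 unfolding iter_dd_Suc by (rule dd_cong[OF assms(1) Suc.prems]) (rule Suc.IH)
 also have "... = ?s * dd ?Y (iter_dd X n f) x"
 by (rule dd_bounded_linear[OF bounded_linear_mult_right sm Suc.prems])
 also have "dd ?Y (iter_dd X n f) x = a *R dd X (iter_dd X n f) x + b *R dd (I X) (iter_dd X n f) x"
 using dd_linear[OF sm Suc.prems] by (simp add: linear_add linear_scale)
 also have "dd (I X) (iter_dd X n f) x = c * dd X (iter_dd X n f) x"
 using iter_dd_commute[OF assms(1,2) Suc.prems] 1 by simp
 finally show ?case by (simp add: iter_dd_Suc algebra_simps scaleR_conv_of_real)
qed simp

context local_symmetric
begin

abbreviation herm :: "'e => 'e => 'e => complex"
 where "herm u v x \<equiv> of_real (G x u v) - \<i> * of_real (G x (I u) v)"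

lemma smooth_herm: "smooth_on \<O> (herm u v)"
 by (intro smooth_diff_fun open_\<O> smooth_bl[OF open_\<O> bounded_linear_of_real] G_smooth
  smooth_bl[OF open_\<O> bounded_linear_mult_right])

lemma herm_linear: "x : \<O> ==> linear (%u. herm u v x)" "x : \<O> ==> linear (%v. herm u v x)"
 by (rule linearI; simp add: G_simps I_simps scaleR_conv_of_real algebra_simps)+

lemma herm_bilinear: "x : \<O> ==> bilinear (%u v. herm u v x)"
 using herm_linear by (simp add: bilinear_def)

lemma herm_I: "x : \<O> ==> herm (I u) v x = \<i> * herm u v x" "x : \<O> ==> herm u (I v) x = - \<i> * herm u v x"
 using G_I_left[of x "I u" v] G_I_left[of x u v] G_I[of x u v] by (auto simp: G_simps I_simps algebra_simps)

lemma herm_eqI: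
 assumes "x : \<O>" "!!v. herm a v x = herm b v x"
 shows "a = b"
proof (rule G_eqI[OF assms(1)])
 fix v show "G x a v = G x b v" using arg_cong[OF assms(2)[of v], of Re] by simp
qed

text \<open>The derivative of \<open>E\<close> commutes with \<open>I\<close>, so the Killing
  equation for u and for I u combine to one for the hermitean metric.\<close>

lemma killing_pair_herm:
 assumes kp: "killing_pair E B" and hol: "!!x w. x : \<O> ==> B x (I w) = I (B x w)"
 and skew: "!!x v w. x : \<O> ==> G x (B x v) w + G x v (B x w) = 0" and x: "x : \<O>"
 shows "dd (E x) (herm u v) x + herm (dd u E x) v x + herm u (dd v E x) x = 0"
proof -
 have 1: "dd (E x) (%y. G y u v) x + G x (dd u E x) v + G x u (dd v E x) = 0" for u v
 using compat[OF x, of u v "E x"] skew[OF x, of u v]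
 by (simp add: killing_pair_dd[OF kp x] G_simps x \<G>_sym[OF x, of "E x"])
 have 2: "dd a (herm u v) x = of_real (dd a (%y. G y u v) x) - \<i> * of_real (dd a (%y. G y (I u) v) x)" for a
 proof -
 note d = smooth_deriv[OF G_smooth x]
 show ?thesis
  by (rule dd_eqI[OF has_derivative_diff[OF has_derivative_of_real[OF d] has_derivative_mult_right[OF has_derivative_of_real[OF d]]]])
 qed
 have "of_real (dd (E x) (%y. G y u v) x + G x (dd u E x) v + G x u (dd v E x))
 - \<i> * of_real (dd (E x) (%y. G y (I u) v) x + G x (dd (I u) E x) v + G x (I u) (dd v E x)) = (0::complex)"
 by (simp only: 1[of u v] 1[of "I u" v]) simp
 moreover have "dd (I u) E x = I (dd u E x)" by (rule killing_pair_dd_I[OF kp x]) (rule hol[OF x])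
 ultimately show ?thesis by (simp add: 2[of "E x"] algebra_simps)
qed


text \<open>The t^m coefficient along a ray of the Killing equation for a field agreeing with \<open>x \<mapsto> I x\<close> up to order \<open>m\<close>.\<close>

lemma killing_ray_estimate:
 assumes kp: "killing_pair E B" and hol: "!!x w. x : \<O> ==> B x (I w) = I (B x w)"
 and skew: "!!x v w. x : \<O> ==> G x (B x v) w + G x v (B x w) = 0" and o: "0 : \<O>"
 and ini: "E 0 = 0" "!!w. B 0 w = I w" and m: "m >= 1"
 and IH: "!!i X u. i >= 1 ==> i < m ==> iter_dd X i (dd u E) 0 = 0"
 and ray: "!!t. t : {0..1} ==> t *R X : \<O>"
 shows "EX C>=0. ALL t:{0..1}. norm (of_real t * dd (I X) (herm u v) (t *R X) +
 of_real (t ^ m / fact m) * (herm (iter_dd X m (dd u E) 0) v 0 + herm u (iter_dd X m (dd v E) 0) 0)) <= C * t ^ Suc m"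
proof -
 note sE = kpD(1)[OF kp]
 have d0: "dd u E 0 = I u" for u using killing_pair_dd[OF kp o, of u] by (simp add: ini \<G>_simps o)
 have "EX C>=0. ALL t:{0..1}. norm (dd u E (t *R X) - I u - (t ^ m / fact m) *R iter_dd X m (dd u E) 0) <= C * t ^ Suc m" for u
 proof -
 have s: "smooth_on \<O> (%x. dd u E x - I u)" by (intro smooth_diff_fun open_\<O> smooth_dd sE smooth_const)
 have it: "iter_dd X i (%x. dd u E x - I u) 0 = iter_dd X i (dd u E) 0 - iter_dd X i (%x. I u) 0" for i
  by (rule iter_dd_diff[OF open_\<O> smooth_dd[OF sE] smooth_const o])
 have z: "iter_dd X i (%x. dd u E x - I u) 0 = 0" if "i < m" for i
  using IH[of i X u] that by (cases "i = 0") (auto simp: it d0 iter_dd_const)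
 then have "EX C>=0. ALL t:{0..1}. norm (dd u E (t *R X) - I u - (t ^ m / fact m) *R iter_dd X m (%x. dd u E x - I u) 0) <= C * t ^ Suc m"
  using ray_taylor[OF open_\<O> s ray z, of m] by blast
 then show ?thesis using m by (simp add: it iter_dd_const)
 qed
 then obtain C1 where C1: "!!u. C1 u >= 0" "!!u t. t : {0..1} ==>
 norm (dd u E (t *R X) - I u - (t ^ m / fact m) *R iter_dd X m (dd u E) 0) <= C1 u * t ^ Suc m" by metis
 \<comment> \<open>\<open>IH\<close> concerns the derivative of \<open>E\<close> below order m,
   hence \<open>E\<close> itself up to order m; this remainder is one order better than that of the
   derivative.\<close>
 have exE: "EX C>=0. ALL t:{0..1}. norm (E (t *R X) - t *R I X) <= C * t ^ Suc m"
 proof -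
 have s: "smooth_on \<O> (%x. E x - I x)" by (intro smooth_diff_fun open_\<O> sE smooth_on_linear I_bounded_linear)
 have dx: "dd X (%x. E x - I x) x = dd X E x - I X" if "x : \<O>" for x
  by (rule dd_eqI) (intro has_derivative_diff smooth_deriv[OF sE that] bounded_linear_imp_has_derivative I_bounded_linear)
 have "iter_dd X i (%x. E x - I x) 0 = 0" if "i < Suc m" for i
 proof (cases i)
  case 0 then show ?thesis by (simp add: ini I_simps)
 next
  case (Suc j)
  have "iter_dd X i (%x. E x - I x) 0 = iter_dd X j (%x. dd X E x - I X) 0"
  unfolding Suc iter_dd_Suc' by (rule iter_dd_cong[OF open_\<O> _ o]) (rule dx)
  also have "... = iter_dd X j (dd X E) 0 - iter_dd X j (%x. I X) 0"
  by (rule iter_dd_diff[OF open_\<O> smooth_dd[OF sE] smooth_const o])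
  also have "... = 0" using IH[of j X X] that Suc by (cases "j = 0") (auto simp: d0 iter_dd_const)
  finally show ?thesis .
 qed
 from ray_taylor_bound[where m = "Suc m", OF open_\<O> s ray this] show ?thesis by (simp add: I_simps)
 qed
 then obtain C3 where C3: "C3 >= 0" "!!t. t : {0..1} ==> norm (E (t *R X) - t *R I X) <= C3 * t ^ Suc m" by metis
 let ?K = "(%t. t *R X) ` {0..1}"
 have K: "compact ?K" "?K \<subseteq> \<O>" "convex ?K"
 using ray by (auto intro!: compact_continuous_image continuous_intros convex_linear_image linearI simp: algebra_simps)
 obtain L where L: "L >= 0" "!!x u w. x : ?K ==> norm (herm u w x) <= L * (norm u * norm w)"
 "!!x h u w. x : ?K ==> norm (dd h (herm u w) x) <= L * norm h * (norm u * norm w)"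
 by (rule bilinear_smooth_bounds[OF open_\<O> herm_bilinear smooth_herm K(1,3,2)]) (assumption, rule that, assumption, blast, blast)
 have hl: "norm (herm a b (t *R X) - herm a b 0) <= L * norm X * (norm a * norm b) * t" if t: "t : {0..1}" for a b t
 proof -
 have "norm ((%s. herm a b (s *R X)) t - (%s. herm a b (s *R X)) 0 - t *R 0) <= L * norm X * (norm a * norm b) * t"
 proof (rule hvd_linearization)
  fix s assume "s : {0..t}"
  then have s: "s : {0..1}" using t by auto
  show "((%s. herm a b (s *R X)) hvd dd X (herm a b) (s *R X)) (at s within {0..t})"
  by (rule smooth_on_ray_derivative) (rule smooth_herm ray[OF s])+
  show "norm (dd X (herm a b) (s *R X) - 0) <= L * norm X * (norm a * norm b)" using L(3)[OF imageI[OF s], of a b X] by simp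
 qed (use t in auto)
 then show ?thesis by simp
 qed
 define a where "a u = iter_dd X m (dd u E) 0" for u
 let ?N = "norm u" and ?V = "norm v"
 define C where "C = L * C3 * (?N * ?V) + (L * (C1 u * ?V) + L * norm X * (norm (a u) * ?V)) + (L * (?N * C1 v) + L * norm X * (?N * norm (a v)))"
 show ?thesis
 proof (rule exI[of _ C], intro conjI ballI)
 show "C >= 0" unfolding C_def using C1(1) C3(1) L(1) by (intro add_nonneg_nonneg mult_nonneg_nonneg) auto
 fix t :: real assume t: "t : {0..1}"
 let ?x = "t *R X" and ?f = "t ^ m / fact m"
 have xK: "?x : ?K" and x: "?x : \<O>" using t ray by auto
 have f01: "0 <= ?f" "?f * t <= t ^ Suc m"
  using t mult_left_mono[OF power_div_fact_le[of t m], of t] by (auto simp: mult.commute)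
 \<comment> \<open>\<open>e1\<close> is the cost of replacing \<open>E\<close> by the rotation
   field, \<open>e2\<close> and \<open>e3\<close> that of replacing the derivatives of
   \<open>E\<close> by their expansion and the hermitean form by its value at 0.\<close>
 define e1 where "e1 = dd (E ?x - t *R I X) (herm u v) ?x"
 define r where "r u = dd u E ?x - I u - ?f *R a u" for u
 define e2 where "e2 = herm (r u) v ?x + of_real ?f * (herm (a u) v ?x - herm (a u) v 0)"
 define e3 where "e3 = herm u (r v) ?x + of_real ?f * (herm u (a v) ?x - herm u (a v) 0)"
 have n1: "norm e1 <= L * C3 * (?N * ?V) * t ^ Suc m"
 proof -
  have "norm e1 <= L * norm (E ?x - t *R I X) * (?N * ?V)" unfolding e1_def by (rule L(3)[OF xK])
  also have "... <= L * (C3 * t ^ Suc m) * (?N * ?V)" using C3(2)[OF t] L(1) by (intro mult_right_mono mult_left_mono) auto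
  finally show ?thesis by (simp add: mult_ac)
 qed
 have sc: "norm (of_real ?f * z) <= k * t ^ Suc m" if "norm z <= k * t" "k >= 0" for z :: complex and k
 proof -
  have "norm (of_real ?f * z) = ?f * norm z" by (simp only: norm_mult norm_of_real abs_of_nonneg[OF f01(1)])
  also have "... <= ?f * (k * t)" by (rule mult_left_mono[OF that(1) f01(1)])
  also have "... = k * (?f * t)" by simp
  also have "... <= k * t ^ Suc m" by (rule mult_left_mono[OF f01(2) that(2)])
  finally show ?thesis .
 qed
 have rn: "norm (r u) <= C1 u * t ^ Suc m" for u unfolding r_def a_def by (rule C1(2)[OF t])
 have n2: "norm e2 <= (L * (C1 u * ?V) + L * norm X * (norm (a u) * ?V)) * t ^ Suc m"
 proof -
  have "norm (herm (r u) v ?x) <= L * ((C1 u * t ^ Suc m) * ?V)"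
  using L(2)[OF xK, of "r u" v] mult_left_mono[OF mult_right_mono[OF rn[of u] norm_ge_zero[of v]] L(1)] by linarith
  moreover have "norm (of_real ?f * (herm (a u) v ?x - herm (a u) v 0)) <= L * norm X * (norm (a u) * ?V) * t ^ Suc m"
  by (rule sc[OF hl[OF t]]) (use L(1) in auto)
  ultimately have "norm (herm (r u) v ?x) + norm (of_real ?f * (herm (a u) v ?x - herm (a u) v 0)) <=
  (L * (C1 u * ?V) + L * norm X * (norm (a u) * ?V)) * t ^ Suc m" by (simp add: algebra_simps)
  then show ?thesis unfolding e2_def using norm_triangle_ineq order_trans by blast
 qed
 have n3: "norm e3 <= (L * (?N * C1 v) + L * norm X * (?N * norm (a v))) * t ^ Suc m"
 proof -
  have "norm (herm u (r v) ?x) <= L * (?N * (C1 v * t ^ Suc m))"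
  using L(2)[OF xK, of u "r v"] mult_left_mono[OF mult_left_mono[OF rn[of v] norm_ge_zero[of u]] L(1)] by linarith
  moreover have "norm (of_real ?f * (herm u (a v) ?x - herm u (a v) 0)) <= L * norm X * (?N * norm (a v)) * t ^ Suc m"
  by (rule sc[OF hl[OF t]]) (use L(1) in auto)
  ultimately have "norm (herm u (r v) ?x) + norm (of_real ?f * (herm u (a v) ?x - herm u (a v) 0)) <=
  (L * (?N * C1 v) + L * norm X * (?N * norm (a v))) * t ^ Suc m" by (simp add: algebra_simps)
  then show ?thesis unfolding e3_def using norm_triangle_ineq order_trans by blast
 qed
 have dd: "dd u E ?x = I u + ?f *R a u + r u" for u by (simp add: r_def)
 have e1': "dd (E ?x) (herm u v) ?x = of_real t * dd (I X) (herm u v) ?x + e1"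
  using dd_linear[OF smooth_herm x] by (simp add: e1_def linear_diff linear_scale scaleR_conv_of_real)
 have "0 = dd (E ?x) (herm u v) ?x + herm (dd u E ?x) v ?x + herm u (dd v E ?x) ?x"
  using killing_pair_herm[OF kp hol skew x] by simp
 also have "... = (of_real t * dd (I X) (herm u v) ?x + of_real ?f * (herm (a u) v 0 + herm u (a v) 0)) + (e1 + e2 + e3)"
 proof -
  have "herm (dd u E ?x) v ?x = \<i> * herm u v ?x + of_real ?f * herm (a u) v ?x + herm (r u) v ?x"
  unfolding dd using linear_add[OF herm_linear(1)[OF x]] linear_scale[OF herm_linear(1)[OF x]] herm_I(1)[OF x]
  by (simp only: scaleR_conv_of_real)
  moreover have "herm u (dd v E ?x) ?x = - \<i> * herm u v ?x + of_real ?f * herm u (a v) ?x + herm u (r v) ?x"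
  unfolding dd using linear_add[OF herm_linear(2)[OF x]] linear_scale[OF herm_linear(2)[OF x]] herm_I(2)[OF x]
  by (simp only: scaleR_conv_of_real)
  ultimately show ?thesis unfolding e1' e2_def e3_def ring_distribs by (simp add: ring_distribs)
 qed
 finally have e: "of_real t * dd (I X) (herm u v) ?x + of_real ?f * (herm (a u) v 0 + herm u (a v) 0) = - (e1 + e2 + e3)"
  unfolding eq_neg_iff_add_eq_0 by (rule sym)
 have "norm (e1 + e2 + e3) <= norm e1 + norm e2 + norm e3" by norm
 also have "... <= C * t ^ Suc m" using n1 n2 n3 unfolding C_def by (simp add: algebra_simps)
 finally show "norm (of_real t * dd (I X) (herm u v) ?x + of_real ?f * (herm (iter_dd X m (dd u E) 0) v 0 + herm u (iter_dd X m (dd v E) 0) 0)) <= C * t ^ Suc m"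
  unfolding a_def[symmetric] e norm_minus_cancel .
 qed
qed

end

context local_symmetric begin

lemma herm_potential:
 assumes "smooth_on (ball 0 \<d>) \<q>" "ball 0 \<d> \<subseteq> \<O>"
 and pot: "!!x u v. x : ball 0 \<d> ==> G x u v = (dd u (dd v \<q>) x + dd (I u) (dd (I v) \<q>) x) / 4" and x: "x : ball 0 \<d>"
 shows "herm u v x = levi_op I u v (%x. of_real (\<q> x)) x"
proof -
 have "dd u (dd v (%x. complex_of_real (\<q> x))) x = of_real (dd u (dd v \<q>) x)" for u v
 proof -
 have "dd u (dd v (%x. complex_of_real (\<q> x))) x = dd u (%x. complex_of_real (dd v \<q> x)) x"
  by (rule dd_cong[OF open_ball x]) (rule dd_bounded_linear[OF bounded_linear_of_real assms(1)])
 also have "... = of_real (dd u (dd v \<q>) x)" by (rule dd_bounded_linear[OF bounded_linear_of_real smooth_dd[OF assms(1)] x])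
 finally show ?thesis .
 qed
 then show ?thesis by (simp add: levi_op_def pot[OF x] I_simps field_simps)
qed

end

text \<open>\<open>ser\<close> speaks of Taylor coefficients only: the potential \<open>\<q>\<close>
  need not be the sum of its series, and it is defined on a ball which may be smaller than the
  convex domain.\<close>

locale kaehler_normal_potential = local_symmetric +
 fixes \<d> :: real and \<q> :: "'a => real" and \<h> :: "nat => nat => 'a => complex"
 assumes \<d>: "\<d> > 0" "ball 0 \<d> \<subseteq> \<O>" and convex: "convex \<O>" and \<q>: "smooth_on (ball 0 \<d>) \<q>"
 and pot: "!!x u v. x : ball 0 \<d> ==> G x u v = (dd u (dd v \<q>) x + dd (I u) (dd (I v) \<q>) x) / 4"
 and \<h>: "!!k l. bihomogeneous I k l (\<h> k l)" and \<h>0: "!!k l. \<h> k l ~= (%_. 0) ==> 2 <= k & 2 <= l"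
 and ser: "!!n X. of_real (taylor_component \<q> n X - (if n = 2 then G 0 X X else 0)) = (\<Sum>k\<le>n. \<h> k (n - k) X)"
begin

lemma o: "0 : \<O>" "0 : ball 0 \<d>" using \<d> by auto

text \<open>The metric term becomes the component of bidegree (1, 1), so that the Taylor series of
  the potential is treated uniformly.\<close>

definition component :: "nat => nat => 'a => complex"
 where "component k l = (if k = 1 & l = 1 then (%X. of_real (G 0 X X)) else \<h> k l)"

lemma component_zero: "component k l = (%_. 0)" if "k < 2 \<or> l < 2" "k ~= 1 \<or> l ~= 1"
 using that \<h>0[of k l] by (cases "\<h> k l = (%_. 0)") (auto simp: component_def)

lemma component_bihomogeneous: "bihomogeneous I k l (component k l)"
proof (cases "k = 1 & l = 1")
 case True
 note b = smooth_bilinear_field[OF open_UNIV, where T = "%_. G 0" and \<s> = "%x. x" and \<t> = "%x. x"]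
 have "((%t. complex_of_real (G 0 (X + t *R I X) (X + t *R I X))) hvd 0) (at 0)" for X
 proof -
 have "G 0 (X + t *R I X) (X + t *R I X) = G 0 X X + t\<^sup>2 * G 0 X X" for t
  using o(1) G_I_left[OF o(1), of X X] by (simp add: G_simps G_I power2_eq_square algebra_simps)
 then show ?thesis unfolding has_vector_derivative_def
  by (auto intro!: derivative_eq_intros)
 qed
 then show ?thesis using True o(1)
 by (auto simp: component_def bihomogeneous_def I_linear I_I G_simps power2_eq_square
  intro!: smooth_bl[OF open_UNIV bounded_linear_of_real] b G_bil)
next
 case False
 then have "component k l = \<h> k l" by (auto simp: component_def)
 then show ?thesis using \<h> by simp
qed

lemma component_series: "of_real (taylor_component \<q> n X) = (\<Sum>k\<le>n. component k (n - k) X)"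
proof (cases "n = 2")
 case True
 have "\<h> 1 1 = (%_. 0)" using \<h>0[of 1 1] by auto
 then show ?thesis using ser[of n X] True by (simp add: component_def numeral_2_eq_2 diff_eq_eq add_ac)
next
 case False
 then have "(\<Sum>k\<le>n. component k (n - k) X) = (\<Sum>k\<le>n. \<h> k (n - k) X)"
 by (intro sum.cong) (auto simp: component_def)
 then show ?thesis using ser[of n X] False by simp
qed

text \<open>The difference between the potential and its Taylor polynomial is flat to order m + 2,
  and polarization extends this to mixed derivatives. Three derivatives cost three orders, the
  factor t gains one. The value t = 0 is excluded because the powers of t are divided by its
  square.\<close>

lemma potential_ray_estimate:
 assumes X: "norm X < \<d>"
 shows "EX C>=0. ALL t:{0<..1}. norm (of_real t * dd (I X) (herm u v) (t *R X)
 - (\<Sum>n\<le>m+2. \<Sum>k\<le>n. \<i> * (of_nat k - of_nat (n - k)) * of_real (t ^ n / t\<^sup>2) * levi_op I u v (component k (n - k)) X)) <= C * t ^ Suc m"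
proof -
 define P where "P x = (\<Sum>n\<le>m+2. \<Sum>k\<le>n. component k (n - k) x)" for x
 note sc = bihomogeneous.smooth[OF component_bihomogeneous]
 have sPn: "smooth_on UNIV (%x. \<Sum>k\<le>n. component k (n - k) x)" for n by (intro smooth_sum open_UNIV sc)
 have sP: "smooth_on UNIV P" unfolding P_def[abs_def] by (intro smooth_sum open_UNIV sPn)
 let ?B = "ball 0 \<d> :: 'a set"
 let ?\<q> = "%x. complex_of_real (\<q> x)"
 have sPB: "smooth_on ?B P" by (rule smooth_subset[OF sP]) simp
 have s\<q>: "smooth_on ?B ?\<q>" by (rule smooth_bl[OF open_ball bounded_linear_of_real \<q>])
 define \<r> where "\<r> x = ?\<q> x - P x" for x
 have s\<r>: "smooth_on ?B \<r>" unfolding \<r>_def[abs_def] by (rule smooth_diff_fun[OF open_ball s\<q> sPB])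
 have z0: "iter_dd Y n \<r> 0 = 0" if "n <= m + 2" for Y n
 proof -
 have "iter_dd Y n \<r> 0 = iter_dd Y n ?\<q> 0 - iter_dd Y n P 0"
  unfolding \<r>_def[abs_def] by (rule iter_dd_diff[OF open_ball s\<q> sPB o(2)])
 moreover have "iter_dd Y n ?\<q> 0 = of_real (iter_dd Y n \<q> 0)"
  by (rule iter_dd_bounded_linear[OF open_ball bounded_linear_of_real \<q> o(2)])
 moreover have "iter_dd Y n \<q> 0 = fact n * taylor_component \<q> n Y"
  by (simp add: taylor_component_iter_dd[OF open_ball o(2) \<q>])
 moreover have "iter_dd Y n P 0 = fact n *R (\<Sum>k\<le>n. component k (n - k) Y)"
 proof -
  have "P (t *R Y) = (\<Sum>d\<le>m+2. t ^ d *R (\<Sum>k\<le>d. component k (d - k) Y))" for t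
  unfolding P_def by (intro sum.cong refl) (simp add: bihomogeneous.hom[OF component_bihomogeneous] scaleR_conv_of_real sum_distrib_left)
  then show ?thesis
  using iter_dd_polynomial_ray[OF open_UNIV UNIV_I sP zero_less_one, where Y = Y and N = "m + 2" and c = "%d. \<Sum>k\<le>d. component k (d - k) Y" and n = n] that by simp
 qed
 ultimately show ?thesis by (simp add: component_series scaleR_conv_of_real)
 qed
 have z1: "iter_dd Y n (dd v \<r>) 0 = 0" if "n <= m + 1" for Y n v
 by (rule iter_dd_polarization[OF open_ball s\<r> o(2)]) (use that in \<open>simp add: z0\<close>)
 have z2: "iter_dd Y n (dd u (dd v \<r>)) 0 = 0" if "n <= m" for Y n u v
 by (rule iter_dd_polarization[OF open_ball smooth_dd[OF s\<r>] o(2)]) (use that in \<open>simp add: z1\<close>)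
 have z3: "iter_dd Y n (dd w (dd u (dd v \<r>))) 0 = 0" if "n < m" for Y n u v w
 by (rule iter_dd_polarization[OF open_ball smooth_dd[OF smooth_dd[OF s\<r>]] o(2)]) (use that in \<open>simp add: z2\<close>)
 have ray: "t *R X : ?B" if "t : {0..1}" for t
 using that X mult_left_le_one_le[of "norm X" t] by auto
 have ex: "EX C>=0. ALL t:{0..1}. norm (dd (I X) (dd a (dd b \<r>)) (t *R X)) <= C * t ^ m" for a b
 by (rule ray_taylor_bound[OF open_ball smooth_dd[OF smooth_dd[OF smooth_dd[OF s\<r>]]] ray z3])
 define C where "C a b = (SOME C. C >= 0 & (ALL t:{0..1}. norm (dd (I X) (dd a (dd b \<r>)) (t *R X)) <= C * t ^ m))" for a b
 have "C a b >= 0 & (ALL t:{0..1}. norm (dd (I X) (dd a (dd b \<r>)) (t *R X)) <= C a b * t ^ m)" for a b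
 unfolding C_def by (rule someI_ex[OF ex])
 then have C: "C a b >= 0" "!!t. t : {0..1} ==> norm (dd (I X) (dd a (dd b \<r>)) (t *R X)) <= C a b * t ^ m" for a b
 by blast+
 let ?C = "C u v + C (I u) (I v) + C (I u) v + C (I (I u)) (I v)"
 show ?thesis
 proof (rule exI[of _ ?C], intro conjI ballI)
 fix t :: real assume "t : {0<..1}"
 then have t: "t : {0..1}" "t > 0" by auto
 let ?x = "t *R X"
 note x = ray[OF t(1)]
 have "norm (dd (I X) (levi_op I u v \<r>) ?x) <= ?C * t ^ m"
 proof -
  have "norm (dd (I X) (levi_op I u v \<r>) ?x) <= norm (4 * dd (I X) (levi_op I u v \<r>) ?x)" by (simp add: norm_mult)
  also have "... = norm (dd (I X) (dd u (dd v \<r>)) ?x + dd (I X) (dd (I u) (dd (I v) \<r>)) ?x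
  - \<i> * (dd (I X) (dd (I u) (dd v \<r>)) ?x + dd (I X) (dd (I (I u)) (dd (I v) \<r>)) ?x))"
  proof -
  have "4 * (z / 4) = z" for z :: complex by simp
  then show ?thesis by (simp only: dd_levi_op[OF s\<r> x])
  qed
  also have "... <= norm (dd (I X) (dd u (dd v \<r>)) ?x) + norm (dd (I X) (dd (I u) (dd (I v) \<r>)) ?x)
  + (norm (dd (I X) (dd (I u) (dd v \<r>)) ?x) + norm (dd (I X) (dd (I (I u)) (dd (I v) \<r>)) ?x))"
  by (intro order_trans[OF norm_triangle_ineq4] add_mono norm_triangle_ineq) (simp add: norm_mult norm_triangle_ineq)
  also have "... <= ?C * t ^ m"
  using C(2)[OF t(1), of v u] C(2)[OF t(1), of "I v" "I u"] C(2)[OF t(1), of v "I u"] C(2)[OF t(1), of "I v" "I (I u)"]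
  by (simp add: ring_distribs)
  finally show ?thesis .
 qed
 then have bound: "norm (of_real t * dd (I X) (levi_op I u v \<r>) ?x) <= ?C * t ^ Suc m"
  using mult_left_mono[of _ _ t] t(2) by (fastforce simp: norm_mult mult_ac)
 have "dd (I X) (herm u v) ?x = dd (I X) (%x. levi_op I u v \<r> x + (\<Sum>n\<le>m+2. \<Sum>k\<le>n. levi_op I u v (component k (n - k)) x)) ?x"
 proof (rule dd_cong[OF open_ball x])
  fix y :: 'a assume y: "y : ?B"
  have "levi_op I u v P y = (\<Sum>n\<le>m+2. \<Sum>k\<le>n. levi_op I u v (component k (n - k)) y)"
  unfolding P_def[abs_def]
  by (simp only: levi_op_sum[OF open_UNIV finite_atMost sPn UNIV_I] levi_op_sum[OF open_UNIV finite_atMost sc UNIV_I])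
  then show "herm u v y = levi_op I u v \<r> y + (\<Sum>n\<le>m+2. \<Sum>k\<le>n. levi_op I u v (component k (n - k)) y)"
  using levi_op_diff[OF open_ball s\<q> sPB y, of I u v] herm_potential[OF \<q> \<d>(2) pot y, of u v]
  by (simp add: \<r>_def[abs_def])
 qed
 also have "... = dd (I X) (levi_op I u v \<r>) ?x + (\<Sum>n\<le>m+2. \<Sum>k\<le>n. dd (I X) (levi_op I u v (component k (n - k))) ?x)"
 proof -
  have h: "(levi_op I u v (component k l) has_derivative frechet_derivative (levi_op I u v (component k l)) (at ?x)) (at ?x)" for k l
  by (rule smooth_deriv[OF smooth_levi_op[OF open_UNIV sc] UNIV_I])
  show ?thesis
  by (rule dd_eqI) (intro has_derivative_add has_derivative_sum h smooth_deriv[OF smooth_levi_op[OF open_ball s\<r>] x])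
 qed
 finally have e1: "dd (I X) (herm u v) ?x =
  dd (I X) (levi_op I u v \<r>) ?x + (\<Sum>n\<le>m+2. \<Sum>k\<le>n. dd (I X) (levi_op I u v (component k (n - k))) ?x)" .
 have e2: "of_real t * dd (I X) (levi_op I u v (component k l)) ?x =
  \<i> * (of_nat k - of_nat l) * of_real (t ^ (k + l) / t\<^sup>2) * levi_op I u v (component k l) X" for k l
 proof -
  have "of_real t * dd (I X) (levi_op I u v (component k l)) ?x = dd (I ?x) (levi_op I u v (component k l)) ?x"
  using linear_scale[OF dd_linear[OF smooth_levi_op[OF open_UNIV sc] UNIV_I]]
  by (simp add: I_simps scaleR_conv_of_real)
  also have "... = \<i> * (of_nat k - of_nat l) * levi_op I u v (component k l) ?x"
  by (rule bihomogeneous.levi_rotation[OF component_bihomogeneous])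
  also have "levi_op I u v (component k l) ?x = of_real (t ^ (k + l) / t\<^sup>2) * levi_op I u v (component k l) X"
  using bihomogeneous.levi_homogeneous[OF component_bihomogeneous t(2), of u v k l X] t(2) by (simp add: field_simps)
  finally show ?thesis by simp
 qed
 have "of_real t * dd (I X) (herm u v) ?x = of_real t * dd (I X) (levi_op I u v \<r>) ?x +
  (\<Sum>n\<le>m+2. \<Sum>k\<le>n. \<i> * (of_nat k - of_nat (n - k)) * of_real (t ^ n / t\<^sup>2) * levi_op I u v (component k (n - k)) X)"
  unfolding e1 distrib_left sum_distrib_left e2 by simp
 then show "norm (of_real t * dd (I X) (herm u v) ?x -
  (\<Sum>n\<le>m+2. \<Sum>k\<le>n. \<i> * (of_nat k - of_nat (n - k)) * of_real (t ^ n / t\<^sup>2) * levi_op I u v (component k (n - k)) X)) <= ?C * t ^ Suc m"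
  using bound by simp
 qed (use C(1) in auto)
qed


text \<open>The coefficient of order m in the Killing equation. Around the circle through X its two
  unknown terms have weights m and -m, as the derivative of \<open>E\<close> is complex linear. The
  potential contributes weights k - l with k, l >= 2 and k + l <= m + 2, besides terms with k = l,
  which carry the factor 0. Averaging against the character of weight m therefore isolates the first
  unknown.\<close>

lemma killing_rotation_coefficient:
 assumes kp: "killing_pair E B" and ini: "E 0 = 0" "!!w. B 0 w = I w" and m: "m >= 1"
 and IH: "!!i X u. i >= 1 ==> i < m ==> iter_dd X i (dd u E) 0 = 0"
 shows "iter_dd Y m (dd u E) 0 = 0"
proof -
 note sE = kpD(1)[OF kp]
 have hol: "B x (I w) = I (B x w)" if "x : \<O>" for x w
 by (rule killing_pair_holomorphic[OF kp convex o(1) _ that]) (simp add: ini)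
 have skew: "G x (B x v) w + G x v (B x w) = 0" if "x : \<O>" for x v w
 by (rule killing_pair_skew[OF kp convex o(1) _ that]) (simp add: ini G_I_left o)
 have dI: "dd (I w) (dd u E) x = I (dd w (dd u E) x)" if x: "x : \<O>" for x u w
 proof -
 have "dd (I w) (dd u E) x = dd u (dd (I w) E) x" by (rule dd_commute[OF open_\<O> sE x])
 also have "... = dd u (%x. I (dd w E x)) x"
  by (rule dd_cong[OF open_\<O> x]) (rule killing_pair_dd_I[OF kp], assumption, rule hol)
 also have "... = I (dd u (dd w E) x)" by (rule dd_bounded_linear[OF I_bounded_linear smooth_dd[OF sE] x])
 finally show ?thesis using dd_commute[OF open_\<O> sE x] by simp
 qed
 have lin1: "bounded_linear (%a. herm a v 0)" and lin2: "bounded_linear (%a. herm v a 0)" for v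
 using herm_linear[OF o(1)] linear_conv_bounded_linear by blast+
 \<comment> \<open>Enough sample points to avoid aliasing: the weight differences that must average
   out lie strictly between - (2m + 1) and 0.\<close>
 let ?N = "2 * m + 1"
 define \<t> where "\<t> j = 2 * pi * real j / real ?N" for j
 define p where "p X j = cos (\<t> j) *R X + sin (\<t> j) *R I X" for X j
 have rot1: "herm (iter_dd (p X j) m (dd u E) 0) v 0 = cis (m * \<t> j) * herm (iter_dd X m (dd u E) 0) v 0"
 and rot2: "herm v (iter_dd (p X j) m (dd u E) 0) 0 = cis (- (m * \<t> j)) * herm v (iter_dd X m (dd u E) 0) 0" for X j u v
 proof -
 have 1: "dd (I w) (%x. herm (dd u E x) v 0) x = \<i> * dd w (%x. herm (dd u E x) v 0) x" if "x : \<O>" for x w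
  using herm_I(1)[OF o(1)] by (simp only: dd_bounded_linear[OF lin1 smooth_dd[OF sE] that] dI[OF that])
 have 2: "dd (I w) (%x. herm v (dd u E x) 0) x = - \<i> * dd w (%x. herm v (dd u E x) 0) x" if "x : \<O>" for x w
  using herm_I(2)[OF o(1)] by (simp only: dd_bounded_linear[OF lin2 smooth_dd[OF sE] that] dI[OF that])
 have s: "smooth_on \<O> (%x. herm (dd u E x) v 0)" "smooth_on \<O> (%x. herm v (dd u E x) 0)"
  by (rule smooth_bl[OF open_\<O> lin1 smooth_dd[OF sE]] smooth_bl[OF open_\<O> lin2 smooth_dd[OF sE]])+
 have c: "of_real (cos \<t>) + \<i> * of_real (sin \<t>) = cis \<t>" "of_real (cos \<t>) + - \<i> * of_real (sin \<t>) = cis (- \<t>)" for \<t>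
  by (simp_all add: complex_eq_iff)
 have "herm (iter_dd (p X j) m (dd u E) 0) v 0 = iter_dd (p X j) m (%x. herm (dd u E x) v 0) 0"
  by (rule iter_dd_bounded_linear[OF open_\<O> lin1 smooth_dd[OF sE] o(1), symmetric])
 also have "... = cis (\<t> j) ^ m * iter_dd X m (%x. herm (dd u E x) v 0) 0"
  using iter_dd_circle[OF open_\<O> s(1) 1 o(1), of "cos (\<t> j)" X "sin (\<t> j)" m] unfolding c p_def .
 also have "iter_dd X m (%x. herm (dd u E x) v 0) 0 = herm (iter_dd X m (dd u E) 0) v 0"
  by (rule iter_dd_bounded_linear[OF open_\<O> lin1 smooth_dd[OF sE] o(1)])
 finally show "herm (iter_dd (p X j) m (dd u E) 0) v 0 = cis (m * \<t> j) * herm (iter_dd X m (dd u E) 0) v 0"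
  by (simp only: Complex.DeMoivre)
 have "herm v (iter_dd (p X j) m (dd u E) 0) 0 = iter_dd (p X j) m (%x. herm v (dd u E x) 0) 0"
  by (rule iter_dd_bounded_linear[OF open_\<O> lin2 smooth_dd[OF sE] o(1), symmetric])
 also have "... = cis (- \<t> j) ^ m * iter_dd X m (%x. herm v (dd u E x) 0) 0"
  using iter_dd_circle[OF open_\<O> s(2) 2 o(1), of "cos (\<t> j)" X "sin (\<t> j)" m] unfolding c p_def .
 also have "iter_dd X m (%x. herm v (dd u E x) 0) 0 = herm v (iter_dd X m (dd u E) 0) 0"
  by (rule iter_dd_bounded_linear[OF open_\<O> lin2 smooth_dd[OF sE] o(1)])
 finally show "herm v (iter_dd (p X j) m (dd u E) 0) 0 = cis (- (m * \<t> j)) * herm v (iter_dd X m (dd u E) 0) 0"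
  by (simp only: Complex.DeMoivre mult_minus_right)
 qed
 \<comment> \<open>X must be so small that the whole circle through it lies in the ball where the
   potential is defined; homogeneity in X removes this restriction at the end.\<close>
 have small: "iter_dd X m (dd u E) 0 = 0" if X: "norm X + norm (I X) < \<d>" for X u
 proof (rule herm_eqI[OF o(1)])
 fix v
 define A where "A = herm (iter_dd X m (dd u E) 0) v 0"
 define A' where "A' = herm u (iter_dd X m (dd v E) 0) 0"
 have pX: "norm (p X j) < \<d>" for j
 proof -
  have "norm (p X j) <= norm (cos (\<t> j) *R X) + norm (sin (\<t> j) *R I X)" unfolding p_def by (rule norm_triangle_ineq)
  also have "... <= norm X + norm (I X)" by (auto intro!: add_mono mult_left_le_one_le)
  finally show ?thesis using X by simp
 qed
 have ray: "t *R p X j : \<O>" if "t : {0..1}" for t j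
  using that pX[of j] mult_left_le_one_le[of "norm (p X j)" t] \<d>(2) by (intro subsetD[OF \<d>(2)]) auto
 let ?h = "%j t. of_real t * dd (I (p X j)) (herm u v) (t *R p X j)"
 let ?f = "%t. complex_of_real (t ^ m / fact m)"
 let ?S = "%j t. \<Sum>n\<le>m+2. \<Sum>k\<le>n. \<i> * (of_nat k - of_nat (n - k)) * of_real (t ^ n / t\<^sup>2) * levi_op I u v (component k (n - k)) (p X j)"
 define Q where "Q j C \<longleftrightarrow> C >= 0 & (ALL t:{0..1}. norm (?h j t + ?f t * (cis (m * \<t> j) * A + cis (- (m * \<t> j)) * A')) <= C * t ^ Suc m)" for j C
 have "EX C. Q j C" for j
  unfolding Q_def A_def A'_def rot1[symmetric] rot2[symmetric]
  by (rule killing_ray_estimate[OF kp hol skew o(1) ini m IH ray])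
 then obtain C where "!!j. Q j (C j)" by metis
 then have C: "C j >= 0" "t : {0..1} ==>
  norm (?h j t + ?f t * (cis (m * \<t> j) * A + cis (- (m * \<t> j)) * A')) <= C j * t ^ Suc m" for j t
  unfolding Q_def by blast+
 define Q' where "Q' j C \<longleftrightarrow> C >= 0 & (ALL t:{0<..1}. norm (?h j t - ?S j t) <= C * t ^ Suc m)" for j C
 have "EX C. Q' j C" for j
  unfolding Q'_def by (rule potential_ray_estimate[OF pX])
 then obtain C' where "!!j. Q' j (C' j)" by metis
 then have C': "C' j >= 0" "t : {0<..1} ==> norm (?h j t - ?S j t) <= C' j * t ^ Suc m" for j t
  unfolding Q'_def by blast+
 let ?K = "\<Sum>j<?N. C j + C' j"
 have wS: "(\<Sum>j<?N. cis (- (m * \<t> j)) * ?S j t) = 0" for t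
 proof -
  have "(\<Sum>j<?N. cis (- (m * \<t> j)) * (\<i> * (of_nat k - of_nat l) * of_real (t ^ (k + l) / t\<^sup>2) * levi_op I u v (component k l) (p X j))) = 0"
  if kl: "k + l <= m + 2" for k l
  proof (cases "k = l \<or> component k l = (%_. 0)")
  case True
  have "levi_op I u v (%_. 0) x = 0" for x :: 'a by (simp add: levi_op_def)
  then show ?thesis using True by auto
  next
  case False
  then have "k >= 2" "l >= 2" using component_zero[of k l] by (auto simp: not_less)
  then have "0 < int m + int l - int k" "int m + int l - int k < int ?N" using kl by linarith+
  from zdvd_not_zless[OF this] have nd: "\<not> int ?N dvd int k - int l - int m"
   using dvd_minus_iff[of "int ?N" "int m + int l - int k"] by (simp add: algebra_simps)
  let ?c = "\<i> * (of_nat k - of_nat l) * of_real (t ^ (k + l) / t\<^sup>2) * levi_op I u v (component k l) X"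
  have "(\<Sum>j<?N. cis (- (m * \<t> j)) * (\<i> * (of_nat k - of_nat l) * of_real (t ^ (k + l) / t\<^sup>2) * levi_op I u v (component k l) (p X j)))
   = (\<Sum>j<?N. ?c * cis (of_int (int k - int l - int m) * (2 * pi * real j / real ?N)))"
  proof (rule sum.cong[OF refl])
   fix j
   have "cis (of_int (int k - int l - int m) * (2 * pi * real j / real ?N)) = cis (- (m * \<t> j)) * cis ((real k - real l) * \<t> j)"
   unfolding cis_mult \<t>_def[symmetric] by (simp add: algebra_simps)
   then show "cis (- (m * \<t> j)) * (\<i> * (of_nat k - of_nat l) * of_real (t ^ (k + l) / t\<^sup>2) * levi_op I u v (component k l) (p X j)) =
   ?c * cis (of_int (int k - int l - int m) * (2 * pi * real j / real ?N))"
   unfolding p_def bihomogeneous.levi_circle[OF component_bihomogeneous] by (simp only: mult_ac)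
  qed
  also have "... = 0" unfolding sum_distrib_left[symmetric] using sum_cis_roots[OF _ nd] by simp
  finally show ?thesis .
  qed
  note * = this
  have "(\<Sum>j<?N. cis (- (m * \<t> j)) * ?S j t) = (\<Sum>n\<le>m+2. \<Sum>k\<le>n. \<Sum>j<?N. cis (- (m * \<t> j)) *
  (\<i> * (of_nat k - of_nat (n - k)) * of_real (t ^ n / t\<^sup>2) * levi_op I u v (component k (n - k)) (p X j)))"
  unfolding sum_distrib_left by (subst sum.swap, rule sum.cong[OF refl], subst sum.swap, rule refl)
  also have "... = 0"
  proof (rule sum.neutral, rule ballI, rule sum.neutral, rule ballI)
  fix n k assume "n : {..m+2}" "k : {..n}"
  then show "(\<Sum>j<?N. cis (- (m * \<t> j)) *
   (\<i> * (of_nat k - of_nat (n - k)) * of_real (t ^ n / t\<^sup>2) * levi_op I u v (component k (n - k)) (p X j))) = 0"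
   using *[of k "n - k"] by simp
  qed
  finally show ?thesis .
 qed
 have w2: "(\<Sum>j<?N. cis (- (m * \<t> j)) * cis (- (m * \<t> j))) = 0"
 proof -
  have "\<not> int ?N dvd - 2 * int m" using m zdvd_not_zless[of "2 * int m" "int ?N"] by simp
  from sum_cis_roots[OF _ this] show ?thesis unfolding cis_mult \<t>_def by (simp add: algebra_simps)
 qed
 have main: "norm (of_nat ?N * A) <= (fact m * ?K) * t" if t: "t : {0<..1}" for t
 proof -
  have wh: "norm (\<Sum>j<?N. cis (- (m * \<t> j)) * g j) <= (\<Sum>j<?N. norm (g j))" for g :: "nat => complex"
  by (rule sum_norm_le) (simp add: norm_mult)
  have "(\<Sum>j<?N. cis (- (m * \<t> j)) * (?h j t + ?f t * (cis (m * \<t> j) * A + cis (- (m * \<t> j)) * A')))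
  = (\<Sum>j<?N. cis (- (m * \<t> j)) * ?h j t) + (\<Sum>j<?N. ?f t * A) + ?f t * A' * (\<Sum>j<?N. cis (- (m * \<t> j)) * cis (- (m * \<t> j)))"
  unfolding sum_distrib_left sum.distrib[symmetric]
  proof (rule sum.cong[OF refl])
  fix j
  have g: "c * (h + f * (d * A + c * A')) = c * h + (c * d) * (f * A) + f * A' * (c * c)" for c d h f :: complex
   by (simp add: algebra_simps)
  have 1: "cis (- (m * \<t> j)) * cis (m * \<t> j) = 1" by (simp add: cis_mult)
  show "cis (- (m * \<t> j)) * (?h j t + ?f t * (cis (m * \<t> j) * A + cis (- (m * \<t> j)) * A')) =
   cis (- (m * \<t> j)) * ?h j t + ?f t * A + ?f t * A' * (cis (- (m * \<t> j)) * cis (- (m * \<t> j)))"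
   unfolding g 1 by simp
  qed
  also have "... = (\<Sum>j<?N. cis (- (m * \<t> j)) * (?h j t - ?S j t)) + ?f t * (of_nat ?N * A)"
  proof -
  have gen: "(\<Sum>j<?N. c j * (h j - S j)) = (\<Sum>j<?N. c j * h j) - (\<Sum>j<?N. c j * S j)" for c h S :: "nat => complex"
   by (simp add: right_diff_distrib sum_subtractf)
  show ?thesis unfolding w2 gen wS
   by (simp only: sum_constant card_lessThan mult_zero_right add_0_right diff_zero mult.left_commute)
  qed
  finally have e: "?f t * (of_nat ?N * A) = (\<Sum>j<?N. cis (- (m * \<t> j)) * (?h j t + ?f t * (cis (m * \<t> j) * A + cis (- (m * \<t> j)) * A')))
  - (\<Sum>j<?N. cis (- (m * \<t> j)) * (?h j t - ?S j t))" by (simp only: add_diff_cancel_left')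
  have "norm (?f t * (of_nat ?N * A)) <= (\<Sum>j<?N. norm (?h j t + ?f t * (cis (m * \<t> j) * A + cis (- (m * \<t> j)) * A'))) + (\<Sum>j<?N. norm (?h j t - ?S j t))"
  unfolding e by (rule order_trans[OF norm_triangle_ineq4 add_mono[OF wh wh]])
  also have "... <= (\<Sum>j<?N. C j * t ^ Suc m) + (\<Sum>j<?N. C' j * t ^ Suc m)"
  using t by (intro add_mono sum_mono C(2) C'(2)) auto
  also have "... = ?K * t ^ Suc m" by (simp add: sum.distrib sum_distrib_right ring_distribs)
  finally have "(t ^ m / fact m) * norm (of_nat ?N * A) <= ?K * t ^ Suc m"
  using t by (simp only: norm_mult norm_of_real) (simp add: abs_of_nonneg)
  then have "t ^ m * norm (of_nat ?N * A) <= t ^ m * ((fact m * ?K) * t)" by (simp add: field_simps)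
  then show ?thesis using t by (simp only: mult_le_cancel_left_pos[OF zero_less_power] greaterThanAtMost_iff)
 qed
 have "norm (of_nat ?N * A) <= 0 + e" if "e > 0" for e
 proof -
  let ?k = "fact m * ?K"
  have k: "?k >= 0" using C(1) C'(1) by (intro mult_nonneg_nonneg sum_nonneg add_nonneg_nonneg) auto
  define t where "t = min 1 (e / (?k + 1))"
  have t: "t : {0<..1}" using that k by (auto simp: t_def)
  have "?k * t <= ?k * (e / (?k + 1))" using k by (intro mult_left_mono) (auto simp: t_def)
  also have "... <= e" using k that by (simp add: field_simps)
  finally show ?thesis using main[OF t] by simp
 qed
 then have "norm (of_nat ?N * A) <= 0" by (rule field_le_epsilon)
 then have "A = 0" by (simp add: norm_mult mult_le_0_iff del: of_nat_Suc)
 then show "herm (iter_dd X m (dd u E) 0) v 0 = herm 0 v 0" by (simp add: A_def G_simps I_simps o)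
 qed
 \<comment> \<open>Scales Y into the range covered by \<open>small\<close>.\<close>
 define c where "c = \<d> / (2 * (norm Y + norm (I Y) + 1))"
 have c: "c > 0" using \<d> by (simp add: c_def add_nonneg_pos)
 have "norm (c *R Y) + norm (I (c *R Y)) = c * (norm Y + norm (I Y))" using c by (simp add: I_simps ring_distribs)
 also have "... < \<d>" using \<d> by (simp add: c_def divide_less_eq add_nonneg_pos)
 finally have "iter_dd (c *R Y) m (dd u E) 0 = 0" by (rule small)
 then show ?thesis using c iter_dd_scale[OF open_\<O> smooth_dd[OF sE] o(1), of c Y m u] by simp
qed

text \<open>The derivative of \<open>E\<close> has no Taylor coefficients of positive order at 0.
  Being complex linear in the base point direction, it restricts to holomorphic functions on complex
  lines, and these are constant by the identity theorem.\<close>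

theorem rotation_killing_field:
 assumes kp: "killing_pair E B" and ini: "E 0 = 0" "!!w. B 0 w = I w"
 shows "killing_pair I B"
proof -
 note sE = kpD(1)[OF kp]
 have hol: "B x (I w) = I (B x w)" if "x : \<O>" for x w
 by (rule killing_pair_holomorphic[OF kp convex o(1) _ that]) (simp add: ini)
 have coeff: "iter_dd X m (dd u E) 0 = 0" if "m >= 1" for X m u
 using that
 proof (induction m arbitrary: X u rule: less_induct)
 case (less m)
 show ?case by (rule killing_rotation_coefficient[OF kp ini less.prems less.IH])
 qed
 have dE: "dd u E X = I u" if X: "X : \<O>" for u X
 proof (rule herm_eqI[OF o(1)])
 fix v
 have lin: "bounded_linear (%a. herm a v 0)" using herm_linear(1)[OF o(1)] linear_conv_bounded_linear by blast
 define f where "f x = herm (dd u E x) v 0" for x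
 have sf: "smooth_on \<O> f" unfolding f_def[abs_def] by (rule smooth_bl[OF open_\<O> lin smooth_dd[OF sE]])
 \<comment> \<open>\<open>L\<close> parametrizes the complex line through X. The preimage of the
   convex domain is convex, hence connected.\<close>
 define L where "L z = Re z *R X + Im z *R I X" for z
 have L: "bounded_linear L" unfolding L_def[abs_def]
  by (intro bounded_linear_add bounded_linear_scaleR_left[THEN bounded_linear_compose] bounded_linear_Re bounded_linear_Im)
 define S where "S = L -` \<O>"
 have "convex S" unfolding S_def by (rule convex_linear_vimage[OF bounded_linear.linear[OF L] convex])
 moreover have "open S" unfolding S_def
  by (rule continuous_open_vimage[OF open_\<O>]) (rule linear_continuous_at[OF L])
 ultimately have S: "open S" "connected S" "0 : S" "1 : S" using X o(1) by (auto simp: S_def L_def convex_connected)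
 have dI: "dd (I w) (dd u E) x = I (dd w (dd u E) x)" if x: "x : \<O>" for x w
 proof -
  have "dd (I w) (dd u E) x = dd u (dd (I w) E) x" by (rule dd_commute[OF open_\<O> sE x])
  also have "... = dd u (%x. I (dd w E x)) x"
  by (rule dd_cong[OF open_\<O> x]) (rule killing_pair_dd_I[OF kp], assumption, rule hol)
  also have "... = I (dd u (dd w E) x)" by (rule dd_bounded_linear[OF I_bounded_linear smooth_dd[OF sE] x])
  finally show ?thesis using dd_commute[OF open_\<O> sE x] by simp
 qed
 have fI: "dd (I w) f x = \<i> * dd w f x" if "x : \<O>" for x w
  unfolding f_def[abs_def] using herm_I(1)[OF o(1)]
  by (simp only: dd_bounded_linear[OF lin smooth_dd[OF sE] that] dI[OF that])
 have itI: "dd (I X) (iter_dd X n f) x = \<i> * dd X (iter_dd X n f) x" if x: "x : \<O>" for n x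
 proof -
  have "dd (I X) (iter_dd X n f) x = iter_dd X n (dd (I X) f) x" by (rule iter_dd_commute[OF open_\<O> sf x])
  also have "... = iter_dd X n (%x. \<i> * dd X f x) x" by (rule iter_dd_cong[OF open_\<O> _ x]) (rule fI)
  also have "... = \<i> * iter_dd X n (dd X f) x"
  by (rule iter_dd_bounded_linear[OF open_\<O> bounded_linear_mult_right smooth_dd[OF sf] x])
  finally show ?thesis by (simp add: iter_dd_commute[OF open_\<O> sf x])
 qed
 have der: "((%z. iter_dd X n f (L z)) has_field_derivative iter_dd X (Suc n) f (L z)) (at z)" if "z : S" for n z
 proof -
  have x: "L z : \<O>" using that by (simp add: S_def)
  note l = dd_linear[OF smooth_iter_dd[OF sf] x, of X n]
  have "dd (L h) (iter_dd X n f) (L z) = h * iter_dd X (Suc n) f (L z)" for h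
  unfolding L_def linear_add[OF l[unfolded L_def]] linear_scale[OF l[unfolded L_def]] itI[OF x[unfolded L_def]] iter_dd_Suc
  by (simp add: scaleR_conv_of_real complex_eq_iff algebra_simps)
  then have "(%h. dd (L h) (iter_dd X n f) (L z)) = (*) (iter_dd X (Suc n) f (L z))" by (auto simp: mult.commute)
  then show ?thesis unfolding has_field_derivative_def
  using has_derivative_compose[OF bounded_linear_imp_has_derivative[OF L] smooth_deriv[OF smooth_iter_dd[OF sf] x], of X n] by simp
 qed
 have hd: "(deriv ^^ n) (%z. f (L z)) z = iter_dd X n f (L z)" if "z : S" for n z
  using that
 proof (induction n arbitrary: z)
  case (Suc n)
  have "deriv ((deriv ^^ n) (%z. f (L z))) z = deriv (%z. iter_dd X n f (L z)) z"
  using Suc.IH eventually_nhds_in_open[OF S(1) Suc.prems] by (intro deriv_cong_ev) (auto elim!: eventually_mono)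
  then show ?case using DERIV_imp_deriv[OF der[OF Suc.prems]] by simp
 qed simp
 have "f (L 1) = f (L 0)"
 proof (rule holomorphic_fun_eq_const_on_connected[OF _ S(1,2) _ S(3,4)])
  show "(%z. f (L z)) holomorphic_on S"
  using der[of _ 0] by (auto simp: holomorphic_on_open[OF S(1)])
  show "(deriv ^^ n) (%z. f (L z)) 0 = 0" if "0 < n" for n
  proof -
  have "(deriv ^^ n) (%z. f (L z)) 0 = iter_dd X n f 0" using hd[OF S(3)] by (simp add: L_def)
  also have "... = 0"
   using coeff[of n X u] that iter_dd_bounded_linear[OF open_\<O> lin smooth_dd[OF sE] o(1), of X n u]
   by (simp add: f_def[abs_def] G_simps I_simps o)
  finally show ?thesis .
  qed
 qed
 moreover have "dd u E 0 = I u" using killing_pair_dd[OF kp o(1), of u] by (simp add: ini \<G>_simps o)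
 ultimately show "herm (dd u E X) v 0 = herm (I u) v 0" by (simp add: L_def f_def)
 qed
 have eq: "E X = I X" if "X : \<O>" for X
 proof -
 have "((%x. E x - I x) has_derivative (%h. 0)) (at x within \<O>)" if "x : \<O>" for x
  using has_derivative_at_withinI[OF has_derivative_diff[OF smooth_deriv[OF sE that] bounded_linear_imp_has_derivative[OF I_bounded_linear]]]
  by (simp add: dE that)
 from has_derivative_zero_unique[OF convex this o(1) that] show ?thesis by (simp add: ini I_simps)
 qed
 show ?thesis
 unfolding killing_pair_def
 proof (intro conjI ballI allI)
 show "smooth_on \<O> I" by (rule smooth_on_linear[OF I_bounded_linear])
 show "nab u I x = B x u" if "x : \<O>" for x u
  using kpD(4)[OF kp that, of u] nab_cong[OF that, of E I u] eq by simp
 show "nab u (%y. B y w) x = B x (\<G> x u w) + R x u (I x) w" if "x : \<O>" for x u w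
  using kpD(5)[OF kp that] eq[OF that] by simp
 qed (use kpD[OF kp] in auto)
qed

end

section \<open>The Jordan triple product and antilinear derivations of the curvature\<close>

context local_symmetric begin

text \<open>The part of the curvature antilinear in u, which is the Jordan triple product of the
  symmetric space: complex linear and symmetric in v and w. The curvature is recovered as
  \<open>triple x u v w - triple x v u w\<close>.\<close>

definition triple :: "'e => 'e => 'e => 'e => 'e"
 where "triple x u v w = (1/2) *R (R x u v w + I (R x (I u) v w))"

lemma transvection_term_triple: "x : \<O> ==> transvection_term x W X = (1/2) *R triple x W X X"
 using R_I_left[of x W X X] by (simp add: transvection_term_def triple_def R_I I_simps)

lemma triple_linear:
 assumes "x : \<O>"
 shows "linear (triple x u v)" "linear (%v. triple x u v w)" "linear (%u. triple x u v w)"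
 unfolding triple_def
 by (rule linearI; simp add: R_simps[OF assms] I_simps scaleR_right_distrib)+

lemma triple_sym: "x : \<O> ==> triple x u v w = triple x u w v"
proof -
 assume x: "x : \<O>"
 have 1: "R x u v w - R x u w v = - R x v w u" for u
 using bianchi[OF x, of u v w] by (subst R_anti[of x u w v]) (simp add: eq_neg_iff_add_eq_0 add_ac)
 have "triple x u v w - triple x u w v = (1/2) *R ((R x u v w - R x u w v) + I (R x (I u) v w - R x (I u) w v))"
 by (simp add: triple_def scaleR_right_distrib scaleR_right_diff_distrib I_simps)
 also have "... = 0" unfolding 1 by (simp add: I_simps R_I x)
 finally show ?thesis by simp
qed

lemma triple_swap:
 assumes x: "x : \<O>"
 shows "triple x v u w = (1/2) *R (I (R x (I u) v w) - R x u v w)"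
 using R_anti[of x v u w] R_anti[of x "I v" u w] R_I_left[OF x, of u v w] by (simp add: triple_def I_simps)

lemma triple_I:
 assumes x: "x : \<O>"
 shows "triple x (I u) v w = - I (triple x u v w)" "triple x u v (I w) = I (triple x u v w)" "triple x u (I v) w = I (triple x u v w)"
proof -
 show "triple x (I u) v w = - I (triple x u v w)" by (simp add: triple_def I_simps R_simps x algebra_simps)
 show *: "triple x u v (I w) = I (triple x u v w)" for v w by (simp add: triple_def I_simps R_I x)
 show "triple x u (I v) w = I (triple x u v w)" using *[of w v] triple_sym[OF x] by metis
qed

lemmas triple_simps = triple_linear(1)[THEN linear_add] triple_linear(1)[THEN linear_diff] triple_linear(1)[THEN linear_scale] triple_linear(1)[THEN linear_neg]
 triple_linear(2)[THEN linear_add] triple_linear(2)[THEN linear_diff] triple_linear(2)[THEN linear_scale] triple_linear(2)[THEN linear_neg]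
 triple_linear(3)[THEN linear_add] triple_linear(3)[THEN linear_diff] triple_linear(3)[THEN linear_scale] triple_linear(3)[THEN linear_neg]
 triple_linear(1)[THEN linear_0] triple_linear(2)[THEN linear_0] triple_linear(3)[THEN linear_0]

lemma triple_adjoint: "x : \<O> ==> G x (triple x u v w) z = G x w (triple x v u z)"
 using R_skew[of x u v w z] R_skew[of x "I u" v w "I z"] G_I_left[of x "R x (I u) v w" z] G_I_left[of x w "R x (I u) v z"]
 by (simp add: triple_swap triple_def[of x u v w] G_simps R_I I_simps algebra_simps)

lemma R_triple:
 assumes x: "x : \<O>"
 shows "R x a b (triple x u v w) = triple x (R x a b u) v w + triple x u (R x a b v) w + triple x u v (R x a b w)"
 by (simp add: triple_def R_simps R_I x R_R[OF x, of a b] I_simps algebra_simps scaleR_right_distrib)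

text \<open>\<open>R x b a\<close> and \<open>R x (I b) a\<close> are derivations of the triple
  product. Multiplying the second by \<open>I\<close> changes a sign in the antilinear slot, and
  this turns \<open>triple x b a\<close> into minus \<open>triple x a b\<close> there.\<close>

lemma jordan_triple_identity:
 assumes x: "x : \<O>"
 shows "triple x b a (triple x u v w) = triple x u (triple x b a v) w + triple x u v (triple x b a w) - triple x (triple x a b u) v w"
proof -
 let ?S = "R x b a" and ?S' = "%z. R x (I b) a z"
 have T: "triple x b a z = (1/2) *R (?S z + I (?S' z))" "triple x a b z = (1/2) *R (I (?S' z) - ?S z)" for z
 by (simp add: triple_def) (rule triple_swap[OF x])
 show ?thesis
 unfolding T by (simp add: R_triple x triple_simps I_simps triple_I algebra_simps scaleR_right_distrib)
qed

text \<open>In the application \<open>B\<close> is the commutator of the endomorphism of a Killing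
  field with \<open>I\<close>, which anticommutes with \<open>I\<close>.\<close>

context
 fixes x B
 assumes x: "x : \<O>" and B_linear: "linear B" and B_skew: "!!v w. G x (B v) w = - G x v (B w)"
 and B_I: "!!v. B (I v) = - I (B v)" and B_R: "curvature_invariant x B"
begin

text \<open>Passing from (u, v) to (I u, I v) leaves \<open>B (R x u v w)\<close> unchanged and
  flips the sign of the terms in which \<open>B\<close> hits u or v. So the derivation rule splits
  into two identities.\<close>

lemma B_curvature:
 shows "B (R x u v w) = R x u v (B w)" "R x (B u) v w = - R x u (B v) w"
proof -
 have 1: "B (R x u v w) = R x (B u) v w + R x u (B v) w + R x u v (B w)" for u v
 using B_R by (simp add: curvature_invariant_def)
 have "R x (B (I u)) (I v) w = - R x (B u) v w" "R x (I u) (B (I v)) w = - R x u (B v) w"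
 by (simp_all add: B_I R_simps x R_I_I)
 then have 2: "B (R x u v w) = - R x (B u) v w - R x u (B v) w + R x u v (B w)"
 using 1[of "I u" "I v"] by (simp add: R_I_I x)
 have "2 *R (R x (B u) v w + R x u (B v) w) = 0" using 1[of u v] 2 by (simp add: scaleR_2 algebra_simps)
 then have "R x (B u) v w + R x u (B v) w = 0" by simp
 then show "R x (B u) v w = - R x u (B v) w" "B (R x u v w) = R x u v (B w)"
 using 1[of u v] by (simp_all add: eq_neg_iff_add_eq_0)
qed

lemma B_triple: "B (triple x u v w) = - triple x v u (B w)"
 by (simp add: triple_swap[OF x, of v u "B w"] triple_def[of x u v w] linear_scale[OF B_linear] linear_add[OF B_linear] B_I B_curvature
  scaleR_right_diff_distrib scaleR_right_distrib)

lemma triple_range_B: "triple x u v (B w) : range B"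
 using B_triple[of v u "- w"] by (metis linear_neg[OF B_linear] linear_neg[OF triple_linear(1)[OF x]] minus_minus rangeI)

text \<open>On \<open>B u\<close> the operator \<open>D\<close> has the eigenvalue -h. For nonzero h
  the Peirce relations between \<open>D\<close> and \<open>P\<close> exclude this unless
  \<open>B u = 0\<close>, but then u, lying in the range of the skew map \<open>B\<close>, is
  orthogonal to itself.\<close>

lemma tripotent_range_B:
 assumes u: "u : range B" "triple x u u u = h *R u" "u ~= 0"
 shows "h = 0"
proof (rule ccontr)
 assume h: "h ~= 0"
 define D where "D w = triple x u u w" for w
 define P where "P w = triple x w u u" for w
 have lin: "linear D" "linear P" using triple_linear[OF x] by (simp_all add: D_def[abs_def] P_def[abs_def])
 note ls = linear_add[OF lin(1)] linear_diff[OF lin(1)] linear_scale[OF lin(1)] linear_neg[OF lin(1)]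
 linear_add[OF lin(2)] linear_diff[OF lin(2)] linear_scale[OF lin(2)] linear_neg[OF lin(2)]
 have DP: "D (P w) = (2 * h) *R P w - P (D w)" for w
 using jordan_triple_identity[OF x, of u u w u u] triple_sym[OF x, of w "h *R u" u]
 by (simp add: D_def P_def u(2) triple_simps x scaleR_2 flip: scaleR_scaleR)
 have PP: "P (P w) = 2 *R D (D w) - h *R D w" for w
 using jordan_triple_identity[OF x, of u w u u u] triple_sym[OF x, of u "triple x u w u" u] triple_sym[OF x, of u w u]
 by (simp add: D_def P_def u(2) triple_simps x scaleR_2 algebra_simps)
 \<comment> \<open>Computing \<open>P (P (P w))\<close> in two ways by \<open>PP\<close>, and moving
   \<open>D\<close> past \<open>P\<close> by \<open>DP\<close>, leaves 6 h (h P w - P (D w)) =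
   0.\<close>
 have PD: "P (D w) = h *R P w" for w
 proof (rule euclidean_eqI)
 fix b
 have "P (P (P w)) \<bullet> b = 2 * (D (D (P w)) \<bullet> b) - h * (D (P w) \<bullet> b)" unfolding PP[of "P w"] by (simp add: inner_simps)
 moreover have "P (P (P w)) \<bullet> b = 2 * (P (D (D w)) \<bullet> b) - h * (P (D w) \<bullet> b)" unfolding PP[of w] ls by (simp add: inner_simps)
 moreover have "D (P w) \<bullet> b = 2 * h * (P w \<bullet> b) - P (D w) \<bullet> b" for w unfolding DP[of w] by (simp add: inner_simps)
 moreover have "D (D (P w)) \<bullet> b = 2 * h * (D (P w) \<bullet> b) - D (P (D w)) \<bullet> b" unfolding DP[of w] ls by (simp add: inner_simps)
 ultimately have "h * (6 * (h * (P w \<bullet> b) - P (D w) \<bullet> b)) = 0" by (auto simp: algebra_simps)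
 then show "P (D w) \<bullet> b = (h *R P w) \<bullet> b" using h by simp
 qed
 have DB: "D (B u) = - h *R B u" using B_triple[of u u u] by (simp add: D_def u(2) linear_scale[OF B_linear])
 have "- (h *R P (B u)) = h *R P (B u)" using PD[of "B u"] by (simp add: DB ls)
 then have "2 *R (h *R P (B u)) = 0" unfolding scaleR_2 by (metis add.right_inverse)
 then have "P (B u) = 0" using h by simp
 then have "(3 * h * h) *R B u = 0" using PP[of "B u"] by (simp add: DB ls linear_0[OF lin(2)] scaleR_left_distrib[symmetric])
 then have Bu: "B u = 0" using h by simp
 obtain w where "u = B w" using u(1) by blast
 then have "G x u u = - G x w (B u)" using B_skew[of w u] by simp
 then show False using G_pos[OF x u(3)] by (simp add: Bu G_simps x)
qed

text \<open>A Lagrange multiplier argument: the difference of the quartic form and h times the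
  squared metric is extremal at u on the range of \<open>B\<close>. The test direction
  \<open>y\<close> is its gradient up to a factor, and it lies in that range. The sign \<s> treats
  maxima and minima together.\<close>

lemma quartic_critical:
 assumes u: "u : range B" "G x (triple x u u u) u = h * (G x u u)\<^sup>2" and \<s>: "\<s> = 1 \<or> \<s> = - 1"
 and max: "!!v. v : range B ==> \<s> * G x (triple x v v v) v <= \<s> * (h * (G x v v)\<^sup>2)"
 shows "triple x u u u = (h * G x u u) *R u"
proof -
 define y where "y = triple x u u u - (h * G x u u) *R u"
 note sub = linear_subspace_image[OF B_linear subspace_UNIV]
 have y: "y : range B" unfolding y_def using u(1) triple_range_B by (intro subspace_diff subspace_scale sub) auto
 let ?v = "%s. u + s *R y"
 let ?p = "%s. \<s> * (G x (triple x (?v s) (?v s) (?v s)) (?v s) - h * (G x (?v s) (?v s))\<^sup>2)"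
 have dv: "(?v has_derivative (%s. s *R y)) (at 0)" by (auto intro!: derivative_eq_intros)
 have g: "bounded_bilinear (G x)" using bilinear_conv_bounded_bilinear G_bil[OF x] by blast
 have bT: "bilinear (triple x z)" for z using triple_linear[OF x] by (simp add: bilinear_def)
 have dT: "((%s. triple x (?v s) (?v s) (?v s)) has_derivative
  (%s. s *R triple x y (?v 0) (?v 0) + triple x (?v 0) (?v 0) (s *R y) + triple x (?v 0) (s *R y) (?v 0))) (at 0)"
 proof (rule bilinear_field_deriv[OF open_UNIV UNIV_I bT _ dv dv, where T' = "%v w s. s *R triple x y v w"])
 fix v w show "((%s. triple x (?v s) v w) has_derivative (%s. s *R triple x y v w)) (at 0)"
  unfolding triple_simps(9)[OF x] triple_simps(11)[OF x] by (auto intro!: derivative_eq_intros)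
 qed
 have dq: "((%s. (G x (?v s) (?v s))\<^sup>2) has_derivative (%s. 2 * (G x (?v 0) (s *R y) + G x (s *R y) (?v 0)) * G x (?v 0) (?v 0))) (at 0)"
 using has_derivative_power[OF bounded_bilinear.FDERIV[OF g dv dv], of 2] by (simp add: mult_ac)
 have "(?p has_derivative (%s. \<s> * ((G x (triple x (?v 0) (?v 0) (?v 0)) (s *R y)
  + G x (s *R triple x y (?v 0) (?v 0) + triple x (?v 0) (?v 0) (s *R y) + triple x (?v 0) (s *R y) (?v 0)) (?v 0))
  - h * (2 * (G x (?v 0) (s *R y) + G x (s *R y) (?v 0)) * G x (?v 0) (?v 0))))) (at 0)"
 by (intro has_derivative_mult_right has_derivative_diff bounded_bilinear.FDERIV[OF g] dT dv dq)
 then have "(?p has_real_derivative \<s> * (G x (triple x u u u) y + G x (triple x y u u + triple x u u y + triple x u y u) u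
  - h * (4 * G x u y * G x u u))) (at 0)"
 unfolding has_field_derivative_def
 by (rule has_derivative_eq_rhs) (simp add: fun_eq_iff G_simps triple_simps x G_sym[OF x, of y u] algebra_simps)
 moreover have "?p s <= ?p 0" for s
 proof -
 have "?v s : range B" using u(1) y by (intro subspace_add subspace_scale sub) auto
 from max[OF this] show ?thesis using u(2) by (simp add: algebra_simps)
 qed
 ultimately have "\<s> * (G x (triple x u u u) y + G x (triple x y u u + triple x u u y + triple x u y u) u - h * (4 * G x u y * G x u u)) = 0"
 by (intro DERIV_local_max[of ?p _ 0 1]) auto
 moreover have "G x (triple x u u y) u = G x (triple x u u u) y"
 using triple_adjoint[OF x, of u u y u] G_sym[OF x] by simp
 moreover have "G x (triple x y u u) u = G x (triple x u u u) y"
 using triple_adjoint[OF x, of y u u u] triple_sym[OF x, of u y u] triple_adjoint[OF x, of u u y u] G_sym[OF x] by metis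
 ultimately have "G x (triple x u u u) y = h * G x u u * G x u y"
 using \<s> triple_sym[OF x, of u y u] by (auto simp: G_simps x)
 moreover have "G x y z = G x (triple x u u u) z - h * G x u u * G x u z" for z by (simp add: y_def G_simps x)
 ultimately have "G x y y = 0" by simp
 then have "y = 0" using G_pos[OF x, of y] by force
 then show ?thesis by (simp add: y_def)
qed

text \<open>At a maximum u on the unit sphere of the range of \<open>B\<close>,
  \<open>quartic_critical\<close> gives \<open>triple x u u u = h *R u\<close> with h the maximal
  value, and \<open>tripotent_range_B\<close> gives h = 0.\<close>

lemma quartic_zero:
 assumes \<s>: "\<s> = 1 \<or> \<s> = - 1" and v: "v : range B"
 shows "\<s> * G x (triple x v v v) v <= 0"
proof (cases "v = 0")
 case False
 let ?f = "%v. \<s> * G x (triple x v v v) v"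
 let ?S = "range B \<inter> {v. G x v v = 1}"
 note sub = linear_subspace_image[OF B_linear subspace_UNIV]
 have bT: "bilinear (triple x z)" for z using triple_linear[OF x] by (simp add: bilinear_def)
 have sT: "smooth_on UNIV (%v. triple x v v v)"
 by (rule smooth_bilinear_field[OF open_UNIV bT smooth_on_linear smooth_on_id smooth_on_id])
  (use triple_linear(3)[OF x] linear_conv_bounded_linear in blast)
 have g: "bounded_bilinear (G x)" using bilinear_conv_bounded_bilinear G_bil[OF x] by blast
 have c: "continuous_on UNIV ?f" "continuous_on UNIV (%v. G x v v)"
 by (intro continuous_on_mult continuous_on_const bounded_bilinear.continuous_on[OF g] smooth_cont[OF sT] continuous_on_id)+
 obtain k where k: "k > 0" "!!z. k * (norm z)\<^sup>2 <= G x z z" using coercive_bilinear[OF G_bil[OF x] G_pos[OF x]] by blast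
 have "bounded ?S"
 proof (rule boundedI)
 fix z assume "z : ?S"
 then have "(norm z)\<^sup>2 <= (sqrt (1/k))\<^sup>2" using k(2)[of z] k(1) by (simp add: field_simps)
 then show "norm z <= sqrt (1/k)" by (rule power2_le_imp_le) (use k in simp)
 qed
 moreover have "closed ?S"
 using continuous_closed_vimage[of "{1}" "%v. G x v v"] c(2) closed_subspace[OF sub]
 by (auto simp: continuous_on_eq_continuous_at vimage_def)
 ultimately have S: "compact ?S" by (simp add: compact_eq_bounded_closed)
 have normalize: "(1 / sqrt (G x z z)) *R z : ?S" "?f z = (G x z z)\<^sup>2 * ?f ((1 / sqrt (G x z z)) *R z)" if "z : range B" "z ~= 0" for z
 proof -
 note p = G_pos[OF x that(2)]
 show "(1 / sqrt (G x z z)) *R z : ?S" using that p subspace_scale[OF sub that(1)] by (simp add: G_simps x)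
 show "?f z = (G x z z)\<^sup>2 * ?f ((1 / sqrt (G x z z)) *R z)" using p by (simp add: G_simps triple_simps x power2_eq_square)
 qed
 obtain u where u: "u : ?S" "!!z. z : ?S ==> ?f z <= ?f u"
 using continuous_attains_sup[OF S _ continuous_on_subset[OF c(1)]] normalize(1)[OF v False] by blast
 define h where "h = G x (triple x u u u) u"
 have max: "\<s> * G x (triple x z z z) z <= \<s> * (h * (G x z z)\<^sup>2)" if "z : range B" for z
 proof (cases "z = 0")
 case False
 show ?thesis unfolding normalize(2)[OF that False]
  using mult_left_mono[OF u(2)[OF normalize(1)[OF that False]], of "(G x z z)\<^sup>2"] by (simp add: h_def mult_ac)
 qed (simp add: G_simps x)
 have "triple x u u u = (h * G x u u) *R u"
 by (rule quartic_critical[OF _ _ \<s> max]) (use u(1) in \<open>auto simp: h_def\<close>)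
 moreover have "u ~= 0" using u(1) by (auto simp: G_simps x)
 ultimately have "h = 0" using tripotent_range_B[of u h] u(1) by auto
 then show ?thesis using max[OF v] by simp
qed (simp add: G_simps x)

text \<open>With both signs in \<open>quartic_zero\<close> the quartic form vanishes, so every
  vector of the range is critical with h = 0 and the cubic map vanishes. The rest is
  polarization.\<close>

lemma triple_range_B_zero:
 assumes "u : range B" "v : range B" "w : range B"
 shows "triple x u v w = 0"
proof -
 note sub = linear_subspace_image[OF B_linear subspace_UNIV]
 have q: "G x (triple x v v v) v = 0" if "v : range B" for v
 using quartic_zero[of 1 v] quartic_zero[of "- 1" v] that by simp
 have c: "triple x v v v = 0" if "v : range B" for v
 using quartic_critical[of v 0 1] q that by simp
 have c2: "triple x z v v + 2 *R triple x v v z = 0" if "v : range B" "z : range B" for v z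
 proof -
 let ?a = "triple x z v v + 2 *R triple x v v z" and ?b = "triple x v z z + 2 *R triple x z v z"
 have s: "triple x v z v = triple x v v z" "triple x z z v = triple x z v z" by (rule triple_sym[OF x])+
 have "triple x (v + z) (v + z) (v + z) = triple x v v v + (?a + ?b) + triple x z z z"
  "triple x (v - z) (v - z) (v - z) = triple x v v v + (?b - ?a) - triple x z z z"
  by (simp_all add: triple_simps x s scaleR_2 algebra_simps)
 moreover have "triple x (v + z) (v + z) (v + z) = 0" "triple x (v - z) (v - z) (v - z) = 0"
  by (rule c; intro subspace_add subspace_diff sub that)+
 ultimately have "?a + ?b = 0" "?b - ?a = 0" by (simp_all only: c[OF that(1)] c[OF that(2)] add_0_left diff_zero add_0_right)
 moreover have "a = 0" if "a + b = 0" "b - a = 0" for a b :: 'e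
  using that by (simp flip: scaleR_2)
 ultimately show ?thesis by blast
 qed
 \<comment> \<open>The two summands of \<open>c2\<close> behave differently under z \<mapsto> I z,
   one being antilinear and one linear in z, so both vanish.\<close>
 have c3: "triple x z v v = 0" if "v : range B" "z : range B" for v z
 proof -
 have "I z : range B" using that(2) B_I linear_neg[OF B_linear] by (metis (no_types, lifting) minus_minus rangeE rangeI)
 from c2[OF that(1) this] have "I (2 *R triple x v v z - triple x z v v) = 0" by (simp add: triple_I x I_simps algebra_simps)
 then have "I (I (2 *R triple x v v z - triple x z v v)) = 0" by (simp add: I_simps)
 then have "2 *R triple x v v z = triple x z v v" unfolding I_I by simp
 then show ?thesis using c2[OF that] by (simp flip: scaleR_2)
 qed
 have "triple x u (v + w) (v + w) = 0" by (rule c3) (intro subspace_add sub assms assms(1))+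
 then have "2 *R triple x u v w = 0" using triple_sym[OF x, of u w v] by (simp add: triple_simps x c3 assms scaleR_2)
 then show ?thesis by simp
qed

text \<open>Vanishing spreads from arguments in the range of \<open>B\<close> to arbitrary ones.
  Pair symmetry and the skewness of \<open>B\<close> and of the curvature show in turn that the
  vectors in question are orthogonal to themselves.\<close>

theorem antilinear_curvature_derivation:
 shows "R x u v (B w) = 0" "R x (B u) v w = 0" "R x u (B v) w = 0"
proof -
 have z: "R x (B u) (B v) (B w) = 0" for u v w
 proof -
 have "R x (B u) (B v) (B w) = triple x (B u) (B v) (B w) - triple x (B v) (B u) (B w)"
  by (simp add: triple_swap[OF x, of "B v"] triple_def[of x "B u"] scaleR_right_distrib scaleR_right_diff_distrib flip: scaleR_left_distrib)
 then show ?thesis by (simp add: triple_range_B_zero)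
 qed
 have zB: "R x (B u) (B v) w = 0" for u v w
 proof -
 define y where "y = R x (B u) (B v) w"
 have By: "B y = 0" unfolding y_def B_curvature(1) by (rule z)
 have yB: "G x y (B c) = 0" for c using B_skew[of y c] by (simp add: By G_simps x)
 have "R x w y (B u) = - R x y (B u) w - R x (B u) w y"
  using bianchi[OF x, of w y "B u"] by (simp add: algebra_simps eq_neg_iff_add_eq_0)
 also have "R x y (B u) w = 0" using B_curvature(2)[of y u w] by (simp add: By R_simps x)
 finally have e: "R x w y (B u) = - R x (B u) w y" by simp
 have "G x y y = G x (R x w y (B u)) (B v)" unfolding y_def by (rule R_pair[OF x])
 also have "... = G x y (R x (B u) w (B v))" unfolding e using R_skew[OF x, of "B u" w y "B v"] by (simp add: G_simps x)
 also have "... = 0" unfolding B_curvature(1)[symmetric] by (rule yB)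
 finally show ?thesis using G_pos[OF x, of y] by (force simp: y_def)
 qed
 have main: "R x u v (B w) = 0" for u v w
 proof -
 have BB: "R x u v (B (B c)) = 0" for c
 proof (rule G_eqI[OF x])
  fix d
  have "G x (R x u v (B (B c))) d = - G x (R x u v (B c)) (B d)" unfolding B_curvature(1)[symmetric] B_skew ..
  also have "G x (R x u v (B c)) (B d) = G x (R x (B c) (B d) u) v" by (rule R_pair[OF x])
  finally show "G x (R x u v (B (B c))) d = G x 0 d" by (simp add: zB G_simps x)
 qed
 let ?K = "%c. R x u v (B c)"
 have "G x (?K w) (?K w) = - G x (B w) (R x u v (?K w))" by (rule R_skew[OF x])
 also have "... = G x w (B (R x u v (?K w)))" by (simp add: B_skew)
 also have "B (R x u v (?K w)) = R x u v (R x u v (B (B w)))" by (simp add: B_curvature)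
 also have "... = 0" by (simp add: BB R_simps x)
 finally show ?thesis using G_pos[OF x, of "?K w"] by (force simp: G_simps x)
 qed
 have m2: "R x (B u) v w = 0" for u v w
 proof (rule G_eqI[OF x])
 fix d show "G x (R x (B u) v w) d = G x 0 d"
  using R_pair[OF x, of "B u" v w d] by (simp add: main G_simps x)
 qed
 show "R x u v (B w) = 0" by (rule main)
 show "R x (B u) v w = 0" by (rule m2)
 show "R x u (B v) w = 0" using m2[of v u w] R_anti[of x u "B v" w] by simp
qed

end

end

section \<open>The Levi-Civita connection from the Koszul formula\<close>

lemma koszul_unique:
 fixes g :: "'e::euclidean_space => 'e => real"
 assumes g: "bilinear g" "!!u v. g u v = g v u" "!!u. u ~= 0 ==> g u u > 0"
 and \<G>: "!!u v. \<G> u v = \<G> v u" "!!u v w. g (\<G> u v) w + g v (\<G> u w) = k u v w"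
 and \<G>': "!!u v. \<G>' u v = \<G>' v u" "!!u v w. g (\<G>' u v) w + g v (\<G>' u w) = k u v w"
 shows "\<G> = \<G>'"
proof (intro ext posdef_eqI[OF g(1,3)])
 have "2 * g (\<Theta> u v) w = k u v w + k v u w - k w u v"
 if "!!u v. \<Theta> u v = \<Theta> v u" "!!u v w. g (\<Theta> u v) w + g v (\<Theta> u w) = k u v w" for \<Theta> u v w
 using that(2)[of u v w] that(2)[of v u w] that(2)[of w u v] that(1)[of u v] that(1)[of u w] that(1)[of v w] g(2)[of v "\<Theta> u w"] g(2)[of u "\<Theta> v w"]
 by simp
 from this[OF \<G>] this[OF \<G>'] show "g (\<G> u v) w = g (\<G>' u v) w" for u v w by (smt (verit))
qed

text \<open>\<open>k\<close> is the right-hand side of the Koszul formula. The connection is chosen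
  pointwise by duality, so its bilinearity and smoothness are recovered from uniqueness and from
  \<open>smooth_on_metric_solve\<close>.\<close>

lemma levi_civita_exists:
 fixes G :: "'e::euclidean_space => 'e => 'e => real"
 assumes S: "open S" and bil: "!!x. x : S ==> bilinear (G x)" and sym: "!!x u v. x : S ==> G x u v = G x v u"
 and pos: "!!x u. x : S ==> u ~= 0 ==> G x u u > 0" and sm: "!!u v. smooth_on S (%x. G x u v)"
 shows "EX \<G>. connection S \<G> & (ALL x:S. ALL u v w. dd u (%x. G x v w) x = G x (\<G> x u v) w + G x v (\<G> x u w))"
proof -
 define k where "k u v w x = (1/2) * (dd u (%x. G x v w) x + dd v (%x. G x u w) x - dd w (%x. G x u v) x)" for u v w x
 note b = bilinear_dd[OF S bil sm]
 note l = dd_linear[OF sm]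
 note simps = bilinear_ladd[OF b] bilinear_radd[OF b] bilinear_lmul[OF b] bilinear_rmul[OF b] linear_add[OF l] linear_scale[OF l]
 have lin: "linear (%w. k u v w x)" "linear (%v. k u v w x)" "linear (%u. k u v w x)" if "x : S" for u v w x
 unfolding k_def by (rule linearI; simp add: simps that algebra_simps)+
 define \<G> where "\<G> x u v = (SOME z. ALL w. G x z w = k u v w x)" for x u v
 have \<G>: "G x (\<G> x u v) w = k u v w x" if x: "x : S" for x u v w
 using someI_ex[OF riesz_bilinear[OF bil[OF x] pos[OF x] lin(1)[OF x]]] unfolding \<G>_def by blast
 have eqI: "z = z'" if "x : S" "!!w. G x z w = G x z' w" for x z z'
 by (rule posdef_eqI[OF bil[OF that(1)] pos[OF that(1)] that(2)])
 note gs = bilinear_ladd[OF bil] bilinear_lmul[OF bil]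
 have "connection S \<G>"
 proof
 show "bilinear (\<G> x)" if x: "x : S" for x
  unfolding bilinear_def
  by (intro conjI allI linearI; rule eqI[OF x]; simp add: \<G> x gs linear_add[OF lin(2)] linear_add[OF lin(3)] linear_scale[OF lin(2)] linear_scale[OF lin(3)])
 show "\<G> x u v = \<G> x v u" if x: "x : S" for x u v
 proof (rule eqI[OF x])
  have "dd w (%x. G x u v) x = dd w (%x. G x v u) x" for w by (rule dd_cong[OF S x]) (rule sym)
  then show "G x (\<G> x u v) w = G x (\<G> x v u) w" for w by (simp add: \<G> x k_def)
 qed
 have sk: "smooth_on S (k u v w)" for u v w
 proof -
  have "smooth_on S (%x. (1/2) *R (dd u (%x. G x v w) x + dd v (%x. G x u w) x - dd w (%x. G x u v) x))"
  by (intro smooth_scaleR smooth_add smooth_diff_fun smooth_dd sm S smooth_const)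
  then show ?thesis by (simp add: k_def[abs_def])
 qed
 show "smooth_on S (%x. \<G> x u v)" for u v by (rule smooth_on_metric_solve[OF S bil pos sym sm \<G> sk])
 qed (rule S)
 moreover have "dd u (%x. G x v w) x = G x (\<G> x u v) w + G x v (\<G> x u w)" if x: "x : S" for x u v w
 proof -
 have "dd z (%x. G x a b) x = dd z (%x. G x b a) x" for z a b by (rule dd_cong[OF S x]) (rule sym)
 note this[of v w u] this[of u v w] this[of u w v]
 then show ?thesis unfolding sym[OF x, of v] \<G>[OF x] k_def by (simp add: field_simps)
 qed
 ultimately show ?thesis by blast
qed

section \<open>The manifold seen through a parametrization by an open set\<close>

locale parametrization =
 fixes M :: "('m::{t2_space,second_countable_topology}, 'e::euclidean_space) almost_hermitian" and U :: "'e set" and f :: "'e => 'm" and g :: "'m => 'e"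
 assumes manifold: "smooth_manifold M" and open_U: "open U" and open_image: "open (f ` U)" and g_f: "!!x. x : U ==> g (f x) = x"
 and smooth_f: "smooth_into M U f" and smooth_g: "smooth_fun M (f ` U) g"
begin

text \<open>\<open>f\<close> and its inverse \<open>g\<close> read in the chart around c. A tangent
  vector at \<open>f x\<close> is represented in the chart centred at \<open>f x\<close>, so
  \<open>df x\<close> involves a different chart at every x.\<close>

abbreviation "\<p> c \<equiv> chart M c \<circ> f"
abbreviation "\<k> c \<equiv> g \<circ> chart_inv M c"
abbreviation "W c \<equiv> U \<inter> f -` cdom M c"
abbreviation "V c \<equiv> chart M c ` (f ` U \<inter> cdom M c)"
abbreviation "df \<equiv> map_differential M f"

lemma center: "q : cdom M q" and open_cdom: "open (cdom M c)"
 and chart_homeo: "homeomorphism (cdom M c) (chart M c ` cdom M c) (chart M c) (chart_inv M c)"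
 and open_chart: "open (chart M c ` cdom M c)"
 using manifold by (auto simp: smooth_manifold_def)

lemma chart_inv_chart: "q : cdom M c ==> chart_inv M c (chart M c q) = q"
 using chart_homeo[of c] by (simp add: homeomorphism_def)

lemma in_W: "x : U ==> x : W (f x)" using center by simp

lemma open_W: "open (W c)"
 using smooth_f open_U open_cdom[of c] by (simp add: smooth_into_def continuous_on_open_vimage Int_commute)

lemma open_V: "open (V c)"
proof -
 have "openin (top_of_set (cdom M c)) (f ` U \<inter> cdom M c)" using open_image by (simp add: openin_open_Int inf.commute)
 then have "openin (top_of_set (chart M c ` cdom M c)) (V c)" by (rule homeomorphism_imp_open_map[OF chart_homeo])
 then show ?thesis using openin_open_trans open_chart by blast
qed

lemma smooth_\<p>: "smooth_on (W c) (\<p> c)" using smooth_f by (simp add: smooth_into_def)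
lemma smooth_\<k>: "smooth_on (V c) (\<k> c)" using smooth_g by (simp add: smooth_fun_def)

lemma \<p>_V: "x : W c ==> \<p> c x : V c" by auto
lemma \<k>_W: "y : V c ==> \<k> c y : W c" by (auto simp: chart_inv_chart g_f)
lemma \<k>_\<p>: "x : W c ==> \<k> c (\<p> c x) = x" by (auto simp: chart_inv_chart g_f)
lemma \<p>_\<k>: "y : V c ==> \<p> c (\<k> c y) = y" by (auto simp: chart_inv_chart g_f)
lemma f_\<k>: "y : V c ==> f (\<k> c y) = chart_inv M c y" by (auto simp: chart_inv_chart g_f)

lemma df_eq: "df x u = dd u (\<p> (f x)) x" by (simp add: map_differential_def)

lemma df_linear: "x : U ==> linear (df x)"
 unfolding df_eq[abs_def] by (rule dd_linear[OF smooth_\<p> in_W])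

lemma d\<k>_d\<p>: "x : W c ==> dd (dd u (\<p> c) x) (\<k> c) (\<p> c x) = u"
proof -
 assume x: "x : W c"
 note d = has_derivative_compose[OF smooth_deriv[OF smooth_\<p> x] smooth_deriv[OF smooth_\<k> \<p>_V[OF x]]]
 have "dd u (%x. \<k> c (\<p> c x)) x = dd u (%x. x) x" by (rule dd_cong[OF open_W x \<k>_\<p>])
 then show ?thesis using dd_eqI[OF d, of u] dd_eqI[OF has_derivative_ident, of u x] by simp
qed

lemma d\<p>_d\<k>: "y : V c ==> dd (dd u (\<k> c) y) (\<p> c) (\<k> c y) = u"
proof -
 assume y: "y : V c"
 note d = has_derivative_compose[OF smooth_deriv[OF smooth_\<k> y] smooth_deriv[OF smooth_\<p> \<k>_W[OF y]]]
 have "dd u (%y. \<p> c (\<k> c y)) y = dd u (%y. y) y" by (rule dd_cong[OF open_V y \<p>_\<k>])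
 then show ?thesis using dd_eqI[OF d, of u] dd_eqI[OF has_derivative_ident, of u y] by simp
qed

definition dg :: "'e => 'e => 'e" where "dg x v = dd v (\<k> (f x)) (chart M (f x) (f x))"

lemma dg_df: "x : U ==> dg x (df x u) = u" and df_dg: "x : U ==> df x (dg x v) = v"
 using d\<k>_d\<p>[of x "f x" u] d\<p>_d\<k>[of "\<p> (f x) x" "f x" v] \<k>_\<p>[of x "f x"] in_W[of x] by (auto simp: dg_def df_eq)

lemma dg_linear: "x : U ==> linear (dg x)"
 unfolding dg_def[abs_def] by (rule dd_linear[OF smooth_\<k>]) (use center in auto)

lemma df_inject: "x : U ==> df x u = df x v ==> u = v" using dg_df by metis

lemma inv_df: "x : U ==> inv (df x) = dg x"
 by (rule inv_equality) (auto simp: dg_df df_dg)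

text \<open>The definitions on the manifold differentiate at the centre of the chart of the point;
  this converts such derivatives into derivatives at x.\<close>

lemma dd_through_chart:
 assumes x: "x : U" and h: "(h has_derivative h') (at x)" and eq: "!!y. y : S ==> k y = h (\<k> (f x) y)"
 and S: "open S" "chart M (f x) (f x) : S"
 shows "(k has_derivative (%v. h' (dg x v))) (at (chart M (f x) (f x)))"
proof -
 let ?c = "f x"
 have y: "chart M ?c ?c : V ?c" using x center by auto
 have xx: "\<k> ?c (chart M ?c ?c) = x" using \<k>_\<p>[OF in_W[OF x]] by simp
 have "((%y. h (\<k> ?c y)) has_derivative (%v. h' (dg x v))) (at (chart M ?c ?c))"
 using has_derivative_compose[OF smooth_deriv[OF smooth_\<k> y], of h h'] h xx by (simp add: dg_def)
 then show ?thesis by (rule has_derivative_transform_within_open[OF _ S]) (simp add: eq)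
qed

lemma dchart_df: "x : W c ==> dchart M c (f x) (df x u) = dd u (\<p> c) x"
proof -
 assume x: "x : W c"
 then have xU: "x : U" by simp
 let ?S = "V (f x) \<inter> \<k> (f x) -` W c"
 have "open ?S" by (rule continuous_open_preimage[OF smooth_cont[OF smooth_\<k>] open_V open_W])
 moreover have "chart M (f x) (f x) : ?S" using x center \<k>_\<p>[OF in_W[OF xU]] by (auto simp: chart_inv_chart g_f)
 moreover have "(chart M c \<circ> chart_inv M (f x)) y = \<p> c (\<k> (f x) y)" if "y : ?S" for y
 using that f_\<k>[of y "f x"] by auto
 ultimately have "(chart M c \<circ> chart_inv M (f x) has_derivative (%v. dd (dg x v) (\<p> c) x)) (at (chart M (f x) (f x)))"
 by (intro dd_through_chart[OF xU smooth_deriv[OF smooth_\<p> x], of ?S]) auto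
 from dd_eqI[OF this] show ?thesis by (simp add: dchart_def dg_df xU)
qed

lemma coord_field_df: "x : W c ==> coord_field M c w (f x) = df x (dd w (\<k> c) (\<p> c x))"
proof -
 assume x: "x : W c"
 then have xU: "x : U" by simp
 let ?S = "V c \<inter> \<k> c -` W (f x)"
 have S: "open ?S" by (rule continuous_open_preimage[OF smooth_cont[OF smooth_\<k>] open_V open_W])
 have y: "\<p> c x : ?S" "\<p> c x : V c" using x center by (auto simp: chart_inv_chart g_f)
 have "((%y. \<p> (f x) (\<k> c y)) has_derivative (%w. df x (dd w (\<k> c) (\<p> c x)))) (at (\<p> c x))"
 unfolding df_eq
 by (rule has_derivative_compose[OF smooth_deriv[OF smooth_\<k> y(2)]])
  (simp only: \<k>_\<p>[OF x] smooth_deriv[OF smooth_\<p> in_W[OF xU]])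
 then have "(chart M (f x) \<circ> chart_inv M c has_derivative (%w. df x (dd w (\<k> c) (\<p> c x)))) (at (\<p> c x))"
 by (rule has_derivative_transform_within_open[OF _ S y(1)]) (use f_\<k>[of _ c] in auto)
 from dd_eqI[OF this] show ?thesis by (simp add: coord_field_def)
qed

lemma dir_deriv_df:
 assumes x: "x : U" and h: "(h has_derivative h') (at x)" and eq: "!!z. z : S ==> k (f z) = h z" and S: "open S" "x : S" "S \<subseteq> U"
 shows "dir_deriv M k (f x) (df x u) = h' u"
proof -
 let ?S = "V (f x) \<inter> \<k> (f x) -` S"
 have "open ?S" by (rule continuous_open_preimage[OF smooth_cont[OF smooth_\<k>] open_V S(1)])
 moreover have "chart M (f x) (f x) : ?S" using x S(2) center by (auto simp: chart_inv_chart g_f)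
 moreover have "(k \<circ> chart_inv M (f x)) y = h (\<k> (f x) y)" if "y : ?S" for y
 using that f_\<k>[of y "f x"] eq[of "\<k> (f x) y"] by auto
 ultimately have "(k \<circ> chart_inv M (f x) has_derivative (%v. h' (dg x v))) (at (chart M (f x) (f x)))"
 by (intro dd_through_chart[OF x h, of ?S]) auto
 from dd_eqI[OF this] show ?thesis by (simp add: dir_deriv_def dg_df x)
qed

definition push :: "('e => 'e) => 'm => 'e" where "push b m = df (g m) (b (g m))"

lemma push_f: "x : U ==> push b (f x) = df x (b x)" by (simp add: push_def g_f)

lemma components_eq:
 assumes "ALL z:S. Y (f z) = df z (b z)" "S \<subseteq> U" "y : V c" "\<k> c y : S"
 shows "components M c Y y = dd (b (\<k> c y)) (\<p> c) (\<k> c y)"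
 using bspec[OF assms(1,4)] dchart_df[OF \<k>_W[OF assms(3)]] f_\<k>[OF assms(3)] by (simp add: components_def)

lemma smooth_field_push:
 assumes Y: "ALL z:S. Y (f z) = df z (b z)" and S: "open S" "S \<subseteq> U" and b: "smooth_on S b"
 shows "smooth_field M (f ` S) Y" "open (f ` S)"
proof -
 have o: "open (V c \<inter> \<k> c -` S)" for c
 by (rule continuous_open_preimage[OF smooth_cont[OF smooth_\<k>] open_V S(1)])
 have eq: "chart M c ` (f ` S \<inter> cdom M c) = V c \<inter> \<k> c -` S" for c
 proof (intro equalityI subsetI)
 fix y assume "y : chart M c ` (f ` S \<inter> cdom M c)"
 then obtain z where z: "z : S" "f z : cdom M c" "y = \<p> c z" by auto
 then have "z : W c" using S(2) by auto
 then show "y : V c \<inter> \<k> c -` S" using \<p>_V[of z c] \<k>_\<p>[of z c] z by auto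
 next
 fix y assume y: "y : V c \<inter> \<k> c -` S"
 then show "y : chart M c ` (f ` S \<inter> cdom M c)"
  using \<p>_\<k>[of y c] \<k>_W[of y c] by (intro image_eqI[of _ _ "f (\<k> c y)"]) auto
 qed
 show "smooth_field M (f ` S) Y"
 unfolding smooth_field_def eq
 proof
 fix c
 let ?T = "V c \<inter> \<k> c -` S"
 have "smooth_on (W c \<inter> S) (%z. dd (b z) (\<p> c) z)"
  by (rule smooth_on_dd_var[OF open_Int[OF open_W S(1)] smooth_subset[OF smooth_\<p>] smooth_subset[OF b]]) auto
 then have "smooth_on ?T (%y. dd (b (\<k> c y)) (\<p> c) (\<k> c y))"
  by (intro smooth_compose[where g = "\<k> c" and T = "W c \<inter> S" and f = "%z. dd (b z) (\<p> c) z", OF o open_Int[OF open_W S(1)]]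
   smooth_subset[OF smooth_\<k>]) (use \<k>_W[of _ c] in auto)
 then show "smooth_on ?T (components M c Y)"
  using smooth_cong[OF o, of c "components M c Y"] components_eq[OF Y S(2)] by auto
 qed
 show "open (f ` S)"
 proof (subst open_subopen, intro ballI)
 fix m assume m: "m : f ` S"
 have h: "homeomorphism (chart M m ` cdom M m) (cdom M m) (chart_inv M m) (chart M m)"
  using chart_homeo homeomorphism_symD by blast
 have "openin (top_of_set (chart M m ` cdom M m)) (chart M m ` (f ` S \<inter> cdom M m))"
  unfolding eq by (rule open_subset) (use o[of m] in auto)
 then have "openin (top_of_set (cdom M m)) (chart_inv M m ` chart M m ` (f ` S \<inter> cdom M m))"
  by (rule homeomorphism_imp_open_map[OF h])
 moreover have "chart_inv M m ` chart M m ` (f ` S \<inter> cdom M m) = f ` S \<inter> cdom M m"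
  by (force simp: chart_inv_chart image_iff)
 ultimately show "EX T. open T & m : T & T \<subseteq> f ` S"
  using openin_open_trans[OF _ open_cdom] m center by (metis IntI Int_lower1)
 qed
qed

text \<open>The first summand is a second derivative of the parametrization. It is symmetric and
  drops out of brackets; in \<open>nabla_push\<close> the transformation law of
  \<open>christoffel\<close> cancels it.\<close>

lemma components_derivative:
 assumes Y: "ALL z:S. Y (f z) = df z (b z)" and S: "open S" "S \<subseteq> U" and b: "smooth_on S b" and x: "x : S"
 shows "frechet_derivative (components M (f x) Y) (at (chart M (f x) (f x))) (df x a) =
 dd a (dd (b x) (\<p> (f x))) x + df x (dd a b x)"
proof -
 let ?c = "f x"
 have xU: "x : U" using x S by auto
 note xW = in_W[OF xU]
 have "((%z. dd (b z) (\<p> ?c) z) has_derivative (%h. dd h (dd (b x) (\<p> ?c)) x + dd (dd h b x) (\<p> ?c) x)) (at x)"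
 by (rule linear_field_deriv[OF open_W xW, where T = "%z v. dd v (\<p> ?c) z" and T' = "%v h. dd h (dd v (\<p> ?c)) x"])
  (use dd_linear[OF smooth_\<p>] smooth_deriv[OF smooth_dd[OF smooth_\<p>] xW] smooth_deriv[OF b x] in auto)
 note d = dd_through_chart[OF xU this]
 let ?T = "V ?c \<inter> \<k> ?c -` S"
 have "open ?T" by (rule continuous_open_preimage[OF smooth_cont[OF smooth_\<k>] open_V S(1)])
 moreover have "chart M ?c ?c : ?T" using x xU center by (auto simp: chart_inv_chart g_f)
 moreover have "components M ?c Y y = dd (b (\<k> ?c y)) (\<p> ?c) (\<k> ?c y)" if "y : ?T" for y
 using components_eq[OF Y S(2)] that by auto
 ultimately have "(components M ?c Y has_derivative (%v. dd (dg x v) (dd (b x) (\<p> ?c)) x + dd (dd (dg x v) b x) (\<p> ?c) x)) (at (chart M ?c ?c))"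
 by (intro d[of ?T]) auto
 from dd_eqI[OF this, of "df x a"] show ?thesis unfolding dg_df[OF xU] df_eq[symmetric] .
qed

lemma lie_bracket_push:
 assumes X: "ALL z:S. X (f z) = df z (a z)" and Y: "ALL z:S. Y (f z) = df z (b z)"
 and S: "open S" "S \<subseteq> U" and sm: "smooth_on S a" "smooth_on S b" and x: "x : S"
 shows "lie_bracket M X Y (f x) = df x (dd (a x) b x - dd (b x) a x)"
proof -
 have xU: "x : U" using x S by auto
 note 1 = components_derivative[OF Y S sm(2) x]
 components_derivative[OF X S sm(1) x]
 show ?thesis
 unfolding lie_bracket_def bspec[OF X x] bspec[OF Y x] 1
 using dd_commute[OF open_W smooth_\<p> in_W[OF xU], of "a x" "b x"] linear_diff[OF df_linear[OF xU]] by simp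
qed

end

section \<open>Connection, curvature, Killing fields and potentials in coordinates\<close>

locale riemannian_parametrization = parametrization +
 assumes riemannian: "riemannian_metric M"
begin

definition G where "G x u v = metric M (f x) (df x u) (df x v)"
definition \<G> where "\<G> = (SOME \<G>. connection U \<G> & (ALL x:U. ALL u v w. dd u (%x. G x v w) x = G x (\<G> x u v) w + G x v (\<G> x u w)))"

lemma metric_props: "bilinear (metric M q)" "metric M q u v = metric M q v u" "u ~= 0 ==> metric M q u u > 0"
 using riemannian by (auto simp: riemannian_metric_def)

lemma G_props:
 assumes x: "x : U"
 shows "bilinear (G x)" "G x u v = G x v u" "u ~= 0 ==> G x u u > 0"
proof -
 note l = df_linear[OF x]
 show "bilinear (G x)"
 unfolding bilinear_def G_def
 by (intro conjI allI linearI; simp add: linear_add[OF l] linear_scale[OF l]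
  bilinear_ladd[OF metric_props(1)] bilinear_radd[OF metric_props(1)] bilinear_lmul[OF metric_props(1)] bilinear_rmul[OF metric_props(1)])
 show "G x u v = G x v u" by (simp add: G_def metric_props(2))
 show "G x u u > 0" if "u ~= 0"
 using that dg_df[OF x, of u] linear_0[OF dg_linear[OF x]] by (auto simp: G_def intro: metric_props(3))
qed

lemma smooth_G: "smooth_on U (%x. G x u v)"
proof (rule smooth_on_local)
 fix x assume x: "x : U"
 let ?c = "f x"
 let ?H = "%y a b. metric M (chart_inv M ?c y) (coord_field M ?c a (chart_inv M ?c y)) (coord_field M ?c b (chart_inv M ?c y))"
 have H: "smooth_on (chart M ?c ` cdom M ?c) (%y. ?H y a b)" for a b
 proof -
 have "smooth_fun M (cdom M ?c) (%q. metric M q (coord_field M ?c a q) (coord_field M ?c b q))"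
  using riemannian unfolding riemannian_metric_def by blast
 then have "smooth_on (chart M ?c ` (cdom M ?c \<inter> cdom M ?c)) ((%q. metric M q (coord_field M ?c a q) (coord_field M ?c b q)) \<circ> chart_inv M ?c)"
  unfolding smooth_fun_def by blast
 then show ?thesis by (simp add: comp_def)
 qed
 have l: "linear (%a. coord_field M ?c a (f z))" if "z : W ?c" for z
 unfolding coord_field_df[OF that]
 using linear_compose[OF dd_linear[OF smooth_\<k> \<p>_V[OF that]] df_linear[of z]] that by (simp add: comp_def)
 have "smooth_on (W ?c) (%z. ?H (\<p> ?c z) (dd u (\<p> ?c) z) (dd v (\<p> ?c) z))"
 proof (rule smooth_bilinear_field[where T = "%z. ?H (\<p> ?c z)", OF open_W])
 show "bilinear (?H (\<p> ?c z))" if "z : W ?c" for z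
  using that unfolding bilinear_def
  by (intro conjI allI linearI; simp add: chart_inv_chart linear_add[OF l[OF that]] linear_scale[OF l[OF that]]
  bilinear_ladd[OF metric_props(1)] bilinear_radd[OF metric_props(1)] bilinear_lmul[OF metric_props(1)] bilinear_rmul[OF metric_props(1)])
 show "smooth_on (W ?c) (%z. ?H (\<p> ?c z) a b)" for a b
  by (rule smooth_compose[OF open_W open_chart _ H smooth_\<p>]) auto
 qed (intro smooth_dd smooth_\<p>)+
 then have sm: "smooth_on (W ?c) (%z. ?H (\<p> ?c z) (dd u (\<p> ?c) z) (dd v (\<p> ?c) z))" .
 have eq: "?H (\<p> ?c z) (dd u (\<p> ?c) z) (dd v (\<p> ?c) z) = G z u v" if z: "z : W ?c" for z
 using z coord_field_df[OF z] d\<k>_d\<p>[OF z] by (simp add: G_def chart_inv_chart)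
 have "smooth_on (W ?c) (%x. G x u v)" by (rule smooth_cong[OF open_W, THEN iffD1, OF _ sm]) (rule eq)
 then show "EX T. open T & x : T & smooth_on T (%x. G x u v)" using in_W[OF x] open_W by blast
qed

sublocale metric_connection U \<G> G
proof -
 have *: "connection U \<G> & (ALL x:U. ALL u v w. dd u (%x. G x v w) x = G x (\<G> x u v) w + G x v (\<G> x u w))"
 unfolding \<G>_def by (rule someI_ex[OF levi_civita_exists[OF open_U G_props smooth_G]])
 show "metric_connection U \<G> G"
 using * G_props smooth_G by (intro metric_connection.intro metric_connection_axioms.intro) auto
qed

lemma d\<p>_has_derivative:
 assumes x: "x : W c" and b: "(b has_derivative b') (at x)"
 shows "((%z. dd (b z) (\<p> c) z) has_derivative (%h. dd h (dd (b x) (\<p> c)) x + dd (b' h) (\<p> c) x)) (at x)"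
 by (rule linear_field_deriv[OF open_W x, where T = "%z v. dd v (\<p> c) z" and T' = "%v h. dd h (dd v (\<p> c)) x"])
 (use dd_linear[OF smooth_\<p>] smooth_deriv[OF smooth_dd[OF smooth_\<p>] x] b in auto)

lemma smooth_d\<k>: "smooth_on (W c) (%z. dd v (\<k> c) (\<p> c z))"
 by (rule smooth_compose[OF open_W open_V \<p>_V smooth_dd[OF smooth_\<k>] smooth_\<p>])

text \<open>The transformation law of Christoffel symbols. As \<open>christoffel\<close> is a
  definite description, the candidate \<open>C\<close> is checked against its defining conditions,
  and the Koszul formula gives uniqueness.\<close>

lemma christoffel_df:
 assumes x: "x : U"
 shows "christoffel M (f x) (df x u) (df x v) = df x (\<G> x u v) - dd u (dd v (\<p> (f x))) x"
proof -
 let ?q = "f x"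
 note xW = in_W[OF x]
 define C where "C u v = df x (\<G> x (dg x u) (dg x v)) - dd (dg x u) (dd (dg x v) (\<p> ?q)) x" for u v
 note dl = dd_linear[OF smooth_dd[OF smooth_\<p>] xW]
 have C_sym: "C u v = C v u" for u v
 using \<G>_sym[OF x] dd_commute[OF open_W smooth_\<p> xW] by (simp add: C_def)
 have "linear (%u. C u v)" for v
 unfolding C_def
 by (intro linear_compose_sub linear_compose[OF dg_linear[OF x], unfolded comp_def] linear_compose[OF \<G>_linear(2)[OF x] df_linear[OF x], unfolded comp_def] dl)
 then have C_bil: "bilinear C" using C_sym unfolding bilinear_def by (metis (no_types, lifting) ext)
 \<comment> \<open>\<open>C\<close> is the covariant derivative of a coordinate field of the chart
   at \<open>f x\<close>; its derivative in U is found by differentiating the relation that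
   \<open>\<p>\<close> and \<open>\<k>\<close> have inverse differentials.\<close>
 have dv: "df x (nab a (%z. dd v (\<k> ?q) (\<p> ?q z)) x) = C (df x a) v" for a v
 proof -
 let ?v = "%z. dd v (\<k> ?q) (\<p> ?q z)"
 have v0: "?v x = dg x v" by (simp add: dg_def)
 have "dd a (%z. dd (?v z) (\<p> ?q) z) x = dd a (%z. v) x"
  by (rule dd_cong[OF open_W xW]) (use d\<p>_d\<k>[OF \<p>_V] \<k>_\<p> in metis)
 then have "dd a (dd (?v x) (\<p> ?q)) x + dd (dd a ?v x) (\<p> ?q) x = 0"
  using dd_eqI[OF d\<p>_has_derivative[OF xW smooth_deriv[OF smooth_d\<k> xW]], of v a] by simp
 then have "df x (dd a ?v x) = - dd a (dd (dg x v) (\<p> ?q)) x" unfolding v0 df_eq[symmetric] by (simp add: eq_neg_iff_add_eq_0 add.commute)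
 then show ?thesis unfolding cov_def v0 linear_add[OF df_linear[OF x]] by (simp add: C_def dg_df x)
 qed
 have C_compat: "dir_deriv M (%r. metric M r (coord_field M ?q v r) (coord_field M ?q w r)) ?q u = metric M ?q (C u v) w + metric M ?q v (C u w)" for u v w
 proof -
 let ?v = "%v z. dd v (\<k> ?q) (\<p> ?q z)"
 have u: "u = df x (dg x u)" using df_dg[OF x] by simp
 interpret L: metric_connection "W ?q" \<G> G
  using metric_connection_axioms open_W by (intro metric_connection_subset) auto
 have "dir_deriv M (%r. metric M r (coord_field M ?q v r) (coord_field M ?q w r)) ?q (df x (dg x u)) = dd (dg x u) (%z. G z (?v v z) (?v w z)) x"
 proof (rule dir_deriv_df[OF x smooth_deriv[OF _ xW] _ open_W xW])
  show "smooth_on (W ?q) (%z. G z (?v v z) (?v w z))"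
  by (rule smooth_bilinear_field[OF open_W L.G_bil L.G_smooth smooth_d\<k> smooth_d\<k>])
 qed (auto simp: G_def coord_field_df)
 also have "... = G x (nab (dg x u) (?v v) x) (dg x w) + G x (dg x v) (nab (dg x u) (?v w) x)"
  using L.dd_G_field[OF xW smooth_d\<k> smooth_d\<k>] by (simp add: dg_def)
 also have "... = metric M ?q (C u v) w + metric M ?q v (C u w)"
  unfolding G_def dv df_dg[OF x] ..
 finally show ?thesis using u by simp
 qed
 have "christoffel M ?q = C"
 unfolding christoffel_def
 proof (rule the_equality)
 show "bilinear C & (ALL u v. C u v = C v u) & (ALL u v w. dir_deriv M (%r. metric M r (coord_field M ?q v r) (coord_field M ?q w r)) ?q u =
  metric M ?q (C u v) w + metric M ?q v (C u w))"
  by (intro conjI allI C_bil) (rule C_sym, rule C_compat)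
 fix C' assume C': "bilinear C' & (ALL u v. C' u v = C' v u) & (ALL u v w. dir_deriv M (%r. metric M r (coord_field M ?q v r) (coord_field M ?q w r)) ?q u =
  metric M ?q (C' u v) w + metric M ?q v (C' u w))"
 note sym' = C'[THEN conjunct2, THEN conjunct1, rule_format] and compat' = C'[THEN conjunct2, THEN conjunct2, rule_format, symmetric]
 show "C' = C"
  by (rule koszul_unique[where g = "metric M ?q" and k = "%u v w. dir_deriv M (%r. metric M r (coord_field M ?q v r) (coord_field M ?q w r)) ?q u"])
  (rule metric_props sym' compat' C_sym C_compat[symmetric] | assumption)+
 qed
 then show ?thesis by (simp add: C_def dg_df x)
qed

lemma nabla_push:
 assumes X: "X (f x) = df x a" and Y: "ALL z:S. Y (f z) = df z (b z)" and S: "open S" "S \<subseteq> U" and b: "smooth_on S b" and x: "x : S"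
 shows "nabla M X Y (f x) = df x (nab a b x)"
proof -
 have xU: "x : U" using x S by auto
 show ?thesis
 unfolding nabla_def X bspec[OF Y x] components_derivative[OF Y S b x] christoffel_df[OF xU] cov_def linear_add[OF df_linear[OF xU]] by simp
qed

text \<open>The coordinate fields in the definition of \<open>curvature\<close> have the nonconstant
  components \<open>k u\<close> here, so the Ricci identity is needed with its bracket term.\<close>

lemma curvature_df:
 assumes x: "x : U"
 shows "curvature M (f x) (df x u) (df x v) (df x w) = df x (R x u v w)"
proof -
 let ?q = "f x"
 let ?S = "W ?q"
 note xW = in_W[OF x] and sub = Int_lower1[of U "f -` cdom M ?q"]
 interpret L: connection ?S \<G> using metric_connection_subset[OF open_W sub] metric_connection_def by blast
 define k where "k u z = dd (df x u) (\<k> ?q) (\<p> ?q z)" for u z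
 have k: "ALL z:?S. coord_field M ?q (df x u) (f z) = df z (k u z)" for u by (simp add: coord_field_df k_def)
 have kx: "k u x = u" for u using dg_df[OF x] by (simp add: k_def dg_def)
 have sk: "smooth_on ?S (k u)" for u unfolding k_def[abs_def] by (rule smooth_d\<k>)
 have smd: "smooth_on ?S (%z. nab (k u z) (k v) z)" for u v
 unfolding cov_def by (intro smooth_add open_W smooth_on_dd_var sk L.smooth_\<G>_field)
 let ?X = "%u. coord_field M ?q (df x u)"
 have n1: "ALL z:?S. nabla M (?X u) (?X v) (f z) = df z (nab (k u z) (k v) z)" for u v
 proof
 fix z assume z: "z : ?S"
 show "nabla M (?X u) (?X v) (f z) = df z (nab (k u z) (k v) z)"
  by (rule nabla_push[OF _ k open_W sub sk z]) (rule bspec[OF k z])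
 qed
 have n2: "nabla M (?X u) (nabla M (?X v) (?X w)) ?q = df x (nab u (%z. nab (k v z) (k w) z) x)" for u v w
 by (rule nabla_push[OF _ n1 open_W sub smd xW]) (use bspec[OF k xW, of u] in \<open>simp add: kx\<close>)
 have n3: "nabla M (lie_bracket M (?X u) (?X v)) (?X w) ?q = df x (nab (dd u (k v) x - dd v (k u) x) (k w) x)"
 by (rule nabla_push[OF _ k open_W sub sk xW]) (use lie_bracket_push[OF k k open_W sub sk sk xW, of u v] in \<open>simp add: kx\<close>)
 show ?thesis
 unfolding curvature_def curvature_field_def n2 n3
 using L.ricci_identity_field[OF xW sk[of u] sk[of v] sk[of w]] by (simp add: kx linear_diff[OF df_linear[OF x], symmetric])
qed

end


locale hermitean_parametrization = riemannian_parametrization M U f g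
 for M :: "('m::{t2_space,second_countable_topology}, 'e::euclidean_space) almost_hermitian" and U f g +
 fixes I :: "'e => 'e"
 assumes hss: "hermitean_symmetric_space M"
 and hol: "!!x u. x : U ==> df x (I u) = cplx M (f x) (df x u)"
begin

lemma cplx_props: "linear (cplx M q)" "cplx M q (cplx M q u) = - u" "metric M q (cplx M q u) (cplx M q v) = metric M q u v"
 using hss by (auto simp: hermitean_symmetric_space_def kahler_manifold_def orthogonal_almost_complex_def)

text \<open>Constant fields are pushed to the manifold, where the parallelism conditions are stated,
  and the results are pulled back by injectivity of \<open>df x\<close>. The algebra of the constant
  \<open>I\<close> is read off at one point, so U must not be empty.\<close>

lemma local_symmetric: "U ~= {} ==> local_symmetric U \<G> G I"
proof (intro local_symmetric.intro[OF metric_connection_axioms] local_symmetric_axioms.intro)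
 assume "U ~= {}"
 then obtain x0 where x0: "x0 : U" by blast
 note l = df_linear[OF x0]
 show "linear I"
 by (rule linearI; rule df_inject[OF x0])
  (simp_all add: hol x0 linear_add[OF l] linear_scale[OF l] linear_add[OF cplx_props(1)] linear_scale[OF cplx_props(1)])
 show "I (I u) = - u" for u
 by (rule df_inject[OF x0]) (simp add: hol x0 cplx_props(2) linear_neg[OF l])
 show "G x (I u) (I v) = G x u v" if "x : U" for x u v using that by (simp add: G_def hol cplx_props(3))
 have push: "ALL z:U. push b (f z) = df z (b z)" for b by (simp add: push_f)
 note sf = smooth_field_push(1)[OF push open_U subset_refl smooth_const]
 note np = nabla_push[OF _ push open_U subset_refl]
 have pc: "parallel_cplx M" and pR: "parallel_curvature M"
 using hss by (auto simp: hermitean_symmetric_space_def kahler_manifold_def)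
 show "\<G> x u (I v) = I (\<G> x u v)" if x: "x : U" for x u v
 proof (rule df_inject[OF x])
 have "nabla M (push (%_. u)) (%r. cplx M r (push (%_. v) r)) (f x) = cplx M (f x) (nabla M (push (%_. u)) (push (%_. v)) (f x))"
  using pc[unfolded parallel_cplx_def, rule_format, OF conjI[OF open_image conjI[OF sf sf]] imageI[OF x]] .
 moreover have "nabla M (push (%_. u)) (%r. cplx M r (push (%_. v) r)) (f x) = df x (nab u (%_. I v) x)"
  by (rule nabla_push[OF _ _ open_U subset_refl smooth_const x]) (simp_all add: push_f hol x)
 moreover have "nabla M (push (%_. u)) (push (%_. v)) (f x) = df x (nab u (%_. v) x)"
  by (rule np[OF _ smooth_const x]) (simp add: push_f x)
 ultimately show "df x (\<G> x u (I v)) = df x (I (\<G> x u v))" using x by (simp add: nab_const hol)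
 qed
 show "nab t (%y. R y u v w) x = R x (\<G> x t u) v w + R x u (\<G> x t v) w + R x u v (\<G> x t w)" if x: "x : U" for x t u v w
 proof (rule df_inject[OF x])
 let ?p = "%u. push (%_. u)"
 have "nabla M (?p t) (%r. curvature M r (?p u r) (?p v r) (?p w r)) (f x) = curvature M (f x) (nabla M (?p t) (?p u) (f x)) (?p v (f x)) (?p w (f x))
  + curvature M (f x) (?p u (f x)) (nabla M (?p t) (?p v) (f x)) (?p w (f x)) + curvature M (f x) (?p u (f x)) (?p v (f x)) (nabla M (?p t) (?p w) (f x))"
  using pR[unfolded parallel_curvature_def, rule_format, OF conjI[OF open_image conjI[OF sf conjI[OF sf conjI[OF sf sf]]]] imageI[OF x]] .
 moreover have "nabla M (?p t) (%r. curvature M r (?p u r) (?p v r) (?p w r)) (f x) = df x (nab t (%y. R y u v w) x)"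
  by (rule nabla_push[OF _ _ open_U subset_refl smooth_R x]) (simp_all add: push_f curvature_df x)
 moreover have "nabla M (?p t) (?p u) (f x) = df x (\<G> x t u)" for u
 proof -
  have "nabla M (?p t) (?p u) (f x) = df x (nab t (%_. u) x)" by (rule np[OF _ smooth_const x]) (simp add: push_f x)
  then show ?thesis by (simp add: nab_const)
 qed
 ultimately show "df x (nab t (%y. R y u v w) x) = df x (R x (\<G> x t u) v w + R x u (\<G> x t v) w + R x u v (\<G> x t w))"
  using x by (simp add: push_f curvature_df linear_add[OF df_linear[OF x]])
 qed
qed

end

context riemannian_parametrization begin

lemma killing_field_local:
 assumes kf: "killing_field M \<x>"
 shows "smooth_on U (%x. dg x (\<x> (f x)))"
 and "x : U ==> dd (dg x (\<x> (f x))) (%y. G y u v) x + G x (dd u (%x. dg x (\<x> (f x))) x) v + G x u (dd v (%x. dg x (\<x> (f x))) x) = 0"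
proof -
 let ?\<x> = "%x. dg x (\<x> (f x))"
 have \<x>: "ALL z:U. \<x> (f z) = df z (?\<x> z)" by (simp add: df_dg)
 show s: "smooth_on U ?\<x>"
 proof (rule smooth_on_local)
 fix x assume x: "x : U"
 let ?c = "f x"
 have "smooth_on (V ?c) (components M ?c \<x>)"
  using kf unfolding killing_field_def smooth_field_def by (auto intro: smooth_subset)
 then have "smooth_on (V ?c) (%y. dd (components M ?c \<x> y) (\<k> ?c) y)" by (rule smooth_on_dd_var[OF open_V smooth_\<k>])
 then have sm: "smooth_on (W ?c) (%z. dd (components M ?c \<x> (\<p> ?c z)) (\<k> ?c) (\<p> ?c z))"
  using smooth_compose[OF open_W open_V \<p>_V _ smooth_\<p>] by blast
 have eq: "dd (components M ?c \<x> (\<p> ?c z)) (\<k> ?c) (\<p> ?c z) = ?\<x> z" if z: "z : W ?c" for z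
  using components_eq[OF \<x> subset_refl \<p>_V[OF z]] d\<k>_d\<p>[OF z] \<k>_\<p>[OF z] z by simp
 have "smooth_on (W ?c) ?\<x>" by (rule smooth_cong[OF open_W, THEN iffD1, OF _ sm]) (rule eq)
 then show "EX T. open T & x : T & smooth_on T ?\<x>" using in_W[OF x] open_W by blast
 qed
 assume x: "x : U"
 have push: "ALL z:U. push b (f z) = df z (b z)" for b by (simp add: push_f)
 note sf = smooth_field_push(1)[OF push open_U subset_refl smooth_const]
 let ?p = "%u. push (%_. u)"
 have "dir_deriv M (%r. metric M r (?p u r) (?p v r)) (f x) (\<x> (f x)) =
 metric M (f x) (lie_bracket M \<x> (?p u) (f x)) (?p v (f x)) + metric M (f x) (?p u (f x)) (lie_bracket M \<x> (?p v) (f x))"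
 using kf open_image sf[of u] sf[of v] x unfolding killing_field_def by (meson imageI)
 moreover have "dir_deriv M (%r. metric M r (?p u r) (?p v r)) (f x) (df x (?\<x> x)) = dd (?\<x> x) (%y. G y u v) x"
 by (rule dir_deriv_df[OF x smooth_deriv[OF smooth_G x] _ open_U x subset_refl]) (simp add: push_f G_def)
 moreover have "lie_bracket M \<x> (?p u) (f x) = df x (- dd u ?\<x> x)" for u
 using lie_bracket_push[OF \<x> push open_U subset_refl s smooth_const x] dd_eqI[OF has_derivative_const] by simp
 ultimately have "dd (?\<x> x) (%y. G y u v) x = G x (- dd u ?\<x> x) v + G x u (- dd v ?\<x> x)"
 using x by (simp add: df_dg push_f G_def)
 then show "dd (?\<x> x) (%y. G y u v) x + G x (dd u ?\<x> x) v + G x u (dd v ?\<x> x) = 0" by (simp add: G_simps x)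
qed

end

context hermitean_parametrization begin

text \<open>The coordinate fields of the chart are not constant in U. Their derivatives, collected
  in the terms \<open>A (dd a (k b) x) x\<close>, cancel against the bracket term of
  \<open>ext_deriv\<close>, so only second derivatives of the potential remain.\<close>

lemma local_potential_levi:
 assumes lp: "local_potential M P \<q>" and S: "open S" "S \<subseteq> U" "f ` S \<subseteq> P"
 shows "smooth_on S (\<q> \<circ> f)"
 and "x : S ==> G x u v = (dd u (dd v (\<q> \<circ> f)) x + dd (I u) (dd (I v) (\<q> \<circ> f)) x) / 4"
proof -
 let ?t = "\<q> \<circ> f"
 show s: "smooth_on S ?t"
 proof (rule smooth_on_local)
 fix x assume x: "x : S"
 let ?c = "f x"
 have sP: "smooth_on (chart M ?c ` (P \<inter> cdom M ?c)) (\<q> \<circ> chart_inv M ?c)" and oP: "open P"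
  using lp by (auto simp: local_potential_def smooth_fun_def)
 have oPc: "open (chart M ?c ` (P \<inter> cdom M ?c))"
 proof -
  have "openin (top_of_set (cdom M ?c)) (P \<inter> cdom M ?c)" using openin_open_Int[OF oP, of "cdom M ?c"] by (simp add: Int_commute)
  from homeomorphism_imp_open_map[OF chart_homeo this] show ?thesis using openin_open_trans open_chart by blast
 qed
 have sm: "smooth_on (S \<inter> W ?c) (%z. (\<q> \<circ> chart_inv M ?c) (\<p> ?c z))"
  by (rule smooth_compose[OF open_Int[OF S(1) open_W] oPc _ sP smooth_subset[OF smooth_\<p>]]) (use S in auto)
 have "smooth_on (S \<inter> W ?c) ?t"
  by (rule smooth_cong[OF open_Int[OF S(1) open_W], THEN iffD1, OF _ sm]) (auto simp: chart_inv_chart)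
 then show "EX T. open T & x : T & smooth_on T ?t"
  using in_W[of x] x S open_W by (intro exI[of _ "S \<inter> W ?c"]) auto
 qed
 assume x: "x : S"
 then have xU: "x : U" and xP: "f x : P" using S by auto
 interpret local_symmetric U \<G> G I by (rule local_symmetric) (use xU in blast)
 let ?q = "f x"
 note xW = in_W[OF xU]
 let ?T = "S \<inter> W ?q"
 have T: "open ?T" "x : ?T" "?T \<subseteq> U" using S x xW open_W by auto
 have sT: "smooth_on ?T ?t" by (rule smooth_subset[OF s]) auto
 have db: "delbar M \<q> (f z) (df z a) = (complex_of_real (dd a ?t z) + \<i> * complex_of_real (dd (I a) ?t z)) / 2" if z: "z : ?T" for z a
 proof -
 have zS: "z : S" and zU: "z : U" using z by auto
 have "dir_deriv M \<q> (f z) (df z a) = dd a ?t z" for a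
  by (rule dir_deriv_df[OF zU smooth_deriv[OF s zS] _ S(1) zS S(2)]) simp
 then show ?thesis by (simp add: delbar_def hol[OF zU, symmetric])
 qed
 define k where "k a z = dd (df x a) (\<k> ?q) (\<p> ?q z)" for a z
 have k: "ALL z:?T. coord_field M ?q (df x a) (f z) = df z (k a z)" for a by (simp add: coord_field_df k_def)
 have kx: "k a x = a" for a using dg_df[OF xU] by (simp add: k_def dg_def)
 have sk: "smooth_on ?T (k a)" for a unfolding k_def[abs_def] by (rule smooth_subset[OF smooth_d\<k>]) auto
 define A where "A a z = (complex_of_real (dd a ?t z) + \<i> * complex_of_real (dd (I a) ?t z)) / 2" for a z
 have Al: "A (a - b) z = A a z - A b z" if "z : ?T" for a b z
 unfolding A_def linear_diff[OF I_linear] linear_diff[OF dd_linear[OF sT that]] by (simp add: field_simps)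
 have dk: "((%z. dd (k a z) ?t z) has_derivative (%h. dd h (dd a ?t) x + dd (dd h (k a) x) ?t x)) (at x)"
 "((%z. dd (I (k a z)) ?t z) has_derivative (%h. dd h (dd (I a) ?t) x + dd (I (dd h (k a) x)) ?t x)) (at x)" for a
 proof -
 note d = linear_field_deriv[OF T(1,2), where T = "%z v. dd v ?t z" and T' = "%v h. dd h (dd v ?t) x",
  OF dd_linear[OF sT] smooth_deriv[OF smooth_dd[OF sT] T(2)]]
 have c: "(k a has_derivative (%h. dd h (k a) x)) (at x)" by (rule smooth_deriv[OF sk T(2)])
 from d[OF _ c] show "((%z. dd (k a z) ?t z) has_derivative (%h. dd h (dd a ?t) x + dd (dd h (k a) x) ?t x)) (at x)" by (simp add: kx)
 from d[OF _ bounded_linear.has_derivative[OF I_bounded_linear c]]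
 show "((%z. dd (I (k a z)) ?t z) has_derivative (%h. dd h (dd (I a) ?t) x + dd (I (dd h (k a) x)) ?t x)) (at x)" by (simp add: kx)
 qed
 have dA: "dir_deriv M (%r. delbar M \<q> r (coord_field M ?q (df x b) r)) ?q (df x a) =
 (of_real (dd a (dd b ?t) x) + \<i> * of_real (dd a (dd (I b) ?t) x)) / 2 + A (dd a (k b) x) x" for a b
 proof -
 have "((%z. A (k b z) z) has_derivative (%h. (of_real (dd h (dd b ?t) x + dd (dd h (k b) x) ?t x)
  + \<i> * of_real (dd h (dd (I b) ?t) x + dd (I (dd h (k b) x)) ?t x)) / 2)) (at x)"
  unfolding A_def
  by (intro bounded_linear.has_derivative[OF bounded_linear_divide] has_derivative_add has_derivative_mult_right has_derivative_of_real dk)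
 then have *: "dir_deriv M (%r. delbar M \<q> r (coord_field M ?q (df x b) r)) ?q (df x a) =
  (of_real (dd a (dd b ?t) x + dd (dd a (k b) x) ?t x) + \<i> * of_real (dd a (dd (I b) ?t) x + dd (I (dd a (k b) x)) ?t x)) / 2"
  by (rule dir_deriv_df[OF xU _ _ T]) (use k db in \<open>auto simp: A_def\<close>)
 show ?thesis unfolding * A_def by (simp add: field_simps)
 qed
 have ext: "ext_deriv M (delbar M \<q>) ?q (df x a) (df x b) = \<i> / 2 * of_real (dd a (dd (I b) ?t) x - dd b (dd (I a) ?t) x)" for a b
 proof -
 have L: "delbar M \<q> ?q (lie_bracket M (coord_field M ?q (df x a)) (coord_field M ?q (df x b)) ?q) = A (dd a (k b) x) x - A (dd b (k a) x) x"
  using lie_bracket_push[OF k k T(1,3) sk sk T(2), of a b] db[OF T(2)] by (simp add: kx flip: A_def Al[OF T(2)])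
 have c: "dd a (dd b ?t) x = dd b (dd a ?t) x" by (rule dd_commute[OF T(1) sT T(2)])
 show ?thesis unfolding ext_deriv_def dA L c by (simp add: field_simps)
 qed
 have del: "G x (I a) b = - (dd a (dd (I b) ?t) x - dd b (dd (I a) ?t) x) / 4" for a b
 proof -
 have neg: "dd c (dd (- a) ?t) x = - dd c (dd a ?t) x" for a c
  using dd_commute[OF T(1) sT T(2), of "- a" c] dd_commute[OF T(1) sT T(2), of a c] linear_neg[OF dd_linear[OF smooth_dd[OF sT] T(2)]] by simp
 have "complex_of_real (kahler_form M ?q (df x a) (df x b)) = \<i> / 2 * del M (delbar M \<q>) ?q (df x a) (df x b)"
  using lp xP by (simp add: local_potential_def)
 also have "... = of_real (- (dd a (dd (I b) ?t) x - dd b (dd (I a) ?t) x) / 4)"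
  unfolding del_def hol[OF xU, symmetric] ext I_I neg using dd_commute[OF T(1) sT T(2), of "I a" b] dd_commute[OF T(1) sT T(2), of "I b" a]
  by (simp add: field_simps)
 finally have "kahler_form M ?q (df x a) (df x b) = - (dd a (dd (I b) ?t) x - dd b (dd (I a) ?t) x) / 4"
  unfolding of_real_eq_iff .
 then show ?thesis by (simp add: kahler_form_def G_def hol[OF xU])
 qed
 have neg: "dd (- a) h x = - dd a h x" if "smooth_on ?T h" for a and h :: "'e => real" by (rule linear_neg[OF dd_linear[OF that T(2)]])
 show "G x u v = (dd u (dd v ?t) x + dd (I u) (dd (I v) ?t) x) / 4"
 using del[of "- I u" v] dd_commute[OF T(1) sT T(2), of u v] by (simp add: I_simps neg smooth_dd[OF sT])
qed

end

section \<open>Curves and parallel transport\<close>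

lemma smooth_hvd:
 fixes c :: "real => 'a::real_normed_vector"
 assumes "smooth_on T c" "t : T"
 shows "(c hvd dd 1 c t) (at t)"
proof -
 have "frechet_derivative c (at t) = (%h. h *R dd 1 c t)"
 using linear_scale[OF dd_linear[OF assms], of _ 1] by (intro ext) (metis mult.right_neutral real_scaleR_def)
 then show ?thesis using smooth_deriv[OF assms] by (simp only: has_vector_derivative_def)
qed

lemma chart_parametrization:
 assumes M: "smooth_manifold M"
 shows "parametrization M (chart M q ` cdom M q) (chart_inv M q) (chart M q)"
proof -
 have h: "homeomorphism (cdom M c) (chart M c ` cdom M c) (chart M c) (chart_inv M c)" "open (cdom M c)" "open (chart M c ` cdom M c)" for c
 using M by (auto simp: smooth_manifold_def)
 have inv: "chart_inv M c (chart M c z) = z" if "z : cdom M c" for c z using h(1)[of c] that by (simp add: homeomorphism_def)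
 have im: "chart_inv M q ` chart M q ` cdom M q = cdom M q" using inv by force
 have "chart M q ` cdom M q \<inter> chart_inv M q -` cdom M c = chart M q ` (cdom M q \<inter> cdom M c)" for c using inv by force
 then have "smooth_into M (chart M q ` cdom M q) (chart_inv M q)"
 using M h(1)[of q] by (simp add: smooth_into_def smooth_manifold_def homeomorphism_def)
 moreover have "smooth_fun M (chart_inv M q ` chart M q ` cdom M q) (chart M q)"
 unfolding im smooth_fun_def using M by (simp add: smooth_manifold_def Int_commute)
 ultimately show ?thesis
 using M h inv by (intro parametrization.intro) (auto simp: im)
qed

lemma (in parametrization) curve_in_coordinates:
 assumes \<c>: "smooth_into M J \<c>" and J: "open J"
 shows "open (J \<inter> \<c> -` (f ` U))" "smooth_on (J \<inter> \<c> -` (f ` U)) (%s. g (\<c> s))"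
proof -
 have c: "continuous_on J \<c>" and s: "smooth_on (J \<inter> \<c> -` cdom M c) (chart M c \<circ> \<c>)" for c using \<c> by (auto simp: smooth_into_def)
 have o: "open (J \<inter> \<c> -` S)" if "open S" for S by (rule continuous_open_preimage[OF c J that])
 show "open (J \<inter> \<c> -` (f ` U))" by (rule o[OF open_image])
 show "smooth_on (J \<inter> \<c> -` (f ` U)) (%s. g (\<c> s))"
 proof (rule smooth_on_local)
 fix s assume s0: "s : J \<inter> \<c> -` (f ` U)"
 let ?q = "\<c> s"
 let ?N = "J \<inter> \<c> -` (f ` U \<inter> cdom M ?q)"
 have N: "open ?N" by (rule o) (intro open_Int open_image open_cdom)
 have sm: "smooth_on ?N (%r. \<k> ?q ((chart M ?q \<circ> \<c>) r))"
  by (rule smooth_compose[OF N open_V _ smooth_\<k> smooth_subset[OF s]]) auto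
 have "smooth_on ?N (%s. g (\<c> s))"
  by (rule smooth_cong[OF N, THEN iffD1, OF _ sm]) (auto simp: chart_inv_chart)
 then show "EX T. open T & s : T & smooth_on T (%s. g (\<c> s))" using N s0 center by blast
 qed
qed

context riemannian_parametrization begin

text \<open>In the definition of parallelism the chart changes with t; in U the condition is a
  differential equation in one coordinate system. One direction produces parallel fields, the other
  evaluates given ones.\<close>

lemma parallel_coordinates:
 assumes T: "open T" and c: "smooth_on T c" and \<c>: "!!s. s : T ==> c s : U & f (c s) = \<c> s" and t: "t : T"
 shows "((%s. dchart M (\<c> t) (\<c> s) (Y s)) hvd - christoffel M (\<c> t) (velocity M \<c> t) (Y t)) (at t) \<longleftrightarrow>
 ((%s. dg (c s) (Y s)) hvd - \<G> (c t) (dd 1 c t) (dg (c t) (Y t))) (at t)"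
 and "velocity M \<c> t = df (c t) (dd 1 c t)"
proof -
 let ?x = "c t" and ?q = "\<c> t" and ?c' = "dd 1 c t"
 have x: "?x : U" and q: "?q = f ?x" using \<c>[OF t] by auto
 let ?N = "T \<inter> c -` W ?q"
 have xW: "?x : W ?q" using in_W[OF x] q by simp
 have N: "open ?N" "t : ?N" using continuous_open_preimage[OF smooth_cont[OF c] T open_W] xW t by auto
 have dc: "(c has_derivative (%h. h *R ?c')) (at t)"
 using smooth_hvd[OF c t] by (simp add: has_vector_derivative_def)
 have d\<p>: "((%s. h (c s)) has_derivative (%r. r *R dd ?c' h ?x)) (at t)" if "smooth_on (W ?q) h" for h :: "'b => 'b"
 using has_derivative_compose[OF dc smooth_deriv[OF that xW]] by (simp add: linear_scale[OF dd_linear[OF that xW]])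
 have "(chart M ?q \<circ> \<c> has_derivative (%r. r *R df ?x ?c')) (at t)"
 by (rule has_derivative_transform_within_open[OF d\<p>[OF smooth_\<p>, folded q[symmetric], unfolded q, folded df_eq] T t, unfolded q[symmetric]])
  (use \<c> q in auto)
 then have vel: "velocity M \<c> t = df ?x ?c'"
 unfolding velocity_def by (intro vector_derivative_at) (simp add: has_vector_derivative_def)
 then show "velocity M \<c> t = df (c t) (dd 1 c t)" .
 define y where "y s = dg (c s) (Y s)" for s
 define w where "w s = dchart M ?q (\<c> s) (Y s)" for s
 have Y: "Y s = df (c s) (y s)" if "s : T" for s using df_dg \<c>[OF that] by (simp add: y_def)
 have w: "w s = dd (y s) (\<p> ?q) (c s)" if "s : ?N" for s
 using dchart_df[of "c s" ?q "y s"] Y[of s] \<c>[of s] that by (simp add: w_def)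
 have y: "y s = dd (w s) (\<k> ?q) (\<p> ?q (c s))" if "s : ?N" for s
 using d\<k>_d\<p>[of "c s" ?q "y s"] w[OF that] that by simp
 have fwd: "(w hvd (dd ?c' (dd (y t) (\<p> ?q)) ?x + df ?x y')) (at t)" if "(y hvd y') (at t)" for y'
 proof -
 have "((%s. dd (y s) (\<p> ?q) (c s)) has_derivative (%r. r *R dd ?c' (dd (y t) (\<p> ?q)) ?x + dd (r *R y') (\<p> ?q) ?x)) (at t)"
  by (rule linear_field_deriv[OF N, where T = "%s u. dd u (\<p> ?q) (c s)" and T' = "%u r. r *R dd ?c' (dd u (\<p> ?q)) ?x"])
  (use dd_linear[OF smooth_\<p>] d\<p>[OF smooth_dd[OF smooth_\<p>]] that in \<open>auto simp: has_vector_derivative_def\<close>)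
 then have "(w has_derivative (%r. r *R dd ?c' (dd (y t) (\<p> ?q)) ?x + dd (r *R y') (\<p> ?q) ?x)) (at t)"
  by (rule has_derivative_transform_within_open[OF _ N]) (simp add: w)
 then show ?thesis
  using linear_scale[OF dd_linear[OF smooth_\<p> xW]] by (simp add: has_vector_derivative_def df_eq q[symmetric] scaleR_right_distrib)
 qed
 have chr: "- christoffel M ?q (velocity M \<c> t) (Y t) = dd ?c' (dd (y t) (\<p> ?q)) ?x + df ?x (- \<G> ?x ?c' (y t))"
 using christoffel_df[OF x, of ?c' "y t"] by (simp add: vel Y[OF t] q[symmetric] linear_neg[OF df_linear[OF x]])
 have iff: "(w hvd - christoffel M ?q (velocity M \<c> t) (Y t)) (at t) \<longleftrightarrow> (y hvd - \<G> ?x ?c' (y t)) (at t)"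
 proof
 assume "(y hvd - \<G> ?x ?c' (y t)) (at t)"
 from fwd[OF this] show "(w hvd - christoffel M ?q (velocity M \<c> t) (Y t)) (at t)" unfolding chr .
 next
 \<comment> \<open>Differentiability of \<open>y\<close> has to be obtained from that of
   \<open>w\<close> before \<open>fwd\<close> can identify the derivative.\<close>
 assume dw: "(w hvd - christoffel M ?q (velocity M \<c> t) (Y t)) (at t)"
 let ?k = "%u z. dd u (\<k> ?q) (\<p> ?q z)"
 have "((%s. ?k (w s) (c s)) has_derivative (%r. r *R dd ?c' (?k (w t)) ?x + ?k (r *R (- christoffel M ?q (velocity M \<c> t) (Y t))) ?x)) (at t)"
  by (rule linear_field_deriv[OF N, where T = "%s u. ?k u (c s)" and T' = "%u r. r *R dd ?c' (?k u) ?x"])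
  (use dd_linear[OF smooth_\<k> \<p>_V] d\<p>[OF smooth_d\<k>] dw in \<open>auto simp: has_vector_derivative_def\<close>)
 then have "(y has_derivative (%r. r *R dd ?c' (?k (w t)) ?x + ?k (r *R (- christoffel M ?q (velocity M \<c> t) (Y t))) ?x)) (at t)"
  by (rule has_derivative_transform_within_open[OF _ N]) (simp add: y)
 then obtain y' where dy: "(y hvd y') (at t)"
  unfolding linear_scale[OF dd_linear[OF smooth_\<k> \<p>_V[OF xW]]] scaleR_right_distrib[symmetric] has_vector_derivative_def by blast
 have "dd ?c' (dd (y t) (\<p> ?q)) ?x + df ?x y' = dd ?c' (dd (y t) (\<p> ?q)) ?x + df ?x (- \<G> ?x ?c' (y t))"
  using vector_derivative_unique_at[OF fwd[OF dy] dw] unfolding chr .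
 then have "y' = - \<G> ?x ?c' (y t)" by (rule df_inject[OF x add_left_imp_eq])
 then show "(y hvd - \<G> ?x ?c' (y t)) (at t)" using dy by simp
 qed
 have wl: "w = (%s. dchart M (\<c> t) (\<c> s) (Y s))" and yl: "y = (%s. dg (c s) (Y s))" by (rule ext, rule w_def y_def)+
 show "((%s. dchart M (\<c> t) (\<c> s) (Y s)) hvd - christoffel M (\<c> t) (velocity M \<c> t) (Y t)) (at t) \<longleftrightarrow>
 ((%s. dg (c s) (Y s)) hvd - \<G> (c t) (dd 1 c t) (dg (c t) (Y t))) (at t)"
 by (rule iff[unfolded wl yl])
qed

end


locale riemannian_curve =
 fixes M :: "('m::{t2_space,second_countable_topology}, 'e::euclidean_space) almost_hermitian" and J :: "real set" and \<c> :: "real => 'm"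
 assumes manifold: "smooth_manifold M" and riemannian: "riemannian_metric M" and \<c>: "smooth_into M J \<c>"
 and J: "open J" "convex J" "0 : J"
begin

lemma chart_riemannian: "riemannian_parametrization M (chart M q ` cdom M q) (chart_inv M q) (chart M q)"
 using chart_parametrization[OF manifold] riemannian by (simp add: riemannian_parametrization_def riemannian_parametrization_axioms_def)

lemma chart_curve:
 "open (J \<inter> \<c> -` cdom M q)" "smooth_on (J \<inter> \<c> -` cdom M q) (%s. chart M q (\<c> s))"
 "s : J \<inter> \<c> -` cdom M q ==> chart M q (\<c> s) : chart M q ` cdom M q & chart_inv M q (chart M q (\<c> s)) = \<c> s"
proof -
 interpret riemannian_parametrization M "chart M q ` cdom M q" "chart_inv M q" "chart M q" by (rule chart_riemannian)
 have im: "chart_inv M q ` chart M q ` cdom M q = cdom M q" using chart_inv_chart by force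
 show "open (J \<inter> \<c> -` cdom M q)" "smooth_on (J \<inter> \<c> -` cdom M q) (%s. chart M q (\<c> s))"
 using curve_in_coordinates[OF \<c> J(1)] unfolding im by auto
 show "s : J \<inter> \<c> -` cdom M q ==> chart M q (\<c> s) : chart M q ` cdom M q & chart_inv M q (chart M q (\<c> s)) = \<c> s"
 by (auto simp: chart_inv_chart)
qed

lemma parallel_metric:
 assumes T: "open T" "convex T" "T \<subseteq> J" and X: "parallel_along M T \<c> X" and Y: "parallel_along M T \<c> Y" and st: "s : T" "t : T"
 shows "metric M (\<c> s) (X s) (Y s) = metric M (\<c> t) (X t) (Y t)"
proof -
 have "((%s. metric M (\<c> s) (X s) (Y s)) has_derivative (%h. 0)) (at t)" if t: "t : T" for t
 proof -
 let ?q = "\<c> t"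
 interpret riemannian_parametrization M "chart M ?q ` cdom M ?q" "chart_inv M ?q" "chart M ?q" by (rule chart_riemannian)
 let ?N = "T \<inter> (J \<inter> \<c> -` cdom M ?q)"
 define c where "c s = chart M ?q (\<c> s)" for s
 have N: "open ?N" "t : ?N" using T(1,3) chart_curve(1)[of ?q] t center by auto
 have c: "smooth_on ?N c" unfolding c_def[abs_def] by (rule smooth_subset[OF chart_curve(2)]) auto
 have cU: "c s : chart M ?q ` cdom M ?q & chart_inv M ?q (c s) = \<c> s" if "s : ?N" for s
  using chart_curve(3)[of s ?q] that by (simp add: c_def)
 let ?x = "%X s. dg (c s) (X s)"
 have dx: "(?x X hvd - \<G> (c t) (dd 1 c t) (?x X t)) (at t)" if "parallel_along M T \<c> X" for X
  using parallel_coordinates(1)[OF N(1) c cU N(2), of X] that t by (simp add: parallel_along_def)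
 have dG: "((%s. G (c s) u v) has_derivative (%h. h *R dd (dd 1 c t) (%y. G y u v) (c t))) (at t)" for u v
  using has_derivative_compose[OF smooth_hvd[OF c N(2), unfolded has_vector_derivative_def] smooth_deriv[OF smooth_G, of "c t" u v]]
  cU[OF N(2)] linear_scale[OF dd_linear[OF smooth_G]] by simp
 have "((%s. G (c s) (?x X s) (?x Y s)) has_derivative (%h. h *R dd (dd 1 c t) (%y. G y (?x X t) (?x Y t)) (c t)
  + G (c t) (?x X t) (h *R (- \<G> (c t) (dd 1 c t) (?x Y t))) + G (c t) (h *R (- \<G> (c t) (dd 1 c t) (?x X t))) (?x Y t))) (at t)"
  by (rule bilinear_field_deriv[OF N, where T = "%s. G (c s)", OF _ dG dx[OF X, unfolded has_vector_derivative_def] dx[OF Y, unfolded has_vector_derivative_def]])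
  (use cU G_bil in blast)
 then have "((%s. G (c s) (?x X s) (?x Y s)) has_derivative (%h. 0)) (at t)"
  by (rule has_derivative_eq_rhs) (use cU[OF N(2)] in \<open>simp add: fun_eq_iff compat G_simps algebra_simps\<close>)
 then show ?thesis
 proof (rule has_derivative_transform_within_open[OF _ N])
  fix s assume "s : ?N"
  then show "G (c s) (?x X s) (?x Y s) = metric M (\<c> s) (X s) (Y s)" using cU[of s] by (simp add: G_def df_dg)
 qed
 qed
 from has_derivative_zero_unique[OF T(2) has_derivative_at_withinI[OF this] st(2,1)] show ?thesis by simp
qed

lemma metric_props: "bilinear (metric M q)" "metric M q u v = metric M q v u" "u ~= 0 ==> metric M q u u > 0"
 using riemannian by (auto simp: riemannian_metric_def)

lemmas metric_simps = bilinear_ladd[OF metric_props(1)] bilinear_radd[OF metric_props(1)] bilinear_lsub[OF metric_props(1)] bilinear_rsub[OF metric_props(1)]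
 bilinear_lmul[OF metric_props(1)] bilinear_rmul[OF metric_props(1)]

lemma parallel_unique:
 assumes T: "open T" "convex T" "T \<subseteq> J" and X: "parallel_along M T \<c> X" and Y: "parallel_along M T \<c> Y" and i: "i : T" "X i = Y i" and t: "t : T"
 shows "X t = Y t"
proof (rule ccontr)
 assume "X t ~= Y t"
 then have "metric M (\<c> t) (X t - Y t) (X t - Y t) > 0" by (intro metric_props(3)) simp
 moreover have "metric M (\<c> t) (X t - Y t) (X t - Y t) = metric M (\<c> i) (X i - Y i) (X i - Y i)"
 by (simp add: metric_simps parallel_metric[OF T _ _ t i(1)] X Y)
 ultimately show False using i(2) bilinear_lzero[OF metric_props(1)] by simp
qed

text \<open>The initial time i is arbitrary, because gluing restarts the equation at a common point
  of two intervals.\<close>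

definition transportable :: "real set => bool"
 where "transportable T \<longleftrightarrow> open T & convex T & T \<subseteq> J & (ALL i:T. ALL v. EX X. parallel_along M T \<c> X & X i = v)"

lemma parallel_along_cong:
 assumes T: "open T" "T \<subseteq> S" and X: "parallel_along M S \<c> X" and eq: "!!s. s : T ==> Y s = X s"
 shows "parallel_along M T \<c> Y"
 unfolding parallel_along_def
proof
 fix t assume t: "t : T"
 have "((%s. dchart M (\<c> t) (\<c> s) (X s)) hvd - christoffel M (\<c> t) (velocity M \<c> t) (Y t)) (at t)"
 using X t T(2) eq[OF t] by (auto simp: parallel_along_def)
 then show "((%s. dchart M (\<c> t) (\<c> s) (Y s)) hvd - christoffel M (\<c> t) (velocity M \<c> t) (Y t)) (at t)"
 by (rule has_vector_derivative_transform_within_open[OF _ T(1) t]) (simp add: eq)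
qed

lemma parallel_along_Un: "parallel_along M S \<c> X ==> parallel_along M T \<c> X ==> parallel_along M (S \<union> T) \<c> X"
 by (auto simp: parallel_along_def)

lemma transportable_local: "x : J ==> EX T. transportable T & x : T"
proof -
 assume x: "x : J"
 let ?q = "\<c> x"
 interpret riemannian_parametrization M "chart M ?q ` cdom M ?q" "chart_inv M ?q" "chart M ?q" by (rule chart_riemannian)
 obtain d where d: "d > 0" "ball x d \<subseteq> J \<inter> \<c> -` cdom M ?q"
 using chart_curve(1)[of ?q] x center open_contains_ball by (metis IntI vimageI)
 let ?T = "ball x d"
 define c where "c s = chart M ?q (\<c> s)" for s
 have c: "smooth_on ?T c" unfolding c_def[abs_def] by (rule smooth_subset[OF chart_curve(2) d(2)])
 have cU: "c s : chart M ?q ` cdom M ?q & chart_inv M ?q (c s) = \<c> s" if "s : ?T" for s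
 using chart_curve(3)[OF subsetD[OF d(2) that]] by (simp add: c_def)
 have "EX X. parallel_along M ?T \<c> X & X i = v" if i: "i : ?T" for i v
 proof -
 have "EX s. s i = dg (c i) v & (ALL t:?T. (s hvd - \<G> (c t) (dd 1 c t) (s t)) (at t))"
 proof (rule linear_ode_interval[where A = "%t w. - \<G> (c t) (dd 1 c t) w", OF open_ball convex_ball i])
  show "linear (%w. - \<G> (c t) (dd 1 c t) w)" if "t : ?T" for t
  using \<G>_linear(1) cU[OF that] by (intro linear_compose_neg) auto
  show "smooth_on ?T (%t. - \<G> (c t) (dd 1 c t) w)" for w
  proof (rule smooth_on_minus[OF open_ball smooth_bilinear_field[where T = "%t. \<G> (c t)", OF open_ball _ _ smooth_dd[OF c] smooth_const]])
  show "bilinear (\<G> (c t))" if "t : ?T" for t using \<G>_bil cU[OF that] by blast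
  show "smooth_on ?T (%t. \<G> (c t) a b)" for a b
   by (rule smooth_compose[OF open_ball open_chart _ \<G>_smooth c]) (use cU in blast)
  qed
 qed
 then obtain s where s: "s i = dg (c i) v" "!!t. t : ?T ==> (s hvd - \<G> (c t) (dd 1 c t) (s t)) (at t)" by blast
 let ?X = "%t. df (c t) (s t)"
 have "parallel_along M ?T \<c> ?X"
  unfolding parallel_along_def
 proof
  fix t assume t: "t : ?T"
  have "((%r. dg (c r) (?X r)) hvd - \<G> (c t) (dd 1 c t) (s t)) (at t)"
  by (rule has_vector_derivative_transform_within_open[OF s(2)[OF t] open_ball t]) (use cU in \<open>simp add: dg_df\<close>)
  then show "((%s. dchart M (\<c> t) (\<c> s) (?X s)) hvd - christoffel M (\<c> t) (velocity M \<c> t) (?X t)) (at t)"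
  using parallel_coordinates(1)[OF open_ball c cU t, of ?X] cU[OF t] by (simp add: dg_df)
 qed
 moreover have "?X i = v" using cU[OF i] by (simp add: s(1) df_dg)
 ultimately show ?thesis by blast
 qed
 then have "transportable ?T" using d(2) by (auto simp: transportable_def)
 then show ?thesis using d(1) by (intro exI[of _ ?T]) auto
qed

lemma transportable_Un:
 assumes S: "transportable S" and T: "transportable T" and b: "b : S" "b : T"
 shows "transportable (S \<union> T)"
proof -
 have o: "open S" "open T" "convex S" "convex T" "S \<subseteq> J" "T \<subseteq> J" using S T by (auto simp: transportable_def)
 have cv: "convex (S \<union> T)"
 using o b by (metis convex_connected connected_Un is_interval_connected_1 is_interval_convex_1 disjoint_iff)
 have half: "EX X. parallel_along M (S \<union> T) \<c> X & X i = v" if S: "transportable S" and T: "transportable T" and b: "b : S" "b : T" and i: "i : S" for S T i v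
 proof -
 have o: "open S" "open T" "convex S" "convex T" "S \<subseteq> J" "T \<subseteq> J" using S T by (auto simp: transportable_def)
 obtain X where X: "parallel_along M S \<c> X" "X i = v" using S i unfolding transportable_def by blast
 obtain Y where Y: "parallel_along M T \<c> Y" "Y b = X b" using T b unfolding transportable_def by blast
 have I: "open (S \<inter> T)" "convex (S \<inter> T)" "S \<inter> T \<subseteq> J" using o by (auto intro: convex_Int)
 have eq: "Y s = X s" if "s : S \<inter> T" for s
 proof (rule parallel_unique[where X = Y and Y = X and i = b, OF I _ _ _ Y(2) that])
  show "parallel_along M (S \<inter> T) \<c> Y" "parallel_along M (S \<inter> T) \<c> X" using X(1) Y(1) unfolding parallel_along_def by blast+
 qed (use b in blast)
 let ?Z = "%s. if s : S then X s else Y s"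
 have "parallel_along M S \<c> ?Z" by (rule parallel_along_cong[OF o(1) subset_refl X(1)]) simp
 moreover have "parallel_along M T \<c> ?Z" by (rule parallel_along_cong[OF o(2) subset_refl Y(1)]) (use eq in auto)
 ultimately show ?thesis using X(2) i by (intro exI[of _ ?Z]) (simp add: parallel_along_Un)
 qed
 show ?thesis
 unfolding transportable_def
 proof (intro conjI ballI allI cv)
 fix i v assume "i : S \<union> T"
 then show "EX X. parallel_along M (S \<union> T) \<c> X & X i = v"
  using half[OF S T b] half[OF T S b(2,1)] by (auto simp: Un_commute)
 qed (use o in auto)
qed

text \<open>A curve may leave every single chart; bisection glues the local solutions along a
  compact interval.\<close>

lemma transportable_interval:
 assumes "a : J" "b : J" "a <= b"
 shows "EX T. transportable T & {a..b} \<subseteq> T"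
proof -
 have sub: "{a..b} \<subseteq> J" using closed_segment_subset[OF assms(1,2) J(2)] assms(3) by (simp add: closed_segment_eq_real_ivl)
 have "a <= b --> {a..b} \<subseteq> J --> (EX T. transportable T & {a..b} \<subseteq> T)"
 proof (rule Bolzano[OF assms(3)])
 fix a b c :: real
 assume *: "a <= b --> {a..b} \<subseteq> J --> (EX T. transportable T & {a..b} \<subseteq> T)" "b <= c --> {b..c} \<subseteq> J --> (EX T. transportable T & {b..c} \<subseteq> T)" "a <= b" "b <= c"
 show "a <= c --> {a..c} \<subseteq> J --> (EX T. transportable T & {a..c} \<subseteq> T)"
 proof (intro impI)
  assume "{a..c} \<subseteq> J"
  then have "{a..b} \<subseteq> J" "{b..c} \<subseteq> J" using *(3,4) by auto
  then obtain S T where ST: "transportable S" "{a..b} \<subseteq> S" "transportable T" "{b..c} \<subseteq> T" using * by blast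
  moreover have "{a..c} = {a..b} \<union> {b..c}" using *(3,4) by auto
  moreover have "transportable (S \<union> T)" by (rule transportable_Un[OF ST(1,3), of b]) (use ST *(3,4) in auto)
  ultimately show "EX T. transportable T & {a..c} \<subseteq> T" by (intro exI[of _ "S \<union> T"]) auto
 qed
 next
 fix x assume x: "a <= x" "x <= b"
 then have "x : J" using sub by auto
 then obtain T where T: "transportable T" "x : T" using transportable_local by blast
 then obtain d where d: "d > 0" "ball x d \<subseteq> T" using open_contains_ball[of T] unfolding transportable_def by blast
 show "EX d>0. ALL a b. a <= x & x <= b & b - a < d --> a <= b --> {a..b} \<subseteq> J --> (EX T. transportable T & {a..b} \<subseteq> T)"
 proof (intro exI[of _ d] conjI d(1) allI impI)
  fix a b assume "a <= x & x <= b & b - a < d"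
  then have "{a..b} \<subseteq> ball x d" by (auto simp: dist_real_def)
  then show "EX T. transportable T & {a..b} \<subseteq> T" using T d by blast
 qed
 qed
 then show ?thesis using assms sub by blast
qed

text \<open>The open interval \<open>J\<close> need not lie in one of the intervals obtained by
  gluing, so the solution is put together diagonally from solutions on the segments from 0 to
  t.\<close>

theorem parallel_exists: "EX X. parallel_along M J \<c> X & X 0 = v"
proof -
 have "EX T X. open T & convex T & T \<subseteq> J & closed_segment 0 t \<subseteq> T & parallel_along M T \<c> X & X 0 = v" if "t : J" for t
 proof -
 have "EX T. transportable T & closed_segment 0 t \<subseteq> T"
  using transportable_interval[OF J(3) that] transportable_interval[OF that J(3)] by (cases "0 <= t") (simp_all add: closed_segment_eq_real_ivl)
 then obtain T where T: "transportable T" "closed_segment 0 t \<subseteq> T" by blast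
 then have "0 : T" by auto
 then obtain X where "parallel_along M T \<c> X" "X 0 = v" using T unfolding transportable_def by blast
 then show ?thesis using T by (auto simp: transportable_def)
 qed
 then obtain T X where TX: "!!t. t : J ==> open (T t) & convex (T t) & T t \<subseteq> J & closed_segment 0 t \<subseteq> T t & parallel_along M (T t) \<c> (X t) & X t 0 = v"
 by metis
 have eq: "X s s = X t s" if "t : J" "s : T t" for s t
 proof -
 have s: "s : J" using TX[OF that(1)] that(2) by blast
 let ?I = "T s \<inter> T t"
 have I: "open ?I" "convex ?I" "?I \<subseteq> J" "0 : ?I" "s : ?I" using TX[OF s] TX[OF that(1)] that(2) by (auto intro: convex_Int)
 show ?thesis
 proof (rule parallel_unique[where X = "X s" and Y = "X t", OF I(1-3) _ _ I(4) _ I(5)])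
  show "parallel_along M ?I \<c> (X s)" "parallel_along M ?I \<c> (X t)" using TX[OF s] TX[OF that(1)] unfolding parallel_along_def by blast+
 qed (use TX[OF s] TX[OF that(1)] in simp)
 qed
 have "parallel_along M J \<c> (%t. X t t)"
 unfolding parallel_along_def
 proof
 fix t assume t: "t : J"
 have "parallel_along M (T t) \<c> (%s. X s s)"
  by (rule parallel_along_cong[of _ "T t" "X t"]) (use TX[OF t] eq[OF t] in auto)
 moreover have "t : T t" using TX[OF t] by auto
 ultimately show "((%s. dchart M (\<c> t) (\<c> s) (X s s)) hvd - christoffel M (\<c> t) (velocity M \<c> t) (X t t)) (at t)"
  by (simp add: parallel_along_def)
 qed
 then show ?thesis using TX[OF J(3)] by blast
qed

abbreviation "PT \<equiv> parallel_transport M J \<c>"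

lemma PT_eq: "parallel_along M J \<c> X ==> t : J ==> PT t (X 0) = X t"
 unfolding parallel_transport_def using parallel_unique[OF J(1,2) subset_refl _ _ J(3)] by (intro the_equality) metis+

lemma PT_parallel: "parallel_along M J \<c> (%t. PT t v)" and PT_0: "PT 0 v = v"
proof -
 obtain X where X: "parallel_along M J \<c> X" "X 0 = v" using parallel_exists by blast
 show "parallel_along M J \<c> (%t. PT t v)" by (rule parallel_along_cong[OF J(1) subset_refl X(1)]) (use PT_eq[OF X(1)] X(2) in simp)
 show "PT 0 v = v" using PT_eq[OF X(1) J(3)] X(2) by simp
qed

lemma PT_metric: "t : J ==> metric M (\<c> t) (PT t u) (PT t v) = metric M (\<c> 0) u v"
 using parallel_metric[OF J(1,2) subset_refl PT_parallel PT_parallel _ J(3)] by (simp add: PT_0)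

text \<open>Linearity follows from the isometry property: it gives the length 0 for the difference
  of the two sides.\<close>

lemma PT_linear: "t : J ==> linear (PT t)"
proof (rule linearI)
 assume t: "t : J"
 have z: "x = 0" if "metric M (\<c> t) x x = 0" for x using metric_props(3)[of x "\<c> t"] that by fastforce
 show "PT t (u + v) = PT t u + PT t v" for u v
 using z[of "PT t (u + v) - (PT t u + PT t v)"] by (simp add: metric_simps PT_metric t metric_props(2))
 show "PT t (r *R u) = r *R PT t u" for r u
 using z[of "PT t (r *R u) - r *R PT t u"] by (simp add: metric_simps PT_metric t metric_props(2))
qed

end

section \<open>Quadratic transvections and the displacement estimate\<close>

context kaehler_normal_potential begin

definition K :: "'a => 'a => 'a" where "K W X = W - transvection_term 0 W X"

abbreviation "tr \<equiv> triple 0"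

lemma K_triple: "K W X = W - (1/2) *R tr W X X"
 by (simp add: K_def transvection_term_triple o)

lemma tr_linear: "linear (tr u v)" "linear (%v. tr u v w)" "linear (%u. tr u v w)" and tr_bilinear: "bilinear (tr u)"
 using triple_linear[OF o(1)] by (auto simp: bilinear_def)

lemmas tr_simps = triple_simps[OF o(1)]

lemma K_linear: "linear (%W. K W X)"
 unfolding K_triple by (rule linearI; simp add: tr_simps algebra_simps)

lemma tr_bound: obtains C where "C >= 0" "!!u v w. norm (tr u v w) <= C * (norm u * norm v * norm w)"
proof -
 obtain F where F: "!!x u v w. blinfun_apply (blinfun_apply (blinfun_apply (F (x::real)) u) v) w = tr u v w"
 by (rule trilinear_blinfun_field[OF open_UNIV, of "%_::real. tr"]) (auto simp: tr_bilinear tr_linear(3))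
 have "norm (tr u v w) <= norm (F 0) * (norm u * norm v * norm w)" for u v w
 proof -
 have "norm (F 0 u v) <= norm (F 0) * norm u * norm v" by (rule order_trans[OF norm_blinfun mult_right_mono[OF norm_blinfun norm_ge_zero]])
 then have "norm (F 0 u v w) <= norm (F 0) * norm u * norm v * norm w" by (rule order_trans[OF norm_blinfun mult_right_mono[OF _ norm_ge_zero]])
 then show ?thesis by (simp add: F mult.assoc)
 qed
 then show thesis using that by (metis norm_ge_zero)
qed

lemma K_has_derivative: "(K W has_derivative (%h. - tr W x h)) (at x)"
proof -
 have bb: "bounded_bilinear (tr W)" using tr_bilinear bilinear_conv_bounded_bilinear by blast
 have "((%x. W - (1/2) *R tr W x x) has_derivative (%h. 0 - (1/2) *R (tr W x h + tr W h x))) (at x)"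
 by (intro has_derivative_diff has_derivative_const has_derivative_scaleR_right bounded_bilinear.FDERIV[OF bb] has_derivative_ident)
 moreover have "tr W x h + tr W h x = 2 *R tr W x h" for h using triple_sym[OF o(1), of W h x] by (simp add: scaleR_2)
 ultimately show ?thesis by (simp add: K_triple[abs_def])
qed

lemma dd_K: "dd h (K W) x = - tr W x h" by (rule dd_eqI[OF K_has_derivative])

lemma killing_pair_cong:
 assumes kp: "killing_pair \<x> A" and eq: "!!x. x : \<O> ==> \<x>' x = \<x> x"
 shows "killing_pair \<x>' A"
 unfolding killing_pair_def
proof (intro conjI ballI allI)
 show "smooth_on \<O> \<x>'" by (rule smooth_cong[OF open_\<O>, THEN iffD1, OF _ kpD(1)[OF kp]]) (rule eq[symmetric])
 show "nab u \<x>' x = A x u" if "x : \<O>" for x u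
 using nab_cong[OF that, of \<x>' \<x> u] eq kpD(4)[OF kp that, of u] by simp
 show "nab u (%y. A y w) x = A x (\<G> x u w) + R x u (\<x>' x) w" if "x : \<O>" for x u w
 using kpD(5)[OF kp that] eq[OF that] by simp
qed (use kpD[OF kp] in auto)

lemma rotation: "EX B. killing_pair I B"
proof -
 have "curvature_invariant 0 I"
 by (simp add: curvature_invariant_def R_I R_I_left o)
 then obtain E B where "killing_pair E B" "E 0 = 0" "B 0 = I"
 using killing_pair_exists[OF convex o(1) I_linear, of 0] by blast
 then show ?thesis using rotation_killing_field[of E B] by auto
qed

lemma K_pairs: obtains A where "!!W. killing_pair (K W) (A W)" "!!W w. A W 0 w = 0"
proof -
 obtain B where B: "killing_pair I B" using rotation by blast
 have "EX \<x> A. killing_pair \<x> A & \<x> 0 = W & A 0 = (%_. 0)" for W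
 by (rule killing_pair_exists[OF convex o(1)]) (simp_all add: curvature_invariant_def linear_zero R_simps o)
 then obtain \<x> A where kp: "!!W. killing_pair (\<x> W) (A W)" "!!W. \<x> W 0 = W" "!!W. A W 0 = (%_. 0)" by metis
 have "\<x> W X = K W X" if "X : \<O>" for W X
 unfolding K_def by (rule transvection_field[OF B kp(1) convex o(1) kp(2) _ that]) (simp add: kp(3))
 then have k: "killing_pair (K W) (A W)" for W using killing_pair_cong[OF kp(1)] by simp
 show thesis by (rule that[of A]) (use k kp(3) in auto)
qed

lemma linear_killing: "killing_pair \<x> A ==> \<x> 0 = 0 ==> (!!w. A 0 (I w) = I (A 0 w)) ==> X : \<O> ==> \<x> X = A 0 X"
 using rotation linear_killing_field[OF _ _ convex o(1)] by blast

text \<open>For small y the quadratic part of \<open>K W y\<close> has at most half the norm of W.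
  So W \<mapsto> K W y is injective, hence onto, and its inverse has norm at most 2.\<close>

lemma K_solve:
 obtains \<r> where "\<r> > 0" "cball 0 (2 * \<r>) \<subseteq> \<O>" "!!y Y. y : cball 0 \<r> ==> EX W. K W y = Y & norm W <= 2 * norm Y"
proof -
 obtain C where C: "C >= 0" "!!u v w. norm (tr u v w) <= C * (norm u * norm v * norm w)" by (rule tr_bound) blast
 \<comment> \<open>\<open>1 / (C + 1)\<close> makes C \<r>^2 at most 1, and \<open>\<d> / 4\<close>
   keeps the ball of radius 2 \<r> in the domain.\<close>
 define \<r> where "\<r> = min (\<d> / 4) (1 / (C + 1))"
 have \<r>: "\<r> > 0" "\<r> <= \<d> / 4" "\<r> <= 1 / (C + 1)" using C(1) \<d>(1) by (auto simp: \<r>_def)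
 have "\<r> <= 1" using \<r>(3) C(1) by (smt (verit) divide_le_eq_1)
 have "C * (\<r> * \<r>) <= 1"
 proof -
 have "C * (\<r> * \<r>) <= C * (1 / (C + 1) * 1)" using C(1) \<r> \<open>\<r> <= 1\<close> by (intro mult_left_mono mult_mono) auto
 also have "... <= 1" using C(1) by (simp add: field_simps)
 finally show ?thesis .
 qed
 have low: "norm W <= 2 * norm (K W y)" if y: "y : cball 0 \<r>" for y W :: 'a
 proof -
 have "norm (tr W y y) <= C * (norm W * norm y * norm y)" by (rule C(2))
 also have "... <= C * (norm W * \<r> * \<r>)" using y C(1) \<r> by (intro mult_left_mono mult_mono) auto
 also have "... <= norm W" using mult_right_mono[OF \<open>C * (\<r> * \<r>) <= 1\<close> norm_ge_zero[of W]] by (simp add: mult_ac)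
 finally have 1: "norm ((1/2) *R tr W y y) <= norm W / 2" by simp
 have "norm W <= norm (K W y) + norm ((1/2) *R tr W y y)"
  using norm_triangle_ineq[of "K W y" "(1/2) *R tr W y y"] by (simp add: K_triple)
 then show ?thesis using 1 by linarith
 qed
 show thesis
 proof (rule that[OF \<r>(1)])
 show "cball 0 (2 * \<r>) \<subseteq> \<O>" using \<d> \<r>(2) by (intro order_trans[OF _ \<d>(2)]) auto
 fix y Y :: 'a assume y: "y : cball 0 \<r>"
 have "inj (%W. K W y)"
 proof (subst linear_injective_0[OF K_linear], intro allI impI)
  fix W assume "K W y = 0"
  then show "W = 0" using low[OF y, of W] by simp
 qed
 then have "surj (%W. K W y)" by (rule linear_inj_imp_surj[OF K_linear])
 then obtain W where "K W y = Y" by (metis surjD)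
 then show "EX W. K W y = Y & norm W <= 2 * norm Y" using low[OF y, of W] by auto
 qed
qed

lemma K_0: "K W 0 = W"
 by (simp add: K_triple tr_simps)

text \<open>The bracket vanishes at 0 and its endomorphism there is a curvature endomorphism, which
  commutes with \<open>I\<close>; so the bracket is linear.\<close>

lemma K_bracket:
 assumes A: "!!W. killing_pair (K W) (A W)" "!!W w. A W 0 w = 0" and x: "x : \<O>"
 shows "A Z x (K W x) - A W x (K Z x) = R 0 W Z x"
 using linear_killing[OF killing_pair_bracket[OF A(1)[of W] A(1)[of Z]] _ _ x] A(2) by (simp add: K_0 R_I o)

text \<open>\<open>\<p>\<close> stands for the change of coordinates and \<open>\<z> b\<close> for
  the transvections at the displaced centre. Writing the ray direction as
  \<open>Y = K W (s *R Y)\<close>, the derivative of \<open>\<p>\<close> along the ray is a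
  combination of the \<open>\<z> b\<close>, and the deviation of \<open>\<p>\<close> from the map Y
  \<mapsto> Y + t K Z Y satisfies a Gronwall inequality. C is independent of t, e and the maps, as
  the limit t = 0 demands.\<close>

lemma displacement_estimate:
 assumes \<r>: "\<r> > 0" "cball 0 (2 * \<r>) \<subseteq> \<O>" and solve: "!!y Y. y : cball 0 \<r> ==> EX W. K W y = Y & norm W <= 2 * norm Y"
 shows "EX C>=0. ALL t e \<p> \<p>' \<z> Y. \<bar>t\<bar> <= 1 --> \<bar>t\<bar> <= e --> norm Y <= \<r> -->
 (ALL s:{0..1}. (\<p> has_derivative \<p>' (s *R Y)) (at (s *R Y)) & \<p> (s *R Y) : cball 0 (2 * \<r>) &
  (ALL b:Basis. \<p>' (s *R Y) (K b (s *R Y)) = \<z> b (\<p> (s *R Y)))) -->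
 (ALL b:Basis. ALL x:cball 0 (2 * \<r>). norm (\<z> b x - K b x - t *R R 0 b Z x) <= e * \<bar>t\<bar>) -->
 norm (\<p> 0 - t *R Z) <= e * \<bar>t\<bar> --> norm (\<p> Y - Y - t *R K Z Y) <= C * (e * \<bar>t\<bar>)"
proof -
 obtain A where A: "!!W. killing_pair (K W) (A W)" "!!W w. A W 0 w = 0" by (rule K_pairs) blast
 obtain C where C: "C >= 0" "!!u v w. norm (tr u v w) <= C * (norm u * norm v * norm w)" by (rule tr_bound) blast
 \<comment> \<open>In this form the bracket cancels the terms of first order in t in the derivative
   of the deviation.\<close>
 have bracket: "dd (K W x) (K Z) x = dd (K Z x) (K W) x + R 0 W Z x" if x: "x : \<O>" for W x
 proof -
 show ?thesis
  using K_bracket[OF A x, of Z W]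
  using killing_pair_dd[OF A(1) x, of Z "K W x"] killing_pair_dd[OF A(1) x, of W "K Z x"] \<G>_sym[OF x, of "K W x" "K Z x"] by (simp add: diff_eq_eq add.commute)
 qed
 define m where "m = norm Z + C * (norm Z * \<r> * \<r>)"
 have m: "m >= 0" using C(1) \<r>(1) by (simp add: m_def)
 have Kb: "norm (K Z y) <= m" if "y : cball 0 \<r>" for y
 proof -
 have "norm (tr Z y y) <= C * (norm Z * norm y * norm y)" by (rule C(2))
 also have "... <= C * (norm Z * \<r> * \<r>)" using that C(1) \<r> by (intro mult_left_mono mult_mono) auto
 finally have 1: "norm (tr Z y y) <= C * (norm Z * \<r> * \<r>)" .
 have "norm ((1/2) *R tr Z y y) <= norm (tr Z y y)" by simp
 then have "norm ((1/2) *R tr Z y y) <= C * (norm Z * \<r> * \<r>)" using 1 by linarith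
 then show ?thesis using norm_triangle_ineq4[of Z "(1/2) *R tr Z y y"] by (simp add: K_triple m_def)
 qed
 obtain CR where CR: "CR >= 0" "!!W x. norm (R 0 W Z x) <= CR * norm W * norm x"
 proof -
 obtain c where c: "c >= 1" "!!u v w. norm (R 0 u v w) <= c * (norm u * norm v * norm w)"
  by (rule compact_bounds[of "{0}"]) (use o(1) in auto)
 show thesis
 proof (rule that[of "c * norm Z"])
  show "norm (R 0 W Z x) <= c * norm Z * norm W * norm x" for W x using c(2)[of W Z x] by (simp add: mult_ac)
 qed (use c in simp)
 qed
 define n where "n = real DIM('a)"
 have n: "n >= 1" by (simp add: n_def Suc_leI)
 define C1 where "C1 = 1 + 2 * \<r> * C * (5 * \<r> + m) + 2 * \<r> * C * \<r> + 2 * \<r> * CR"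
 define C2 where "C2 = 2 * \<r> * n + 2 * \<r> * C * m * m + 2 * \<r> * CR * m"
 have C1: "C1 >= 1" unfolding C1_def using C(1) CR(1) \<r>(1) m by (simp add: add_nonneg_nonneg)
 have C2: "C2 >= 0" unfolding C2_def using C(1) CR(1) \<r>(1) m n by (intro add_nonneg_nonneg mult_nonneg_nonneg) auto
 show ?thesis
 proof (intro exI[of _ "(1 + C2) * exp C1"] conjI allI impI)
 show "(1 + C2) * exp C1 >= 0" using C2 by simp
 fix t e \<p> \<p>' \<z> Y
 assume t: "\<bar>t\<bar> <= 1" "\<bar>t\<bar> <= e" and Y: "norm Y <= \<r>"
  and \<p>: "ALL s:{0..1}. (\<p> has_derivative \<p>' (s *R Y)) (at (s *R Y)) & \<p> (s *R Y) : cball 0 (2 * \<r>) &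
  (ALL b:Basis. \<p>' (s *R Y) (K b (s *R Y)) = \<z> b (\<p> (s *R Y)))"
  and \<z>: "ALL b:Basis. ALL x:cball 0 (2 * \<r>). norm (\<z> b x - K b x - t *R R 0 b Z x) <= e * \<bar>t\<bar>"
  and ini: "norm (\<p> 0 - t *R Z) <= e * \<bar>t\<bar>"
 define E where "E s = \<p> (s *R Y) - s *R Y - t *R K Z (s *R Y)" for s
 define E' where "E' s = \<p>' (s *R Y) Y - Y - t *R dd Y (K Z) (s *R Y)" for s
 have dE: "(E hvd E' s) (at01 s)" if s: "s : {0..1}" for s
 proof -
  have "((%s. h (s *R Y)) hvd h' Y) (at01 s)" if "(h has_derivative h') (at (s *R Y))" for h h' :: "'a => 'a"
  using hvd_along_line[of h h' 0 s Y "{0..1}"] that by simp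
  note d = this
  have dY: "((%s. s *R Y) hvd Y) (at01 s)" using d[OF has_derivative_ident] .
  have dK: "((%s. K Z (s *R Y)) hvd dd Y (K Z) (s *R Y)) (at01 s)"
  using d[OF K_has_derivative] by (simp add: dd_K)
  have d\<p>: "((%s. \<p> (s *R Y)) hvd \<p>' (s *R Y) Y) (at01 s)" using d \<p> s by blast
  have "((%s. t *R K Z (s *R Y)) hvd t *R dd Y (K Z) (s *R Y)) (at01 s)"
  by (rule bounded_linear.has_vector_derivative[OF bounded_linear_scaleR_right dK])
  then show ?thesis
  unfolding E_def[abs_def] E'_def by (intro has_vector_derivative_diff d\<p> dY)
 qed
 have step: "norm (E' s) <= C1 * norm (E s) + C2 * (e * \<bar>t\<bar>)" if s: "s : {0..1}" for s
 proof -
  let ?y = "s *R Y"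
  let ?p = "\<p> ?y"
  have y: "?y : cball 0 \<r>" using s Y mult_left_le_one_le[of "norm Y" s] by auto
  then have y\<O>: "?y : \<O>" using \<r> by auto
  obtain W where W: "K W ?y = Y" "norm W <= 2 * norm Y" using solve[OF y] by blast
  have nW: "norm W <= 2 * \<r>" using W(2) Y by linarith
  have p: "?p : cball 0 (2 * \<r>)" using \<p> s by blast
  have lin: "linear (\<p>' ?y)" using \<p> s has_derivative_linear by blast
  have Wb: "W = (\<Sum>b\<in>Basis. (W \<bullet> b) *R b)" by (simp add: euclidean_representation)
  have KW: "K W x = (\<Sum>b\<in>Basis. (W \<bullet> b) *R K b x)" for x by (rule basis_expansion[OF K_linear])
  have RW: "R 0 W Z x = (\<Sum>b\<in>Basis. (W \<bullet> b) *R R 0 b Z x)" for x by (rule basis_expansion[OF R_linear(3)[OF o(1)]])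
  define S where "S = (\<Sum>b\<in>Basis. (W \<bullet> b) *R (\<z> b ?p - K b ?p - t *R R 0 b Z ?p))"
  have "\<p>' ?y (K W ?y) = (\<Sum>b\<in>Basis. (W \<bullet> b) *R \<z> b ?p)"
  unfolding KW[of ?y] linear_sum[OF lin] linear_scale[OF lin] by (rule sum.cong[OF refl]) (use \<p> s in simp)
  then have "\<p>' ?y Y = (\<Sum>b\<in>Basis. (W \<bullet> b) *R \<z> b ?p)" unfolding W(1) .
  then have \<p>Y: "\<p>' ?y Y = S + K W ?p + t *R R 0 W Z ?p"
  unfolding S_def KW[of ?p] RW[of ?p] scaleR_sum_right sum.distrib[symmetric] by (simp add: algebra_simps)
  define d where "d = ?p - ?y"
  have dE': "d = E s + t *R K Z ?y" by (simp add: d_def E_def)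
  have quad: "K W ?p = K W ?y - tr W ?y d - (1/2) *R tr W d d"
  proof -
  have "?p = ?y + d" by (simp add: d_def)
  then have "tr W ?p ?p = tr W ?y ?y + 2 *R tr W ?y d + tr W d d"
   using triple_sym[OF o(1), of W d ?y] by (simp add: triple_linear(1)[OF o(1), THEN linear_add] triple_linear(2)[OF o(1), THEN linear_add] scaleR_2)
  then show ?thesis by (simp add: K_triple scaleR_right_distrib)
  qed
  have Rd: "R 0 W Z ?p = R 0 W Z ?y + R 0 W Z d" using linear_add[OF R_linear(1)[OF o(1)], of W Z ?y d] by (simp add: d_def)
  have ddY: "dd Y (K Z) ?y = - tr W ?y (K Z ?y) + R 0 W Z ?y"
  using bracket[OF y\<O>, of W] by (simp only: W(1) dd_K)
  have E'_eq: "E' s = S - tr W ?y (E s) - (1/2) *R tr W d d + t *R R 0 W Z d"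
  unfolding E'_def \<p>Y quad Rd W(1) ddY by (simp add: dE' tr_simps algebra_simps)
  have nS: "norm S <= 2 * \<r> * n * (e * \<bar>t\<bar>)"
  proof -
  have "norm S <= (\<Sum>b\<in>(Basis::'a set). 2 * \<r> * (e * \<bar>t\<bar>))"
   unfolding S_def
  proof (rule sum_norm_le)
   fix b :: 'a assume b: "b : Basis"
   have "\<bar>W \<bullet> b\<bar> <= 2 * \<r>" using Basis_le_norm[OF b, of W] nW by linarith
   then show "norm ((W \<bullet> b) *R (\<z> b ?p - K b ?p - t *R R 0 b Z ?p)) <= 2 * \<r> * (e * \<bar>t\<bar>)"
   using \<z> b p \<r>(1) by (simp add: mult_mono)
  qed
  then show ?thesis by (simp add: n_def mult_ac)
  qed
  have nd: "norm d <= norm (E s) + \<bar>t\<bar> * m"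
  unfolding dE' using norm_triangle_ineq[of "E s" "t *R K Z ?y"] mult_left_mono[OF Kb[OF y], of "\<bar>t\<bar>"] by simp
  have "norm d <= norm ?p + norm ?y" unfolding d_def by (rule norm_triangle_ineq4)
  then have nd3: "norm d <= 5 * \<r>" using p y \<r>(1) by auto
  have et: "\<bar>t\<bar> * \<bar>t\<bar> <= e * \<bar>t\<bar>" using t(2) by (intro mult_right_mono) auto
  \<comment> \<open>One factor is bounded crudely by 5 \<r> where it multiplies
    \<open>norm (E s)\<close>; elsewhere both factors use \<open>nd\<close>, and the square of t is
    absorbed into e |t|.\<close>
  have nd2: "norm d * norm d <= (5 * \<r> + m) * norm (E s) + m * m * (e * \<bar>t\<bar>)"
  proof -
  have "norm d * norm d <= norm d * (norm (E s) + \<bar>t\<bar> * m)" by (rule mult_left_mono[OF nd]) simp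
  also have "... = norm d * norm (E s) + norm d * (\<bar>t\<bar> * m)" by (simp add: algebra_simps)
  also have "... <= 5 * \<r> * norm (E s) + (norm (E s) + \<bar>t\<bar> * m) * (\<bar>t\<bar> * m)"
   using nd nd3 m by (intro add_mono mult_right_mono) auto
  also have "... = 5 * \<r> * norm (E s) + (\<bar>t\<bar> * (m * norm (E s)) + m * m * (\<bar>t\<bar> * \<bar>t\<bar>))" by (simp add: algebra_simps)
  also have "... <= 5 * \<r> * norm (E s) + (1 * (m * norm (E s)) + m * m * (e * \<bar>t\<bar>))"
   using m by (intro add_left_mono add_mono mult_right_mono[OF t(1)] mult_left_mono[OF et]) auto
  finally show ?thesis by (simp add: algebra_simps)
  qed
  have n2: "norm (tr W ?y (E s)) <= 2 * \<r> * C * \<r> * norm (E s)"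
  proof -
  have "norm (tr W ?y (E s)) <= C * (norm W * norm ?y * norm (E s))" by (rule C(2))
  also have "... <= C * (2 * \<r> * \<r> * norm (E s))" using nW y C(1) \<r>(1) by (intro mult_left_mono mult_right_mono mult_mono) auto
  finally show ?thesis by (simp add: mult_ac)
  qed
  have n3: "norm ((1/2) *R tr W d d) <= 2 * \<r> * C * ((5 * \<r> + m) * norm (E s) + m * m * (e * \<bar>t\<bar>))"
  proof -
  have "norm (tr W d d) <= C * (norm W * norm d * norm d)" by (rule C(2))
  also have "... = C * norm W * (norm d * norm d)" by simp
  also have "... <= C * (2 * \<r>) * ((5 * \<r> + m) * norm (E s) + m * m * (e * \<bar>t\<bar>))"
   using nW C(1) \<r>(1) by (intro mult_mono[OF mult_left_mono nd2]) auto
  finally have 1: "norm (tr W d d) <= 2 * \<r> * C * ((5 * \<r> + m) * norm (E s) + m * m * (e * \<bar>t\<bar>))" by (simp add: mult_ac)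
  have "norm ((1/2) *R tr W d d) <= norm (tr W d d)" by simp
  then show ?thesis using 1 by linarith
  qed
  have n4: "norm (t *R R 0 W Z d) <= 2 * \<r> * CR * (norm (E s) + m * (e * \<bar>t\<bar>))"
  proof -
  have "norm (t *R R 0 W Z d) <= \<bar>t\<bar> * (CR * norm W * norm d)" using mult_left_mono[OF CR(2)[of W d], of "\<bar>t\<bar>"] by simp
  also have "... <= \<bar>t\<bar> * (CR * (2 * \<r>) * (norm (E s) + \<bar>t\<bar> * m))"
   using nW nd CR(1) \<r>(1) by (intro mult_left_mono mult_mono) auto
  also have "... = 2 * \<r> * CR * (\<bar>t\<bar> * norm (E s) + m * (\<bar>t\<bar> * \<bar>t\<bar>))" by (simp add: algebra_simps)
  also have "... <= 2 * \<r> * CR * (1 * norm (E s) + m * (e * \<bar>t\<bar>))"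
   using m CR(1) \<r>(1) by (intro mult_left_mono[of _ _ "2 * \<r> * CR"] add_mono mult_right_mono[OF t(1)] mult_left_mono[OF et]) auto
  finally show ?thesis by simp
  qed
  have "norm (E' s) <= norm S + norm (tr W ?y (E s)) + norm ((1/2) *R tr W d d) + norm (t *R R 0 W Z d)"
  unfolding E'_eq by (intro order_trans[OF norm_triangle_ineq] add_mono order_trans[OF norm_triangle_ineq4] order_refl)
  also have "... <= 2 * \<r> * n * (e * \<bar>t\<bar>) + 2 * \<r> * C * \<r> * norm (E s) + 2 * \<r> * C * ((5 * \<r> + m) * norm (E s) + m * m * (e * \<bar>t\<bar>))
  + 2 * \<r> * CR * (norm (E s) + m * (e * \<bar>t\<bar>))" by (intro add_mono nS n2 n3 n4)
  also have "... <= C1 * norm (E s) + C2 * (e * \<bar>t\<bar>)"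
  unfolding C1_def C2_def by (simp add: algebra_simps)
  finally show ?thesis .
 qed
 have e0: "e * \<bar>t\<bar> >= 0" using t by simp
 have "norm (E 1) <= (norm (E 0) + C2 * (e * \<bar>t\<bar>)) * exp C1"
  by (rule gronwall[OF C1 _ dE step]) (use e0 C2 in auto)
 also have "... <= (e * \<bar>t\<bar> + C2 * (e * \<bar>t\<bar>)) * exp C1"
  using ini by (intro mult_right_mono add_right_mono) (auto simp: E_def K_triple tr_simps)
 finally show "norm (\<p> Y - Y - t *R K Z Y) <= (1 + C2) * exp C1 * (e * \<bar>t\<bar>)" by (simp add: E_def algebra_simps)
 qed
qed


text \<open>\<open>\<z>\<close> is the transvection at \<open>c t\<close> whose initial vector is
  the transported W. Its difference from K W + t [K W, K Z] has the initial data \<open>- e1\<close>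
  and \<open>- e2\<close> at \<open>c t\<close>, which vanish to first order at t = 0;
  \<open>killing_pair_bound\<close> spreads this over the ball.\<close>

lemma transport_data:
 assumes \<r>: "\<r> > 0" "cball 0 (2 * \<r>) \<subseteq> \<O>" and c: "(c hvd Z) (at 0)" "c 0 = 0"
 and v: "!!W. (v W hvd 0) (at 0)" "!!W. v W 0 = W" and e: "e > 0"
 shows "\<forall>\<^sub>F t in nhds 0. c t : cball 0 (2 * \<r>) & (ALL W:Basis. ALL \<z> B. killing_pair \<z> B --> \<z> (c t) = v W t --> (ALL w. B (c t) w = 0) -->
 (ALL x:cball 0 (2 * \<r>). norm (\<z> x - K W x - t *R R 0 W Z x) <= e * \<bar>t\<bar>))"
proof -
 obtain A where A: "!!W. killing_pair (K W) (A W)" "!!W w. A W 0 w = 0" by (rule K_pairs) blast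
 define C where "C W x w = A Z x (A W x w) - A W x (A Z x w) + R x (K W x) (K Z x) w" for W x w
 have kpC: "killing_pair (%x. A Z x (K W x) - A W x (K Z x)) (C W)" for W
 using killing_pair_bracket[OF A(1)[of W] A(1)[of Z]] unfolding C_def[abs_def] .
 have cd: "(c has_derivative (%h. h *R Z)) (at 0)" using c(1) by (simp add: has_vector_derivative_def)
 have small: "\<forall>\<^sub>F t in nhds 0. norm (f t) <= k * \<bar>t\<bar>" if f: "(f hvd 0) (at 0)" "f 0 = 0" and k: "k > 0" for f :: "real => 'a" and k
 proof -
 obtain d where d: "d > 0" "!!y. norm (y - 0) < d ==> norm (f y - f 0 - 0) <= k * norm (y - 0)"
  using f(1) k unfolding has_vector_derivative_def has_derivative_at_alt by (metis scaleR_zero_right)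
 then show ?thesis using f(2) by (auto simp: eventually_nhds_metric dist_real_def)
 qed
 have lin: "linear (%h. dd h f (c 0))" if "smooth_on \<O> f" for f :: "'a => 'a" by (rule dd_linear[OF that]) (simp add: c(2) o)
 have comp: "((%t. f (c t)) hvd dd Z f 0) (at 0)" if "smooth_on \<O> f" for f :: "'a => 'a"
 proof -
 have "((%t. f (c t)) has_derivative (%h. dd (h *R Z) f (c 0))) (at 0)"
  by (rule has_derivative_compose[OF cd smooth_deriv[OF that]]) (simp add: c(2) o)
 then show ?thesis unfolding linear_scale[OF lin[OF that]] by (simp add: has_vector_derivative_def c(2))
 qed
 have prod: "((%t. t *R f (c t)) hvd f 0) (at 0)" if "smooth_on \<O> f" for f :: "'a => 'a"
 using has_vector_derivative_scaleR[OF DERIV_ident comp[OF that]] by (simp add: c(2))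
 have sR: "smooth_on \<O> (%x. R 0 W Z x)" for W
 by (rule smooth_on_linear) (use R_linear(1)[OF o(1)] linear_conv_bounded_linear in blast)
 define e1 where "e1 W t = K W (c t) + t *R R 0 W Z (c t) - v W t" for W t
 define e2 where "e2 W w t = A W (c t) w + t *R C W (c t) w" for W w t
 have d1: "(e1 W hvd 0) (at 0)" "e1 W 0 = 0" for W
 proof -
 have "(e1 W hvd dd Z (K W) 0 + R 0 W Z 0 - 0) (at 0)"
  unfolding e1_def[abs_def] by (intro has_vector_derivative_diff has_vector_derivative_add comp prod sR kpD(1)[OF A(1)] v(1))
 then show "(e1 W hvd 0) (at 0)" by (simp add: dd_K tr_simps R_simps o)
 show "e1 W 0 = 0" by (simp add: e1_def c(2) v(2) K_0)
 qed
 have d2: "(e2 W w hvd 0) (at 0)" "e2 W w 0 = 0" for W w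
 proof -
 have "(e2 W w hvd dd Z (%x. A W x w) 0 + C W 0 w) (at 0)"
  unfolding e2_def[abs_def] by (intro has_vector_derivative_add comp prod kpD(2)[OF A(1)] kpD(2)[OF kpC])
 moreover have "dd Z (%x. A W x w) 0 + C W 0 w = 0"
  unfolding killing_pair_dd_A[OF A(1) o(1)] C_def A(2) using R_anti[of 0 Z W w] by (simp add: K_0 \<G>_simps o)
 ultimately show "(e2 W w hvd 0) (at 0)" by simp
 show "e2 W w 0 = 0" by (simp add: e2_def c(2) A(2))
 qed
 obtain L where L: "L >= 0" "!!\<x> B x0 x \<e>. killing_pair \<x> B ==> x0 : cball 0 (2 * \<r>) ==> x : cball 0 (2 * \<r>) ==> norm (\<x> x0) <= \<e> ==>
 (!!b. b : Basis ==> norm (B x0 b) <= \<e>) ==> norm (\<x> x) <= L * \<e> & (ALL b:Basis. norm (B x b) <= L * \<e>)"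
 by (rule killing_pair_bound[OF compact_cball convex_cball \<r>(2)]) blast
 define k where "k = e / (L + 1)"
 have k: "k > 0" "L * k <= e" using e L(1) by (auto simp: k_def field_simps)
 have "\<forall>\<^sub>F t in nhds 0. c t : ball 0 (2 * \<r>)"
 proof -
 have "isCont c 0" using has_derivative_continuous[OF cd] .
 then have "(c \<longlongrightarrow> c 0) (nhds 0)" by (simp add: continuous_at tendsto_at_iff_tendsto_nhds)
 then show ?thesis using topological_tendstoD[of c "c 0" "nhds 0" "ball 0 (2 * \<r>)"] \<r>(1) c(2) by simp
 qed
 moreover have "\<forall>\<^sub>F t in nhds 0. ALL W:Basis. norm (e1 W t) <= k * \<bar>t\<bar>"
 by (intro eventually_ball_finite ballI finite_Basis small d1 k)
 moreover have "\<forall>\<^sub>F t in nhds 0. ALL W:Basis. ALL b:Basis. norm (e2 W b t) <= k * \<bar>t\<bar>"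
 by (intro eventually_ball_finite ballI finite_Basis small d2 k)
 ultimately show ?thesis
 proof eventually_elim
 case (elim t)
 have ct: "c t : cball 0 (2 * \<r>)" using elim(1) by simp
 have "norm (\<z> x - K W x - t *R R 0 W Z x) <= e * \<bar>t\<bar>"
  if W: "W : Basis" and kp: "killing_pair \<z> B" and \<z>: "\<z> (c t) = v W t" "!!w. B (c t) w = 0" and x: "x : cball 0 (2 * \<r>)" for W \<z> B x
 proof -
  define X where "X y = \<z> y - K W y - t *R (A Z y (K W y) - A W y (K Z y))" for y
  define XB where "XB y w = B y w - A W y w - t *R C W y w" for y w
  have kpX: "killing_pair X XB"
  unfolding X_def[abs_def] XB_def[abs_def]
  by (rule killing_pair_diff[OF killing_pair_diff[OF kp A(1)[of W]] killing_pair_scale[OF kpC[of W], of t]])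
  have X: "X y = \<z> y - K W y - t *R R 0 W Z y" if "y : \<O>" for y unfolding X_def K_bracket[OF A that] ..
  have "X (c t) = - e1 W t" unfolding X[OF subsetD[OF \<r>(2) ct]] by (simp add: \<z>(1) e1_def)
  then have X0: "norm (X (c t)) <= k * \<bar>t\<bar>" using elim(2) W by simp
  have "norm (XB (c t) b) <= k * \<bar>t\<bar>" if b: "b : Basis" for b
  proof -
  have "XB (c t) b = - e2 W b t" by (simp add: XB_def \<z>(2) e2_def)
  then show ?thesis using elim(3) W b by simp
  qed
  from L(2)[OF kpX ct x X0 this] have "norm (\<z> x - K W x - t *R R 0 W Z x) <= L * (k * \<bar>t\<bar>)"
  unfolding X[OF subsetD[OF \<r>(2) x]] by (rule conjunct1)
  also have "... <= e * \<bar>t\<bar>" using mult_right_mono[OF k(2), of "\<bar>t\<bar>"] by (simp add: mult_ac)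
  finally show ?thesis .
 qed
 then show ?case using ct by blast
 qed
qed

text \<open>\<open>A 0\<close> need not commute with \<open>I\<close>, so
  \<open>linear_killing\<close> does not apply to the rest \<open>\<m>\<close>. But the commutator
  \<open>C\<close> kills the curvature in every slot, hence \<open>A 0\<close> is still a derivation
  of the triple product. By the bracket relation with \<open>K W\<close>, the deviation
  \<open>D\<close> of \<open>\<m>\<close> from \<open>A 0\<close> then solves a homogeneous linear
  equation along rays.\<close>

theorem killing_field_quadratic:
 assumes kp: "killing_pair \<x> A" and skew: "!!v w. G 0 (A 0 v) w + G 0 v (A 0 w) = 0"
 shows "EX r>0. ALL X:ball 0 r. \<x> X = \<x> 0 + A 0 X - (1/2) *R tr (\<x> 0) X X"
proof -
 obtain AK where AK: "!!W. killing_pair (K W) (AK W)" "!!W w. AK W 0 w = 0" by (rule K_pairs) blast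
 define Z where "Z = \<x> 0"
 define \<m> where "\<m> x = \<x> x - K Z x" for x
 define B where "B x w = A x w - AK Z x w" for x w
 have kp\<m>: "killing_pair \<m> B" unfolding \<m>_def[abs_def] B_def[abs_def] by (rule killing_pair_diff[OF kp AK(1)])
 have \<m>0: "\<m> 0 = 0" and B0: "B 0 w = A 0 w" for w by (simp_all add: \<m>_def Z_def K_0 B_def AK(2))
 have l: "linear (A 0)" by (rule kpD(3)[OF kp o(1)])
 note ls = linear_add[OF l] linear_diff[OF l] linear_scale[OF l] linear_neg[OF l]
 note AR = kp_curvature[OF kp o(1)]
 define C where "C w = A 0 (I w) - I (A 0 w)" for w
 have "linear C" unfolding C_def by (rule linearI) (simp_all add: ls I_simps algebra_simps)
 moreover have "G 0 (C v) w = - G 0 v (C w)" for v w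
 proof -
 have sk: "G 0 (A 0 v) w = - G 0 v (A 0 w)" for v w using skew[of v w] by simp
 show ?thesis by (simp add: C_def G_simps sk G_I_left o)
 qed
 moreover have "C (I v) = - I (C v)" for v by (simp add: C_def I_simps ls)
 moreover have "curvature_invariant 0 C"
 proof -
 have "C (R 0 u v w) = R 0 u v (C w)" for u v w
  using AR[of u v "I w"] by (simp add: C_def AR R_I R_simps I_simps o)
 moreover have "R 0 (C u) v w + R 0 u (C v) w = 0" for u v w
 proof -
  have "A 0 (R 0 (I u) v w) = - A 0 (R 0 u (I v) w)" by (simp only: R_I_left[OF o(1)] ls)
  then show ?thesis unfolding AR C_def using R_I_left[OF o(1), of u v "A 0 w"] R_I_left[OF o(1), of "A 0 u" v w] R_I_left[OF o(1), of u "A 0 v" w]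
  by (simp add: R_simps o algebra_simps)
 qed
 ultimately show ?thesis by (simp add: curvature_invariant_def)
 qed
 ultimately have CR: "R 0 u v (C w) = 0" "R 0 (C u) v w = 0" "R 0 u (C v) w = 0" and "curvature_invariant 0 C" for u v w
 using antilinear_curvature_derivation[OF o(1), of C] by blast+
 then have CR4: "C (R 0 u v w) = 0" for u v w by (simp add: curvature_invariant_def)
 have AI: "A 0 (I w) = I (A 0 w) + C w" for w by (simp add: C_def)
 have inv: "A 0 (tr u v w) = tr (A 0 u) v w + tr u (A 0 v) w + tr u v (A 0 w)" for u v w
 by (simp add: triple_def ls AR AI CR CR4 R_simps I_simps o scaleR_right_distrib algebra_simps)
 have br: "dd (K W x) \<m> x = dd (\<m> x) (K W) x + K (A 0 W) x" if x: "x : \<O>" for W x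
 proof -
 have "AK W x (\<m> x) - B x (K W x) = (- 1) *R K (A 0 W) x"
  by (rule killing_pair_unique(1)[OF killing_pair_bracket[OF kp\<m> AK(1)[of W]] killing_pair_scale[OF AK(1)] convex o(1) _ _ x])
  (simp_all add: AK(2) B0 K_0 \<m>0 ls linear_0[OF l] R_simps o linear_0[OF kpD(3)[OF AK(1) o(1)]])
 then have c: "B x (K W x) = AK W x (\<m> x) + K (A 0 W) x" by (simp add: algebra_simps)
 show ?thesis
  unfolding killing_pair_dd[OF AK(1) x] killing_pair_dd[OF kp\<m> x] c \<G>_sym[OF x, of "K W x" "\<m> x"] by simp
 qed
 define D where "D x = \<m> x - A 0 x" for x
 have bl: "bounded_linear (A 0)" using l linear_conv_bounded_linear by blast
 have sD: "smooth_on \<O> D" unfolding D_def[abs_def] by (intro smooth_diff_fun open_\<O> kpD(1)[OF kp\<m>] smooth_on_linear bl)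
 have dD: "dd (K W x) D x = - tr W x (D x)" if x: "x : \<O>" for W x
 proof -
 have "dd (K W x) D x = dd (K W x) \<m> x - A 0 (K W x)"
  unfolding D_def[abs_def]
  by (rule dd_eqI[OF has_derivative_diff[OF smooth_deriv[OF kpD(1)[OF kp\<m>] x] bounded_linear_imp_has_derivative[OF bl]]])
 then show ?thesis
  unfolding br[OF x] dd_K using triple_sym[OF o(1), of W "A 0 x" x]
  by (simp add: K_triple ls inv D_def tr_simps scaleR_right_distrib algebra_simps) (simp flip: scaleR_add_left)
 qed
 obtain \<r> where \<r>: "\<r> > 0" "cball 0 (2 * \<r>) \<subseteq> \<O>" and solve: "!!y Y. y : cball 0 \<r> ==> EX W. K W y = Y & norm W <= 2 * norm Y" by (rule K_solve) blast
 obtain c where c: "c >= 0" "!!u v w. norm (tr u v w) <= c * (norm u * norm v * norm w)" by (rule tr_bound) blast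
 have "\<x> Y = \<x> 0 + A 0 Y - (1/2) *R tr (\<x> 0) Y Y" if Y: "Y : ball 0 \<r>" for Y
 proof -
 have y: "s *R Y : cball 0 \<r>" if "s : {0..1}" for s using that Y mult_left_le_one_le[of "norm Y" s] by auto
 have y\<O>: "s *R Y : \<O>" if "s : {0..1}" for s using y[OF that] \<r> by auto
 define k where "k = 1 + c * (2 * \<r>) * \<r>"
 have "norm (D (1 *R Y)) <= (norm (D (0 *R Y)) + 0) * exp k"
 proof (rule gronwall[of k 0 "%s. D (s *R Y)" "%s. dd Y D (s *R Y)"])
  show "k >= 1" using c(1) \<r>(1) by (simp add: k_def)
  fix s :: real assume s: "s : {0..1}"
  show "((%s. D (s *R Y)) hvd dd Y D (s *R Y)) (at01 s)"
  by (rule smooth_on_ray_derivative[OF sD y\<O>[OF s]])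
  obtain W where W: "K W (s *R Y) = Y" "norm W <= 2 * norm Y" using solve[OF y[OF s]] by blast
  have "norm (dd Y D (s *R Y)) <= c * (norm W * norm (s *R Y) * norm (D (s *R Y)))"
  using dD[OF y\<O>[OF s], of W] c(2)[of W "s *R Y" "D (s *R Y)"] unfolding W(1) by simp
  also have "... <= c * (2 * \<r> * \<r> * norm (D (s *R Y)))"
  using W(2) Y y[OF s] c(1) \<r>(1) by (intro mult_left_mono mult_right_mono mult_mono) auto
  also have "... <= k * norm (D (s *R Y)) + 0" by (simp add: k_def algebra_simps)
  finally show "norm (dd Y D (s *R Y)) <= k * norm (D (s *R Y)) + 0" .
 qed auto
 then have "D Y = 0" by (simp add: D_def \<m>0 linear_0[OF l])
 then show ?thesis by (simp add: D_def \<m>_def K_triple Z_def algebra_simps)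
 qed
 then show ?thesis using \<r>(1) by blast
qed

end

section \<open>Change of parametrization\<close>

lemma (in parametrization) smooth_field_coordinates:
 assumes Y: "smooth_field M N Y" and S: "open S" "S \<subseteq> U" "f ` S \<subseteq> N"
 shows "smooth_on S (%x. dg x (Y (f x)))"
proof (rule smooth_on_local)
 fix x assume x: "x : S"
 let ?c = "f x" and ?Y = "%x. dg x (Y (f x))"
 let ?W = "W ?c \<inter> S" and ?V = "V ?c \<inter> \<k> ?c -` S"
 have oV: "open ?V" by (rule continuous_open_preimage[OF smooth_cont[OF smooth_\<k>] open_V S(1)])
 have oW: "open ?W" using open_W S(1) by blast
 have "?V \<subseteq> chart M ?c ` (N \<inter> cdom M ?c)"
 proof
 fix y assume y: "y : ?V"
 then have "f (\<k> ?c y) : N \<inter> cdom M ?c" using \<k>_W[of y ?c] S(3) by auto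
 then show "y : chart M ?c ` (N \<inter> cdom M ?c)" using \<p>_\<k>[of y ?c] y by (intro image_eqI[of _ _ "f (\<k> ?c y)"]) auto
 qed
 then have "smooth_on ?V (components M ?c Y)" using Y unfolding smooth_field_def by (blast intro: smooth_subset)
 then have sV: "smooth_on ?V (%y. dd (components M ?c Y y) (\<k> ?c) y)"
 by (rule smooth_on_dd_var[OF oV smooth_subset[OF smooth_\<k> Int_lower1]])
 have sm: "smooth_on ?W (%z. dd (components M ?c Y (\<p> ?c z)) (\<k> ?c) (\<p> ?c z))"
 by (rule smooth_compose[OF oW oV _ sV smooth_subset[OF smooth_\<p> Int_lower1]]) (use \<p>_V[of _ ?c] \<k>_\<p>[of _ ?c] in auto)
 have Yd: "ALL z:U. Y (f z) = df z (?Y z)" by (simp add: df_dg)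
 have eq: "dd (components M ?c Y (\<p> ?c z)) (\<k> ?c) (\<p> ?c z) = ?Y z" if z: "z : ?W" for z
 using components_eq[OF Yd subset_refl, of "\<p> ?c z" ?c] \<p>_V[of z ?c] d\<k>_d\<p>[of z ?c] \<k>_\<p>[of z ?c] z by simp
 have "smooth_on ?W ?Y" by (rule smooth_cong[OF oW, THEN iffD1, OF _ sm]) (rule eq)
 then show "EX T. open T & x : T & smooth_on T ?Y" using in_W[of x] x S(2) oW by blast
qed

lemma (in parametrization) open_image_subset: "open S ==> S \<subseteq> U ==> open (f ` S)"
 by (rule smooth_field_push(2)[of S "push (%_. 0)" "%_. 0"]) (auto simp: push_f)

lemma (in parametrization) continuous_f: "continuous_on U f"
 using smooth_f by (simp add: smooth_into_def)

lemma (in local_symmetric) killing_pair_subset: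
 assumes S: "open S" "S \<subseteq> \<O>" and kp: "killing_pair \<x> A"
 shows "local_symmetric.killing_pair S \<G> \<x> A"
proof -
 interpret L: local_symmetric S \<G> G I by (rule local_symmetric_subset[OF S])
 show ?thesis
 unfolding L.killing_pair_def
 using smooth_subset[OF kpD(1)[OF kp] S(2)] smooth_subset[OF kpD(2)[OF kp] S(2)]
  kpD(3-5)[OF kp subsetD[OF S(2)]] by blast
qed

locale transition = P: hermitean_parametrization M U f g I + Q: hermitean_parametrization M U' f' g' I
 for M :: "('m::{t2_space,second_countable_topology}, 'e::euclidean_space) almost_hermitian" and U f g I U' f' g' +
 assumes zero: "0 : U" "0 : U'"
begin

sublocale PL: local_symmetric U P.\<G> P.G I using P.local_symmetric zero(1) by blast
sublocale QL: local_symmetric U' Q.\<G> Q.G I using Q.local_symmetric zero(2) by blast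

definition \<f> where "\<f> y = g (f' y)"
definition O' where "O' = U' \<inter> f' -` (f ` U)"

lemma open_O: "open O'"
 unfolding O'_def by (rule continuous_open_preimage[OF Q.continuous_f Q.open_U P.open_image])

lemma \<f>_in: "y : O' ==> \<f> y : U" and f_\<f>: "y : O' ==> f (\<f> y) = f' y" and O_U: "y : O' ==> y : U'"
 by (auto simp: O'_def \<f>_def P.g_f)

lemma \<f>_has_derivative: "y : O' ==> (\<f> has_derivative (%h. P.dg (\<f> y) (Q.df y h))) (at y)"
proof -
 assume y: "y : O'"
 let ?c = "f' y"
 have yW: "y : Q.W ?c" by (rule Q.in_W[OF O_U[OF y]])
 have v: "Q.\<p> ?c y : P.V ?c" using P.\<p>_V[OF P.in_W[OF \<f>_in[OF y]]] f_\<f>[OF y] by simp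
 have "((%z. P.\<k> ?c (Q.\<p> ?c z)) has_derivative (%h. P.dg (\<f> y) (Q.df y h))) (at y)"
 using has_derivative_compose[OF smooth_deriv[OF Q.smooth_\<p> yW] smooth_deriv[OF P.smooth_\<k> v]]
 by (simp add: P.dg_def Q.df_eq f_\<f>[OF y] comp_def)
 then show ?thesis
 by (rule has_derivative_transform_within_open[OF _ open_Int[OF open_O Q.open_W[of ?c]]]) (use y yW in \<open>auto simp: \<f>_def Q.chart_inv_chart\<close>)
qed

text \<open>\<open>transfer\<close> compares the covariant derivatives in the two systems through
  \<open>nabla\<close> on the manifold. A constant vector of one system is not constant in the
  other, so it is carried along as the field \<open>?w\<close>.\<close>

lemma pull_killing_pair:
 assumes kp: "PL.killing_pair \<z> A" and S: "open S" "S \<subseteq> O'"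
 shows "local_symmetric.killing_pair S Q.\<G> (%y. Q.dg y (P.df (\<f> y) (\<z> (\<f> y))))
 (%y w. Q.dg y (P.df (\<f> y) (A (\<f> y) (P.dg (\<f> y) (Q.df y w)))))"
proof -
 have SU: "S \<subseteq> U'" using S O_U by blast
 interpret QS: local_symmetric S Q.\<G> Q.G I by (rule QL.local_symmetric_subset[OF S(1) SU])
 define S' where "S' = U \<inter> f -` (f' ` S)"
 have S': "open S'" "S' \<subseteq> U"
 unfolding S'_def using continuous_open_preimage[OF P.continuous_f P.open_U Q.open_image_subset[OF S(1) SU]] by auto
 have fS: "f ` S' = f' ` S" using S f_\<f> \<f>_in by (force simp: S'_def)
 have \<f>S: "\<f> y : S'" if "y : S" for y using that S f_\<f> \<f>_in by (auto simp: S'_def)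
 interpret PS: local_symmetric S' P.\<G> P.G I by (rule PL.local_symmetric_subset[OF S'])
 have kpS: "PS.killing_pair \<z> A" by (rule PL.killing_pair_subset[OF S' kp])
 let ?b = "%y. Q.dg y (P.df (\<f> y) (\<z> (\<f> y)))"
 let ?A = "%y w. Q.dg y (P.df (\<f> y) (A (\<f> y) (P.dg (\<f> y) (Q.df y w))))"
 let ?w = "%w x. P.dg x (Q.push (%_. w) (f x))"
 have transfer: "smooth_on S (%y. Q.dg y (P.df (\<f> y) (\<s> (\<f> y))))"
 "y : S ==> P.df (\<f> y) (PS.nab (P.dg (\<f> y) (Q.df y u)) \<s> (\<f> y)) = Q.df y (QS.nab u (%y. Q.dg y (P.df (\<f> y) (\<s> (\<f> y)))) y)"
 if \<s>: "smooth_on S' \<s>" for \<s> y u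
 proof -
 let ?Y = "P.push \<s>"
 have YP: "ALL z:S'. ?Y (f z) = P.df z (\<s> z)" by (simp add: P.push_f subsetD[OF S'(2)])
 have YQ0: "?Y (f' y) = P.df (\<f> y) (\<s> (\<f> y))" if "y : S" for y using P.push_f[OF \<f>_in[OF subsetD[OF S(2) that]], of \<s>] f_\<f>[OF subsetD[OF S(2) that]] by simp
 have YQ: "ALL y:S. ?Y (f' y) = Q.df y (Q.dg y (P.df (\<f> y) (\<s> (\<f> y))))" by (simp add: YQ0 Q.df_dg subsetD[OF SU])
 have "smooth_on S (%y. Q.dg y (?Y (f' y)))"
  by (rule Q.smooth_field_coordinates[OF P.smooth_field_push(1)[OF YP S' \<s>] S(1) SU]) (simp add: fS)
 then show sm: "smooth_on S (%y. Q.dg y (P.df (\<f> y) (\<s> (\<f> y))))"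
  by (rule smooth_cong[OF S(1), THEN iffD1, rotated]) (simp add: YQ0)
 assume y: "y : S"
 have yO: "y : O'" "y : U'" using y S SU by auto
 let ?X = "%_::'m. Q.df y u"
 have "nabla M ?X ?Y (f' y) = Q.df y (QS.nab u (%y. Q.dg y (P.df (\<f> y) (\<s> (\<f> y)))) y)"
  by (rule Q.nabla_push[OF refl YQ S(1) SU sm y])
 moreover have "nabla M ?X ?Y (f (\<f> y)) = P.df (\<f> y) (PS.nab (P.dg (\<f> y) (Q.df y u)) \<s> (\<f> y))"
  by (rule P.nabla_push[OF _ YP S' \<s> \<f>S[OF y]]) (simp add: P.df_dg \<f>_in[OF yO(1)])
 ultimately show "P.df (\<f> y) (PS.nab (P.dg (\<f> y) (Q.df y u)) \<s> (\<f> y)) = Q.df y (QS.nab u (%y. Q.dg y (P.df (\<f> y) (\<s> (\<f> y)))) y)"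
  by (simp add: f_\<f>[OF yO(1)])
 qed
 have sw: "smooth_on S' (?w w)" for w
 proof (rule P.smooth_field_coordinates[OF _ S'])
 show "smooth_field M (f' ` S) (Q.push (%_. w))"
  by (rule Q.smooth_field_push(1)[OF _ S(1) SU smooth_const]) (use SU Q.push_f in blast)
 qed (simp add: fS)
 have w\<f>: "?w w (\<f> y) = P.dg (\<f> y) (Q.df y w)" if "y : S" for w y
 by (simp add: Q.push_f[OF subsetD[OF SU that]] f_\<f>[OF subsetD[OF S(2) that]])
 have sA: "smooth_on S' (%x. A x (?w w x))" for w by (rule PS.smooth_A_field[OF kpS sw])
 show ?thesis
 unfolding QS.killing_pair_def
 proof (intro conjI allI ballI)
 show "smooth_on S ?b" by (rule transfer(1)[OF PS.kpD(1)[OF kpS]])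
 show "smooth_on S (%y. ?A y w)" for w
  by (rule smooth_cong[OF S(1), THEN iffD1, OF _ transfer(1)[OF sA[of w]]]) (simp add: w\<f>)
 fix y assume y: "y : S"
 then have yO: "y : O'" "y : U'" "\<f> y : U" using S SU \<f>_in by auto
 note lA = PS.kpD(3)[OF kpS \<f>S[OF y]]
 show "linear (?A y)"
  using linear_compose[OF linear_compose[OF linear_compose[OF linear_compose[OF Q.df_linear[OF yO(2)] P.dg_linear[OF yO(3)]] lA] P.df_linear[OF yO(3)]] Q.dg_linear[OF yO(2)]]
  by (simp add: comp_def)
 show "QS.nab u ?b y = ?A y u" for u
 proof (rule Q.df_inject[OF yO(2)])
  show "Q.df y (QS.nab u ?b y) = Q.df y (?A y u)"
  unfolding transfer(2)[OF PS.kpD(1)[OF kpS] y, symmetric] PS.kpD(4)[OF kpS \<f>S[OF y]] Q.df_dg[OF yO(2)] ..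
 qed
 show "QS.nab u (%y. ?A y w) y = ?A y (Q.\<G> y u w) + QS.R y u (?b y) w" for u w
 proof (rule Q.df_inject[OF yO(2)])
  let ?u = "P.dg (\<f> y) (Q.df y u)"
  have "QS.nab u (%y. ?A y w) y = QS.nab u (%y. Q.dg y (P.df (\<f> y) (A (\<f> y) (?w w (\<f> y))))) y"
  by (rule QS.nab_cong[OF y]) (simp add: w\<f>)
  then have "Q.df y (QS.nab u (%y. ?A y w) y) = P.df (\<f> y) (PS.nab ?u (%x. A x (?w w x)) (\<f> y))"
  using transfer(2)[OF sA y, of u w] by simp
  also have "... = P.df (\<f> y) (A (\<f> y) (PS.nab ?u (?w w) (\<f> y))) + P.df (\<f> y) (PS.R (\<f> y) ?u (\<z> (\<f> y)) (P.dg (\<f> y) (Q.df y w)))"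
  unfolding PS.nab_A_field[OF kpS sw \<f>S[OF y]] linear_add[OF P.df_linear[OF yO(3)]] w\<f>[OF y] ..
  also have "PS.nab ?u (?w w) (\<f> y) = P.dg (\<f> y) (Q.df y (Q.\<G> y u w))"
  proof -
  have "QS.nab u (%y. Q.dg y (P.df (\<f> y) (?w w (\<f> y)))) y = QS.nab u (%_. w) y"
   by (rule QS.nab_cong[OF y]) (use w\<f> SU S(2) \<f>_in in \<open>auto simp: P.df_dg Q.dg_df subset_iff\<close>)
  then have "P.df (\<f> y) (PS.nab ?u (?w w) (\<f> y)) = Q.df y (Q.\<G> y u w)"
   using transfer(2)[OF sw y, of u w] by (simp add: QS.nab_const)
  then show ?thesis using P.dg_df[OF yO(3)] by metis
  qed
  also have "P.df (\<f> y) (PS.R (\<f> y) ?u (\<z> (\<f> y)) (P.dg (\<f> y) (Q.df y w))) = Q.df y (QS.R y u (?b y) w)"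
  unfolding P.curvature_df[OF yO(3), symmetric] Q.curvature_df[OF yO(2), symmetric] P.df_dg[OF yO(3)] Q.df_dg[OF yO(2)] f_\<f>[OF yO(1)] ..
  finally show "Q.df y (QS.nab u (%y. ?A y w) y) = Q.df y (?A y (Q.\<G> y u w) + QS.R y u (?b y) w)"
  unfolding linear_add[OF Q.df_linear[OF yO(2)]] Q.df_dg[OF yO(2)] .
 qed
 qed
qed

end

lemma polynomial_function_smooth:
 assumes "polynomial_function (f :: 'a::euclidean_space => 'b::euclidean_space)"
 shows "smooth_on UNIV f"
proof -
 have r: "smooth_on UNIV q" if "real_polynomial_function q" for q :: "'a => real"
 using that
 proof (induction rule: real_polynomial_function.induct)
 case (linear f) then show ?case by (rule smooth_on_linear)
 next
 case (mult f g) show ?case by (rule smooth_on_bilinear[OF open_UNIV bounded_bilinear_mult mult.IH])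
 qed (auto intro: smooth_add)
 have "smooth_on UNIV (%x. \<Sum>b\<in>Basis. (f x \<bullet> b) *R b)"
 by (rule smooth_sum[OF open_UNIV], rule smooth_scaleR[OF open_UNIV _ smooth_const], rule r)
  (use assms in \<open>simp add: polynomial_function_iff_Basis_inner\<close>)
 then show ?thesis by (simp add: euclidean_representation)
qed

context parametrization begin

lemma linear_reparametrization:
 assumes L: "linear L" "bij L" and B: "open B" "L ` B \<subseteq> U"
 shows "parametrization M B (f \<circ> L) (inv L \<circ> g)" "x : B ==> map_differential M (f \<circ> L) x u = df (L x) (L u)"
proof -
 note bl = linear_conv_bounded_linear[THEN iffD1, OF L(1)]
 have li: "linear (inv L)" using L by (simp add: inj_linear_imp_inv_linear bij_is_inj)
 note bli = linear_conv_bounded_linear[THEN iffD1, OF li]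
 have iL: "inv L (L x) = x" for x using L(2) by (simp add: bij_is_inj)
 have oi: "open (f ` L ` B)" by (rule open_image_subset[OF open_surjective_linear_image[OF B(1) L(1) bij_is_surj[OF L(2)]] B(2)])
 show "parametrization M B (f \<circ> L) (inv L \<circ> g)"
 proof
 show "open ((f \<circ> L) ` B)" using oi by (simp add: image_comp)
 show "(inv L \<circ> g) ((f \<circ> L) x) = x" if "x : B" for x using that B(2) by (auto simp: g_f iL)
 have c: "continuous_on B (f \<circ> L)"
  by (rule continuous_on_compose[OF linear_continuous_on[OF bl] continuous_on_subset[OF continuous_f B(2)]])
 show "smooth_into M B (f \<circ> L)"
  unfolding smooth_into_def
 proof (intro conjI allI c)
  fix c'
  have "smooth_on (B \<inter> (f \<circ> L) -` cdom M c') (%x. \<p> c' (L x))"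
  by (rule smooth_compose[OF continuous_open_preimage[OF c B(1) open_cdom] open_W _ smooth_\<p> smooth_on_linear[OF bl]])
   (use B(2) in auto)
  then show "smooth_on (B \<inter> (f \<circ> L) -` cdom M c') (chart M c' \<circ> (f \<circ> L))" by (simp add: comp_def)
 qed
 show "smooth_fun M ((f \<circ> L) ` B) (inv L \<circ> g)"
  unfolding smooth_fun_def
 proof
  fix c'
  have s: "(f \<circ> L) ` B \<subseteq> f ` U" using B(2) by auto
  have o: "open (chart M c' ` ((f \<circ> L) ` B \<inter> cdom M c'))"
  proof -
  have "openin (top_of_set (cdom M c')) ((f \<circ> L) ` B \<inter> cdom M c')" using oi by (simp add: openin_open_Int inf.commute image_comp)
  then have "openin (top_of_set (chart M c' ` cdom M c')) (chart M c' ` ((f \<circ> L) ` B \<inter> cdom M c'))" by (rule homeomorphism_imp_open_map[OF chart_homeo])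
  then show ?thesis using openin_open_trans open_chart by blast
  qed
  have "smooth_on (chart M c' ` ((f \<circ> L) ` B \<inter> cdom M c')) (%y. inv L (\<k> c' y))"
  by (rule smooth_bl[OF o bli smooth_subset[OF smooth_\<k>]]) (use s in auto)
  then show "smooth_on (chart M c' ` ((f \<circ> L) ` B \<inter> cdom M c')) (inv L \<circ> g \<circ> chart_inv M c')" by (simp add: comp_def)
 qed
 qed (fact manifold B(1))+
 assume x: "x : B"
 then have y: "L x : U" using B(2) by blast
 have "((%z. \<p> (f (L x)) (L z)) has_derivative (%h. dd (L h) (\<p> (f (L x))) (L x))) (at x)"
 by (rule has_derivative_compose[OF bounded_linear_imp_has_derivative[OF bl] smooth_deriv[OF smooth_\<p> in_W[OF y]]])
 then show "map_differential M (f \<circ> L) x u = df (L x) (L u)"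
 by (simp add: map_differential_def dd_eqI comp_def)
qed

end

section \<open>Normal coordinates at the points of a curve\<close>

locale linear_frame =
 fixes M :: "('m::{t2_space,second_countable_topology}, 'e::euclidean_space) almost_hermitian"
 and p q :: 'm and D :: "'e set" and k :: "'e => 'm" and L :: "'e => 'e" and r :: real
 assumes hss: "hermitean_symmetric_space M" and knc: "kahler_normal_coordinates M q D k" and L: "linear L"
 and isometry: "!!u v. metric M q (L u) (L v) = metric M p u v" and holomorphic: "!!u. cplx M q (L u) = L (cplx M p u)"
 and r: "r > 0" "{v. metric M q v v < r\<^sup>2} \<subseteq> D"
begin

text \<open>A ball for the metric at \<open>p\<close>. It is convex, as the Killing pair arguments
  require, and the isometry \<open>L\<close> maps it into the ball of the same radius at
  \<open>q\<close>, so frames at different points share one domain.\<close>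

definition B where "B = {v. metric M p v v < r\<^sup>2}"
abbreviation "f \<equiv> k \<circ> L"
definition g where "g = inv L \<circ> inv_into D k"

lemma metric: "bilinear (metric M s)" "metric M s u v = metric M s v u" "u ~= 0 ==> metric M s u u > 0"
 using hss by (auto simp: hermitean_symmetric_space_def kahler_manifold_def riemannian_metric_def)

lemma bij_L: "bij L"
proof -
 have "u = 0" if "L u = 0" for u
 using isometry[of u u] metric(3)[of u p] that bilinear_lzero[OF metric(1)] by fastforce
 then have "inj L" using linear_injective_0[OF L] by blast
 then show ?thesis using linear_injective_imp_surjective[OF L] by (simp add: bij_def)
qed

lemma zero_B: "0 : B" using r(1) by (simp add: B_def bilinear_lzero[OF metric(1)])

lemma open_B: "open B"
proof -
 have b: "bounded_bilinear (metric M p)" using metric(1) bilinear_conv_bounded_bilinear by blast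
 show ?thesis unfolding B_def by (rule open_Collect_less) (intro bounded_bilinear.continuous_on[OF b] continuous_intros)+
qed

lemma convex_B: "convex B"
proof (rule convexI)
 fix x y and a b :: real
 assume xy: "x : B" "y : B" and ab: "0 <= a" "0 <= b" "a + b = 1"
 let ?g = "metric M p"
 note s = bilinear_ladd[OF metric(1)] bilinear_radd[OF metric(1)] bilinear_lmul[OF metric(1)] bilinear_rmul[OF metric(1)]
 bilinear_lsub[OF metric(1)] bilinear_rsub[OF metric(1)]
 have b: "b = 1 - a" using ab(3) by simp
 have "?g (a *R x + b *R y) (a *R x + b *R y) = a * ?g x x + b * ?g y y - a * b * ?g (x - y) (x - y)"
 by (simp add: s b metric(2)[of p y x] algebra_simps)
 moreover have "a * b * ?g (x - y) (x - y) >= 0"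
 using metric(3)[of "x - y" p] ab bilinear_lzero[OF metric(1)] by (cases "x = y") (auto intro: mult_nonneg_nonneg)
 moreover have "a * ?g x x + b * ?g y y < r\<^sup>2" using xy ab by (intro convex_bound_lt) (auto simp: B_def)
 ultimately show "a *R x + b *R y : B" by (simp add: B_def)
qed

lemma L_B: "L ` B \<subseteq> D" using r(2) isometry by (auto simp: B_def)

lemma coordinates: "parametrization M D k (inv_into D k)"
 using hss knc by unfold_locales
 (auto simp: hermitean_symmetric_space_def kahler_manifold_def kahler_normal_coordinates_def anchored_coordinates_def inv_into_f_f)

lemma dk: "x : D ==> map_differential M k x (cplx M q u) = cplx M (k x) (map_differential M k x u)" and k0: "k 0 = q"
 "map_differential M k 0 u = u" and zero_D: "0 : D"
 using knc by (auto simp: kahler_normal_coordinates_def anchored_coordinates_def)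

lemmas reparametrized = parametrization.linear_reparametrization[OF coordinates L bij_L open_B L_B]

sublocale P: hermitean_parametrization M B f g "cplx M p"
proof -
 interpret parametrization M B f g using reparametrized(1) by (simp add: g_def)
 show "hermitean_parametrization M B f g (cplx M p)"
 proof
 show "riemannian_metric M" using hss by (simp add: hermitean_symmetric_space_def kahler_manifold_def)
 show "map_differential M f x (cplx M p u) = cplx M (f x) (map_differential M f x u)" if "x : B" for x u
  using L_B that by (auto simp: reparametrized(2) holomorphic[symmetric] dk)
 qed (fact hss)
qed

lemma L0: "L 0 = 0" by (rule linear_0[OF L])

lemma f_0: "f 0 = q" and df_0: "P.df 0 u = L u"
 by (simp_all add: L0 k0 reparametrized(2) zero_B)

lemma curvature_0: "P.R 0 u v w = inv L (curvature M q (L u) (L v) (L w))"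
 using P.curvature_df[OF zero_B, of u v w] bij_L by (simp add: df_0 L0 k0 bij_is_inj)

text \<open>\<open>L\<close> is complex linear and isometric, so composition with it preserves
  bidegrees and the metric term of the potential.\<close>

lemma normal_potential: "EX \<d> \<q> \<h>. kaehler_normal_potential B P.\<G> P.G (cplx M p) \<d> \<q> \<h>"
proof -
 interpret local_symmetric B P.\<G> P.G "cplx M p" by (rule P.local_symmetric) (use zero_B in blast)
 obtain V \<q> \<h> where V: "q : V" "local_potential M V \<q>"
 and \<h>: "bihomogeneous_components M q (%n X. taylor_component (\<q> \<circ> k) n X - (if n = 2 then metric M q X X else 0)) \<h>"
 and \<h>0: "!!k l. \<h> k l ~= (%_. 0) ==> 2 <= k & 2 <= l"
 using knc unfolding kahler_normal_coordinates_def Sym_ge22_def by blast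
 have "open (B \<inter> f -` V)"
 by (rule continuous_open_preimage[OF P.continuous_f open_B]) (use V(2) in \<open>simp add: local_potential_def\<close>)
 moreover have "0 : B \<inter> f -` V" using zero_B V(1) f_0 by auto
 ultimately obtain \<d> where \<d>: "\<d> > 0" "ball 0 \<d> \<subseteq> B \<inter> f -` V" using open_contains_ball by blast
 note lp = P.local_potential_levi[OF V(2) open_ball]
 have s: "ball 0 \<d> \<subseteq> B" "f ` ball 0 \<d> \<subseteq> V" using \<d>(2) by auto
 note bl = linear_conv_bounded_linear[THEN iffD1, OF L]
 have Sym: "\<h> i l : Sym M q i l" for i l using \<h> by (simp add: bihomogeneous_components_def)
 have "kaehler_normal_potential B P.\<G> P.G (cplx M p) \<d> (\<q> \<circ> f) (%i l X. \<h> i l (L X))"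
 proof (rule kaehler_normal_potential.intro[OF local_symmetric_axioms kaehler_normal_potential_axioms.intro])
 show "\<d> > 0" "ball 0 \<d> \<subseteq> B" "convex B" by (fact \<d>(1) s(1) convex_B)+
 show "smooth_on (ball 0 \<d>) (\<q> \<circ> f)" by (rule lp(1)[OF s])
 show "P.G x u v = (dd u (dd v (\<q> \<circ> f)) x + dd (cplx M p u) (dd (cplx M p v) (\<q> \<circ> f)) x) / 4" if "x : ball 0 \<d>" for x u v
  by (rule lp(2)[OF s that])
 show "bihomogeneous (cplx M p) i l (%X. \<h> i l (L X))" for i l
 proof (rule bihomogeneous.intro)
  show "linear (cplx M p)" by (fact P.cplx_props)
  show "cplx M p (cplx M p u) = - u" for u by (fact P.cplx_props)
  have "smooth_on UNIV (\<h> i l)" using Sym[of i l] by (intro polynomial_function_smooth) (simp add: Sym_def)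
  then show "smooth_on UNIV (%X. \<h> i l (L X))"
  by (rule smooth_compose[OF open_UNIV open_UNIV UNIV_I _ smooth_on_linear[OF bl]])
  show "\<h> i l (L (t *R X)) = of_real t ^ (i + l) * \<h> i l (L X)" for t X
  using Sym[of i l] by (simp add: Sym_def linear_scale[OF L])
  show "((%t. \<h> i l (L (X + t *R cplx M p X))) hvd \<i> * (of_nat i - of_nat l) * \<h> i l (L X)) (at 0)" for X
  using Sym[of i l] by (simp add: Sym_def linear_add[OF L] linear_scale[OF L] holomorphic[symmetric])
 qed
 show "2 <= i & 2 <= l" if "(%X. \<h> i l (L X)) ~= (%_. 0)" for i l using \<h>0[of i l] that by (cases "\<h> i l = (%_. 0)") auto
 show "of_real (taylor_component (\<q> \<circ> f) n X - (if n = 2 then P.G 0 X X else 0)) = (\<Sum>i\<le>n. \<h> i (n - i) (L X))" for n X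
 proof -
  have "taylor_component (\<q> \<circ> f) n X = taylor_component (\<q> \<circ> k) n (L X)"
  by (simp add: taylor_component_def linear_scale[OF L])
  moreover have "P.G 0 X X = metric M q (L X) (L X)" unfolding P.G_def df_0 f_0 ..
  ultimately show ?thesis using \<h> unfolding bihomogeneous_components_def by metis
 qed
 qed
 then show ?thesis by blast
qed

end

text \<open>The conclusion of \<open>displacement_estimate\<close> for a fixed constant, named so
  that it can serve as a hypothesis.\<close>

definition (in kaehler_normal_potential) displacement_bound :: "'a => real => real => bool"
 where "displacement_bound Z \<r> C \<longleftrightarrow> (ALL t e \<p> \<p>' \<z> Y. \<bar>t\<bar> <= 1 --> \<bar>t\<bar> <= e --> norm Y <= \<r> -->
 (ALL s:{0..1}. (\<p> has_derivative \<p>' (s *R Y)) (at (s *R Y)) & \<p> (s *R Y) : cball 0 (2 * \<r>) &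
  (ALL b:Basis. \<p>' (s *R Y) (K b (s *R Y)) = \<z> b (\<p> (s *R Y)))) -->
 (ALL b:Basis. ALL x:cball 0 (2 * \<r>). norm (\<z> b x - K b x - t *R R 0 b Z x) <= e * \<bar>t\<bar>) -->
 norm (\<p> 0 - t *R Z) <= e * \<bar>t\<bar> --> norm (\<p> Y - Y - t *R K Z Y) <= C * (e * \<bar>t\<bar>))"

text \<open>\<open>R_eq\<close> is where parallel transport of the curvature enters; it makes the
  fields \<open>K W\<close> of the two coordinate systems coincide.\<close>

locale normal_transition = transition +
 N: kaehler_normal_potential U P.\<G> P.G I \<d> \<q> \<h> + N': kaehler_normal_potential U' Q.\<G> Q.G I \<d>' \<q>' \<h>'
 for \<d> \<q> \<h> \<d>' \<q>' \<h>' +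
 assumes R_eq: "Q.R 0 u v w = P.R 0 u v w"
begin

lemma K_eq: "N'.K = N.K"
 by (intro ext) (simp add: N'.K_def N.K_def QL.transvection_term_def PL.transvection_term_def R_eq)

text \<open>Seen in the primed coordinates, \<open>\<z>\<close> has the initial data of the
  transvection with vector b at the centre, so by uniqueness it is \<open>K b\<close> there.\<close>

lemma pulled_killing_field:
 assumes kp: "PL.killing_pair \<z> B" and ini: "\<z> (\<f> 0) = P.dg (\<f> 0) (Q.df 0 b)" "!!w. B (\<f> 0) w = 0"
 and S: "open S" "convex S" "S \<subseteq> O'" "0 : S" "y : S"
 shows "P.dg (\<f> y) (Q.df y (N.K b y)) = \<z> (\<f> y)"
proof -
 have SU: "S \<subseteq> U'" using S(3) O_U by blast
 have O: "0 : O'" "y : O'" using S by auto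
 interpret QS: local_symmetric S Q.\<G> Q.G I by (rule QL.local_symmetric_subset[OF S(1) SU])
 obtain A where A: "!!W. QL.killing_pair (N.K W) (A W)" "!!W w. A W 0 w = 0"
 using N'.K_pairs unfolding K_eq by metis
 have "Q.dg y (P.df (\<f> y) (\<z> (\<f> y))) = N.K b y"
 proof (rule QS.killing_pair_unique(1)[OF pull_killing_pair[OF kp S(1,3)] QL.killing_pair_subset[OF S(1) SU A(1)] S(2,4) _ _ S(5)])
 show "Q.dg 0 (P.df (\<f> 0) (\<z> (\<f> 0))) = N.K b 0"
  unfolding ini(1) N.K_0 by (simp add: P.df_dg \<f>_in[OF O(1)] Q.dg_df zero)
 show "Q.dg 0 (P.df (\<f> 0) (B (\<f> 0) (P.dg (\<f> 0) (Q.df 0 w)))) = A b 0 w" for w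
  by (simp add: ini(2) A(2) linear_0[OF P.df_linear[OF \<f>_in[OF O(1)]]] linear_0[OF Q.dg_linear[OF zero(2)]])
 qed
 then have "Q.df y (N.K b y) = P.df (\<f> y) (\<z> (\<f> y))" using Q.df_dg[OF O_U[OF O(2)]] by metis
 then show ?thesis by (simp add: P.dg_df \<f>_in[OF O(2)])
qed

text \<open>That the transition map is defined along the whole ray belongs to the claim. Up to a
  first bad parameter the estimate keeps its values in a ball of radius 3/2 \<r>. The image of that
  ball is closed, so the parameter itself is not bad.\<close>

lemma displacement:
 assumes \<r>: "\<r> > 0" "cball 0 (2 * \<r>) \<subseteq> U" "cball 0 \<r> \<subseteq> U'" and C: "N.displacement_bound Z \<r> C"
 and m: "!!y. norm y <= \<r> ==> norm (N.K Z y) <= m" and t: "\<bar>t\<bar> <= 1" "\<bar>t\<bar> <= e" "C * (e * \<bar>t\<bar>) + \<bar>t\<bar> * m <= \<r> / 2"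
 and kp: "!!b. b : Basis ==> PL.killing_pair (\<z> b) (B b) & \<z> b (\<f> 0) = P.dg (\<f> 0) (Q.df 0 b) & (ALL w. B b (\<f> 0) w = 0)"
 and close: "!!b x. b : Basis ==> x : cball 0 (2 * \<r>) ==> norm (\<z> b x - N.K b x - t *R P.R 0 b Z x) <= e * \<bar>t\<bar>"
 and ini: "0 : O'" "norm (\<f> 0) < 2 * \<r>" "norm (\<f> 0 - t *R Z) <= e * \<bar>t\<bar>" and Y: "norm Y <= \<r>"
 shows "Y : O'" "norm (\<f> Y - Y - t *R N.K Z Y) <= C * (e * \<bar>t\<bar>)"
proof -
 define good where "good = O' \<inter> \<f> -` ball 0 (2 * \<r>)"
 have cont: "continuous_on O' \<f>"
 by (rule continuous_at_imp_continuous_on) (use \<f>_has_derivative has_derivative_continuous in blast)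
 have og: "open good" unfolding good_def by (rule continuous_open_preimage[OF cont open_O open_ball])
 have est: "norm (\<f> y - y - t *R N.K Z y) <= C * (e * \<bar>t\<bar>)" if y: "norm y <= \<r>" and g: "!!s. s : {0..1} ==> s *R y : good" for y
 proof -
 have seg: "closed_segment 0 y \<subseteq> O'" using g by (auto simp: in_segment good_def)
 obtain d where d: "d > 0" "(\<Union>x\<in>closed_segment 0 y. ball x d) \<subseteq> O'"
  by (rule compact_subset_open_imp_ball_epsilon_subset[OF compact_segment open_O seg])
 \<comment> \<open>A convex neighbourhood of the segment inside the domain of the transition map,
   since uniqueness of Killing pairs is stated on convex sets.\<close>
 define S where "S = (\<Union>z\<in>ball 0 d. \<Union>x\<in>closed_segment 0 y. {z + x})"
 have oS: "open S" unfolding S_def by (rule open_sums) simp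
 have cS: "convex S" unfolding S_def by (rule convex_sums) auto
 have SO: "S \<subseteq> O'" using d(2) by (force simp: S_def dist_norm)
 have inS: "s *R y : S" if "s : {0..1}" for s
  unfolding S_def by (rule UN_I[of 0], simp add: d(1), rule UN_I[of "s *R y"]) (use that in \<open>auto simp: in_segment\<close>)
 have 0: "0 : S" using inS[of 0] by simp
 let ?\<f>' = "%z h. P.dg (\<f> z) (Q.df z h)"
 have 1: "ALL s:{0..1}. (\<f> has_derivative ?\<f>' (s *R y)) (at (s *R y)) & \<f> (s *R y) : cball 0 (2 * \<r>) &
  (ALL b:Basis. ?\<f>' (s *R y) (N.K b (s *R y)) = \<z> b (\<f> (s *R y)))"
 proof (intro ballI conjI)
  fix s :: real assume s: "s : {0..1}"
  show "(\<f> has_derivative ?\<f>' (s *R y)) (at (s *R y))" by (rule \<f>_has_derivative[OF subsetD[OF SO inS[OF s]]])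
  show "\<f> (s *R y) : cball 0 (2 * \<r>)" using g[OF s] by (auto simp: good_def)
  fix b :: 'b assume b: "b : Basis"
  show "?\<f>' (s *R y) (N.K b (s *R y)) = \<z> b (\<f> (s *R y))"
  using kp[OF b] by (intro pulled_killing_field[OF _ _ _ oS cS SO 0 inS[OF s], of "\<z> b" "B b"]) auto
 qed
 show ?thesis
  using C[unfolded N.displacement_bound_def, rule_format, OF t(1,2) y bspec[OF 1] close ini(3)] .
 qed
 have small: "\<f> y : cball 0 (3 / 2 * \<r>)" if y: "norm y <= \<r>" and g: "!!s. s : {0..1} ==> s *R y : good" for y
 proof -
 have "norm (\<f> y) <= norm (\<f> y - y - t *R N.K Z y) + norm (y + t *R N.K Z y)"
  using norm_triangle_ineq[of "\<f> y - y - t *R N.K Z y" "y + t *R N.K Z y"] by simp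
 also have "... <= C * (e * \<bar>t\<bar>) + (norm y + \<bar>t\<bar> * norm (N.K Z y))"
  using est[OF that] norm_triangle_ineq[of y "t *R N.K Z y"] by simp
 also have "\<bar>t\<bar> * norm (N.K Z y) <= \<bar>t\<bar> * m" by (rule mult_left_mono[OF m[OF y]]) simp
 finally show ?thesis using t(3) y by simp
 qed
 have all: "s *R Y : good" if s01: "s : {0..1}" for s
 proof (rule ccontr)
 assume bad: "s *R Y \<notin> good"
 define Bd where "Bd = {0..1} \<inter> (%s. s *R Y) -` (- good)"
 have "closed Bd" unfolding Bd_def by (rule continuous_closed_preimage) (use og in \<open>auto intro: continuous_intros\<close>)
 then have "compact Bd" unfolding compact_eq_bounded_closed by (auto simp: Bd_def intro: bounded_subset[OF bounded_closed_interval[of 0 1]])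
 moreover have "Bd ~= {}" using bad s01 by (auto simp: Bd_def)
 ultimately obtain \<s> where \<s>: "\<s> : Bd" "!!s. s : Bd ==> \<s> <= s" using compact_attains_inf by metis
 have "0 *R Y : good" using ini by (simp add: good_def)
 then have \<s>0: "\<s> > 0" "\<s> <= 1" using \<s>(1) by (auto simp: Bd_def less_le)
 have before: "s *R Y : good" if "0 <= s" "s < \<s>" for s using \<s>(2)[of s] that \<s>0 by (force simp: Bd_def)
 have sY: "norm (s *R Y) <= \<r>" if "0 <= s" "s <= 1" for s
  using mult_left_le_one_le[of "norm Y" s] that Y by auto
 let ?T = "f ` cball 0 (3 / 2 * \<r>)"
 have sub: "cball 0 (3 / 2 * \<r>) \<subseteq> U" using \<r>(1,2) by (auto simp: subset_iff)
 have cT: "closed ?T" by (rule compact_imp_closed[OF compact_continuous_image[OF continuous_on_subset[OF P.continuous_f sub] compact_cball]])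
 have "(%s. f' (s *R Y)) ` closure {0..<\<s>} \<subseteq> ?T"
 proof (rule image_closure_subset[OF _ cT])
  show "continuous_on (closure {0..<\<s>}) (%s. f' (s *R Y))"
  by (rule continuous_on_compose2[OF Q.continuous_f]) (use \<s>0 sY \<r>(3) in \<open>auto intro!: continuous_intros simp: subset_iff\<close>)
  show "(%s. f' (s *R Y)) ` {0..<\<s>} \<subseteq> ?T"
  proof
  fix x assume "x : (%s. f' (s *R Y)) ` {0..<\<s>}"
  then obtain s where s: "x = f' (s *R Y)" "0 <= s" "s < \<s>" by auto
  have "\<f> (s *R Y) : cball 0 (3 / 2 * \<r>)"
  proof (rule small)
   show "norm (s *R Y) <= \<r>" using sY s \<s>0 by simp
   show "u *R s *R Y : good" if "u : {0..1}" for u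
   using before[of "u * s"] that s mult_left_le_one_le[of s u] by auto
  qed
  then show "x : ?T" using f_\<f>[of "s *R Y"] before[OF s(2,3)] s(1) by (auto simp: good_def intro!: image_eqI)
  qed
 qed
 moreover have "\<s> : closure {0..<\<s>}" using \<s>0 by (simp add: closure_atLeastLessThan)
 ultimately obtain x where x: "x : cball 0 (3 / 2 * \<r>)" "f' (\<s> *R Y) = f x" by blast
 have "\<s> *R Y : U'" using sY[of \<s>] \<s>0 \<r>(3) by (auto simp: subset_iff)
 then have "\<s> *R Y : O'" using x sub by (auto simp: O'_def)
 moreover have "\<f> (\<s> *R Y) = x" using x sub P.g_f by (auto simp: \<f>_def)
 ultimately have "\<s> *R Y : good" using x(1) \<r>(1) by (simp add: good_def)
 then show False using \<s>(1) by (simp add: Bd_def)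
 qed
 show "Y : O'" using all[of 1] by (simp add: good_def)
 show "norm (\<f> Y - Y - t *R N.K Z Y) <= C * (e * \<bar>t\<bar>)" by (rule est[OF Y all])
qed

end

locale transport_frame = riemannian_curve M J \<c> + P: hermitean_parametrization M U f g I
 for M :: "('m::{t2_space,second_countable_topology}, 'e::euclidean_space) almost_hermitian" and J \<c> U f g I +
 assumes zero_U: "0 : U" and f_0: "f 0 = \<c> 0" and df_0: "!!u. P.df 0 u = u"
begin

sublocale L: local_symmetric U P.\<G> P.G I using P.local_symmetric zero_U by blast

definition T where "T = (SOME T. open T & convex T & 0 : T & T \<subseteq> J \<inter> \<c> -` (f ` U))"
definition c where "c s = g (\<c> s)"
definition v where "v w s = P.dg (c s) (PT s w)"

lemma T: "open T" "convex T" "0 : T" "T \<subseteq> J" "T \<subseteq> J \<inter> \<c> -` (f ` U)"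
proof -
 have "0 : J \<inter> \<c> -` (f ` U)" using J(3) zero_U f_0 by (auto intro!: image_eqI[of _ f 0])
 then obtain e where "e > 0" "ball 0 e \<subseteq> J \<inter> \<c> -` (f ` U)"
 using P.curve_in_coordinates(1)[OF \<c> J(1)] open_contains_ball by blast
 then have "EX T. open T & convex T & 0 : T & T \<subseteq> J \<inter> \<c> -` (f ` U)"
 by (intro exI[of _ "ball 0 e"]) auto
 from someI_ex[OF this] show "open T" "convex T" "0 : T" "T \<subseteq> J" "T \<subseteq> J \<inter> \<c> -` (f ` U)" by (auto simp: T_def)
qed

lemma c: "s : T ==> c s : U & f (c s) = \<c> s" and c_0: "c 0 = 0" and smooth_c: "smooth_on T c"
proof -
 show "s : T ==> c s : U & f (c s) = \<c> s" using T(5) by (auto simp: c_def P.g_f dest!: subsetD)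
 show "c 0 = 0" using P.g_f[OF zero_U] by (simp add: c_def f_0)
 show "smooth_on T c"
 unfolding c_def by (rule smooth_subset[OF P.curve_in_coordinates(2)[OF \<c> J(1)] T(5)])
qed

lemmas parallel_iff = P.parallel_coordinates(1)[OF T(1) smooth_c c]

lemma c_derivative: "s : T ==> (c hvd dd 1 c s) (at s)"
 by (rule smooth_hvd[OF smooth_c])

lemma v_derivative: "s : T ==> (v w hvd - P.\<G> (c s) (dd 1 c s) (v w s)) (at s)"
 using PT_parallel[of w] T(4) parallel_iff[of s "%s. PT s w"] unfolding parallel_along_def v_def[abs_def] by blast

lemma dc_0: "dd 1 c 0 = velocity M \<c> 0"
 using P.parallel_coordinates(2)[OF T(1) smooth_c c T(3)] by (simp add: c_0 df_0)

lemma v_0: "v w 0 = w"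
 using P.dg_df[OF zero_U, of w] by (simp add: v_def PT_0 c_0 df_0)

lemma v_PT: "s : T ==> P.df (c s) (v w s) = PT s w" using c P.df_dg by (simp add: v_def)

lemma transported_unique:
 assumes Y: "!!s. s : T ==> ((%s. P.dg (c s) (Y s)) hvd - P.\<G> (c s) (dd 1 c s) (P.dg (c s) (Y s))) (at s)"
 and s: "s : T" and w: "w = Y 0"
 shows "PT s w = Y s"
proof (rule parallel_unique[OF T(1,2,4) _ _ T(3) _ s])
 show "parallel_along M T \<c> (%s. PT s w)" by (rule parallel_along_cong[OF T(1,4) PT_parallel refl])
 show "parallel_along M T \<c> Y" unfolding parallel_along_def using Y parallel_iff by blast
qed (simp add: PT_0 w)

text \<open>In coordinates \<open>I\<close> is constant and the connection complex linear, so
  \<open>I\<close> takes parallel vectors to parallel vectors.\<close>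

lemma PT_cplx: "s : T ==> PT s (I w) = cplx M (\<c> s) (PT s w)"
proof (rule transported_unique)
 have eq: "P.dg (c s) (cplx M (\<c> s) (PT s w)) = I (v w s)" if "s : T" for s
 using P.hol[of "c s" "v w s"] P.dg_df[of "c s" "I (v w s)"] c[OF that] by (simp add: v_PT[OF that])
 show "((%s. P.dg (c s) (cplx M (\<c> s) (PT s w))) hvd
  - P.\<G> (c s) (dd 1 c s) (P.dg (c s) (cplx M (\<c> s) (PT s w)))) (at s)" if s: "s : T" for s
 proof (rule has_vector_derivative_transform_within_open[OF _ T(1) s eq[symmetric]])
 show "((%s. I (v w s)) hvd - P.\<G> (c s) (dd 1 c s) (P.dg (c s) (cplx M (\<c> s) (PT s w)))) (at s)"
  using bounded_linear.has_vector_derivative[OF L.I_bounded_linear v_derivative[OF s, of w]] c[OF s]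
  by (simp add: eq[OF s] L.\<G>_I L.I_simps)
 qed
 show "I w = cplx M (\<c> 0) (PT 0 w)" using P.hol[OF zero_U, of w] by (simp add: df_0 PT_0 f_0)
qed

lemma R_derivative:
 assumes s: "s : T"
 shows "((%s. P.R (c s) (v x s) (v y s) (v z s)) hvd
 - P.\<G> (c s) (dd 1 c s) (P.R (c s) (v x s) (v y s) (v z s))) (at s)"
proof -
 have cU: "s : T ==> c s : U" for s using c by blast
 note A = at_within_open[OF s T(1)]
 have 1: "((%s. P.R (c s) x y z) hvd dd (dd 1 c s) (%q. P.R q x y z) (c s)) (at s within T)" for x y z
 proof -
 have "((%s. P.R (c s) x y z) has_derivative (%h. dd (h *R dd 1 c s) (%q. P.R q x y z) (c s))) (at s)"
  using has_derivative_compose[OF c_derivative[OF s, unfolded has_vector_derivative_def] smooth_deriv[OF P.smooth_R cU[OF s]]] .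
 then show ?thesis
  unfolding A has_vector_derivative_def linear_scale[OF dd_linear[OF P.smooth_R cU[OF s]]] .
 qed
 have vd: "(v w hvd - P.\<G> (c s) (dd 1 c s) (v w s) + 0) (at s within T)" for w
 unfolding A using v_derivative[OF s] by simp
 from L.R_along[where c = c and X = T, OF s cU 1 vd vd vd, of x y z] show ?thesis
 unfolding A by (simp add: P.R_simps[OF cU[OF s]])
qed

text \<open>The parallel curvature of three parallel vectors is parallel, and a parallel field is
  determined by its value at 0.\<close>

lemma PT_curvature: "s : T ==> PT s (curvature M (\<c> 0) x y z) = curvature M (\<c> s) (PT s x) (PT s y) (PT s z)"
proof (rule transported_unique)
 have eq: "P.dg (c s) (curvature M (\<c> s) (PT s x) (PT s y) (PT s z)) = P.R (c s) (v x s) (v y s) (v z s)" if "s : T" for s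
 using P.curvature_df[of "c s" "v x s" "v y s" "v z s"] c[OF that] by (simp add: v_PT[OF that] P.dg_df)
 show "((%s. P.dg (c s) (curvature M (\<c> s) (PT s x) (PT s y) (PT s z))) hvd
  - P.\<G> (c s) (dd 1 c s) (P.dg (c s) (curvature M (\<c> s) (PT s x) (PT s y) (PT s z)))) (at s)" if s: "s : T" for s
 by (rule has_vector_derivative_transform_within_open[OF _ T(1) s eq[symmetric]]) (unfold eq[OF s], rule R_derivative[OF s])
 show "curvature M (\<c> 0) x y z = curvature M (\<c> 0) (PT 0 x) (PT 0 y) (PT 0 z)" by (simp add: PT_0)
qed

end

lemma eventually_small_displacement:
 fixes c :: "real => 'a::real_normed_vector"
 assumes c: "(c hvd Z) (at 0)" "c 0 = 0" and e: "e > 0"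
 shows "\<forall>\<^sub>F t in nhds 0. norm (c t - t *R Z) <= e * \<bar>t\<bar>"
proof -
 obtain d where "d > 0" "!!y. norm (y - 0) < d ==> norm (c y - c 0 - (y - 0) *R Z) <= e * norm (y - 0)"
 using c(1) e unfolding has_vector_derivative_def has_derivative_at_alt by metis
 then show ?thesis using c(2) by (auto simp: eventually_nhds_metric dist_real_def)
qed

section \<open>The two claims at the point p\<close>

locale centered_frame = linear_frame M p p D k id r for M p D k r +
 fixes \<d> \<q> \<h>
 assumes N: "kaehler_normal_potential B P.\<G> P.G (cplx M p) \<d> \<q> \<h>"
begin

text \<open>Keeps \<open>k \<circ> id\<close> intact, since the constants of the frame at
  \<open>p\<close> are formed with it.\<close>

declare comp_id [simp del]

sublocale N: kaehler_normal_potential B P.\<G> P.G "cplx M p" \<d> \<q> \<h> by (rule N)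

lemma g_eq: "g x = inv_into D k x" by (simp add: g_def)

lemma K_eq: "N.K Z X = Z - (1/4) *R (curvature M p Z X X - curvature M p Z (cplx M p X) (cplx M p X))"
 by (simp add: N.K_def N.transvection_term_def curvature_0)

lemma killing_field_at_most_quadratic:
 assumes "killing_field M \<x>"
 shows "EX Q. at_most_quadratic Q & (\<forall>\<^sub>F X in nhds 0. field_in_coordinates M k \<x> X = Q X)"
proof -
 define \<z> where "\<z> x = P.dg x (\<x> (f x))" for x
 define A where "A x u = P.nab u \<z> x" for x u
 note kf = P.killing_field_local[OF assms, folded \<z>_def]
 have kp: "N.killing_pair \<z> A" "x : B ==> P.G x (A x u) v + P.G x u (A x v) = 0" for x u v
 unfolding A_def[abs_def] by (rule N.killing_pair_of_killing_equation[OF kf]; assumption)+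
 obtain s where s: "s > 0" "!!X. X : ball 0 s ==> \<z> X = \<z> 0 + A 0 X - (1/2) *R N.tr (\<z> 0) X X"
 using N.killing_field_quadratic[OF kp(1) kp(2)[OF zero_B]] by blast
 define Q where "Q X = \<z> 0 + A 0 X + (- (1/2)) *R N.tr (\<z> 0) X X" for X
 have "bilinear (%X Y. (- (1/2)) *R N.tr (\<z> 0) X Y)"
 unfolding bilinear_def by (auto intro!: linearI simp: N.tr_simps algebra_simps)
 then have q: "at_most_quadratic Q"
 unfolding at_most_quadratic_def Q_def[abs_def] using N.kpD(3)[OF kp(1) zero_B] by blast
 have dk: "map_differential M k = P.df" by (simp add: comp_id)
 have "\<forall>\<^sub>F X in nhds 0. X : B \<inter> ball 0 s"
 using open_B zero_B s(1) by (intro eventually_nhds_in_open) auto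
 then have "\<forall>\<^sub>F X in nhds 0. field_in_coordinates M k \<x> X = Q X"
 by eventually_elim (use s(2) in \<open>simp add: field_in_coordinates_def Q_def P.inv_df dk \<z>_def\<close>)
 with q show ?thesis by blast
qed

text \<open>For each e > 0 all small t satisfy \<open>near e t\<close>, with a constant C
  independent of e and uniformly in X. This contains both the domain condition and the
  derivative.\<close>

lemma is_knc_extension:
 assumes W: "open W" "p : W" and sys: "!!q. q : W ==> kahler_normal_coordinates M q (D' q) (k' q) & {v. metric M q v v < r\<^sup>2} \<subseteq> D' q"
 and center: "D' p = D" "k' p = k"
 shows "is_knc_extension M D' k' p Z (N.K Z)"
 unfolding is_knc_extension_def Let_def
proof (intro allI impI)
 fix \<e> \<c> assume "\<e> > 0 & smooth_into M {-\<e><..<\<e>} \<c> & \<c> 0 = p & velocity M \<c> 0 = Z"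
 then have \<e>: "\<e> > 0" and \<c>: "smooth_into M {-\<e><..<\<e>} \<c>" and \<c>0: "\<c> 0 = p" and Z: "velocity M \<c> 0 = Z" by auto
 let ?J = "{-\<e><..<\<e>}"
 interpret TF: transport_frame M ?J \<c> B f g "cplx M p"
 proof (rule transport_frame.intro[OF _ P.hermitean_parametrization_axioms])
 show "riemannian_curve M ?J \<c>"
  using P.manifold P.riemannian \<c> \<e> by unfold_locales (auto intro: convex_real_interval)
 show "transport_frame_axioms M \<c> B f"
  by unfold_locales (use zero_B f_0 \<c>0 df_0 in auto)
 qed
 obtain \<r> where \<r>: "\<r> > 0" "cball 0 (2 * \<r>) \<subseteq> B" and solve: "!!y Y. y : cball 0 \<r> ==> EX W. N.K W y = Y & norm W <= 2 * norm Y"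
 by (rule N.K_solve) blast
 have \<r>B: "cball 0 \<r> \<subseteq> B" using \<r> by (auto simp: subset_iff)
 obtain C where C: "C >= 0" "N.displacement_bound Z \<r> C"
 using N.displacement_estimate[OF \<r> solve] unfolding N.displacement_bound_def by blast
 have "compact (N.K Z ` cball 0 \<r>)"
 by (intro compact_continuous_image compact_cball continuous_at_imp_continuous_on ballI has_derivative_continuous[OF N.K_has_derivative])
 then obtain m where m: "m > 0" "!!y. norm y <= \<r> ==> norm (N.K Z y) <= m"
 using compact_imp_bounded bounded_pos by (metis imageI mem_cball_0)
 let ?c = "TF.c" and ?PT = "parallel_transport M ?J \<c>"
 have cd: "(?c hvd Z) (at 0)" using TF.c_derivative[OF TF.T(3)] by (simp add: TF.dc_0 Z)
 \<comment> \<open>The connection vanishes at the centre of normal coordinates, so the components of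
   a parallel vector are stationary at t = 0.\<close>
 have vd: "(TF.v w hvd 0) (at 0)" for w
 proof -
 obtain A where "N.killing_pair (cplx M p) A" using N.rotation by blast
 then have "P.\<G> 0 u v = 0" for u v by (rule N.rotation_connection_origin[OF _ zero_B])
 then show ?thesis using TF.v_derivative[OF TF.T(3), of w] by (simp add: TF.c_0)
 qed
 define near where "near e t \<longleftrightarrow> (ALL X. norm X <= \<r> --> ?PT t X : D' (\<c> t) & k' (\<c> t) (?PT t X) : k ` D &
  norm (inv_into D k (k' (\<c> t) (?PT t X)) - X - t *R N.K Z X) <= C * (e * \<bar>t\<bar>))" for e t
 have main: "\<forall>\<^sub>F t in nhds 0. near e t" if e: "e > 0" for e
 proof -
 define data where "data t \<longleftrightarrow> (ALL W:Basis. ALL \<z> B. N.killing_pair \<z> B --> \<z> (?c t) = TF.v W t --> (ALL w. B (?c t) w = 0) -->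
  (ALL x:cball 0 (2 * \<r>). norm (\<z> x - N.K W x - t *R P.R 0 W Z x) <= e * \<bar>t\<bar>))" for t
 \<comment> \<open>The last bound on |t| makes C e |t| + |t| m at most \<r> / 2, as
   \<open>displacement\<close> requires.\<close>
 define a where "a = min (min 1 e) (\<r> / (2 * (C * e + m)))"
 have Cm: "C * e + m > 0" using C(1) e m(1) by (simp add: add_nonneg_pos)
 have a: "a > 0" using e \<r>(1) Cm by (simp add: a_def)
 have 1: "\<forall>\<^sub>F t in nhds 0. data t"
  using N.transport_data[OF \<r> cd TF.c_0 vd TF.v_0 e] unfolding data_def by (rule eventually_mono) blast
 have 2: "\<forall>\<^sub>F t in nhds 0. norm (?c t - t *R Z) <= e * \<bar>t\<bar>" by (rule eventually_small_displacement[OF cd TF.c_0 e])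
 have "open (?J \<inter> \<c> -` W)" by (rule continuous_open_preimage) (use \<c> W(1) in \<open>auto simp: smooth_into_def\<close>)
 then have 3: "\<forall>\<^sub>F t in nhds 0. t : ?J \<inter> \<c> -` W" using \<e> W(2) \<c>0 by (intro eventually_nhds_in_open) auto
 have "open (TF.T \<inter> ?c -` ball 0 (2 * \<r>))"
  by (rule continuous_open_preimage[OF smooth_cont[OF TF.smooth_c] TF.T(1) open_ball])
 then have 4: "\<forall>\<^sub>F t in nhds 0. t : TF.T \<inter> ?c -` ball 0 (2 * \<r>)"
  using TF.T(3) TF.c_0 \<r>(1) by (intro eventually_nhds_in_open) auto
 have 5: "\<forall>\<^sub>F t in nhds 0. t : ball 0 a" by (intro eventually_nhds_in_open) (use a in auto)
 from 1 2 3 4 5 show ?thesis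
 proof eventually_elim
  fix t assume t: "data t" "norm (?c t - t *R Z) <= e * \<bar>t\<bar>" "t : ?J \<inter> \<c> -` W" "t : TF.T \<inter> ?c -` ball 0 (2 * \<r>)" "t : ball 0 a"
  then have tT: "t : TF.T" "t : ?J" and ct: "?c t : B" "f (?c t) = \<c> t" using TF.c by auto
  have ta: "\<bar>t\<bar> <= 1" "\<bar>t\<bar> <= e" "\<bar>t\<bar> <= \<r> / (2 * (C * e + m))" using t(5) by (auto simp: a_def)
  have "\<bar>t\<bar> * (2 * (C * e + m)) <= \<r>" using ta(3) Cm by (subst pos_le_divide_eq[symmetric]) auto
  then have small: "C * (e * \<bar>t\<bar>) + \<bar>t\<bar> * m <= \<r> / 2" by (simp add: algebra_simps)
  \<comment> \<open>Normal coordinates at \<open>\<c> t\<close>, read on the tangent space at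
    \<open>p\<close> by means of parallel transport.\<close>
  interpret F': linear_frame M p "\<c> t" "D' (\<c> t)" "k' (\<c> t)" "?PT t" r
  using sys[of "\<c> t"] t(3) hss TF.PT_linear[OF tT(2)] TF.PT_metric[OF tT(2)] TF.PT_cplx[OF tT(1)] r(1)
  by (intro linear_frame.intro) (auto simp: \<c>0)
  obtain \<d>' \<q>' \<h>' where "kaehler_normal_potential B F'.P.\<G> F'.P.G (cplx M p) \<d>' \<q>' \<h>'"
  using F'.normal_potential by blast
  then interpret N': kaehler_normal_potential B F'.P.\<G> F'.P.G "cplx M p" \<d>' \<q>' \<h>' .
  interpret X: normal_transition M B f g "cplx M p" B F'.f F'.g \<d> \<q> \<h> \<d>' \<q>' \<h>'
  proof (intro normal_transition.intro transition.intro transition_axioms.intro normal_transition_axioms.intro)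
  show "F'.P.R 0 u v w = P.R 0 u v w" for u v w
   unfolding F'.curvature_0 TF.PT_curvature[OF tT(1), symmetric] curvature_0
   using F'.bij_L \<c>0 by (simp add: bij_is_inj)
  qed (fact P.hermitean_parametrization_axioms F'.P.hermitean_parametrization_axioms zero_B N.kaehler_normal_potential_axioms N'.kaehler_normal_potential_axioms)+
  have \<f>0: "X.\<f> 0 = ?c t" by (simp add: X.\<f>_def TF.c_def F'.f_0[unfolded comp_def])
  have O: "0 : X.O'" using ct F'.f_0 zero_B by (auto simp: X.O'_def intro!: image_eqI)
  have dv: "P.dg (X.\<f> 0) (F'.P.df 0 b) = TF.v b t" for b by (simp add: \<f>0 F'.df_0 TF.v_def)
  define pair where "pair b \<z> B \<longleftrightarrow> N.killing_pair \<z> B & \<z> (?c t) = TF.v b t & (ALL w. B (?c t) w = 0)" for b \<z> B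
  have "EX \<z> B. pair b \<z> B" for b
  proof -
  have l: "linear (%_::'b. 0 :: 'b)" by (simp add: linear_iff)
  have "N.curvature_invariant (?c t) (%_. 0)" by (simp add: N.curvature_invariant_def P.R_simps ct)
  from N.killing_pair_exists[OF N.convex ct(1) l this, of "TF.v b t"] show ?thesis unfolding pair_def by metis
  qed
  then obtain \<z> B where \<z>: "!!b. pair b (\<z> b) (B b)" by metis
  show "near e t"
  unfolding near_def
  proof (intro allI impI)
  fix X :: 'b assume X: "norm X <= \<r>"
  have kp: "N.killing_pair (\<z> b) (B b) & \<z> b (X.\<f> 0) = P.dg (X.\<f> 0) (F'.P.df 0 b) & (ALL w. B b (X.\<f> 0) w = 0)" for b
   using \<z>[of b] unfolding pair_def dv unfolding \<f>0 .
  have close: "norm (\<z> b x - N.K b x - t *R P.R 0 b Z x) <= e * \<bar>t\<bar>" if "b : Basis" "x : cball 0 (2 * \<r>)" for b x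
   using t(1) \<z>[of b] that unfolding data_def pair_def by blast
  have ini: "norm (X.\<f> 0) < 2 * \<r>" "norm (X.\<f> 0 - t *R Z) <= e * \<bar>t\<bar>" using t(2,4) unfolding \<f>0 by auto
  note d = X.displacement[OF \<r> \<r>B C(2) m(2) ta(1,2) small kp close O ini X]
  have XB: "X : linear_frame.B M p r" using \<r>B X by auto
  have "F'.f X : f ` linear_frame.B M p r" using d(1) by (simp add: X.O'_def)
  then have "k' (\<c> t) (?PT t X) : k ` D" using L_B by auto
  moreover have "?PT t X : D' (\<c> t)" using F'.L_B XB by blast
  moreover have "norm (inv_into D k (k' (\<c> t) (?PT t X)) - X - t *R N.K Z X) <= C * (e * \<bar>t\<bar>)"
   using d(2) by (simp add: X.\<f>_def g_eq)
  ultimately show "?PT t X : D' (\<c> t) & k' (\<c> t) (?PT t X) : k ` D &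
   norm (inv_into D k (k' (\<c> t) (?PT t X)) - X - t *R N.K Z X) <= C * (e * \<bar>t\<bar>)" by blast
  qed
 qed
 qed
 have "\<forall>\<^sub>F X in nhds 0. X : ball 0 \<r>" by (intro eventually_nhds_in_open) (use \<r>(1) in auto)
 then show "\<forall>\<^sub>F X in nhds 0. (\<forall>\<^sub>F t in nhds 0. ?PT t X : D' (\<c> t) & k' (\<c> t) (?PT t X) : k' p ` D' p) &
  ((%t. inv_into (D' p) (k' p) (k' (\<c> t) (?PT t X))) hvd N.K Z X) (at 0)"
 unfolding center
 proof (rule eventually_mono, intro conjI)
 fix X :: 'b assume "X : ball 0 \<r>"
 then have X: "norm X <= \<r>" "X : D" using \<r>B L_B by (auto simp: subset_iff)
 show "\<forall>\<^sub>F t in nhds 0. ?PT t X : D' (\<c> t) & k' (\<c> t) (?PT t X) : k ` D"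
  using main[OF zero_less_one] by (rule eventually_mono) (use X(1) in \<open>auto simp: near_def\<close>)
 let ?F = "%t. inv_into D k (k' (\<c> t) (?PT t X))"
 have "inj_on k D" using knc by (simp add: kahler_normal_coordinates_def anchored_coordinates_def)
 then have F0: "?F 0 = X" using X(2) by (simp add: TF.PT_0 \<c>0 center)
 show "(?F hvd N.K Z X) (at 0)"
  unfolding has_vector_derivative_def has_derivative_at_alt
 proof (intro conjI allI impI bounded_linear_scaleR_left)
  fix e :: real assume e: "e > 0"
  have "e / (C + 1) > 0" using e C(1) by simp
  from main[OF this] obtain d where d: "d > 0" "!!t. \<bar>t\<bar> < d ==> near (e / (C + 1)) t"
  by (auto simp: eventually_nhds_metric dist_real_def)
  have "norm (?F t - ?F 0 - (t - 0) *R N.K Z X) <= e * norm (t - 0)" if "norm (t - 0) < d" for t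
  proof -
  have "norm (?F t - X - t *R N.K Z X) <= C * (e / (C + 1) * \<bar>t\<bar>)" using d(2)[of t] that X(1) by (simp add: near_def)
  also have "... = C / (C + 1) * (e * \<bar>t\<bar>)" by simp
  also have "... <= 1 * (e * \<bar>t\<bar>)" using C(1) e by (intro mult_right_mono) auto
  finally show ?thesis by (simp add: F0)
  qed
  then show "EX d>0. ALL t. norm (t - 0) < d --> norm (?F t - ?F 0 - (t - 0) *R N.K Z X) <= e * norm (t - 0)" using d(1) by blast
 qed
 qed
qed

end

theorem corollary5p5:
  fixes M :: "('m::{t2_space,second_countable_topology}, 'e::euclidean_space) almost_hermitian"
    and D :: "'m \<Rightarrow> 'e set" and knc :: "'m \<Rightarrow> 'e \<Rightarrow> 'm"
    and p :: 'm and Z :: 'e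
  assumes "hermitean_symmetric_space M"
    and "knc_system M D knc"
  shows "is_knc_extension M D knc p Z
           (\<lambda>X. Z - (1/4) *\<^sub>R (curvature M p Z X X - curvature M p Z (cplx M p X) (cplx M p X))) \<and>
         (\<forall>\<xi>. killing_field M \<xi> \<longrightarrow>
           (\<exists>Q. at_most_quadratic Q \<and>
             (\<forall>\<^sub>F X in nhds 0. field_in_coordinates M (knc p) \<xi> X = Q X)))"
proof -
 \<comment> \<open>One radius for all points near \<open>p\<close>: it fixes the common domain of
   the frames along a curve.\<close>
 obtain W r where W: "open W" "p : W" "r > 0" "!!q. q : W ==> {v. metric M q v v < r\<^sup>2} \<subseteq> D q"
 using assms(2) unfolding knc_system_def by meson
 have knc: "kahler_normal_coordinates M q (D q) (knc q)" for q using assms(2) by (simp add: knc_system_def)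
 interpret F: linear_frame M p p "D p" "knc p" id r
 using assms(1) knc W by (intro linear_frame.intro linear_id) auto
 obtain \<d> \<q> \<h> where "kaehler_normal_potential F.B F.P.\<G> F.P.G (cplx M p) \<d> \<q> \<h>" using F.normal_potential by blast
 then interpret F: centered_frame M p "D p" "knc p" r \<d> \<q> \<h>
 by (intro centered_frame.intro centered_frame_axioms.intro F.linear_frame_axioms)
 have "is_knc_extension M D knc p Z (F.N.K Z)"
 by (rule F.is_knc_extension[OF W(1,2)]) (use knc W(4) in auto)
 then show ?thesis using F.killing_field_at_most_quadratic by (simp add: F.K_eq[abs_def])
qed

end
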